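(* Let $k$ be a field with $\operatorname{char}(k)\neq 2$, and let $f\in\mathrm{Aut}(\mathbb{A}^4_k)$ be a quadratic automorphism, i.e. $\deg(f)=2$. Then the dynamical degree $\lambda(f)$ is an algebraic integer of degree $\le 4$ (over $\mathbb{Q}$).
   Context: Let $k$ be a field and $n\ge 1$. An endomorphism $f\in\mathrm{End}(\mathbb{A}^n_k)$ is a tuple $f=(f_1,\dots,f_n)$ with $f_i\in k[x_1,\dots,x_n]$; composition is given by substitution, $(f\circ g)_i=f_i(g_1,\dots,g_n)$, and $f^r$ is the $r$-fold iterate. $\mathrm{Aut}(\mathbb{A}^n_k)$ is the group of endomorphisms having an inverse in $\mathrm{End}(\mathbb{A}^n_k)$. The degree is $\deg(f)=\max\{\deg(f_1),\dots,\deg(f_n)\}$, and the dynamical degree is $\lambda(f)=\lim_{r\to\infty}\big(\deg(f^r)\big)^{1/r}$ (the limit exists). *)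

theory Defs
  imports "HOL-Library.Poly_Mapping" "HOL-Library.Numeral_Type"
    "HOL-Computational_Algebra.Computational_Algebra"
begin

text \<open>
  Polynomials over \<open>'k\<close> in variables indexed by \<open>'n\<close>: finitely supported functions from
  exponent vectors to coefficients, with the convolution product of
  \<^theory>\<open>HOL-Library.Poly_Mapping\<close>.
\<close>

type_synonym ('n, 'k) mpoly = "('n \<Rightarrow>\<^sub>0 nat) \<Rightarrow>\<^sub>0 'k"

definition mconst :: "'k \<Rightarrow> ('n, 'k::comm_ring_1) mpoly"
  where "mconst c = Poly_Mapping.single 0 c"

definition mvar :: "'n \<Rightarrow> ('n, 'k::comm_ring_1) mpoly"
  where "mvar i = Poly_Mapping.single (Poly_Mapping.single i 1) 1"

text \<open>Total degree; the zero polynomial is given degree 0.\<close>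

definition mdegree :: "('n::finite, 'k::comm_ring_1) mpoly \<Rightarrow> nat"
  where "mdegree p =
    Max (insert 0 ((\<lambda>m. \<Sum>i\<in>UNIV. Poly_Mapping.lookup m i) ` Poly_Mapping.keys p))"

definition msubst :: "('n::finite, 'k::comm_ring_1) mpoly \<Rightarrow> ('n \<Rightarrow> ('n, 'k) mpoly) \<Rightarrow> ('n, 'k) mpoly"
  where "msubst p g =
    (\<Sum>m\<in>Poly_Mapping.keys p.
       mconst (Poly_Mapping.lookup p m) * (\<Prod>i\<in>UNIV. g i ^ Poly_Mapping.lookup m i))"

text \<open>
  Endomorphisms of affine space over \<open>'k\<close>, of dimension the cardinality of \<open>'n\<close>.
\<close>

type_synonym ('n, 'k) endo = "'n \<Rightarrow> ('n, 'k) mpoly"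

definition endo_comp ::
    "('n::finite, 'k::comm_ring_1) endo \<Rightarrow> ('n, 'k) endo \<Rightarrow> ('n, 'k) endo"
  where "endo_comp f g = (\<lambda>i. msubst (f i) g)"

definition endo_iter :: "('n::finite, 'k::comm_ring_1) endo \<Rightarrow> nat \<Rightarrow> ('n, 'k) endo"
  where "endo_iter f r = (endo_comp f ^^ r) mvar"

definition Aut_affine :: "('n::finite, 'k::comm_ring_1) endo set"
  where "Aut_affine = {f. \<exists>g. endo_comp f g = mvar \<and> endo_comp g f = mvar}"

definition endo_degree :: "('n::finite, 'k::comm_ring_1) endo \<Rightarrow> nat"
  where "endo_degree f = Max (range (\<lambda>i. mdegree (f i)))"

definition dynamical_degree :: "('n::finite, 'k::comm_ring_1) endo \<Rightarrow> real"
  where "dynamical_degree f = lim (\<lambda>r. root r (real (endo_degree (endo_iter f r))))"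

text \<open>
  The degree over $\mathbb{Q}$ of an algebraic number, i.e. the degree of its minimal polynomial
  over $\mathbb{Q}$. The value is unspecified for transcendental numbers.
\<close>

definition degree_over_rat :: "'a::field_char_0 \<Rightarrow> nat"
  where "degree_over_rat x =
    (LEAST d. \<exists>p :: rat poly. p \<noteq> 0 \<and> degree p = d \<and> poly (map_poly of_rat p) x = 0)"

end

theory Submission imports Defs "HOL-Analysis.Analysis" "HOL-Algebra.Algebraic_Closure_Type"
begin

text \<open>
  The proof computes the growth of degrees of every quadratic automorphism over an algebraic closure, which changes
  neither degrees nor invertibility.

  Normal form. Only injectivity of \<open>h(v) = c + M v + B(v, v)\<close> on points is used. Comparing \<open>h\<close> at \<open>u + v\<close> and \<open>u - v\<close>
  shows that \<open>M\<close> is invertible and that the commutative product \<open>u \<diamondop> v = M\<^sup>-\<^sup>1 B(u, v)\<close> has the property that no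
  multiplication \<open>v \<mapsto> u \<diamondop> v\<close> has a nonzero eigenvalue. In dimension four such an algebra contains a nonzero
  element annihilated by all others (\<open>annihilator_exists\<close>); the argument distinguishes the largest left power \<open>x \<diamondop> (x \<diamondop> ...)\<close> that does
  not vanish. Passing to quotients gives a full flag (\<open>flag_exists\<close>): there are coordinates in which the quadratic part
  of each one involves only the earlier ones. A Bruhat decomposition of the linear part relative to this flag
  (\<open>reduction\<close>) turns the map into a permutation normal form: the image of each coordinate is a multiple of the
  coordinate given by a permutation, plus a polynomial of degree at most two in coordinates preceding that one.

  Classification. The functionals with vanishing quadratic part form a space of dimension 1, 2, or at least 3. If it
  contains an eigenvector of the linear part, one coordinate is affine over itself and three coordinates remain.
  Otherwise the dimension restricts the permutation (\<open>good_rank3\<close>, \<open>good_rank2\<close>) or allows to write the map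
  as a recurrence (\<open>good_rank1\<close>), and only a handful of explicit families of systems survive.

  Growth. For each family the growth rate is found by weights (\<open>leaf\<close>): give the coordinates real weights such that
  every monomial in the image of a coordinate weighs at most \<open>\<theta>\<close> times that coordinate, with equality for
  designated leading monomials. Degrees then grow at most like \<open>\<theta> ^ r\<close>, and at least so if the leading
  coefficients do not cancel, which an invariant set of coefficient vectors ensures. The weights solve an
  eigenvalue problem for a small nonnegative matrix, and this is why \<open>\<theta>\<close> is a root of a monic integer polynomial of
  degree at most four. To make weights visible the orbits are computed in formal sums of real powers of a variable; the
  coefficients are polynomials in four indeterminates, which provides a generic point, and at a generic point the largest exponent
  is the degree of the iterate. Bounds up to constant factors suffice, because they disappear under \<open>r\<close>-th roots.
\<close>

section \<open>Series with real exponents\<close>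

text \<open>
  Finite sums of powers of a formal variable with real exponents: substituting powers of the variable for the
  coordinates makes weights, which may be irrational, visible as exponents. The coefficients are polynomials so that
  generic points exist.
\<close>
type_synonym 'k ser = "real \<Rightarrow>\<^sub>0 (4, 'k) mpoly"

definition bd :: "(real \<Rightarrow>\<^sub>0 'p::zero) \<Rightarrow> real \<Rightarrow> bool"
  where "bd p t \<longleftrightarrow> (\<forall>k\<in>Poly_Mapping.keys p. k \<le> t)"

lemma bd_mono: "bd p s \<Longrightarrow> s \<le> t \<Longrightarrow> bd p t"
  unfolding bd_def by force

lemma bd_0 [simp]: "bd 0 t"
  unfolding bd_def by simp

lemma bd_single: "k \<le> t \<Longrightarrow> bd (Poly_Mapping.single k c) t"
  unfolding bd_def by (cases "c = 0") auto

lemma bd_1: "0 \<le> t \<Longrightarrow> bd (1 :: real \<Rightarrow>\<^sub>0 'p::zero_neq_one) t"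
  by (metis bd_single single_one)

lemma bd_add:
  fixes p q :: "real \<Rightarrow>\<^sub>0 'p::comm_monoid_add"
  shows "bd p t \<Longrightarrow> bd q t \<Longrightarrow> bd (p + q) t"
  using Poly_Mapping.keys_add[of p q] unfolding bd_def by blast

lemma bd_mult:
  fixes p q :: "real \<Rightarrow>\<^sub>0 'p::comm_semiring_1"
  assumes "bd p s" "bd q t" shows "bd (p * q) (s + t)"
  unfolding bd_def
proof
  fix k assume "k \<in> Poly_Mapping.keys (p * q)"
  then obtain a b where "a \<in> Poly_Mapping.keys p" "b \<in> Poly_Mapping.keys q" "k = a + b"
    using keys_mult[of p q] by blast
  then show "k \<le> s + t" using assms unfolding bd_def by (simp add: add_mono)
qed

lemma bd_sum:
  fixes p :: "'i \<Rightarrow> real \<Rightarrow>\<^sub>0 'p::comm_monoid_add"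
  shows "(\<And>i. i \<in> I \<Longrightarrow> bd (p i) t) \<Longrightarrow> bd (sum p I) t"
  by (induction I rule: infinite_finite_induct) (auto intro: bd_add)

lemma bd_ex: "\<exists>t\<ge>0. bd p t"
proof (cases "p = 0")
  case False
  then have "bd p (Max (insert 0 (Poly_Mapping.keys p)))" unfolding bd_def by (auto intro!: Max_ge simp del: Max_insert)
  then show ?thesis by (intro exI[of _ "Max (insert 0 (Poly_Mapping.keys p))"]) (auto intro!: Max_ge simp del: Max_insert)
qed auto

lemma lookup_above_bd: "bd p t \<Longrightarrow> t < k \<Longrightarrow> Poly_Mapping.lookup p k = 0"
  unfolding bd_def by (meson in_keys_iff linorder_not_less)

lemma bd_lookup_le: "bd p t \<Longrightarrow> Poly_Mapping.lookup p k \<noteq> 0 \<Longrightarrow> k \<le> t"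
  using lookup_above_bd linorder_not_less by blast

lemma lookup_mult_top:
  fixes p q :: "real \<Rightarrow>\<^sub>0 'p::comm_semiring_1"
  assumes "bd p s" "bd q t"
  shows "Poly_Mapping.lookup (p * q) (s + t) = Poly_Mapping.lookup p s * Poly_Mapping.lookup q t"
proof -
  let ?f = "Poly_Mapping.lookup p" and ?g = "Poly_Mapping.lookup q"
  have inner: "Sum_any (\<lambda>b. ?g b when s + t = l + b) = ?g (s + t - l)" for l
  proof -
    have "(\<lambda>b. ?g b when s + t = l + b) = (\<lambda>b. ?g b when b = s + t - l)"
      by (auto simp: when_def fun_eq_iff)
    then show ?thesis by (simp only: Sum_any_when_equal)
  qed
  have "Poly_Mapping.lookup (p * q) (s + t) = Sum_any (\<lambda>l. ?f l * Sum_any (\<lambda>b. ?g b when s + t = l + b))"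
    by (simp add: lookup_mult)
  also have "\<dots> = Sum_any (\<lambda>l. ?f l * ?g (s + t - l))" by (simp add: inner)
  also have "(\<lambda>l. ?f l * ?g (s + t - l)) = (\<lambda>l. ?f s * ?g t when l = s)"
  proof
    fix l
    show "?f l * ?g (s + t - l) = (?f s * ?g t when l = s)"
    proof (cases "l = s")
      case False
      then have "?f l = 0 \<or> ?g (s + t - l) = 0"
        using lookup_above_bd[OF assms(1), of l] lookup_above_bd[OF assms(2), of "s + t - l"]
        by (cases "l < s") auto
      then show ?thesis using False by (auto simp: when_def)
    qed auto
  qed
  finally show ?thesis by simp
qed

section \<open>Growth of orbits of polynomial systems\<close>

datatype idx = Vx | Vy | Vz | Vw

lemma UNIV_idx: "UNIV = {Vx, Vy, Vz, Vw}"
  using idx.exhaust by auto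

instance idx :: finite
  by standard (simp add: UNIV_idx)

lemma all_idx: "(\<forall>j. P j) \<longleftrightarrow> P Vx \<and> P Vy \<and> P Vz \<and> P Vw"
  by (metis idx.exhaust)

lemma ex_idx: "(\<exists>j. P j) \<longleftrightarrow> P Vx \<or> P Vy \<or> P Vz \<or> P Vw"
  by (metis idx.exhaust)

text \<open>
  Each component is a list of coefficients and words in the coordinates. Zero coefficients and repeated monomials are
  permitted, so that whole families of systems have a uniform shape.
\<close>
type_synonym 'k sys = "idx \<Rightarrow> ('k \<times> idx list) list"

definition cst :: "'k::comm_ring_1 \<Rightarrow> 'k ser"
  where "cst c = Poly_Mapping.single 0 (mconst c)"

lemma cst_0 [simp]: "cst 0 = 0" and cst_1 [simp]: "cst 1 = 1"
  by (simp_all add: cst_def mconst_def)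

lemma mconst_0 [simp]: "mconst 0 = 0" and mconst_1 [simp]: "mconst 1 = 1"
  by (simp_all add: mconst_def)

lemma mconst_add: "mconst (a + b) = mconst a + mconst b"
  and mconst_mult: "mconst (a * b) = mconst a * mconst b"
  and mconst_uminus: "mconst (- a) = - mconst a"
  and mconst_diff: "mconst (a - b) = mconst a - mconst b"
  by (simp_all add: mconst_def single_add mult_single single_uminus single_diff)

lemma mconst_eq_0 [simp]: "mconst c = 0 \<longleftrightarrow> c = 0"
  by (auto simp: mconst_def) (metis lookup_single_eq lookup_zero)

lemma cst_add: "cst (a + b) = cst a + cst b"
  and cst_mult: "cst (a * b) = cst a * cst b"
  and cst_uminus: "cst (- a) = - cst a"
  and cst_diff: "cst (a - b) = cst a - cst b"
  by (simp_all add: cst_def mconst_add mconst_mult mconst_uminus mconst_diff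
      single_add mult_single single_uminus single_diff)

lemma cst_of_nat: "cst (of_nat n) = of_nat n"
  by (induction n) (simp_all add: cst_add)

lemma cst_numeral [simp]: "cst (numeral n) = numeral n"
  using cst_of_nat[of "numeral n"] by simp

lemmas cst_hom = cst_add cst_mult cst_uminus cst_diff

lemma bd_cst: "0 \<le> t \<Longrightarrow> bd (cst c) t"
  by (simp add: cst_def bd_single)

definition ev :: "('k::field \<times> idx list) list \<Rightarrow> (idx \<Rightarrow> 'k ser) \<Rightarrow> 'k ser"
  where "ev L a = (\<Sum>(c, m)\<leftarrow>L. cst c * prod_list (map a m))"

lemma ev_Nil [simp]: "ev [] a = 0"
  and ev_Cons [simp]: "ev ((c, m) # L) a = cst c * prod_list (map a m) + ev L a"
  by (simp_all add: ev_def)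

definition hmap :: "'k::field sys \<Rightarrow> (idx \<Rightarrow> 'k ser) \<Rightarrow> (idx \<Rightarrow> 'k ser)"
  where "hmap F a = (\<lambda>j. ev (F j) a)"

definition wt :: "(idx \<Rightarrow> real) \<Rightarrow> idx list \<Rightarrow> real"
  where "wt \<mu> m = sum_list (map \<mu> m)"

lemma wt_Nil [simp]: "wt \<mu> [] = 0"
  and wt_Cons [simp]: "wt \<mu> (i # m) = \<mu> i + wt \<mu> m"
  by (simp_all add: wt_def)

lemma bd_prod_list:
  assumes "\<And>i. i \<in> set m \<Longrightarrow> bd (a i) (\<mu> i)"
  shows "bd (prod_list (map a m) :: real \<Rightarrow>\<^sub>0 'p::{comm_semiring_1}) (wt \<mu> m)"
  using assms by (induction m) (auto intro!: bd_mult bd_1)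

lemma lookup_prod_list_top:
  fixes a :: "idx \<Rightarrow> real \<Rightarrow>\<^sub>0 'p::comm_semiring_1"
  assumes "\<And>i. i \<in> set m \<Longrightarrow> bd (a i) (\<mu> i)"
  shows "Poly_Mapping.lookup (prod_list (map a m)) (wt \<mu> m)
     = prod_list (map (\<lambda>i. Poly_Mapping.lookup (a i) (\<mu> i)) m)"
  using assms
proof (induction m)
  case Nil
  then show ?case by (simp flip: single_one)
next
  case (Cons i m)
  then show ?case by (simp add: lookup_mult_top bd_prod_list)
qed

lemma bd_cst_mult: "bd p t \<Longrightarrow> bd (cst c * p) t"
  using bd_mult[of "cst c" 0 p t] by (simp add: bd_cst)

lemma lookup_cst_mult:
  assumes "bd p t" shows "Poly_Mapping.lookup (cst c * p) t = mconst c * Poly_Mapping.lookup p t"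
  using lookup_mult_top[of "cst c" 0 p t] assms by (simp add: bd_cst) (simp add: cst_def)

lemma bd_ev:
  assumes "\<And>i. bd (a i) (\<mu> i)" "\<forall>(c, m)\<in>set L. c = 0 \<or> wt \<mu> m \<le> t"
  shows "bd (ev L a) t"
  using assms(2)
proof (induction L)
  case (Cons cm L)
  obtain c m where [simp]: "cm = (c, m)" by (cases cm)
  have "bd (prod_list (map a m)) (wt \<mu> m)" using assms(1) by (intro bd_prod_list) auto
  then have "c \<noteq> 0 \<Longrightarrow> bd (prod_list (map a m)) t" using Cons.prems by (auto intro: bd_mono)
  then have "bd (cst c * prod_list (map a m)) t"
    by (cases "c = 0") (auto intro: bd_cst_mult)
  then show ?case using Cons by (auto intro!: bd_add)
qed simp

text \<open>Only the monomials of weight exactly \<open>t\<close> contribute to the coefficient at \<open>t\<close>.\<close>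

lemma lookup_ev:
  assumes a: "\<And>i. bd (a i) (\<mu> i)"
    and L: "\<forall>(c, m)\<in>set L. if m \<in> set T then wt \<mu> m = t else c = 0 \<or> wt \<mu> m < t"
  shows "Poly_Mapping.lookup (ev L a) t = (\<Sum>(c, m)\<leftarrow>filter (\<lambda>(c, m). m \<in> set T) L.
           mconst c * prod_list (map (\<lambda>i. Poly_Mapping.lookup (a i) (\<mu> i)) m))"
  using L
proof (induction L)
  case (Cons cm L)
  obtain c m where [simp]: "cm = (c, m)" by (cases cm)
  have b: "bd (prod_list (map a m)) (wt \<mu> m)" using a by (intro bd_prod_list) auto
  have IH: "Poly_Mapping.lookup (ev L a) t = (\<Sum>(c, m)\<leftarrow>filter (\<lambda>(c, m). m \<in> set T) L.
           mconst c * prod_list (map (\<lambda>i. Poly_Mapping.lookup (a i) (\<mu> i)) m))"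
    using Cons by simp
  show ?case
  proof (cases "m \<in> set T")
    case True
    then have "wt \<mu> m = t" using Cons.prems by auto
    then have "Poly_Mapping.lookup (cst c * prod_list (map a m)) t
      = mconst c * prod_list (map (\<lambda>i. Poly_Mapping.lookup (a i) (\<mu> i)) m)"
      using lookup_cst_mult[OF b, of c] lookup_prod_list_top[of m a \<mu>] a by simp
    then show ?thesis using True IH by (simp add: lookup_add)
  next
    case False
    then have "c = 0 \<or> wt \<mu> m < t" using Cons.prems by auto
    then have "Poly_Mapping.lookup (cst c * prod_list (map a m)) t = 0"
      using lookup_above_bd[OF bd_cst_mult[OF b]] by auto
    then show ?thesis using False IH by (simp add: lookup_add)
  qed
qed simp

text \<open>
  The rate may be exceeded slightly. This leaves room for polynomial factors and for coordinates of weight zero.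
\<close>
definition UB :: "'k::field sys \<Rightarrow> real \<Rightarrow> bool"
  where "UB F \<theta> \<longleftrightarrow> (\<forall>s. \<forall>\<theta>'>\<theta>. \<exists>C. \<forall>r j. bd ((hmap F ^^ r) s j) (C * \<theta>' ^ r))"

text \<open>
  The starting point may depend on \<open>r\<close> as long as its exponents are bounded by a common \<open>D\<close>. Comparison with
  degrees is still possible, since evaluating a polynomial multiplies exponents at most by its degree.
\<close>
definition LB :: "'k::field sys \<Rightarrow> real \<Rightarrow> bool"
  where "LB F \<theta> \<longleftrightarrow> (\<exists>c>0. \<exists>D. \<forall>r. \<exists>s. (\<forall>j. bd (s j) D) \<and>
           (\<forall>t. (\<forall>j. bd ((hmap F ^^ r) s j) t) \<longrightarrow> c * \<theta> ^ r \<le> t))"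

definition alg4 :: "real \<Rightarrow> bool"
  where "alg4 \<theta> \<longleftrightarrow> (\<exists>p :: int poly. Polynomial.lead_coeff p = 1 \<and> Polynomial.degree p \<le> 4 \<and> poly (map_poly of_int p) \<theta> = 0)"

text \<open>
  No lower bound is required for \<open>\<theta> = 1\<close>, since iterates of an automorphism have degree at least 1.
\<close>
definition good :: "'k::field sys \<Rightarrow> bool"
  where "good F \<longleftrightarrow> (\<exists>\<theta>\<ge>1. alg4 \<theta> \<and> UB F \<theta> \<and> (\<theta> = 1 \<or> LB F \<theta>))"

text \<open>
  Exponent bounds proportional to the weights propagate along the orbit, multiplied by \<open>\<theta>\<close> in each step.
\<close>
lemma UB_pos:
  assumes pos: "\<And>j. \<mu> j > 0" and th: "\<theta> \<ge> 0"
    and le: "\<forall>j. \<forall>(c, m)\<in>set (F j). c = 0 \<or> wt \<mu> m \<le> \<theta> * \<mu> j"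
  shows "\<exists>C. \<forall>r j. bd ((hmap F ^^ r) s j) (C * \<theta> ^ r)"
proof -
  have "\<exists>D\<ge>0. \<forall>j. bd (s j) (D * \<mu> j)"
  proof -
    have "\<forall>j. \<exists>t\<ge>0. bd (s j) t" using bd_ex by blast
    then obtain t where t: "\<And>j. t j \<ge> 0" "\<And>j. bd (s j) (t j)" by metis
    define D where "D = (\<Sum>j\<in>UNIV. t j / \<mu> j)"
    have "t j \<le> D * \<mu> j" for j
    proof -
      have "t j / \<mu> j \<le> D" unfolding D_def
        using t(1) pos by (intro member_le_sum) (auto simp: less_imp_le)
      then show ?thesis using pos[of j] by (simp add: field_simps)
    qed
    moreover have "D \<ge> 0" unfolding D_def using t(1) pos by (intro sum_nonneg) (auto simp: less_imp_le)
    ultimately show ?thesis using t(2) bd_mono by blast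
  qed
  then obtain D where D: "D \<ge> 0" "\<And>j. bd (s j) (D * \<mu> j)" by blast
  have wt_scale: "wt (\<lambda>i. e * \<mu> i) m = e * wt \<mu> m" for e m
    by (induction m) (auto simp: algebra_simps)
  have *: "bd ((hmap F ^^ r) s j) (D * \<theta> ^ r * \<mu> j)" for r j
  proof (induction r arbitrary: j)
    case (Suc r)
    have "bd (ev (F j) ((hmap F ^^ r) s)) (D * \<theta> ^ Suc r * \<mu> j)"
    proof (rule bd_ev[where \<mu> = "\<lambda>i. D * \<theta> ^ r * \<mu> i"])
      show "\<forall>(c, m)\<in>set (F j). c = 0 \<or> wt (\<lambda>i. D * \<theta> ^ r * \<mu> i) m \<le> D * \<theta> ^ Suc r * \<mu> j"
      proof (clarify)
        fix c m assume "(c, m) \<in> set (F j)" "\<not> wt (\<lambda>i. D * \<theta> ^ r * \<mu> i) m \<le> D * \<theta> ^ Suc r * \<mu> j"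
        moreover have "wt \<mu> m \<le> \<theta> * \<mu> j \<Longrightarrow> D * \<theta> ^ r * wt \<mu> m \<le> D * \<theta> ^ r * (\<theta> * \<mu> j)"
          using D(1) th by (intro mult_left_mono) auto
        moreover have "wt (\<lambda>i. D * \<theta> ^ r * \<mu> i) m = D * \<theta> ^ r * wt \<mu> m" by (rule wt_scale)
        ultimately show "c = 0" using le by (fastforce simp: mult_ac)
      qed
    qed (use Suc in auto)
    moreover have "(hmap F ^^ Suc r) s j = ev (F j) ((hmap F ^^ r) s)" by (simp add: hmap_def)
    ultimately show ?case by simp
  qed (use D in auto)
  define M where "M = Max (range \<mu>)"
  have M: "\<mu> j \<le> M" for j unfolding M_def by simp
  have "D * \<theta> ^ r * \<mu> j \<le> D * M * \<theta> ^ r" for r j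
    using M[of j] D(1) th by (metis mult.assoc mult.commute mult_left_mono mult_nonneg_nonneg zero_le_power)
  then show ?thesis using * bd_mono by blast
qed

text \<open>
  Coordinates of weight zero are perturbed to a small positive weight. Affine components keep the required
  inequality, and the others have enough slack when \<open>\<theta>\<close> is increased a little.
\<close>
lemma UB_nonneg:
  fixes F :: "'k::field sys"
  assumes nn: "\<And>j. \<mu> j \<ge> 0" and th: "\<theta> \<ge> 1"
    and zero: "\<forall>j. \<mu> j = 0 \<longrightarrow> (\<forall>(c, m)\<in>set (F j). c = 0 \<or> length m \<le> 1)"
    and le: "\<forall>j. \<forall>(c, m)\<in>set (F j). c = 0 \<or> wt \<mu> m \<le> \<theta> * \<mu> j"
  shows "UB F \<theta>"
  unfolding UB_def
proof (intro allI impI)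
  fix s :: "idx \<Rightarrow> 'k ser" and \<theta>' assume "\<theta> < \<theta>'"
  define N where "N = real (Max (range (\<lambda>j. Max (insert 0 (length ` snd ` set (F j))))))"
  have N: "real (length m) \<le> N" if "(c, m) \<in> set (F j)" for c m j
  proof -
    have "length m \<le> Max (insert 0 (length ` snd ` set (F j)))"
      using that by (intro Max_ge) (auto intro!: image_eqI[of _ length m] image_eqI[of _ snd "(c, m)"])
    also have "\<dots> \<le> Max (range (\<lambda>j. Max (insert 0 (length ` snd ` set (F j)))))"
      by (intro Max_ge) auto
    finally show ?thesis unfolding N_def by simp
  qed
  have N0: "N \<ge> 0" unfolding N_def by simp
  have "\<exists>e>0. \<forall>j. \<mu> j > 0 \<longrightarrow> N * e \<le> (\<theta>' - \<theta>) * \<mu> j"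
  proof -
    define d where "d = Min (insert 1 (\<mu> ` {j. \<mu> j > 0}))"
    have d: "d > 0" unfolding d_def by (subst Min_gr_iff) auto
    have "d \<le> \<mu> j" if "\<mu> j > 0" for j unfolding d_def using that by (intro Min_le) auto
    then have "N * ((\<theta>' - \<theta>) * d / (N + 1)) \<le> (\<theta>' - \<theta>) * \<mu> j" if "\<mu> j > 0" for j
    proof -
      have "N * ((\<theta>' - \<theta>) * d / (N + 1)) = (N / (N + 1)) * ((\<theta>' - \<theta>) * d)" by simp
      also have "\<dots> \<le> 1 * ((\<theta>' - \<theta>) * d)"
        using N0 d \<open>\<theta> < \<theta>'\<close> by (intro mult_right_mono) auto
      also have "\<dots> \<le> (\<theta>' - \<theta>) * \<mu> j" using \<open>\<And>j. 0 < \<mu> j \<Longrightarrow> d \<le> \<mu> j\<close>[OF that] \<open>\<theta> < \<theta>'\<close> by simp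
      finally show ?thesis .
    qed
    then show ?thesis using d N0 \<open>\<theta> < \<theta>'\<close> by (intro exI[of _ "(\<theta>' - \<theta>) * d / (N + 1)"]) auto
  qed
  then obtain e where e: "e > 0" "\<And>j. \<mu> j > 0 \<Longrightarrow> N * e \<le> (\<theta>' - \<theta>) * \<mu> j" by blast
  define \<nu> where "\<nu> j = (if \<mu> j = 0 then e else \<mu> j)" for j
  have nu: "wt \<nu> m \<le> wt \<mu> m + length m * e" for m
    using e(1) nn by (induction m) (auto simp: \<nu>_def algebra_simps)
  show "\<exists>C. \<forall>r j. bd ((hmap F ^^ r) s j) (C * \<theta>' ^ r)"
  proof (rule UB_pos[where \<mu> = \<nu>])
    show "\<nu> j > 0" for j using e(1) nn[of j] by (auto simp: \<nu>_def)
    show "0 \<le> \<theta>'" using th \<open>\<theta> < \<theta>'\<close> by simp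
    show "\<forall>j. \<forall>(c, m)\<in>set (F j). c = 0 \<or> wt \<nu> m \<le> \<theta>' * \<nu> j"
    proof (clarify)
      fix j c m assume cm: "(c, m) \<in> set (F j)" "\<not> wt \<nu> m \<le> \<theta>' * \<nu> j"
      show "c = 0"
      proof (rule ccontr)
        assume c: "c \<noteq> 0"
        have l: "wt \<mu> m \<le> \<theta> * \<mu> j" using le cm(1) c by auto
        show False
        proof (cases "\<mu> j = 0")
          case True
          then have "length m \<le> 1" using zero cm(1) c by auto
          then have "real (length m) * e \<le> 1 * e" using e(1) by (intro mult_right_mono) auto
          also have "\<dots> \<le> \<theta>' * e" using th \<open>\<theta> < \<theta>'\<close> e(1) by (intro mult_right_mono) auto
          finally show False using nu[of m] l cm(2) True by (simp add: \<nu>_def)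
        next
          case False
          then have "real (length m) * e \<le> N * e" using N[OF cm(1)] e(1) by (intro mult_right_mono) auto
          also have "\<dots> \<le> (\<theta>' - \<theta>) * \<mu> j" using e(2)[of j] nn[of j] False by simp
          finally show False using nu[of m] l cm(2) False by (simp add: \<nu>_def algebra_simps)
        qed
      qed
    qed
  qed
qed

text \<open>
  The orbit starts at a point whose coordinates are single powers with the weights as exponents. In the coordinates
  with designated leading monomials, the coefficient at the largest possible exponent is determined by these monomials
  and by the previous coefficients, whose vector \<open>S\<close> follows; the entries in the other coordinates are arbitrary.
\<close>
lemma LB_lead:
  fixes F :: "'k::field sys" and S :: "nat \<Rightarrow> (idx \<Rightarrow> (4, 'k) mpoly) \<Rightarrow> bool"
  assumes le: "\<forall>j. \<forall>(c, m)\<in>set (F j). c = 0 \<or> wt \<mu> m \<le> \<theta> * \<mu> j" and th: "\<theta> > 0"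
    and ld: "\<forall>j. ld j \<noteq> [] \<longrightarrow> (\<forall>(c, m)\<in>set (F j).
       if m \<in> set (ld j) then wt \<mu> m = \<theta> * \<mu> j else c = 0 \<or> wt \<mu> m < \<theta> * \<mu> j)"
    and S: "\<And>r v v'. S r v \<Longrightarrow> (\<forall>j. ld j \<noteq> [] \<longrightarrow> v' j = (\<Sum>(c, m)\<leftarrow>filter (\<lambda>(c, m). m \<in> set (ld j)) (F j).
           mconst c * prod_list (map v m))) \<Longrightarrow> S (Suc r) v'"
    and S0: "S 0 v0"
  defines "s \<equiv> (\<lambda>j. Poly_Mapping.single (\<mu> j) (v0 j))"
  shows "(\<forall>j. bd ((hmap F ^^ r) s j) (\<theta> ^ r * \<mu> j)) \<and>
     S r (\<lambda>j. Poly_Mapping.lookup ((hmap F ^^ r) s j) (\<theta> ^ r * \<mu> j))"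
proof (induction r)
  case 0
  then show ?case using S0 by (simp add: s_def bd_single)
next
  case (Suc r)
  let ?a = "(hmap F ^^ r) s" and ?\<mu> = "\<lambda>i. \<theta> ^ r * \<mu> i"
  have wt_scale: "wt ?\<mu> m = \<theta> ^ r * wt \<mu> m" for m
    by (induction m) (auto simp: algebra_simps)
  have pw: "\<theta> ^ r > 0" using th by simp
  have sc: "wt ?\<mu> m \<le> \<theta> ^ Suc r * \<mu> j \<longleftrightarrow> wt \<mu> m \<le> \<theta> * \<mu> j"
      "wt ?\<mu> m < \<theta> ^ Suc r * \<mu> j \<longleftrightarrow> wt \<mu> m < \<theta> * \<mu> j"
      "wt ?\<mu> m = \<theta> ^ Suc r * \<mu> j \<longleftrightarrow> wt \<mu> m = \<theta> * \<mu> j" for m j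
    using th by (auto simp: wt_scale mult.assoc mult.left_commute[of \<theta>])
  have st: "(hmap F ^^ Suc r) s j = ev (F j) ?a" for j by (simp add: hmap_def)
  have b: "bd (?a j) (?\<mu> j)" for j using Suc by blast
  have "bd (ev (F j) ?a) (\<theta> ^ Suc r * \<mu> j)" for j
    by (rule bd_ev[where \<mu> = ?\<mu>, OF b]) (use le in \<open>simp only: sc; blast\<close>)
  moreover have "S (Suc r) (\<lambda>j. Poly_Mapping.lookup ((hmap F ^^ Suc r) s j) (\<theta> ^ Suc r * \<mu> j))"
  proof (rule S)
    show "S r (\<lambda>j. Poly_Mapping.lookup (?a j) (?\<mu> j))" using Suc by blast
    show "\<forall>j. ld j \<noteq> [] \<longrightarrow> Poly_Mapping.lookup ((hmap F ^^ Suc r) s j) (\<theta> ^ Suc r * \<mu> j) =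
      (\<Sum>(c, m)\<leftarrow>filter (\<lambda>(c, m). m \<in> set (ld j)) (F j).
           mconst c * prod_list (map (\<lambda>j. Poly_Mapping.lookup (?a j) (?\<mu> j)) m))"
    proof (intro allI impI)
      fix j assume "ld j \<noteq> []"
      then have "\<forall>(c, m)\<in>set (F j). if m \<in> set (ld j) then wt ?\<mu> m = \<theta> ^ Suc r * \<mu> j
            else c = 0 \<or> wt ?\<mu> m < \<theta> ^ Suc r * \<mu> j"
        using ld by (simp only: sc) blast
      then show "Poly_Mapping.lookup ((hmap F ^^ Suc r) s j) (\<theta> ^ Suc r * \<mu> j) =
        (\<Sum>(c, m)\<leftarrow>filter (\<lambda>(c, m). m \<in> set (ld j)) (F j).
             mconst c * prod_list (map (\<lambda>j. Poly_Mapping.lookup (?a j) (?\<mu> j)) m))"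
        unfolding st by (rule lookup_ev[OF b])
    qed
  qed
  ultimately show ?case by (simp only: st simp_thms)
qed

text \<open>
  The weights bound the growth from above, and from below as long as some leading coefficient in a coordinate of positive
  weight survives. The invariant \<open>S\<close> excludes that all of them cancel.
\<close>
lemma leaf:
  fixes F :: "'k::field sys" and S :: "(idx \<Rightarrow> (4, 'k) mpoly) \<Rightarrow> bool"
  assumes th: "\<theta> \<ge> 1" and a4: "alg4 \<theta>"
    and nn: "\<forall>j. \<mu> j \<ge> 0"
    and zero: "\<forall>j. \<mu> j = 0 \<longrightarrow> (\<forall>(c, m)\<in>set (F j). c = 0 \<or> length m \<le> 1)"
    and le: "\<forall>j. \<forall>(c, m)\<in>set (F j). c = 0 \<or> wt \<mu> m \<le> \<theta> * \<mu> j"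
    and ld: "\<forall>j. ld j \<noteq> [] \<longrightarrow> (\<forall>(c, m)\<in>set (F j).
       if m \<in> set (ld j) then wt \<mu> m = \<theta> * \<mu> j else c = 0 \<or> wt \<mu> m < \<theta> * \<mu> j)"
    and S: "\<And>v v'. S v \<Longrightarrow> (\<forall>j. ld j \<noteq> [] \<longrightarrow> v' j = (\<Sum>(c, m)\<leftarrow>filter (\<lambda>(c, m). m \<in> set (ld j)) (F j).
           mconst c * prod_list (map v m))) \<Longrightarrow> S v'"
    and S0: "S v0" and nz: "\<And>v. S v \<Longrightarrow> \<exists>j. \<mu> j > 0 \<and> v j \<noteq> 0"
  shows "good F"
  unfolding good_def
proof (intro exI[of _ \<theta>] conjI disjI2)
  show "UB F \<theta>" by (rule UB_nonneg[OF _ th zero le]) (use nn in blast)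
  let ?s = "\<lambda>j. Poly_Mapping.single (\<mu> j) (v0 j)"
  define c where "c = Min (insert 1 (\<mu> ` {j. \<mu> j > 0}))"
  have c0: "c > 0" unfolding c_def by (subst Min_gr_iff) auto
  have c: "c \<le> \<mu> j" if "\<mu> j > 0" for j unfolding c_def using that by (intro Min_le) auto
  define D where "D = Max (range \<mu>)"
  show "LB F \<theta>" unfolding LB_def
  proof (rule exI[of _ c], rule conjI[OF c0], rule exI[of _ D], rule allI, rule exI[of _ ?s], intro conjI allI impI)
    fix j show "bd (?s j) D" by (rule bd_single) (simp add: D_def)
  next
    fix r t assume t: "\<forall>j. bd ((hmap F ^^ r) ?s j) t"
    have L: "S (\<lambda>j. Poly_Mapping.lookup ((hmap F ^^ r) ?s j) (\<theta> ^ r * \<mu> j))"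
      using LB_lead[of F \<mu> \<theta> ld "\<lambda>_. S", OF le _ ld S S0] th by simp
    obtain j where j: "\<mu> j > 0" "Poly_Mapping.lookup ((hmap F ^^ r) ?s j) (\<theta> ^ r * \<mu> j) \<noteq> 0"
      using nz[OF L] by blast
    have "c * \<theta> ^ r \<le> \<theta> ^ r * \<mu> j" using c[OF j(1)] th by (simp add: mult.commute)
    also have "\<dots> \<le> t" using bd_lookup_le t j(2) by blast
    finally show "c * \<theta> ^ r \<le> t" .
  qed
qed (use th a4 in auto)

text \<open>When every leading coordinate has a single leading monomial, nothing can cancel.\<close>

lemma leaf_mono:
  fixes F :: "'k::field sys"
  assumes "\<theta> \<ge> 1" "alg4 \<theta>" "\<forall>j. \<mu> j \<ge> 0"
    and "\<forall>j. \<mu> j = 0 \<longrightarrow> (\<forall>(c, m)\<in>set (F j). c = 0 \<or> length m \<le> 1)"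
    and "\<forall>j. \<forall>(c, m)\<in>set (F j). c = 0 \<or> wt \<mu> m \<le> \<theta> * \<mu> j"
    and "\<forall>j. ld j \<noteq> [] \<longrightarrow> (\<forall>(c, m)\<in>set (F j).
       if m \<in> set (ld j) then wt \<mu> m = \<theta> * \<mu> j else c = 0 \<or> wt \<mu> m < \<theta> * \<mu> j)"
    and one: "\<forall>j. ld j \<noteq> [] \<longrightarrow> (\<exists>c m. filter (\<lambda>(c, m). m \<in> set (ld j)) (F j) = [(c, m)] \<and> c \<noteq> 0
           \<and> (\<forall>i\<in>set m. ld i \<noteq> []))"
    and "\<exists>j. ld j \<noteq> [] \<and> \<mu> j > 0"
  shows "good F"
proof (rule leaf[where S = "\<lambda>v. \<forall>j. ld j \<noteq> [] \<longrightarrow> v j \<noteq> 0" and ?v0.0 = "\<lambda>_. 1", OF assms(1-6)])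
  fix v v' :: "idx \<Rightarrow> (4, 'k) mpoly"
  assume v: "\<forall>j. ld j \<noteq> [] \<longrightarrow> v j \<noteq> 0"
    and v': "\<forall>j. ld j \<noteq> [] \<longrightarrow> v' j = (\<Sum>(c, m)\<leftarrow>filter (\<lambda>(c, m). m \<in> set (ld j)) (F j).
           mconst c * prod_list (map v m))"
  show "\<forall>j. ld j \<noteq> [] \<longrightarrow> v' j \<noteq> 0"
  proof (intro allI impI)
    fix j assume j: "ld j \<noteq> []"
    obtain c m where cm: "filter (\<lambda>(c, m). m \<in> set (ld j)) (F j) = [(c, m)]" "c \<noteq> 0" "\<forall>i\<in>set m. ld i \<noteq> []"
      using one j by blast
    have "0 \<notin> set (map v m)" using cm(3) v by auto
    then have "prod_list (map v m) \<noteq> 0" by (simp add: prod_list_zero_iff)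
    then show "v' j \<noteq> 0" using v' j cm by simp
  qed
qed (use assms(8) in auto)

definition hom2 :: "'k::field sys \<Rightarrow> (idx \<Rightarrow> 'k) \<Rightarrow> (idx \<Rightarrow> 'k)"
  where "hom2 F v = (\<lambda>j. \<Sum>(c, m)\<leftarrow>F j. if length m = 2 then c * prod_list (map v m) else 0)"

lemma alg4I:
  assumes "Polynomial.lead_coeff p = 1" "Polynomial.degree p \<le> 4" "poly (map_poly of_int p) \<theta> = 0"
  shows "alg4 \<theta>"
  unfolding alg4_def using assms by blast

lemma alg4_of_int: "alg4 (of_int n)"
  by (rule alg4I[of "[:-n, 1:]"]) (auto simp: map_poly_pCons)

text \<open>
  With all weights equal to 1 the leading part is the homogeneous quadratic part; degrees double in each step unless
  some iterate of it vanishes identically.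
\<close>
lemma good2:
  fixes F :: "'k::field sys"
  assumes len: "\<forall>j. \<forall>(c, m)\<in>set (F j). c = 0 \<or> length m \<le> 2"
    and nz: "\<And>r. \<exists>v j. (hom2 F ^^ r) v j \<noteq> 0"
  shows "good F"
  unfolding good_def
proof (intro exI[of _ 2] conjI disjI2)
  let ?\<mu> = "\<lambda>_::idx. 1::real"
  have w1: "wt ?\<mu> m = length m" for m by (induction m) auto
  have le: "\<forall>j. \<forall>(c, m)\<in>set (F j). c = 0 \<or> wt ?\<mu> m \<le> 2 * ?\<mu> j"
    unfolding w1 using len by fastforce
  show "UB F 2" by (rule UB_nonneg[where \<mu> = ?\<mu>]) (use le in auto)
  have q: "(\<Sum>(c, m)\<leftarrow>filter (\<lambda>(c, m). length m = 2) L. mconst c * prod_list (map (\<lambda>i. mconst (v i)) m))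
     = (mconst :: 'k \<Rightarrow> (4, 'k) mpoly) (\<Sum>(c, m)\<leftarrow>L. if length m = 2 then c * prod_list (map v m) else 0)" for L and v :: "idx \<Rightarrow> 'k"
  proof (induction L)
    case (Cons cm L)
    have "prod_list (map (\<lambda>i. mconst (v i)) m) = (mconst (prod_list (map v m)) :: (4, 'k) mpoly)" for m
      by (induction m) (auto simp: mconst_mult)
    then show ?case using Cons by (cases cm) (auto simp: mconst_add mconst_mult)
  qed simp
  show "LB F 2" unfolding LB_def
  proof (intro exI[of _ 1] conjI exI[of _ 1] allI)
    fix r
    obtain v0 j where vj: "(hom2 F ^^ r) v0 j \<noteq> 0" using nz by blast
    let ?s = "\<lambda>j. Poly_Mapping.single (?\<mu> j) (mconst (v0 j))"
    have step: "\<forall>j. bd ((hmap F ^^ n) ?s j) (2 ^ n) \<and>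
        Poly_Mapping.lookup ((hmap F ^^ n) ?s j) (2 ^ n) = mconst ((hom2 F ^^ n) v0 j)" for n
    proof (induction n)
      case 0
      then show ?case by (simp add: bd_single)
    next
      case (Suc n)
      show ?case
      proof
        fix j
        let ?a = "(hmap F ^^ n) ?s"
        have b: "bd (?a i) ((\<lambda>_. 2 ^ n) i)" for i using Suc by blast
        have w: "wt (\<lambda>_. 2 ^ n) m = 2 ^ n * real (length m)" for m by (induction m) (auto simp: algebra_simps)
        have c1: "\<forall>(c, m)\<in>set (F j). c = 0 \<or> wt (\<lambda>_. 2 ^ n) m \<le> 2 ^ Suc n"
          unfolding w using len by fastforce
        have c2: "\<forall>(c, m)\<in>set (F j). if m \<in> set (filter (\<lambda>m. length m = 2) (map snd (F j))) then wt (\<lambda>_. 2 ^ n) m = 2 ^ Suc n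
            else c = 0 \<or> wt (\<lambda>_. 2 ^ n) m < 2 ^ Suc n"
        proof (rule ballI, clarify)
          fix c m assume cm: "(c, m) \<in> set (F j)"
          show "if m \<in> set (filter (\<lambda>m. length m = 2) (map snd (F j))) then wt (\<lambda>_. 2 ^ n) m = 2 ^ Suc n
            else c = 0 \<or> wt (\<lambda>_. 2 ^ n) m < 2 ^ Suc n"
          proof (cases "length m = 2")
            case True
            then show ?thesis using cm by (force simp: w)
          next
            case False
            then have "c = 0 \<or> length m < 2" using len cm by fastforce
            then show ?thesis using False by (auto simp: w)
          qed
        qed
        have f: "filter (\<lambda>(c, m). m \<in> set (filter (\<lambda>m. length m = 2) (map snd (F j)))) (F j)
           = filter (\<lambda>(c, m). length m = 2) (F j)"
          by (rule filter_cong) force+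
        have "Poly_Mapping.lookup (ev (F j) ?a) (2 ^ Suc n) = mconst (hom2 F ((hom2 F ^^ n) v0) j)"
          using lookup_ev[where a = ?a and \<mu> = "\<lambda>_. 2 ^ n", OF b c2] Suc unfolding f
          by (simp add: q hom2_def[of F "(hom2 F ^^ n) v0"])
        then show "bd ((hmap F ^^ Suc n) ?s j) (2 ^ Suc n) \<and>
          Poly_Mapping.lookup ((hmap F ^^ Suc n) ?s j) (2 ^ Suc n) = mconst ((hom2 F ^^ Suc n) v0 j)"
          using bd_ev[OF b c1] by (simp add: hmap_def)
      qed
    qed
    show "\<exists>s. (\<forall>j. bd (s j) 1) \<and> (\<forall>t. (\<forall>j. bd ((hmap F ^^ r) s j) t) \<longrightarrow> 1 * 2 ^ r \<le> t)"
    proof (intro exI[of _ ?s] conjI allI impI)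
      show "bd (?s j) 1" for j by (simp add: bd_single)
      fix t assume "\<forall>j. bd ((hmap F ^^ r) ?s j) t"
      moreover have "Poly_Mapping.lookup ((hmap F ^^ r) ?s j) (2 ^ r) \<noteq> 0" using step[of r] vj by simp
      ultimately show "1 * 2 ^ r \<le> t" using bd_lookup_le by fastforce
    qed
  qed auto
qed (use alg4_of_int[of 2] in auto)

lemma good2_inv:
  fixes F :: "'k::field sys"
  assumes len: "\<forall>j. \<forall>(c, m)\<in>set (F j). c = 0 \<or> length m \<le> 2"
    and S: "\<And>v. S v \<Longrightarrow> S (hom2 F v)" "S v0" "\<And>v. S v \<Longrightarrow> \<exists>j. v j \<noteq> 0"
  shows "good F"
proof (rule good2[OF len])
  fix r
  have "S ((hom2 F ^^ r) v0)" by (induction r) (auto intro: S)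
  then show "\<exists>v j. (hom2 F ^^ r) v j \<noteq> 0" using S(3) by blast
qed

text \<open>
  The weights depend on the excess \<open>e\<close> of the rate over 1, since there need not be weights that work for the rate 1 itself.
\<close>
lemma good1:
  fixes F :: "'k::field sys" and \<mu> :: "real \<Rightarrow> idx \<Rightarrow> real"
  assumes pos: "\<And>e. 0 < e \<Longrightarrow> \<forall>j. \<mu> e j > 0"
    and le: "\<And>e. 0 < e \<Longrightarrow> e < 1/2 \<Longrightarrow> 0 \<le> e * e \<Longrightarrow>
      \<forall>j. \<forall>(c, m)\<in>set (F j). c = 0 \<or> wt (\<mu> e) m \<le> (1 + e) * \<mu> e j"
  shows "good F"
  unfolding good_def
proof (intro exI[of _ 1] conjI disjI1)
  show "UB F 1" unfolding UB_def
  proof (intro allI impI)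
    fix s :: "idx \<Rightarrow> 'k ser" and \<theta> :: real assume th: "\<theta> > 1"
    define e where "e = min (\<theta> - 1) (1/4)"
    have e: "0 < e" "e < 1/2" "1 + e \<le> \<theta>" using th by (auto simp: e_def min_def)
    obtain C where C: "\<And>r j. bd ((hmap F ^^ r) s j) (C * (1 + e) ^ r)"
      using UB_pos[of "\<mu> e" "1 + e" F s] pos[OF e(1)] le[OF e(1,2)] e(1) by auto
    have "bd ((hmap F ^^ r) s j) (max C 0 * \<theta> ^ r)" for r j
    proof (rule bd_mono[OF C])
      have "C * (1 + e) ^ r \<le> max C 0 * (1 + e) ^ r" using e(1) by (intro mult_right_mono) auto
      also have "\<dots> \<le> max C 0 * \<theta> ^ r" using e by (intro mult_left_mono power_mono) auto
      finally show "C * (1 + e) ^ r \<le> max C 0 * \<theta> ^ r" .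
    qed
    then show "\<exists>C. \<forall>r j. bd ((hmap F ^^ r) s j) (C * \<theta> ^ r)" by blast
  qed
qed (use alg4_of_int[of 1] in auto)

lemma bd_hmap_linear: "\<exists>D>0. \<forall>a t. t \<ge> 0 \<longrightarrow> (\<forall>j. bd (a j) t) \<longrightarrow> (\<forall>j. bd (hmap F a j) (D * t))"
proof -
  define D where "D = real (Suc (Max (range (\<lambda>j. Max (insert 0 (length ` snd ` set (F j)))))))"
  have D: "real (length m) \<le> D" if "(c, m) \<in> set (F j)" for c m j
  proof -
    have "length m \<le> Max (insert 0 (length ` snd ` set (F j)))"
      using that by (intro Max_ge) (auto intro!: image_eqI[of _ length m] image_eqI[of _ snd "(c, m)"])
    also have "\<dots> \<le> Max (range (\<lambda>j. Max (insert 0 (length ` snd ` set (F j)))))"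
      by (intro Max_ge) auto
    finally show ?thesis unfolding D_def by simp
  qed
  have w: "wt (\<lambda>_. t) m = real (length m) * t" for m and t :: real by (induction m) (auto simp: algebra_simps)
  show ?thesis
  proof (intro exI[of _ D] conjI allI impI)
    fix a :: "idx \<Rightarrow> 'a ser" and t :: real and j assume "t \<ge> 0" "\<forall>j. bd (a j) t"
    moreover have "wt (\<lambda>_. t) m \<le> D * t" if "(c, m) \<in> set (F j)" for c m
      using mult_right_mono[OF D[OF that] \<open>t \<ge> 0\<close>] w[of t m] by simp
    ultimately show "bd (hmap F a j) (D * t)" unfolding hmap_def
      by (intro bd_ev[where \<mu> = "\<lambda>_. t"]) auto
  qed (simp add: D_def)
qed

text \<open>
  A fixed polynomial map multiplies exponent bounds at most by a constant (\<open>bd_hmap_linear\<close>), so conjugate systems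
  grow at the same rate.
\<close>
lemma good_conj:
  fixes F F' G G' :: "'k::field sys"
  assumes sc: "\<And>a. hmap G (hmap F a) = hmap F' (hmap G a)"
    and i1: "\<And>a. hmap G' (hmap G a) = a" and i2: "\<And>a. hmap G (hmap G' a) = a"
    and good: "good F'"
  shows "good F"
proof -
  have it: "hmap G ((hmap F ^^ r) a) = (hmap F' ^^ r) (hmap G a)" for r a
    by (induction r) (auto simp: sc)
  obtain D where D: "D > 0" "\<And>a t. t \<ge> 0 \<Longrightarrow> (\<forall>j. bd (a j) t) \<Longrightarrow> (\<forall>j. bd (hmap G a j) (D * t))"
    using bd_hmap_linear[of G] by blast
  obtain D' where D': "D' > 0" "\<And>a t. t \<ge> 0 \<Longrightarrow> (\<forall>j. bd (a j) t) \<Longrightarrow> (\<forall>j. bd (hmap G' a j) (D' * t))"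
    using bd_hmap_linear[of G'] by blast
  obtain \<theta> where th: "\<theta> \<ge> 1" "alg4 \<theta>" "UB F' \<theta>" "\<theta> = 1 \<or> LB F' \<theta>" using good unfolding good_def by blast
  have "UB F \<theta>" unfolding UB_def
  proof (intro allI impI)
    fix s \<theta>' assume "\<theta> < \<theta>'"
    then obtain C where C: "\<And>r j. bd ((hmap F' ^^ r) (hmap G s) j) (C * \<theta>' ^ r)"
      using th(3) unfolding UB_def by blast
    define C' where "C' = max C 0"
    have "bd ((hmap F' ^^ r) (hmap G s) j) (C' * \<theta>' ^ r)" for r j
      using th(1) \<open>\<theta> < \<theta>'\<close> by (intro bd_mono[OF C]) (auto simp: C'_def intro!: mult_right_mono)
    moreover have "C' * \<theta>' ^ r \<ge> 0" for r using th(1) \<open>\<theta> < \<theta>'\<close> by (simp add: C'_def)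
    ultimately have "bd (hmap G' ((hmap F' ^^ r) (hmap G s)) j) (D' * (C' * \<theta>' ^ r))" for r j
      using D'(2)[of "C' * \<theta>' ^ r" "(hmap F' ^^ r) (hmap G s)"] by blast
    then have "bd ((hmap F ^^ r) s j) ((D' * C') * \<theta>' ^ r)" for r j
      using it[of r s] i1 by (metis mult.assoc)
    then show "\<exists>C. \<forall>r j. bd ((hmap F ^^ r) s j) (C * \<theta>' ^ r)" by blast
  qed
  moreover have "LB F \<theta>" if lb: "LB F' \<theta>"
  proof -
    obtain c E where c: "c > 0" and E: "\<forall>r. \<exists>s. (\<forall>j. bd (s j) E) \<and>
           (\<forall>t. (\<forall>j. bd ((hmap F' ^^ r) s j) t) \<longrightarrow> c * \<theta> ^ r \<le> t)"
      using lb[unfolded LB_def] by (elim exE conjE) (rule that)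
    have cD: "c / D > 0" using c D(1) by simp
    show ?thesis unfolding LB_def
    proof (rule exI[of _ "c / D"], rule conjI[OF cD], rule exI[of _ "D' * max E 0"], rule allI)
      fix r
      obtain s where s: "\<forall>j. bd (s j) E"
          "\<And>t. (\<forall>j. bd ((hmap F' ^^ r) s j) t) \<Longrightarrow> c * \<theta> ^ r \<le> t" using E by blast
      have "\<forall>j. bd (s j) (max E 0)" using s(1) by (auto intro: bd_mono[of _ E])
      then have "\<forall>j. bd (hmap G' s j) (D' * max E 0)" using D'(2)[of "max E 0" s] by simp
      moreover have "c / D * \<theta> ^ r \<le> t" if t: "\<forall>j. bd ((hmap F ^^ r) (hmap G' s) j) t" for t
      proof -
        have *: "c * \<theta> ^ r \<le> D * u" if "u \<ge> 0" "u \<ge> t" for u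
        proof (rule s(2))
          have "\<forall>j. bd ((hmap F ^^ r) (hmap G' s) j) u" using t that(2) bd_mono by blast
          then have "\<forall>j. bd (hmap G ((hmap F ^^ r) (hmap G' s)) j) (D * u)"
            using D(2) that(1) by blast
          then show "\<forall>j. bd ((hmap F' ^^ r) s j) (D * u)" by (simp add: it i2)
        qed
        have "0 < c * \<theta> ^ r" using c th(1) by simp
        then have "t \<ge> 0" using *[of 0] by (cases "t \<ge> 0") auto
        then show ?thesis using *[of t] D(1) by (simp add: field_simps)
      qed
      ultimately show "\<exists>s. (\<forall>j. bd (s j) (D' * max E 0)) \<and>
          (\<forall>t. (\<forall>j. bd ((hmap F ^^ r) s j) t) \<longrightarrow> c / D * \<theta> ^ r \<le> t)" by blast
    qed
  qed
  ultimately show ?thesis unfolding good_def using th by blast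
qed

section \<open>Growth rates, recurrences and binary quadratic maps\<close>

lemma quad_root:
  fixes a b :: int and l u :: real
  assumes "0 < l" "l \<le> u" "l * l \<le> a * l + b" "a * u + b \<le> u * u"
  obtains \<theta> :: real where "l \<le> \<theta>" "\<theta> \<le> u" "\<theta> * \<theta> = a * \<theta> + b" "alg4 \<theta>"
proof -
  have "\<exists>x::real. x \<ge> l \<and> x \<le> u \<and> x * x - (a * x + b) = 0"
    by (rule IVT') (use assms in \<open>auto intro!: continuous_intros\<close>)
  then obtain x :: real where x: "l \<le> x" "x \<le> u" "x * x = a * x + b" by auto
  moreover have "alg4 x"
    by (rule alg4I[of "[:-b, -a, 1:]"]) (use x in \<open>auto simp: map_poly_pCons algebra_simps\<close>)
  ultimately show ?thesis using that by blast
qed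

lemma cubic_root:
  fixes a b c :: int and l u :: real
  assumes "0 < l" "l \<le> u" "l * (l * l) \<le> a * (l * l) + b * l + c" "a * (u * u) + b * u + c \<le> u * (u * u)"
  obtains \<theta> t :: real where "l \<le> \<theta>" "\<theta> \<le> u" "l * l \<le> t" "t \<le> u * u" "\<theta> * \<theta> = t" "\<theta> * t = a * t + b * \<theta> + c" "alg4 \<theta>"
proof -
  have "\<exists>x::real. x \<ge> l \<and> x \<le> u \<and> x * (x * x) - (a * (x * x) + b * x + c) = 0"
    by (rule IVT') (use assms in \<open>auto intro!: continuous_intros\<close>)
  then obtain x :: real where x: "l \<le> x" "x \<le> u" "x * (x * x) = a * (x * x) + b * x + c" by auto
  moreover have "alg4 x"
    by (rule alg4I[of "[:-c, -b, -a, 1:]"]) (use x in \<open>auto simp: map_poly_pCons algebra_simps\<close>)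
  moreover have "l * l \<le> x * x" "x * x \<le> u * u" using x assms(1) by (auto intro: mult_mono)
  ultimately show ?thesis using that by blast
qed

text \<open>
  Root of \<open>X\<^sup>2 = a X + b\<close> with an isolating interval. The interval turns the inequalities between weights into linear
  arithmetic.
\<close>
definition rt2 :: "int \<Rightarrow> int \<Rightarrow> real \<Rightarrow> real \<Rightarrow> real \<Rightarrow> bool"
  where "rt2 a b l u \<theta> \<longleftrightarrow> l \<le> \<theta> \<and> \<theta> \<le> u \<and> \<theta> * \<theta> = a * \<theta> + b \<and> alg4 \<theta>"

text \<open>
  Root of \<open>X\<^sup>3 = a X\<^sup>2 + b X + c\<close>. Its square has a name of its own, so that the defining equations become linear
  when the weights are polynomials in the root.
\<close>
definition rt3 :: "int \<Rightarrow> int \<Rightarrow> int \<Rightarrow> real \<Rightarrow> real \<Rightarrow> real \<Rightarrow> real \<Rightarrow> bool"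
  where "rt3 a b c l u \<theta> t \<longleftrightarrow> l \<le> \<theta> \<and> \<theta> \<le> u \<and> l * l \<le> t \<and> t \<le> u * u \<and> \<theta> * \<theta> = t
    \<and> \<theta> * t = a * t + b * \<theta> + c \<and> alg4 \<theta>"

lemma rt2I: "0 < l \<Longrightarrow> l \<le> u \<Longrightarrow> l * l \<le> of_int a * l + of_int b \<Longrightarrow> of_int a * u + of_int b \<le> u * u
   \<Longrightarrow> \<exists>\<theta>. rt2 a b l u \<theta>"
  by (rule quad_root[of l u a b]) (auto simp: rt2_def)

lemma rt3I: "0 < l \<Longrightarrow> l \<le> u \<Longrightarrow> l * (l * l) \<le> of_int a * (l * l) + of_int b * l + of_int c
   \<Longrightarrow> of_int a * (u * u) + of_int b * u + of_int c \<le> u * (u * u) \<Longrightarrow> \<exists>\<theta> t. rt3 a b c l u \<theta> t"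
  by (rule cubic_root[of l u a b c]) (auto simp: rt3_def)

lemma golden: "\<exists>\<theta>. rt2 1 1 1.618 1.619 \<theta>" and sqrt2: "\<exists>\<theta>. rt2 0 2 1.414 1.415 \<theta>"
  and sqrt3: "\<exists>\<theta>. rt2 0 3 1.732 1.733 \<theta>"
  by (rule rt2I; simp)+

lemma cub002: "\<exists>\<theta> t. rt3 0 0 2 1.259 1.26 \<theta> t" and cub011: "\<exists>\<theta> t. rt3 0 1 1 1.324 1.325 \<theta> t"
  and cub101: "\<exists>\<theta> t. rt3 1 0 1 1.465 1.466 \<theta> t" and cub012: "\<exists>\<theta> t. rt3 0 1 2 1.521 1.522 \<theta> t"
  and cub004: "\<exists>\<theta> t. rt3 0 0 4 1.587 1.588 \<theta> t" and cub102: "\<exists>\<theta> t. rt3 1 0 2 1.695 1.696 \<theta> t"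
  and cub022: "\<exists>\<theta> t. rt3 0 2 2 1.769 1.77 \<theta> t" and cub111: "\<exists>\<theta> t. rt3 1 1 1 1.839 1.84 \<theta> t"
  and cub2m11: "\<exists>\<theta> t. rt3 2 (-1) 1 1.754 1.755 \<theta> t" and cub12m1: "\<exists>\<theta> t. rt3 1 2 (-1) 1.801 1.802 \<theta> t"
  by (rule rt3I; simp)+

text \<open>
  \<open>Q1\<close>, \<open>Q2\<close>, \<open>Q3\<close> are the general polynomials of degree at most two in the first one, two, three coordinates.
\<close>
definition Q1 :: "'k \<Rightarrow> 'k \<Rightarrow> 'k \<Rightarrow> ('k \<times> idx list) list"
  where "Q1 p1 p2 p3 = [(p1, [Vx, Vx]), (p2, [Vx]), (p3, [])]"

definition Q2 :: "'k \<Rightarrow> 'k \<Rightarrow> 'k \<Rightarrow> 'k \<Rightarrow> 'k \<Rightarrow> 'k \<Rightarrow> ('k \<times> idx list) list"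
  where "Q2 q1 q2 q3 q4 q5 q6 = [(q1, [Vy, Vy]), (q2, [Vx, Vy]), (q3, [Vx, Vx]), (q4, [Vy]), (q5, [Vx]), (q6, [])]"

definition Q3 :: "'k \<Rightarrow> 'k \<Rightarrow> 'k \<Rightarrow> 'k \<Rightarrow> 'k \<Rightarrow> 'k \<Rightarrow> 'k \<Rightarrow> 'k \<Rightarrow> 'k \<Rightarrow> 'k \<Rightarrow> ('k \<times> idx list) list"
  where "Q3 s1 s2 s3 s4 s5 s6 s7 s8 s9 s10 = [(s1, [Vz, Vz]), (s2, [Vy, Vz]), (s3, [Vx, Vz]),
    (s4, [Vy, Vy]), (s5, [Vx, Vy]), (s6, [Vx, Vx]), (s7, [Vz]), (s8, [Vy]), (s9, [Vx]), (s10, [])]"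

lemmas Qs = Q1_def Q2_def Q3_def

lemma transc:
  assumes "mconst \<alpha> * mvar (1::4) + mconst \<beta> = (0 :: (4, 'k::field) mpoly)" shows "\<alpha> = 0 \<and> \<beta> = 0"
proof -
  let ?m = "Poly_Mapping.single (1::4) (1::nat)"
  have ne: "?m \<noteq> 0" by (metis lookup_single_eq lookup_zero zero_neq_one)
  have e: "mconst \<alpha> * mvar (1::4) + mconst \<beta> = Poly_Mapping.single ?m \<alpha> + Poly_Mapping.single 0 \<beta>"
    by (simp add: mconst_def mvar_def mult_single)
  have "Poly_Mapping.lookup (mconst \<alpha> * mvar (1::4) + mconst \<beta>) ?m = \<alpha>"
    unfolding e using ne by (simp add: lookup_add lookup_single)
  moreover have "Poly_Mapping.lookup (mconst \<alpha> * mvar (1::4) + mconst \<beta>) 0 = \<beta>"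
    unfolding e using ne by (simp add: lookup_add lookup_single)
  ultimately show ?thesis using assms by simp
qed

text \<open>
  Affine functions of an indeterminate. A recursion \<open>u \<mapsto> b u + c\<close> with nonzero slope preserves them, and they never vanish.
\<close>
definition trs :: "(4, 'k::field) mpoly \<Rightarrow> bool"
  where "trs u \<longleftrightarrow> (\<exists>\<alpha> \<beta>. \<alpha> \<noteq> 0 \<and> u = mconst \<alpha> * mvar 1 + mconst \<beta>)"

lemma trs_affine: "trs u \<Longrightarrow> b \<noteq> 0 \<Longrightarrow> trs (mconst b * u + mconst c)"
  unfolding trs_def
  by (elim exE conjE, rule_tac x = "b * \<alpha>" in exI, rule_tac x = "b * \<beta> + c" in exI)
    (simp add: mconst_add mconst_mult algebra_simps)

lemma trs_nz: "trs u \<Longrightarrow> b \<noteq> 0 \<or> c \<noteq> 0 \<Longrightarrow> mconst b * u + mconst c \<noteq> 0"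
proof (cases "b = 0")
  case False
  moreover assume "trs u"
  ultimately have "trs (mconst b * u + mconst c)" by (rule trs_affine[rotated])
  then obtain \<alpha> \<beta> where "\<alpha> \<noteq> 0" "mconst b * u + mconst c = mconst \<alpha> * mvar 1 + mconst \<beta>"
    unfolding trs_def by blast
  then show ?thesis using transc[of \<alpha> \<beta>] by auto
qed auto

lemma trs_mvar: "trs (mvar 1)"
  unfolding trs_def by (rule exI[of _ 1], rule exI[of _ 0]) simp

text \<open>
  A recurrence of order four whose quadratic terms do not involve the oldest value. The quadratic monomials
  \<open>w w\<close>, \<open>z w\<close>, \<open>y w\<close>, \<open>z z\<close>, \<open>y z\<close>, \<open>y y\<close> cause growth in decreasing order, each with its own characteristic equation;
  without them the system is affine.
\<close>
lemma good_shift4: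
  fixes F :: "'k::field sys"
  assumes F: "F = case_idx [(u1, [Vy]), (u2, [Vx]), (u3, []), (u4, [Vz])] [(d, [Vz]), (v1, [Vy]), (v2, [Vx]), (v3, [])]
     [(e, [Vw]), (w1, [Vz]), (w2, [Vy]), (w3, [Vx]), (w4, [])]
    [(q1, [Vw, Vw]), (q2, [Vz, Vw]), (q3, [Vy, Vw]), (q4, [Vz, Vz]), (q5, [Vy, Vz]), (q6, [Vy, Vy]),
     (l0, [Vx]), (l1, [Vy]), (l2, [Vz]), (l3, [Vw]), (k, [])]"
    and nz: "d \<noteq> 0" "e \<noteq> 0"
  shows "good F"
proof -
  consider "q1 \<noteq> 0" | "q1 = 0" "q2 \<noteq> 0" | "q1 = 0" "q2 = 0" "q3 \<noteq> 0" | "q1 = 0" "q2 = 0" "q3 = 0" "q4 \<noteq> 0"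
    | "q1 = 0" "q2 = 0" "q3 = 0" "q4 = 0" "q5 \<noteq> 0" | "q1 = 0" "q2 = 0" "q3 = 0" "q4 = 0" "q5 = 0" "q6 \<noteq> 0"
    | "q1 = 0" "q2 = 0" "q3 = 0" "q4 = 0" "q5 = 0" "q6 = 0" by blast
  then show ?thesis
  proof cases
    case 1
    show ?thesis
      by (rule good2_inv[where S = "\<lambda>v. v Vw \<noteq> 0 \<and> v Vx = 0 \<and> v Vy = 0 \<and> v Vz = 0" and ?v0.0 = "case_idx 0 0 0 1"])
        (use 1 in \<open>auto simp: F all_idx hom2_def\<close>)
  next
    case 2
    obtain \<theta> where th: "rt2 1 1 1.618 1.619 \<theta>" using golden by blast
    show ?thesis
      by (rule leaf_mono[where \<theta> = \<theta> and \<mu> = "case_idx 1 1 \<theta> (\<theta> + 1)" and ld = "case_idx [] [] [[Vw]] [[Vz, Vw]]"])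
        (use 2 th nz in \<open>auto simp: F all_idx ex_idx algebra_simps rt2_def\<close>)
  next
    case 3
    obtain \<theta> t where th: "rt3 1 0 1 1.465 1.466 \<theta> t" using cub101 by blast
    show ?thesis
      by (rule leaf_mono[where \<theta> = \<theta> and \<mu> = "case_idx 1 1 \<theta> t" and ld = "case_idx [] [[Vz]] [[Vw]] [[Vy, Vw]]"])
        (use 3 th nz in \<open>auto simp: F all_idx ex_idx algebra_simps rt3_def\<close>)
  next
    case 4
    obtain \<theta> where th: "rt2 0 2 1.414 1.415 \<theta>" using sqrt2 by blast
    show ?thesis
      by (rule leaf_mono[where \<theta> = \<theta> and \<mu> = "case_idx 1 1 \<theta> 2" and ld = "case_idx [] [] [[Vw]] [[Vz, Vz]]"])
        (use 4 th nz in \<open>auto simp: F all_idx ex_idx algebra_simps rt2_def\<close>)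
  next
    case 5
    obtain \<theta> t where th: "rt3 0 1 1 1.324 1.325 \<theta> t" using cub011 by blast
    show ?thesis
      by (rule leaf_mono[where \<theta> = \<theta> and \<mu> = "case_idx 1 1 \<theta> t" and ld = "case_idx [] [[Vz]] [[Vw]] [[Vy, Vz]]"])
        (use 5 th nz in \<open>auto simp: F all_idx ex_idx algebra_simps rt3_def\<close>)
  next
    case 6
    obtain \<theta> t where th: "rt3 0 0 2 1.259 1.26 \<theta> t" using cub002 by blast
    show ?thesis
      by (rule leaf_mono[where \<theta> = \<theta> and \<mu> = "case_idx 1 1 \<theta> t" and ld = "case_idx [] [[Vz]] [[Vw]] [[Vy, Vy]]"])
        (use 6 th nz in \<open>auto simp: F all_idx ex_idx algebra_simps rt3_def\<close>)
  next
    case 7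
    show ?thesis
      by (rule good1[where \<mu> = "\<lambda>_ _. 1"]) (use 7 in \<open>auto simp: F all_idx\<close>)
  qed
qed

text \<open>
  A pair of forms without common zero preserves nonzero vectors. A pair with a common zero is a linear form \<open>l\<close> times a
  linear map \<open>m\<close>, and then the complement of the kernel of \<open>l\<close> or the line of an eigenvector of \<open>m\<close> is preserved, except for
  the maps \<open>q (u, v)\<close> with \<open>q(u, v) = 0\<close>, whose square vanishes.
\<close>
lemma binary_quadratic:
  fixes a1 a2 a3 b1 b2 b3 :: "'k::alg_closed_field"
  defines "A \<equiv> (\<lambda>x y. a1 * x * x + a2 * x * y + a3 * y * y)" and "B \<equiv> (\<lambda>x y. b1 * x * x + b2 * x * y + b3 * y * y)"
  obtains (inv) S x0 y0 where "S x0 y0" "\<And>x y. S x y \<Longrightarrow> S (A x y) (B x y)" "\<And>x y. S x y \<Longrightarrow> x \<noteq> 0 \<or> y \<noteq> 0"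
  | (nil) u v q1 q2 q3 where "a1 = u * q1" "a2 = u * q2" "a3 = u * q3" "b1 = v * q1" "b2 = v * q2" "b3 = v * q3"
      "u \<noteq> 0 \<or> v \<noteq> 0" "q1 * u * u + q2 * u * v + q3 * v * v = 0"
proof (cases "\<exists>p r. (p \<noteq> 0 \<or> r \<noteq> 0) \<and> A p r = 0 \<and> B p r = 0")
  case False
  then show ?thesis by (intro inv[of "\<lambda>x y. x \<noteq> 0 \<or> y \<noteq> 0" 1 1]) auto
next
  case True
  then obtain p r where pr: "p \<noteq> 0 \<or> r \<noteq> 0" "A p r = 0" "B p r = 0" by blast
  have fac: "\<exists>l m. a1 = r * l \<and> a3 = - p * m \<and> a2 = r * m - p * l"
    if "a1 * p * p + a2 * p * r + a3 * r * r = 0" for a1 a2 a3 :: 'k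
  proof (cases "r = 0")
    case True
    then have "a1 = 0" "p \<noteq> 0" using that pr(1) by auto
    then show ?thesis using True by (intro exI[of _ "- a2 / p"] exI[of _ "- a3 / p"]) auto
  next
    case False
    have "a3 * (r * r) = - p * (a1 * p + a2 * r)" using that by (simp add: algebra_simps) (metis add.assoc add_eq_0_iff)
    then have "a3 = - p * ((a1 * p + a2 * r) / (r * r))" using False by (simp add: field_simps)
    moreover have "a2 = r * ((a1 * p + a2 * r) / (r * r)) - p * (a1 / r)" using False by (simp add: field_simps)
    ultimately show ?thesis using False by (intro exI[of _ "a1 / r"] exI[of _ "(a1 * p + a2 * r) / (r * r)"]) auto
  qed
  \<comment> \<open>both forms are divisible by the linear form \<open>r x - p y\<close>; the quotients form a matrix \<open>m\<close>\<close>
  obtain m11 m12 where mA: "a1 = r * m11" "a3 = - p * m12" "a2 = r * m12 - p * m11"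
    using fac[of a1 a2 a3] pr(2) unfolding A_def by blast
  obtain m21 m22 where mB: "b1 = r * m21" "b3 = - p * m22" "b2 = r * m22 - p * m21"
    using fac[of b1 b2 b3] pr(3) unfolding B_def by blast
  define l where "l x y = r * x - p * y" for x y
  have AB: "A x y = l x y * (m11 * x + m12 * y)" "B x y = l x y * (m21 * x + m22 * y)" for x y
    unfolding A_def B_def l_def mA mB by (simp_all add: algebra_simps)
  have eigen: thesis if "m11 * v1 + m12 * v2 = t * v1" "m21 * v1 + m22 * v2 = t * v2" "t \<noteq> 0" "l v1 v2 \<noteq> 0" for v1 v2 t
  proof (rule inv[of "\<lambda>x y. \<exists>c. c \<noteq> 0 \<and> x = c * v1 \<and> y = c * v2" v1 v2])
    show "\<exists>c. c \<noteq> 0 \<and> v1 = c * v1 \<and> v2 = c * v2" by (rule exI[of _ 1]) simp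
    fix x y assume "\<exists>c. c \<noteq> 0 \<and> x = c * v1 \<and> y = c * v2"
    then obtain c where c: "c \<noteq> 0" "x = c * v1" "y = c * v2" by blast
    then show "x \<noteq> 0 \<or> y \<noteq> 0" using that(4) by (auto simp: l_def)
    have "l x y = c * l v1 v2" using c by (simp add: l_def algebra_simps)
    moreover have "m11 * x + m12 * y = c * (t * v1)" "m21 * x + m22 * y = c * (t * v2)"
      using c that(1,2)[symmetric] by (auto simp: algebra_simps)
    ultimately have "A x y = (c * l v1 v2 * (c * t)) * v1" "B x y = (c * l v1 v2 * (c * t)) * v2"
      unfolding AB by (auto simp: algebra_simps)
    then show "\<exists>c. c \<noteq> 0 \<and> A x y = c * v1 \<and> B x y = c * v2"
      using c(1) that(3,4) by (intro exI[of _ "c * l v1 v2 * (c * t)"]) auto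
  qed
  show ?thesis
  proof (cases "m11 * m22 = m12 * m21")
    case True
    obtain u v f1 f2 where uv: "m11 = u * f1" "m12 = u * f2" "m21 = v * f1" "m22 = v * f2" "u \<noteq> 0 \<or> v \<noteq> 0"
    proof (cases "m11 = 0 \<and> m12 = 0")
      case True
      then show ?thesis using that[of 0 m21 m22 1] by auto
    next
      case F: False
      show ?thesis
      proof (cases "m11 = 0")
        case t: True
        then show ?thesis using that[of 1 m11 m12 "m22 / m12"] F True by (auto simp: field_simps)
      next
        case False
        then show ?thesis using that[of 1 m11 m12 "m21 / m11"] True by (auto simp: field_simps)
      qed
    qed
    show ?thesis
    proof (cases "l u v * (f1 * u + f2 * v) = 0")
      case True
      show ?thesis
        by (rule nil[of u "r * f1" "r * f2 - p * f1" "- p * f2" v])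
          (use True uv mA mB in \<open>auto simp: l_def algebra_simps\<close>)
    next
      case False
      then have "l u v \<noteq> 0" "f1 * u + f2 * v \<noteq> 0" by auto
      then show ?thesis using eigen[of u v "f1 * u + f2 * v"] uv by (auto simp: algebra_simps)
    qed
  next
    case det: False
    define n1 n2 where "n1 = r * m11 - p * m21" and "n2 = r * m12 - p * m22"
    show ?thesis
    proof (cases "n1 * p + n2 * r = 0")
      case True
      \<comment> \<open>the kernel of the common factor is invariant, so the factor is an eigenvector of the transpose\<close>
      obtain t where t: "n1 = t * r" "n2 = - t * p"
      proof (cases "r = 0")
        case True
        then show ?thesis using that[of "- n2 / p"] \<open>n1 * p + n2 * r = 0\<close> pr(1) by auto
      next
        case False
        have "n2 * r = - n1 * p" using True by (simp add: add_eq_0_iff add.commute)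
        then have "n2 = - (n1 / r) * p" using False by (simp add: field_simps)
        then show ?thesis using that[of "n1 / r"] False by simp
      qed
      have "t \<noteq> 0"
      proof
        assume "t = 0"
        then have z: "r * m11 = p * m21" "r * m12 = p * m22" using t unfolding n1_def n2_def by auto
        show False
        proof (cases "r = 0")
          case True
          then show False using z pr(1) det by auto
        next
          case False
          have "r * (m11 * m22) = r * (m12 * m21)" using z by (metis mult.assoc mult.commute)
          then show False using False det by simp
        qed
      qed
      have lAB: "l (A x y) (B x y) = t * l x y * l x y" for x y
      proof -
        have "l (A x y) (B x y) = l x y * (n1 * x + n2 * y)"
          unfolding AB n1_def n2_def by (simp add: l_def algebra_simps)
        then show ?thesis unfolding t by (simp add: l_def algebra_simps)
      qed
      show ?thesis
        by (rule inv[of "\<lambda>x y. l x y \<noteq> 0" "if r \<noteq> 0 then 1 else 0" "if r \<noteq> 0 then 0 else 1"])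
          (use pr(1) \<open>t \<noteq> 0\<close> in \<open>auto simp: lAB\<close>, auto simp: l_def)
    next
      case noninv: False
      \<comment> \<open>an eigenvector of \<open>m\<close> does not lie in the kernel of the common factor\<close>
      have "\<exists>t. poly [:m11 * m22 - m12 * m21, - (m11 + m22), 1:] t = 0"
        by (rule alg_closed_imp_poly_has_root) simp
      then obtain t where t: "m11 * m22 - m12 * m21 - (m11 + m22) * t + t * t = 0"
        by (auto simp: algebra_simps)
      have t0: "t \<noteq> 0" using t det by auto
      have chi: "(m11 - t) * (m22 - t) = m12 * m21" using t by (simp add: algebra_simps)
      obtain v1 v2 where v: "v1 \<noteq> 0 \<or> v2 \<noteq> 0" "m11 * v1 + m12 * v2 = t * v1" "m21 * v1 + m22 * v2 = t * v2"
      proof (cases "m12 = 0 \<and> m11 = t")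
        case True
        show ?thesis
        proof (cases "m21 = 0 \<and> m22 = t")
          case T: True
          then show ?thesis using that[of 1 1] True by auto
        next
          case False
          then show ?thesis using that[of "t - m22" m21] True by (auto simp: algebra_simps)
        qed
      next
        case False
        then show ?thesis using that[of m12 "t - m11"] chi by (auto simp: algebra_simps)
      qed
      have "l v1 v2 \<noteq> 0"
      proof
        assume l0: "l v1 v2 = 0"
        have "n1 * v1 + n2 * v2 = t * l v1 v2"
          unfolding n1_def n2_def l_def using v(2,3)[symmetric] by (simp add: algebra_simps)
        then have n0: "n1 * v1 + n2 * v2 = 0" using l0 by simp
        have rv: "r * v1 = p * v2" using l0 by (simp add: l_def)
        have "v1 * (n1 * p + n2 * r) = p * (n1 * v1 + n2 * v2)" "v2 * (n1 * p + n2 * r) = r * (n1 * v1 + n2 * v2)"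
          using rv by (simp_all add: algebra_simps)
        then show False using n0 noninv v(1) by simp
      qed
      then show ?thesis using eigen v t0 by blast
    qed
  qed
qed

section \<open>Systems with an affine first coordinate\<close>

text \<open>
  The coordinate \<open>x\<close> is affine over itself and gets weight zero or an arbitrarily small weight, so
  that the growth comes from the other three coordinates. The digits in the names give the permutation in which the
  images of \<open>y\<close>, \<open>z\<close>, \<open>w\<close> begin with \<open>y\<close>, \<open>z\<close>, \<open>w\<close>. In each case the quadratic monomials are examined in
  the order of the growth that they cause, and the first one with a nonzero coefficient fixes the weights.
\<close>

lemma base_213:
  fixes F :: "'k::field sys"
  assumes F: "F = case_idx [(b, [Vx]), (b0, [])] ((d, [Vz]) # Q2 q1 q2 q3 q4 q5 q6) ((e, [Vy]) # Q1 p1 p2 p3)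
     ((g, [Vw]) # Q3 s1 s2 s3 s4 s5 s6 s7 s8 s9 s10)"
  shows "good F"
proof (cases "q1 = 0")
  case False
  show ?thesis
    by (rule good2_inv[where S = "\<lambda>v. v Vy \<noteq> 0 \<and> v Vx = 0" and ?v0.0 = "case_idx 0 1 0 0"])
      (use False in \<open>auto simp: F Qs all_idx hom2_def\<close>)
next
  case True
  show ?thesis
    by (rule good1[where \<mu> = "\<lambda>e. case_idx (e/4) 1 1 2"]) (use True in \<open>auto simp: F Qs all_idx algebra_simps\<close>)
qed

lemma base_231:
  fixes F :: "'k::field sys"
  assumes F: "F = case_idx [(b, [Vx]), (b0, [])] ((d, [Vz]) # Q2 q1 q2 q3 q4 q5 q6)
     ((e, [Vw]) # Q3 s1 s2 s3 s4 s5 s6 s7 s8 s9 s10) ((g, [Vy]) # Q1 p1 p2 p3)"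
    and nz: "d \<noteq> 0"
  shows "good F"
proof -
  consider "q1 \<noteq> 0" | "q1 = 0" "s1 \<noteq> 0" | "q1 = 0" "s1 = 0" "s2 \<noteq> 0"
    | "q1 = 0" "s1 = 0" "s2 = 0" "s4 \<noteq> 0" | "q1 = 0" "s1 = 0" "s2 = 0" "s4 = 0" by blast
  then show ?thesis
  proof cases
    case 1
    show ?thesis
      by (rule good2_inv[where S = "\<lambda>v. v Vy \<noteq> 0 \<and> v Vx = 0" and ?v0.0 = "case_idx 0 1 0 0"])
        (use 1 in \<open>auto simp: F Qs all_idx hom2_def\<close>)
  next
    case 2
    show ?thesis
      by (rule good2_inv[where S = "\<lambda>v. v Vz \<noteq> 0 \<and> v Vy = 0 \<and> v Vx = 0" and ?v0.0 = "case_idx 0 0 1 0"])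
        (use 2 in \<open>auto simp: F Qs all_idx hom2_def\<close>)
  next
    case 3
    obtain \<theta> where th: "rt2 1 1 1.618 1.619 \<theta>" using golden by blast
    show ?thesis
      by (rule leaf_mono[where \<theta> = \<theta> and \<mu> = "case_idx 0 1 \<theta> (\<theta> - 1)" and ld = "case_idx [] [[Vz]] [[Vy, Vz]] []"])
        (use 3 th nz in \<open>auto simp: F Qs all_idx ex_idx algebra_simps rt2_def\<close>)
  next
    case 4
    obtain \<theta> where th: "rt2 0 2 1.414 1.415 \<theta>" using sqrt2 by blast
    show ?thesis
      by (rule leaf_mono[where \<theta> = \<theta> and \<mu> = "case_idx 0 1 \<theta> 1" and ld = "case_idx [] [[Vz]] [[Vy, Vy]] []"])
        (use 4 th nz in \<open>auto simp: F Qs all_idx ex_idx algebra_simps rt2_def\<close>)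
  next
    case 5
    show ?thesis
      by (rule good1[where \<mu> = "\<lambda>e. case_idx (e/4) 1 1 1"]) (use 5 in \<open>auto simp: F Qs all_idx algebra_simps\<close>)
  qed
qed

text \<open>
  When the image of \<open>y\<close> contains neither \<open>y y\<close> nor \<open>y z\<close>, the coordinate \<open>w + s1 z z\<close> absorbs the square of \<open>z\<close>, and the
  coefficient of \<open>y y\<close> in its image decides.
\<close>
lemma base_312:
  fixes F :: "'k::field sys"
  assumes F: "F = case_idx [(b, [Vx]), (b0, [])] ((1, [Vw]) # Q3 s1 s2 s3 s4 s5 s6 s7 s8 s9 s10)
     ((e, [Vy]) # Q1 p1 p2 p3) ((g, [Vz]) # Q2 q1 q2 q3 q4 q5 q6)"
    and nz: "e \<noteq> 0"
  shows "good F"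
proof -
  consider "s4 \<noteq> 0" | "s4 = 0" "s2 \<noteq> 0" | "s4 = 0" "s2 = 0" by blast
  then show ?thesis
  proof cases
    case 1
    show ?thesis
      by (rule good2_inv[where S = "\<lambda>v. v Vy \<noteq> 0 \<and> v Vx = 0 \<and> v Vz = 0" and ?v0.0 = "case_idx 0 1 0 0"])
        (use 1 in \<open>auto simp: F Qs all_idx hom2_def\<close>)
  next
    case 2
    obtain \<theta> where th: "rt2 1 1 1.618 1.619 \<theta>" using golden by blast
    show ?thesis
      by (rule leaf_mono[where \<theta> = \<theta> and \<mu> = "case_idx 0 \<theta> 1 2" and ld = "case_idx [] [[Vy, Vz]] [[Vy]] []"])
        (use 2 th nz in \<open>auto simp: F Qs all_idx ex_idx algebra_simps rt2_def\<close>)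
  next
    case 3
    let ?F' = "case_idx [(b, [Vx]), (b0, [])] [(1, [Vw]), (s3, [Vx, Vz]), (s5, [Vx, Vy]), (s6, [Vx, Vx]), (s7, [Vz]), (s8, [Vy]), (s9, [Vx]), (s10, [])]
     ((e, [Vy]) # Q1 p1 p2 p3)
     ([(g, [Vz]), (q1 + s1 * e * e, [Vy, Vy]), (2 * s1 * e * p1, [Vx, Vx, Vy]), (2 * s1 * e * p2, [Vx, Vy]),
       (2 * s1 * e * p3, [Vy]), (s1 * p1 * p1, [Vx, Vx, Vx, Vx]), (2 * s1 * p1 * p2, [Vx, Vx, Vx]),
       (s1 * (p2 * p2 + 2 * p1 * p3), [Vx, Vx]), (2 * s1 * p2 * p3, [Vx]), (s1 * p3 * p3, []),
       (q2, [Vx, Vy]), (q3, [Vx, Vx]), (q4, [Vy]), (q5, [Vx]), (q6, [])]) :: 'k sys"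
    show ?thesis
    proof (rule good_conj[where F' = ?F' and G = "case_idx [(1, [Vx])] [(1, [Vy])] [(1, [Vz])] [(1, [Vw]), (s1, [Vz, Vz])]"
          and G' = "case_idx [(1, [Vx])] [(1, [Vy])] [(1, [Vz])] [(1, [Vw]), (-s1, [Vz, Vz])]"])
      show "good ?F'"
      proof (cases "q1 + s1 * e * e = 0")
        case False
        obtain \<theta> where th: "rt2 0 2 1.414 1.415 \<theta>" using sqrt2 by blast
        show ?thesis
          by (rule leaf_mono[where \<theta> = \<theta> and \<mu> = "case_idx 0 1 1 \<theta>" and ld = "case_idx [] [[Vw]] [] [[Vy, Vy]]"])
            (use False th nz in \<open>auto simp: Qs all_idx ex_idx algebra_simps rt2_def\<close>)
      next
        case True
        show ?thesis
          by (rule good1[where \<mu> = "\<lambda>e. case_idx (e/8) 1 1 1"]) (use True in \<open>auto simp: Qs all_idx algebra_simps\<close>)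
      qed
    next
      fix a :: "idx \<Rightarrow> 'k ser"
      let ?G = "case_idx [(1, [Vx])] [(1, [Vy])] [(1, [Vz])] [(1, [Vw]), (s1, [Vz, Vz])]"
      show "hmap ?G (hmap F a) = hmap ?F' (hmap ?G a)"
      proof
        fix j show "hmap ?G (hmap F a) j = hmap ?F' (hmap ?G a) j"
          by (cases j) (simp_all add: hmap_def F Qs 3 cst_hom algebra_simps mult_2)
      qed
    qed (rule ext, case_tac x; simp add: hmap_def cst_hom algebra_simps)+
  qed
qed

text \<open>
  If \<open>y y\<close> occurs in the image of \<open>z\<close>, the pair \<open>(y, z)\<close> carries a binary quadratic map at \<open>x = 0\<close>; otherwise the image of
  \<open>z\<close> depends on \<open>y\<close> only through the product of \<open>y\<close> with an affine function of \<open>x\<close>, which acts like a constant.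
\<close>
lemma base_321:
  fixes F :: "'k::alg_closed_field sys"
  assumes F: "F = case_idx [(b, [Vx]), (b0, [])] ((d, [Vw]) # Q3 s1 s2 s3 s4 s5 s6 s7 s8 s9 s10)
     ((e, [Vz]) # Q2 q1 q2 q3 q4 q5 q6) ((g, [Vy]) # Q1 p1 p2 p3)"
    and nz: "b \<noteq> 0"
  shows "good F"
proof -
  consider "q1 \<noteq> 0" "s1 \<noteq> 0 \<or> s2 \<noteq> 0 \<or> s4 \<noteq> 0" | "q1 \<noteq> 0" "s1 = 0" "s2 = 0" "s4 = 0" "s3 \<noteq> 0 \<or> s7 \<noteq> 0"
    | "q1 \<noteq> 0" "s1 = 0" "s2 = 0" "s4 = 0" "s3 = 0" "s7 = 0"
    | "q1 = 0" "s4 \<noteq> 0" | "q1 = 0" "s4 = 0" "q2 = 0" "q4 = 0"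
    | "q1 = 0" "s4 = 0" "q2 \<noteq> 0 \<or> q4 \<noteq> 0" "s2 \<noteq> 0"
    | "q1 = 0" "s4 = 0" "q2 \<noteq> 0 \<or> q4 \<noteq> 0" "s2 = 0" "s1 \<noteq> 0"
    | "q1 = 0" "s4 = 0" "s2 = 0" "s1 = 0" by blast
  then show ?thesis
  proof cases
    case 1
    show ?thesis
    proof (rule binary_quadratic[of s4 s2 s1 q1 0 0])
      fix S :: "'k \<Rightarrow> 'k \<Rightarrow> bool" and x0 y0
      assume S: "S x0 y0" "\<And>x y. S x y \<Longrightarrow> S (s4 * x * x + s2 * x * y + s1 * y * y) (q1 * x * x + 0 * x * y + 0 * y * y)"
        "\<And>x y. S x y \<Longrightarrow> x \<noteq> 0 \<or> y \<noteq> 0"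
      show "good F"
      proof (rule good2_inv[where S = "\<lambda>v. S (v Vy) (v Vz) \<and> v Vx = 0" and ?v0.0 = "case_idx 0 x0 y0 0"])
        fix v assume "S (v Vy) (v Vz) \<and> v Vx = 0"
        then show "S (hom2 F v Vy) (hom2 F v Vz) \<and> hom2 F v Vx = 0"
          using S(2)[of "v Vy" "v Vz"] by (simp add: F Qs hom2_def algebra_simps)
      next
        fix v assume "S (v Vy) (v Vz) \<and> v Vx = 0"
        then show "\<exists>j. v j \<noteq> 0" using S(3) by blast
      qed (use S(1) in \<open>auto simp: F Qs all_idx\<close>)
    next
      fix u v k1 k2 k3 :: 'k
      assume "s4 = u * k1" "s2 = u * k2" "s1 = u * k3" "q1 = v * k1" "0 = v * k2" "0 = v * k3"
        "u \<noteq> 0 \<or> v \<noteq> 0" "k1 * u * u + k2 * u * v + k3 * v * v = 0"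
      then show "good F" using 1 by auto
    qed
  next
    case 2
    obtain \<theta> where th: "rt2 0 2 1.414 1.415 \<theta>" using sqrt2 by blast
    show ?thesis
    proof (rule leaf[where \<theta> = \<theta> and \<mu> = "case_idx 0 1 \<theta> 1" and ld = "case_idx [[Vx], []] [[Vx, Vz], [Vz]] [[Vy, Vy]] []"
          and S = "\<lambda>v. v Vy \<noteq> 0 \<and> v Vz \<noteq> 0 \<and> trs (v Vx)" and ?v0.0 = "case_idx (mvar 1) 1 1 1"])
      fix v v' :: "idx \<Rightarrow> (4, 'k) mpoly"
      assume v: "v Vy \<noteq> 0 \<and> v Vz \<noteq> 0 \<and> trs (v Vx)" and v': "\<forall>j. case_idx [[Vx], []] [[Vx, Vz], [Vz]] [[Vy, Vy]] [] j \<noteq> [] \<longrightarrow>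
           v' j = (\<Sum>(c, m)\<leftarrow>filter (\<lambda>(c, m). m \<in> set (case_idx [[Vx], []] [[Vx, Vz], [Vz]] [[Vy, Vy]] [] j)) (F j).
                      mconst c * prod_list (map v m))"
      have "v' Vx = mconst b * v Vx + mconst b0" "v' Vy = (mconst s3 * v Vx + mconst s7) * v Vz" "v' Vz = mconst q1 * (v Vy * v Vy)"
        using v' by (simp_all add: F Qs all_idx algebra_simps)
      then show "v' Vy \<noteq> 0 \<and> v' Vz \<noteq> 0 \<and> trs (v' Vx)"
        using v 2 trs_affine[of "v Vx" b b0] nz trs_nz[of "v Vx" s3 s7] by auto
    qed (use 2 th trs_mvar in \<open>auto simp: F Qs all_idx ex_idx algebra_simps rt2_def\<close>)
  next
    case 3
    show ?thesis
      by (rule good1[where \<mu> = "\<lambda>e. case_idx (e/4) 1 2 1"]) (use 3 in \<open>auto simp: F Qs all_idx algebra_simps\<close>)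
  next
    case 4
    show ?thesis
      by (rule good2_inv[where S = "\<lambda>v. v Vy \<noteq> 0 \<and> v Vx = 0 \<and> v Vz = 0" and ?v0.0 = "case_idx 0 1 0 0"])
        (use 4 in \<open>auto simp: F Qs all_idx hom2_def\<close>)
  next
    case 5
    show ?thesis
      by (rule good1[where \<mu> = "\<lambda>e. case_idx (e/8) 1 (e/4) 1"]) (use 5 in \<open>auto simp: F Qs all_idx algebra_simps\<close>)
  next
    case 6
    obtain \<theta> where th: "rt2 1 1 1.618 1.619 \<theta>" using golden by blast
    show ?thesis
    proof (rule leaf[where \<theta> = \<theta> and \<mu> = "case_idx 0 1 (\<theta> - 1) (\<theta> - 1)" and ld = "case_idx [[Vx], []] [[Vy, Vz]] [[Vx, Vy], [Vy]] []"
          and S = "\<lambda>v. v Vy \<noteq> 0 \<and> v Vz \<noteq> 0 \<and> trs (v Vx)" and ?v0.0 = "case_idx (mvar 1) 1 1 1"])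
      fix v v' :: "idx \<Rightarrow> (4, 'k) mpoly"
      assume v: "v Vy \<noteq> 0 \<and> v Vz \<noteq> 0 \<and> trs (v Vx)" and v': "\<forall>j. case_idx [[Vx], []] [[Vy, Vz]] [[Vx, Vy], [Vy]] [] j \<noteq> [] \<longrightarrow>
           v' j = (\<Sum>(c, m)\<leftarrow>filter (\<lambda>(c, m). m \<in> set (case_idx [[Vx], []] [[Vy, Vz]] [[Vx, Vy], [Vy]] [] j)) (F j).
                      mconst c * prod_list (map v m))"
      have "v' Vx = mconst b * v Vx + mconst b0" "v' Vz = (mconst q2 * v Vx + mconst q4) * v Vy" "v' Vy = mconst s2 * (v Vy * v Vz)"
        using v' by (simp_all add: F Qs all_idx algebra_simps)
      then show "v' Vy \<noteq> 0 \<and> v' Vz \<noteq> 0 \<and> trs (v' Vx)"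
        using v 6 trs_affine[of "v Vx" b b0] nz trs_nz[of "v Vx" q2 q4] by auto
    qed (use 6 th trs_mvar in \<open>auto simp: F Qs all_idx ex_idx algebra_simps rt2_def\<close>)
  next
    case 7
    obtain \<theta> where th: "rt2 0 2 1.414 1.415 \<theta>" using sqrt2 by blast
    show ?thesis
    proof (rule leaf[where \<theta> = \<theta> and \<mu> = "case_idx 0 1 (\<theta>/2) (\<theta>/2)" and ld = "case_idx [[Vx], []] [[Vz, Vz]] [[Vx, Vy], [Vy]] []"
          and S = "\<lambda>v. v Vy \<noteq> 0 \<and> v Vz \<noteq> 0 \<and> trs (v Vx)" and ?v0.0 = "case_idx (mvar 1) 1 1 1"])
      fix v v' :: "idx \<Rightarrow> (4, 'k) mpoly"
      assume v: "v Vy \<noteq> 0 \<and> v Vz \<noteq> 0 \<and> trs (v Vx)" and v': "\<forall>j. case_idx [[Vx], []] [[Vz, Vz]] [[Vx, Vy], [Vy]] [] j \<noteq> [] \<longrightarrow>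
           v' j = (\<Sum>(c, m)\<leftarrow>filter (\<lambda>(c, m). m \<in> set (case_idx [[Vx], []] [[Vz, Vz]] [[Vx, Vy], [Vy]] [] j)) (F j).
                      mconst c * prod_list (map v m))"
      have "v' Vx = mconst b * v Vx + mconst b0" "v' Vz = (mconst q2 * v Vx + mconst q4) * v Vy" "v' Vy = mconst s1 * (v Vz * v Vz)"
        using v' by (simp_all add: F Qs all_idx algebra_simps)
      then show "v' Vy \<noteq> 0 \<and> v' Vz \<noteq> 0 \<and> trs (v' Vx)"
        using v 7 trs_affine[of "v Vx" b b0] nz trs_nz[of "v Vx" q2 q4] by auto
    qed (use 7 th trs_mvar in \<open>auto simp: F Qs all_idx ex_idx algebra_simps rt2_def\<close>)
  next
    case 8
    show ?thesis
      by (rule good1[where \<mu> = "\<lambda>e. case_idx (e/4) 1 1 1"]) (use 8 in \<open>auto simp: F Qs all_idx algebra_simps\<close>)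
  qed
qed

text \<open>
  Both \<open>x\<close> and \<open>y\<close> have small weights. A square \<open>x x\<close> in the image of \<open>y\<close> is compatible with this only if the image of \<open>x\<close>
  does not involve \<open>y\<close>, for then \<open>y\<close> can be given twice the weight of \<open>x\<close>.
\<close>
lemma base2_swap:
  fixes F :: "'k::field sys"
  assumes F: "F = case_idx [(b1, [Vx]), (b2, [Vy]), (b3, [])] [(c1, [Vx]), (c2, [Vy]), (c3, []), (p, [Vx, Vx])]
    ((d, [Vw]) # Q3 s1 s2 s3 s4 s5 s6 s7 s8 s9 s10) ((e, [Vz]) # Q2 q1 q2 q3 q4 q5 q6)" and z: "b2 = 0 \<or> p = 0"
  shows "good F"
proof (cases "s1 = 0")
  case False
  show ?thesis
  proof (rule good2_inv[where S = "\<lambda>v. v Vz \<noteq> 0 \<and> v Vx = 0 \<and> v Vy = 0" and ?v0.0 = "case_idx 0 0 1 0"])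
  qed (use False in \<open>auto simp: F Qs all_idx hom2_def\<close>)
next
  case s: True
  show ?thesis
  proof (cases "p = 0")
    case True
    show ?thesis
      by (rule good1[where \<mu> = "\<lambda>e. case_idx (e/8) (e/8) 1 1"]) (use s True in \<open>auto simp: F Qs all_idx algebra_simps\<close>)
  next
    case False
    show ?thesis
      by (rule good1[where \<mu> = "\<lambda>e. case_idx (e/8) (e/4) 1 1"]) (use s False z in \<open>auto simp: F Qs all_idx algebra_simps\<close>)
  qed
qed

lemma base2_id:
  fixes F :: "'k::field sys"
  assumes F: "F = case_idx [(b1, [Vx]), (b2, [Vy]), (b3, [])] [(c1, [Vx]), (c2, [Vy]), (c3, []), (p, [Vx, Vx])]
    ((d, [Vz]) # Q2 q1 q2 q3 q4 q5 q6) ((e, [Vw]) # Q3 s1 s2 s3 s4 s5 s6 s7 s8 s9 s10)" and z: "b2 = 0 \<or> p = 0"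
  shows "good F"
proof (cases "p = 0")
  case True
  show ?thesis
    by (rule good1[where \<mu> = "\<lambda>e. case_idx (e/8) (e/8) 1 2"]) (use True in \<open>auto simp: F Qs all_idx algebra_simps\<close>)
next
  case False
  show ?thesis
    by (rule good1[where \<mu> = "\<lambda>e. case_idx (e/8) (e/4) 1 2"]) (use False z in \<open>auto simp: F Qs all_idx algebra_simps\<close>)
qed

text \<open>
  If the image of \<open>x\<close> contains neither \<open>x x\<close> nor \<open>x y\<close>, its second iterate has leading term \<open>(p1 + q1 c c) x x\<close>. If this
  vanishes as well, the coordinate \<open>z + q1 y y\<close> has an affine image and the growth rate is 1.
\<close>
lemma form_T:
  fixes F :: "'k::field sys"
  assumes F: "F = case_idx ((1, [Vz]) # Q2 q1 q2 q3 q4 q5 q6) [(c, [Vx]), (c0, [])]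
    ((e, [Vy]) # Q1 p1 p2 p3) ((g, [Vw]) # Q3 s1 s2 s3 s4 s5 s6 s7 s8 s9 s10)" and nz: "c \<noteq> 0"
  shows "good F"
proof -
  consider "q3 \<noteq> 0" | "q3 = 0" "q2 \<noteq> 0" | "q3 = 0" "q2 = 0" "p1 + q1 * c * c \<noteq> 0" | "q3 = 0" "q2 = 0" "p1 + q1 * c * c = 0" by blast
  then show ?thesis
  proof cases
    case 1
    show ?thesis
      by (rule good2_inv[where S = "\<lambda>v. v Vx \<noteq> 0 \<and> v Vy = 0" and ?v0.0 = "case_idx 1 0 0 0"])
        (use 1 in \<open>auto simp: F Qs all_idx hom2_def\<close>)
  next
    case 2
    obtain \<theta> where th: "rt2 1 1 1.618 1.619 \<theta>" using golden by blast
    show ?thesis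
      by (rule leaf_mono[where \<theta> = \<theta> and \<mu> = "case_idx \<theta> 1 2 4" and ld = "case_idx [[Vx, Vy]] [[Vx]] [] []"])
        (use 2 th nz in \<open>auto simp: F Qs all_idx ex_idx algebra_simps rt2_def\<close>)
  next
    case 3
    obtain \<theta> where th: "rt2 0 2 1.414 1.415 \<theta>" using sqrt2 by blast
    let ?ld = "case_idx [[Vz], [Vy, Vy]] [[Vx]] [[Vx, Vx]] []"
    show ?thesis
    proof (rule leaf[where \<theta> = \<theta> and \<mu> = "case_idx \<theta> 1 2 4" and ld = ?ld
          and S = "\<lambda>v. v Vx \<noteq> 0 \<and> v Vz + mconst q1 * (v Vy * v Vy) \<noteq> 0" and ?v0.0 = "case_idx 1 0 1 1"])
      fix v v' :: "idx \<Rightarrow> (4, 'k) mpoly"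
      assume v: "v Vx \<noteq> 0 \<and> v Vz + mconst q1 * (v Vy * v Vy) \<noteq> 0" and v': "\<forall>j. ?ld j \<noteq> [] \<longrightarrow>
           v' j = (\<Sum>(c, m)\<leftarrow>filter (\<lambda>(c, m). m \<in> set (?ld j)) (F j). mconst c * prod_list (map v m))"
      have *: "v' Vx = v Vz + mconst q1 * (v Vy * v Vy)" "v' Vy = mconst c * v Vx" "v' Vz = mconst p1 * (v Vx * v Vx)"
        using v' 3 by (simp_all add: F Qs all_idx algebra_simps)
      then have "v' Vz + mconst q1 * (v' Vy * v' Vy) = mconst (p1 + q1 * c * c) * (v Vx * v Vx)"
        by (simp add: mconst_add mconst_mult algebra_simps)
      then show "v' Vx \<noteq> 0 \<and> v' Vz + mconst q1 * (v' Vy * v' Vy) \<noteq> 0" using v * 3 by auto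
    qed (use 3 th in \<open>auto simp: F Qs all_idx ex_idx algebra_simps rt2_def\<close>)
  next
    case 4
    let ?F' = "case_idx [(1, [Vz]), (q4, [Vy]), (q5, [Vx]), (q6, [])] [(c, [Vx]), (c0, [])]
      [(e, [Vy]), (p2 + 2 * q1 * c * c0, [Vx]), (p3 + q1 * c0 * c0, [])]
      ((g, [Vw]) # Q3 s1 s2 s3 s4 s5 s6 s7 s8 s9 s10 @ [(- (2 * s1 * q1), [Vz, Vy, Vy]), (s1 * q1 * q1, [Vy, Vy, Vy, Vy]),
        (- (s2 * q1), [Vy, Vy, Vy]), (- (s3 * q1), [Vx, Vy, Vy]), (- (s7 * q1), [Vy, Vy])]) :: 'k sys"
    let ?G = "case_idx [(1, [Vx])] [(1, [Vy])] [(1, [Vz]), (q1, [Vy, Vy])] [(1, [Vw])]"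
    show ?thesis
    proof (rule good_conj[where F' = ?F' and G = ?G
          and G' = "case_idx [(1, [Vx])] [(1, [Vy])] [(1, [Vz]), (- q1, [Vy, Vy])] [(1, [Vw])]"])
      show "good ?F'"
        by (rule good1[where \<mu> = "\<lambda>e. case_idx 1 1 1 4"]) (auto simp: Qs all_idx algebra_simps)
    next
      fix a :: "idx \<Rightarrow> 'k ser"
      have h: "cst p1 = - (cst q1 * cst c * cst c)" using 4(3) by (metis add_eq_0_iff2 cst_mult cst_uminus)
      show "hmap ?G (hmap F a) = hmap ?F' (hmap ?G a)"
      proof
        fix j show "hmap ?G (hmap F a) j = hmap ?F' (hmap ?G a) j"
          by (cases j) (simp_all add: hmap_def F Qs 4(1,2) h cst_hom algebra_simps mult_2)
      qed
    qed (rule ext, case_tac x; simp add: hmap_def cst_hom algebra_simps)+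
  qed
qed

section \<open>Changes of coordinates\<close>

text \<open>
  On the subspace where the coordinates in \<open>Zs\<close> vanish, the quadratic part restricts to a binary quadratic map in the
  coordinates \<open>i\<close> and \<open>j\<close>; unless this is nilpotent, degrees double.
\<close>
lemma good_binary:
  fixes F :: "'k::alg_closed_field sys"
  assumes len: "\<forall>j. \<forall>(c, m)\<in>set (F j). c = 0 \<or> length m \<le> 2"
    and ij: "i \<noteq> j" "i \<notin> Zs" "j \<notin> Zs"
    and hom: "\<And>v. \<forall>k\<in>Zs. v k = 0 \<Longrightarrow> hom2 F v i = a1 * v i * v i + a2 * v i * v j + a3 * v j * v j \<and>
        hom2 F v j = b1 * v i * v i + b2 * v i * v j + b3 * v j * v j \<and> (\<forall>k\<in>Zs. hom2 F v k = 0)"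
    and not_nil: "\<And>u v q1 q2 q3. \<lbrakk>a1 = u * q1; a2 = u * q2; a3 = u * q3; b1 = v * q1; b2 = v * q2; b3 = v * q3;
        u \<noteq> 0 \<or> v \<noteq> 0; q1 * u * u + q2 * u * v + q3 * v * v = 0\<rbrakk> \<Longrightarrow> False"
  shows "good F"
proof (rule binary_quadratic[of a1 a2 a3 b1 b2 b3])
  fix S :: "'k \<Rightarrow> 'k \<Rightarrow> bool" and x0 y0
  assume S: "S x0 y0" "\<And>x y. S x y \<Longrightarrow> S (a1 * x * x + a2 * x * y + a3 * y * y) (b1 * x * x + b2 * x * y + b3 * y * y)"
    "\<And>x y. S x y \<Longrightarrow> x \<noteq> 0 \<or> y \<noteq> 0"
  show "good F"
  proof (rule good2_inv[where S = "\<lambda>v. S (v i) (v j) \<and> (\<forall>k\<in>Zs. v k = 0)" and ?v0.0 = "\<lambda>k. if k = i then x0 else if k = j then y0 else 0", OF len])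
    fix v assume "S (v i) (v j) \<and> (\<forall>k\<in>Zs. v k = 0)"
    then show "S (hom2 F v i) (hom2 F v j) \<and> (\<forall>k\<in>Zs. hom2 F v k = 0)"
      using S(2)[of "v i" "v j"] hom[of v] by simp
  next
    fix v assume "S (v i) (v j) \<and> (\<forall>k\<in>Zs. v k = 0)"
    then show "\<exists>j. v j \<noteq> 0" using S(3) by blast
  qed (use S(1) ij in auto)
qed (use not_nil in blast)

lemma ev_cong: "(\<And>c m k. (c, m) \<in> set L \<Longrightarrow> k \<in> set m \<Longrightarrow> a k = b k) \<Longrightarrow> ev L a = ev L b"
proof (induction L)
  case (Cons cm L)
  obtain c m where [simp]: "cm = (c, m)" by (cases cm)
  have "map a m = map b m" using Cons.prems by auto
  then have "prod_list (map a m) = prod_list (map b m)" by (rule arg_cong)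
  moreover have "ev L a = ev L b" using Cons by auto
  ultimately show ?case by simp
qed simp

lemma ev_neg: "ev (map (\<lambda>(c, m). (- c, m)) L) a = - ev L a"
  by (induction L) (auto simp: cst_uminus)

text \<open>
  The component \<open>F i\<close>, linear in \<open>v\<close> with the rest \<open>R\<close> free of \<open>v\<close>, serves as a new coordinate in place of \<open>v\<close>. The system
  \<open>F'\<close> is \<open>F\<close> in the new coordinates, in which \<open>b v - R b\<close> expresses the old \<open>v\<close>.
\<close>
lemma good_elem:
  fixes F F' :: "'k::field sys"
  assumes Fi: "F i = (1, [v]) # R" and R: "\<forall>(c, m)\<in>set R. v \<notin> set m"
    and other: "\<And>b. \<forall>j. j \<noteq> v \<longrightarrow> ev (F j) (b(v := b v - ev R b)) = ev (F' j) b"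
    and new: "\<And>b. ev (F i) (\<lambda>j. if j = i then b v else ev (F j) (b(v := b v - ev R b))) = ev (F' v) b"
    and good: "good F'"
  shows "good F"
proof -
  let ?G = "\<lambda>j. if j = v then F i else [(1, [j])]"
  let ?H = "\<lambda>j. if j = v then (1, [v]) # map (\<lambda>(c, m). (- c, m)) R else [(1, [j])]"
  have Rc: "ev R (a(v := t)) = ev R a" for a t
    by (rule ev_cong) (use R in auto)
  have G: "hmap ?G a = a(v := a v + ev R a)" for a
    by (rule ext) (simp add: hmap_def Fi)
  have H: "hmap ?H a = a(v := a v - ev R a)" for a
    by (rule ext) (simp add: hmap_def ev_neg)
  show ?thesis
  proof (rule good_conj[OF _ _ _ good, where G = ?G and G' = ?H])
    fix a :: "idx \<Rightarrow> 'k ser"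
    define b where "b = a(v := a v + ev R a)"
    have a: "a = b(v := b v - ev R b)" unfolding b_def by (simp add: Rc)
    have bv: "ev (F i) a = b v" by (simp add: Fi b_def)
    have eq: "hmap F a = (\<lambda>j. if j = i then b v else ev (F j) (b(v := b v - ev R b)))"
      using bv by (auto simp: hmap_def fun_eq_iff a[symmetric])
    show "hmap ?G (hmap F a) = hmap F' (hmap ?G a)"
    proof
      fix j
      show "hmap ?G (hmap F a) j = hmap F' (hmap ?G a) j"
      proof (cases "j = v")
        case True
        have "hmap ?G (hmap F a) j = ev (F i) (hmap F a)" using True by (simp add: hmap_def)
        also have "\<dots> = ev (F' v) b" unfolding eq by (rule new)
        finally show ?thesis using True unfolding G b_def[symmetric] by (simp add: hmap_def)
      next
        case False
        have "hmap ?G (hmap F a) j = ev (F j) (b(v := b v - ev R b))" using False by (simp add: hmap_def a[symmetric])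
        also have "\<dots> = ev (F' j) b" using other False by blast
        finally show ?thesis unfolding G b_def[symmetric] by (simp add: hmap_def)
      qed
    qed
    show "hmap ?H (hmap ?G a) = a" unfolding H G by (simp add: Rc)
    show "hmap ?G (hmap ?H a) = a" unfolding H G by (simp add: Rc)
  qed
qed

lemma good_rename:
  fixes F F' :: "'k::field sys"
  assumes pq: "\<forall>j. p (q j) = j \<and> q (p j) = j"
    and F': "\<And>j. F' j = map (\<lambda>(c, m). (c, map q m)) (F (p j))" and good: "good F'"
  shows "good F"
proof (rule good_conj[OF _ _ _ good, where G = "\<lambda>j. [(1, [p j])]" and G' = "\<lambda>j. [(1, [q j])]"])
  fix a :: "idx \<Rightarrow> 'k ser"
  have "ev (map (\<lambda>(c, m). (c, map q m)) L) (\<lambda>j. a (p j)) = ev L a" for L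
    by (induction L) (auto simp: pq comp_def)
  then show "hmap (\<lambda>j. [(1, [p j])]) (hmap F a) = hmap F' (hmap (\<lambda>j. [(1, [p j])]) a)"
    by (auto simp: hmap_def F')
qed (use pq in \<open>auto simp: hmap_def\<close>)

text \<open>
  With the image of \<open>z\<close> as a coordinate, the values \<open>y\<close>, \<open>x\<close>, \<open>z\<close> and this image follow each other as in a recurrence.
\<close>
lemma form_chain:
  fixes F :: "'k::field sys"
  assumes F: "F = case_idx [(1, [Vz])] [(c, [Vx]), (c0, [])]
    [(1, [Vw]), (r0, [Vx, Vz]), (r1, [Vx, Vx]), (r2, [Vx, Vy]), (r3, [Vy, Vy]), (r4, [Vx]), (r5, [Vy]), (r6, [Vz]), (r7, [])]
    ((g, [Vw]) # Q2 (g * r3) (g * r2) p1 e p2 p3)" and nz: "c \<noteq> 0"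
  shows "good F"
proof -
  let ?F' = "case_idx [(1, [Vz])] [(c, [Vx]), (c0, [])] [(1, [Vw])]
    [(r0, [Vz, Vw]), (r1, [Vz, Vz]), (c * r2 - g * r0, [Vx, Vz]), (c * c * r3 - g * r1 + p1, [Vx, Vx]), (e - g * r5, [Vy]), (2 * c * c0 * r3 + c * r5 - g * r4 + p2, [Vx]), (c0 * r2 - g * r6 + r4, [Vz]), (g + r6, [Vw]), (c0 * c0 * r3 + c0 * r5 - g * r7 + p3 + r7, [])] :: 'k sys"
  let ?F'' = "case_idx [(c, [Vy]), (0, [Vx]), (c0, []), (0, [Vz])] [(1, [Vz]), (0, [Vy]), (0, [Vx]), (0, [])]
    [(1, [Vw]), (0, [Vz]), (0, [Vy]), (0, [Vx]), (0, [])]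
    [(0, [Vw, Vw]), (r0, [Vz, Vw]), (0, [Vy, Vw]), (r1, [Vz, Vz]), (c * r2 - g * r0, [Vy, Vz]), (c * c * r3 - g * r1 + p1, [Vy, Vy]), (e - g * r5, [Vx]), (2 * c * c0 * r3 + c * r5 - g * r4 + p2, [Vy]), (c0 * r2 - g * r6 + r4, [Vz]), (g + r6, [Vw]), (c0 * c0 * r3 + c0 * r5 - g * r7 + p3 + r7, [])] :: 'k sys"
  have good: "good ?F''" by (rule good_shift4[OF refl]) auto
  let ?p = "case_idx Vy Vx Vz Vw"
  let ?F1 = "\<lambda>j. map (\<lambda>(c, m). (c, map ?p m)) (?F'' (?p j))"
  show ?thesis
  proof (rule good_elem[where i = Vz and v = Vw and F' = ?F1])
    show "F Vz = (1, [Vw]) # [(r0, [Vx, Vz]), (r1, [Vx, Vx]), (r2, [Vx, Vy]), (r3, [Vy, Vy]), (r4, [Vx]), (r5, [Vy]), (r6, [Vz]), (r7, [])]"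
      by (simp add: F)
    show "good ?F1"
      by (rule good_rename[where p = ?p and q = ?p and F' = ?F'', OF _ _ good])
        (auto simp: all_idx, case_tac j, auto)
  qed (simp_all add: F Qs all_idx cst_hom algebra_simps)
qed

lemma good_scale:
  fixes F :: "'k::field sys" and l :: "idx \<Rightarrow> 'k"
  assumes l: "\<And>j. l j \<noteq> 0" and good: "good (\<lambda>j. map (\<lambda>(c, m). (l j * c / prod_list (map l m), m)) (F j))"
  shows "good F"
proof (rule good_conj[OF _ _ _ good, where G = "\<lambda>j. [(l j, [j])]" and G' = "\<lambda>j. [(1 / l j, [j])]"])
  fix a :: "idx \<Rightarrow> 'k ser"
  have inv: "cst (1 / l j) * cst (l j) = 1" for j using l[of j] by (simp flip: cst_mult)
  have pl: "prod_list (map (\<lambda>i. cst (l i) * a i) m) = cst (prod_list (map l m)) * prod_list (map a m)" for m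
    by (induction m) (auto simp: cst_mult algebra_simps)
  have pnz: "prod_list (map l m) \<noteq> 0" for m using l by (induction m) auto
  have pinv: "cst (x / prod_list (map l m)) * cst (prod_list (map l m)) = cst x" for x m
    using pnz[of m] by (simp flip: cst_mult)
  show "hmap (\<lambda>j. [(l j, [j])]) (hmap F a) = hmap (\<lambda>j. map (\<lambda>(c, m). (l j * c / prod_list (map l m), m)) (F j)) (hmap (\<lambda>j. [(l j, [j])]) a)"
  proof
    fix j
    have "cst (l j) * ev L a = ev (map (\<lambda>(c, m). (l j * c / prod_list (map l m), m)) L) (\<lambda>i. cst (l i) * a i)" for L
    proof (induction L)
      case (Cons cm L)
      obtain c m where [simp]: "cm = (c, m)" by (cases cm)
      have "cst (l j * c / prod_list (map l m)) * prod_list (map (\<lambda>i. cst (l i) * a i) m)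
        = cst (l j) * (cst c * prod_list (map a m))"
        unfolding pl mult.assoc[symmetric] pinv by (simp add: cst_mult)
      then show ?case using Cons by (simp add: algebra_simps)
    qed simp
    then show "hmap (\<lambda>j. [(l j, [j])]) (hmap F a) j = hmap (\<lambda>j. map (\<lambda>(c, m). (l j * c / prod_list (map l m), m)) (F j)) (hmap (\<lambda>j. [(l j, [j])]) a) j"
      by (simp add: hmap_def)
  qed
  show "hmap (\<lambda>j. [(1 / l j, [j])]) (hmap (\<lambda>j. [(l j, [j])]) a) = a"
    by (rule ext) (simp add: hmap_def mult.assoc[symmetric] inv)
  have inv': "cst (l j) * cst (1 / l j) = 1" for j using l[of j] by (simp flip: cst_mult)
  show "hmap (\<lambda>j. [(l j, [j])]) (hmap (\<lambda>j. [(1 / l j, [j])]) a) = a"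
    by (rule ext) (simp add: hmap_def mult.assoc[symmetric] inv')
qed

section \<open>Normal forms with a linear second component\<close>

text \<open>
  Here \<open>y\<close> remembers the previous value of \<open>x\<close>. The letters \<open>T\<close>, \<open>A\<close>, \<open>C\<close>, \<open>M\<close> stand for the permutations
  3124, 3142, 4123, 4132, and as before the first nonzero quadratic coefficient fixes the weights.
\<close>

text \<open>
  If none of the quadratic monomials of the first cases occurs, the image of \<open>x\<close> serves as a coordinate and the system becomes a chain.
\<close>
lemma form_A:
  fixes F :: "'k::field sys"
  assumes F: "F = case_idx ((1, [Vz]) # Q2 q1 q2 q3 q4 q5 q6) [(c, [Vx]), (c0, [])]
    ((1, [Vw]) # Q3 s1 s2 s3 s4 s5 s6 s7 s8 s9 s10) ((e, [Vy]) # Q1 p1 p2 p3)" and nz: "c \<noteq> 0"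
  shows "good F"
proof -
  consider "q3 \<noteq> 0" | "q3 = 0" "s1 \<noteq> 0" | "q3 = 0" "s1 = 0" "q2 \<noteq> 0" | "q3 = 0" "s1 = 0" "q2 = 0" "s3 \<noteq> 0"
    | "q3 = 0" "s1 = 0" "q2 = 0" "s3 = 0" "s2 \<noteq> 0" | "q3 = 0" "s1 = 0" "q2 = 0" "s3 = 0" "s2 = 0" by blast
  then show ?thesis
  proof cases
    case 1
    show ?thesis
      by (rule good2_inv[where S = "\<lambda>v. v Vx \<noteq> 0 \<and> v Vy = 0" and ?v0.0 = "case_idx 1 0 0 0"])
        (use 1 in \<open>auto simp: F Qs all_idx hom2_def\<close>)
  next
    case 2
    show ?thesis
      by (rule good2_inv[where S = "\<lambda>v. v Vz \<noteq> 0 \<and> v Vy = 0 \<and> v Vx = 0" and ?v0.0 = "case_idx 0 0 1 0"])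
        (use 2 in \<open>auto simp: F Qs all_idx hom2_def\<close>)
  next
    case 3
    obtain \<theta> where th: "rt2 1 1 1.618 1.619 \<theta>" using golden by blast
    show ?thesis
    proof (rule leaf[where \<theta> = \<theta> and \<mu> = "case_idx \<theta> 1 (\<theta> + 1) 2" and ld = "case_idx [[Vz], [Vx, Vy]] [[Vx]] [[Vx, Vz]] []"
          and S = "\<lambda>v. v Vx \<noteq> 0 \<and> v Vy \<noteq> 0 \<and> v Vz = 0" and ?v0.0 = "case_idx 1 1 0 0"])
    qed (use 3 th nz in \<open>auto simp: F Qs all_idx ex_idx algebra_simps rt2_def\<close>)
  next
    case 4
    obtain \<theta> where th: "rt2 1 1 1.618 1.619 \<theta>" using golden by blast
    show ?thesis
      by (rule leaf_mono[where \<theta> = \<theta> and \<mu> = "case_idx \<theta> 1 (\<theta> + 1) 2" and ld = "case_idx [[Vz]] [] [[Vx, Vz]] []"])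
        (use 4 th nz in \<open>auto simp: F Qs all_idx ex_idx algebra_simps rt2_def\<close>)
  next
    case 5
    obtain \<theta> t where th: "rt3 1 0 1 1.465 1.466 \<theta> t" using cub101 by blast
    show ?thesis
      by (rule leaf_mono[where \<theta> = \<theta> and \<mu> = "case_idx \<theta> 1 t 2" and ld = "case_idx [[Vz]] [[Vx]] [[Vy, Vz]] []"])
        (use 5 th nz in \<open>auto simp: F Qs all_idx ex_idx algebra_simps rt3_def\<close>)
  next
    case 6
    show ?thesis
    proof (rule good_elem[where i = Vx and v = Vz])
      show "F Vx = (1, [Vz]) # [(q1, [Vy, Vy]), (0, [Vx, Vy]), (0, [Vx, Vx]), (q4, [Vy]), (q5, [Vx]), (q6, [])]"
        using 6 by (simp add: F Qs)
      show "good (case_idx [(1, [Vz])] [(c, [Vx]), (c0, [])]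
        [(1, [Vw]), (0, [Vx, Vz]), (c * c * q1 + s6, [Vx, Vx]), (s5, [Vx, Vy]), (- q1 * s7 + s4, [Vy, Vy]), (2 * c * c0 * q1 + c * q4 - q5 * s7 + s9, [Vx]), (- q4 * s7 + s8, [Vy]), (q5 + s7, [Vz]), (c0 * c0 * q1 + c0 * q4 + q6 - q6 * s7 + s10, [])]
        ((0, [Vw]) # Q2 (0 * (- q1 * s7 + s4)) (0 * s5) p1 e p2 p3) :: 'k sys)"
        by (rule form_chain[OF refl nz])
    qed (simp_all add: F Qs 6 all_idx cst_hom algebra_simps)
  qed
qed

text \<open>
  At \<open>y = 0\<close> the pair \<open>(x, z)\<close> carries a binary quadratic map. When the image of \<open>z\<close> does not contain \<open>x x\<close>, or when this
  map is nilpotent and the image of \<open>x\<close> does not contain \<open>y z\<close>, the coordinates can be arranged in a chain.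
\<close>
lemma form_C:
  fixes F :: "'k::alg_closed_field sys"
  assumes F: "F = case_idx ((1, [Vw]) # Q3 s1 s2 s3 s4 s5 s6 s7 s8 s9 s10) [(c, [Vx]), (c0, [])]
    ((e, [Vy]) # Q1 p1 p2 p3) ((1, [Vz]) # Q2 q1 q2 q3 q4 q5 q6)" and nz: "c \<noteq> 0"
  shows "good F"
proof -
  consider "p1 = 0" | "p1 \<noteq> 0" "s6 \<noteq> 0 \<or> s3 \<noteq> 0 \<or> s1 \<noteq> 0" | "p1 \<noteq> 0" "s6 = 0" "s3 = 0" "s1 = 0" "s2 \<noteq> 0"
    | "s6 = 0" "s3 = 0" "s1 = 0" "s2 = 0" by blast
  then show ?thesis
  proof cases
    case 1
    let ?F'' = "case_idx [(e, [Vy]), (0, [Vx]), (p3, []), (p2, [Vz])] [(c, [Vz]), (0, [Vy]), (0, [Vx]), (c0, [])]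
      [(1, [Vw]), (0, [Vz]), (0, [Vy]), (0, [Vx]), (0, [])]
      [(s6, [Vw, Vw]), (c * s5 + p2 * s3, [Vz, Vw]), (e * s3, [Vy, Vw]), (c * c * s4 + c * p2 * s2 + p2 * p2 * s1 + q3, [Vz, Vz]),
       (c * e * s2 + 2 * e * p2 * s1 + q2, [Vy, Vz]), (e * e * s1 + q1, [Vy, Vy]), (1, [Vx]), (c0 * e * s2 + 2 * e * p3 * s1 + e * s7 + q4, [Vy]),
       (2 * c * c0 * s4 + c * p3 * s2 + c * s8 + c0 * p2 * s2 + 2 * p2 * p3 * s1 + p2 * s7 + q5, [Vz]), (c0 * s5 + p3 * s3 + s9, [Vw]),
       (c0 * c0 * s4 + c0 * p3 * s2 + c0 * s8 + p3 * p3 * s1 + p3 * s7 + q6 + s10, [])] :: 'k sys"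
    have good: "good ?F''" by (rule good_shift4[OF refl]) (use nz in auto)
    let ?p = "case_idx Vz Vy Vx Vw"
    let ?F1 = "\<lambda>j. map (\<lambda>(c, m). (c, map ?p m)) (?F'' (?p j))"
    show ?thesis
    proof (rule good_elem[where i = Vx and v = Vw and F' = ?F1])
      show "F Vx = (1, [Vw]) # Q3 s1 s2 s3 s4 s5 s6 s7 s8 s9 s10" by (simp add: F)
      show "good ?F1"
        by (rule good_rename[where p = ?p and q = ?p and F' = ?F'', OF _ _ good])
          (auto simp: all_idx, case_tac j, auto)
    qed (simp_all add: F Qs 1 all_idx cst_hom algebra_simps)
  next
    case 2
    show ?thesis
    proof (rule good_binary[where i = Vx and j = Vz and Zs = "{Vy}" and ?a1.0 = s6 and ?a2.0 = s3 and ?a3.0 = s1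
          and ?b1.0 = p1 and ?b2.0 = 0 and ?b3.0 = 0])
    qed (use 2 in \<open>auto simp: F Qs all_idx hom2_def algebra_simps\<close>)
  next
    case 3
    obtain \<theta> where th: "rt2 0 3 1.732 1.733 \<theta>" using sqrt3 by blast
    show ?thesis
      by (rule leaf_mono[where \<theta> = \<theta> and \<mu> = "case_idx 3 \<theta> (2 * \<theta>) (2 * \<theta>)" and ld = "case_idx [[Vy, Vz]] [[Vx]] [[Vx, Vx]] []"])
        (use 3 th nz in \<open>auto simp: F Qs all_idx ex_idx algebra_simps rt2_def\<close>)
  next
    case 4
    let ?F'' = "case_idx [(1, [Vz])] [(c, [Vx]), (c0, [])]
      [(1, [Vw]), (c * s5, [Vx, Vz]), (c * c * s4 + p1 * s7 + q3, [Vx, Vx]), (q2, [Vx, Vy]), (q1, [Vy, Vy]), (2 * c * c0 * s4 + c * s8 + p2 * s7 + q5, [Vx]), (e * s7 + q4, [Vy]), (c0 * s5 + s9, [Vz]), (c0 * c0 * s4 + c0 * s8 + p3 * s7 + q6 + s10, [])]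
      ((0, [Vw]) # Q2 (0 * q1) (0 * q2) p1 e p2 p3) :: 'k sys"
    have good: "good ?F''" by (rule form_chain[OF refl nz])
    let ?p = "case_idx Vx Vy Vw Vz"
    let ?F1 = "\<lambda>j. map (\<lambda>(c, m). (c, map ?p m)) (?F'' (?p j))"
    show ?thesis
    proof (rule good_elem[where i = Vx and v = Vw and F' = ?F1])
      show "F Vx = (1, [Vw]) # Q3 0 0 0 s4 s5 0 s7 s8 s9 s10" using 4 by (simp add: F)
      show "good ?F1"
        by (rule good_rename[where p = ?p and q = ?p and F' = ?F'', OF _ _ good])
          (auto simp: all_idx, case_tac j, auto simp: Qs)
    qed (simp_all add: F Qs 4 all_idx cst_hom algebra_simps)
  qed
qed

text \<open>
  The form \<open>M\<close> after the image of \<open>x\<close> has become the coordinate \<open>w\<close>.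
\<close>
lemma form_M_reduced:
  fixes F :: "'k::field sys"
  assumes F: "F = case_idx [(1, [Vw])] [(c, [Vx]), (c0, [])] ((g, [Vz]) # Q2 q1 q2 q3 q4 q5 q6)
     [(g * s, [Vz]), (0, [Vx, Vw]), (A, [Vx, Vx]), (q2 * s, [Vx, Vy]), (q1 * s, [Vy, Vy]), (l2, [Vx]), (l1, [Vy]), (l3, [Vw]), (l0, [])]"
    and nz: "c \<noteq> 0" "g \<noteq> 0"
  shows "good F"
proof -
  consider "A \<noteq> 0" | "A = 0" "s = 0" | "s \<noteq> 0" by blast
  then show ?thesis
  proof cases
    case 1
    obtain \<theta> where th: "rt2 0 2 1.414 1.415 \<theta>" using sqrt2 by blast
    show ?thesis
      by (rule leaf_mono[where \<theta> = \<theta> and \<mu> = "case_idx \<theta> 1 2 2" and ld = "case_idx [[Vw]] [] [] [[Vx, Vx]]"])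
        (use 1 th nz in \<open>auto simp: F Qs all_idx ex_idx algebra_simps rt2_def\<close>)
  next
    case 2
    show ?thesis
      by (rule good1[where \<mu> = "\<lambda>e. case_idx 1 1 2 1"]) (use 2 in \<open>auto simp: F Qs all_idx algebra_simps\<close>)
  next
    case 3
    let ?k = "g * s"
    let ?F'' = "case_idx [(1, [Vz])] [(c, [Vx]), (c0, [])]
      [(1, [Vw]), (0, [Vx, Vz]), (A, [Vx, Vx]), (q2 * s, [Vx, Vy]), (q1 * s, [Vy, Vy]), (l2, [Vx]), (l1, [Vy]), (l3, [Vz]), (l0, [])]
      ((g, [Vw]) # Q2 (g * (q1 * s)) (g * (q2 * s)) (?k * q3) (?k * q4) (?k * q5) (?k * q6)) :: 'k sys"
    let ?p = "case_idx Vx Vy Vw Vz"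
    have good: "good ?F''" by (rule form_chain[OF refl nz(1)])
    show ?thesis
    proof (rule good_scale[where l = "case_idx 1 1 ?k 1"])
      show "case_idx 1 1 ?k 1 j \<noteq> 0" for j using 3 nz by (cases j) auto
      show "good (\<lambda>j. map (\<lambda>(c, m). (case_idx 1 1 ?k 1 j * c / prod_list (map (case_idx 1 1 ?k 1) m), m)) (F j))"
        by (rule good_rename[where p = ?p and q = ?p and F' = ?F'', OF _ _ good])
          (auto simp: all_idx, case_tac j, use 3 nz in \<open>auto simp: F Qs\<close>)
    qed
  qed
qed

text \<open>
  The leading monomials of the images of \<open>x\<close> and \<open>z\<close> together fix the weights. If the image of \<open>x\<close> has no quadratic
  monomials except possibly \<open>y y\<close>, it becomes the coordinate \<open>w\<close>.
\<close>
lemma form_M: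
  fixes F :: "'k::alg_closed_field sys"
  assumes F: "F = case_idx ((1, [Vw]) # Q3 s1 s2 s3 s4 s5 s6 s7 s8 s9 s10) [(c, [Vx]), (c0, [])]
    ((g, [Vz]) # Q2 q1 q2 q3 q4 q5 q6) ((e, [Vy]) # Q1 p1 p2 p3)" and nz: "c \<noteq> 0" "g \<noteq> 0"
    and q: "q1 \<noteq> 0 \<or> q2 \<noteq> 0 \<or> q3 \<noteq> 0"
  shows "good F"
proof -
  have red: ?thesis if "s1 = 0" "s2 = 0" "s3 = 0" "s6 = 0" and s5: "s5 = 0"
  proof -
    show ?thesis
    proof (rule good_elem[where i = Vx and v = Vw])
      show "F Vx = (1, [Vw]) # Q3 0 0 0 s4 0 0 s7 s8 s9 s10" using that by (simp add: F)
      show "good (case_idx [(1, [Vw])] [(c, [Vx]), (c0, [])] ((g, [Vz]) # Q2 q1 q2 q3 q4 q5 q6)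
        [(g * s7, [Vz]), (0, [Vx, Vw]), (c * c * s4 + p1 + q3 * s7, [Vx, Vx]), (q2 * s7, [Vx, Vy]), (q1 * s7, [Vy, Vy]),
         (2 * c * c0 * s4 + c * s8 + p2 + q5 * s7, [Vx]), (e + q4 * s7, [Vy]), (s9, [Vw]), (c0 * c0 * s4 + c0 * s8 + p3 + q6 * s7 + s10, [])] :: 'k sys)"
        by (rule form_M_reduced[OF refl nz])
    qed (simp_all add: F Qs that all_idx cst_hom algebra_simps)
  qed
  consider "q3 \<noteq> 0" "s6 \<noteq> 0 \<or> s3 \<noteq> 0 \<or> s1 \<noteq> 0" | "q3 \<noteq> 0" "s6 = 0" "s3 = 0" "s1 = 0" "s2 \<noteq> 0"
    | "q3 \<noteq> 0" "s6 = 0" "s3 = 0" "s1 = 0" "s2 = 0" "s5 \<noteq> 0"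
    | "q3 = 0" "s6 \<noteq> 0" | "q3 = 0" "s6 = 0" "q2 \<noteq> 0" "s3 \<noteq> 0" | "q3 = 0" "s6 = 0" "q2 \<noteq> 0" "s3 = 0" "s1 \<noteq> 0"
    | "q3 = 0" "s6 = 0" "q2 \<noteq> 0" "s3 = 0" "s1 = 0" "s2 \<noteq> 0" | "q3 = 0" "s6 = 0" "q2 \<noteq> 0" "s3 = 0" "s1 = 0" "s2 = 0" "s5 \<noteq> 0"
    | "q3 = 0" "s6 = 0" "q2 = 0" "q1 \<noteq> 0" "s3 \<noteq> 0" | "q3 = 0" "s6 = 0" "q2 = 0" "q1 \<noteq> 0" "s3 = 0" "s5 \<noteq> 0"
    | "q3 = 0" "s6 = 0" "q2 = 0" "q1 \<noteq> 0" "s3 = 0" "s5 = 0" "s1 \<noteq> 0"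
    | "q3 = 0" "s6 = 0" "q2 = 0" "q1 \<noteq> 0" "s3 = 0" "s5 = 0" "s1 = 0" "s2 \<noteq> 0"
    | "s6 = 0" "s3 = 0" "s1 = 0" "s2 = 0" "s5 = 0" using q by argo
  then show ?thesis
  proof cases
    case 1
    show ?thesis
    proof (rule good_binary[where i = Vx and j = Vz and Zs = "{Vy}" and ?a1.0 = s6 and ?a2.0 = s3 and ?a3.0 = s1
          and ?b1.0 = q3 and ?b2.0 = 0 and ?b3.0 = 0])
    qed (use 1 in \<open>auto simp: F Qs all_idx hom2_def algebra_simps\<close>)
  next
    case 2
    obtain \<theta> where th: "rt2 0 3 1.732 1.733 \<theta>" using sqrt3 by blast
    show ?thesis
      by (rule leaf_mono[where \<theta> = \<theta> and \<mu> = "case_idx 3 \<theta> (2 * \<theta>) (2 * \<theta>)" and ld = "case_idx [[Vy, Vz]] [[Vx]] [[Vx, Vx]] []"])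
        (use 2 th nz in \<open>auto simp: F Qs all_idx ex_idx algebra_simps rt2_def\<close>)
  next
    case 3
    obtain \<theta> where th: "rt2 1 1 1.618 1.619 \<theta>" using golden by blast
    show ?thesis
      by (rule leaf_mono[where \<theta> = \<theta> and \<mu> = "case_idx \<theta> 1 2 2" and ld = "case_idx [[Vx, Vy]] [[Vx]] [] []"])
        (use 3 th nz in \<open>auto simp: F Qs all_idx ex_idx algebra_simps rt2_def\<close>)
  next
    case 4
    show ?thesis
      by (rule good2_inv[where S = "\<lambda>v. v Vx \<noteq> 0 \<and> v Vy = 0 \<and> v Vz = 0" and ?v0.0 = "case_idx 1 0 0 0"])
        (use 4 in \<open>auto simp: F Qs all_idx hom2_def\<close>)
  next
    case 5
    obtain \<theta> t where th: "rt3 1 1 1 1.839 1.84 \<theta> t" using cub111 by blast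
    show ?thesis
      by (rule leaf_mono[where \<theta> = \<theta> and \<mu> = "case_idx \<theta> 1 (t - \<theta>) 2" and ld = "case_idx [[Vx, Vz]] [[Vx]] [[Vx, Vy]] []"])
        (use 5 th nz in \<open>auto simp: F Qs all_idx ex_idx algebra_simps rt3_def\<close>)
  next
    case 6
    obtain \<theta> t where th: "rt3 0 2 2 1.769 1.77 \<theta> t" using cub022 by blast
    show ?thesis
      by (rule leaf_mono[where \<theta> = \<theta> and \<mu> = "case_idx \<theta> 1 (t / 2) 2" and ld = "case_idx [[Vz, Vz]] [[Vx]] [[Vx, Vy]] []"])
        (use 6 th nz in \<open>auto simp: F Qs all_idx ex_idx algebra_simps rt3_def\<close>)
  next
    case 7
    obtain \<theta> where th: "rt2 1 1 1.618 1.619 \<theta>" using golden by blast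
    have "\<exists>t. poly [:- q2, s5, s2:] t = 0" using 7 by (intro alg_closed_imp_poly_has_root) simp
    then obtain \<tau> where tau: "\<tau> * (s5 + s2 * \<tau>) = q2" by (auto simp: algebra_simps)
    have nz': "s5 + s2 * \<tau> \<noteq> 0" "\<tau> \<noteq> 0" using tau 7 by auto
    let ?ld = "case_idx [[Vx, Vy], [Vy, Vz]] [[Vx]] [[Vx, Vy]] []"
    show ?thesis
    proof (rule leaf[where \<theta> = \<theta> and \<mu> = "case_idx \<theta> 1 \<theta> 2" and ld = ?ld
          and S = "\<lambda>v. v Vx \<noteq> 0 \<and> v Vy \<noteq> 0 \<and> v Vz = mconst \<tau> * v Vx" and ?v0.0 = "case_idx 1 1 (mconst \<tau>) 0"])
      fix v v' :: "idx \<Rightarrow> (4, 'k) mpoly"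
      assume v: "v Vx \<noteq> 0 \<and> v Vy \<noteq> 0 \<and> v Vz = mconst \<tau> * v Vx" and v': "\<forall>j. ?ld j \<noteq> [] \<longrightarrow>
           v' j = (\<Sum>(c, m)\<leftarrow>filter (\<lambda>(c, m). m \<in> set (?ld j)) (F j). mconst c * prod_list (map v m))"
      have "v' Vx = mconst (s5 + s2 * \<tau>) * (v Vx * v Vy)" "v' Vy = mconst c * v Vx" "v' Vz = mconst (\<tau> * (s5 + s2 * \<tau>)) * (v Vx * v Vy)"
        using v' v unfolding tau by (simp_all add: F Qs all_idx algebra_simps mconst_add mconst_mult)
      then show "v' Vx \<noteq> 0 \<and> v' Vy \<noteq> 0 \<and> v' Vz = mconst \<tau> * v' Vx"
        using v nz nz' by (simp add: mconst_mult mult_ac)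
    qed (use 7 th in \<open>auto simp: F Qs all_idx ex_idx algebra_simps rt2_def\<close>)
  next
    case 8
    obtain \<theta> where th: "rt2 1 1 1.618 1.619 \<theta>" using golden by blast
    show ?thesis
      by (rule leaf_mono[where \<theta> = \<theta> and \<mu> = "case_idx \<theta> 1 \<theta> 2" and ld = "case_idx [[Vx, Vy]] [[Vx]] [] []"])
        (use 8 th nz in \<open>auto simp: F Qs all_idx ex_idx algebra_simps rt2_def\<close>)
  next
    case 9
    obtain \<theta> t where th: "rt3 1 0 2 1.695 1.696 \<theta> t" using cub102 by blast
    show ?thesis
      by (rule leaf_mono[where \<theta> = \<theta> and \<mu> = "case_idx \<theta> 1 (t - \<theta>) 2" and ld = "case_idx [[Vx, Vz]] [[Vx]] [[Vy, Vy]] []"])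
        (use 9 th nz in \<open>auto simp: F Qs all_idx ex_idx algebra_simps rt3_def\<close>)
  next
    case 10
    obtain \<theta> where th: "rt2 1 1 1.618 1.619 \<theta>" using golden by blast
    show ?thesis
      by (rule leaf_mono[where \<theta> = \<theta> and \<mu> = "case_idx \<theta> 1 (2 * \<theta> - 2) 2" and ld = "case_idx [[Vx, Vy]] [[Vx]] [] []"])
        (use 10 th nz in \<open>auto simp: F Qs all_idx ex_idx algebra_simps rt2_def\<close>)
  next
    case 11
    obtain \<theta> t where th: "rt3 0 0 4 1.587 1.588 \<theta> t" using cub004 by blast
    show ?thesis
      by (rule leaf_mono[where \<theta> = \<theta> and \<mu> = "case_idx \<theta> 1 (t / 2) 2" and ld = "case_idx [[Vz, Vz]] [[Vx]] [[Vy, Vy]] []"])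
        (use 11 th nz in \<open>auto simp: F Qs all_idx ex_idx algebra_simps rt3_def\<close>)
  next
    case 12
    obtain \<theta> t where th: "rt3 0 1 2 1.521 1.522 \<theta> t" using cub012 by blast
    show ?thesis
      by (rule leaf_mono[where \<theta> = \<theta> and \<mu> = "case_idx \<theta> 1 (t - 1) 2" and ld = "case_idx [[Vy, Vz]] [[Vx]] [[Vy, Vy]] []"])
        (use 12 th nz in \<open>auto simp: F Qs all_idx ex_idx algebra_simps rt3_def\<close>)
  next
    case 13
    then show ?thesis by (intro red)
  qed
qed

section \<open>Further cyclic normal forms\<close>

text \<open>
  At \<open>z = 0\<close> the pair \<open>(x, y)\<close> carries a binary quadratic map with \<open>x x\<close> as the only leading monomial of the image of \<open>y\<close>.
  If this is nilpotent, the monomials \<open>y z\<close> and \<open>x z\<close>, and after them those in the image of \<open>w\<close>, fix the weights.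
\<close>
lemma form_4213:
  fixes F :: "'k::alg_closed_field sys"
  assumes F: "F = case_idx ((d, [Vw]) # Q3 s1 s2 s3 s4 s5 s6 s7 s8 s9 s10) ((e, [Vy]) # Q1 p1 p2 p3)
    [(c, [Vx]), (c0, [])] ((g, [Vz]) # Q2 q1 q2 q3 q4 q5 q6)"
    and nz: "d \<noteq> 0" "c \<noteq> 0" "p1 \<noteq> 0" and q: "q1 \<noteq> 0 \<or> q2 \<noteq> 0"
  shows "good F"
proof -
  consider "s4 \<noteq> 0 \<or> s5 \<noteq> 0 \<or> s6 \<noteq> 0" | "s4 = 0" "s5 = 0" "s6 = 0" "s2 \<noteq> 0" | "s4 = 0" "s5 = 0" "s6 = 0" "s2 = 0" "s3 \<noteq> 0"
    | "s4 = 0" "s5 = 0" "s6 = 0" "s2 = 0" "s3 = 0" "q1 \<noteq> 0" | "s4 = 0" "s5 = 0" "s6 = 0" "s2 = 0" "s3 = 0" "q1 = 0" "q2 \<noteq> 0"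
    using q by argo
  then show ?thesis
  proof cases
    case 1
    show ?thesis
    proof (rule good_binary[where i = Vx and j = Vy and Zs = "{Vz}" and ?a1.0 = s6 and ?a2.0 = s5 and ?a3.0 = s4
          and ?b1.0 = p1 and ?b2.0 = 0 and ?b3.0 = 0])
    qed (use 1 nz in \<open>auto simp: F Qs all_idx hom2_def algebra_simps\<close>)
  next
    case 2
    obtain \<theta> where th: "rt2 0 3 1.732 1.733 \<theta>" using sqrt3 by blast
    show ?thesis
      by (rule leaf_mono[where \<theta> = \<theta> and \<mu> = "case_idx 3 (2 * \<theta>) \<theta> 4" and ld = "case_idx [[Vy, Vz]] [[Vx, Vx]] [[Vx]] []"])
        (use 2 th nz in \<open>auto simp: F Qs all_idx ex_idx algebra_simps rt2_def\<close>)
  next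
    case 3
    obtain \<theta> where th: "rt2 1 1 1.618 1.619 \<theta>" using golden by blast
    show ?thesis
      by (rule leaf_mono[where \<theta> = \<theta> and \<mu> = "case_idx 1 (2 * \<theta> - 2) (\<theta> - 1) 1.53" and ld = "case_idx [[Vx, Vz]] [] [[Vx]] []"])
        (use 3 th nz in \<open>auto simp: F Qs all_idx ex_idx algebra_simps rt2_def\<close>)
  next
    case 4
    obtain \<theta> t where th: "rt3 0 0 4 1.587 1.588 \<theta> t" using cub004 by blast
    show ?thesis
      by (rule leaf_mono[where \<theta> = \<theta> and \<mu> = "case_idx \<theta> 2 1 t" and ld = "case_idx [[Vw]] [[Vx, Vx]] [] [[Vy, Vy]]"])
        (use 4 th nz in \<open>auto simp: F Qs all_idx ex_idx algebra_simps rt3_def\<close>)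
  next
    case 5
    obtain \<theta> t where th: "rt3 0 1 2 1.521 1.522 \<theta> t" using cub012 by blast
    show ?thesis
      by (rule leaf_mono[where \<theta> = \<theta> and \<mu> = "case_idx \<theta> 2 1 t" and ld = "case_idx [[Vw]] [[Vx, Vx]] [] [[Vx, Vy]]"])
        (use 5 th nz in \<open>auto simp: F Qs all_idx ex_idx algebra_simps rt3_def\<close>)
  qed
qed

text \<open>
  The form \<open>E\<close> after the new coordinate \<open>w + m3 z z + h3 z\<close> has removed \<open>z\<close> from the image of \<open>y\<close>.
\<close>
lemma form_E_W:
  fixes F :: "'k::field sys"
  assumes F: "F = case_idx [(d, [Vz]), (q1, [Vx, Vy]), (q2, [Vy, Vy]), (x1, [Vx]), (x2, [Vy]), (x0, [])]
    [(1, [Vw]), (h1, [Vx]), (h2, [Vy]), (h0, [])] [(c1, [Vx]), (c2, [Vy]), (c0, [])]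
    [(A, [Vx, Vx]), (B, [Vx, Vy]), (C, [Vy, Vy]), (k1, [Vx]), (k2, [Vy]), (k0, [])]"
    and q: "q1 \<noteq> 0 \<or> q2 \<noteq> 0" and A: "A = 0 \<Longrightarrow> B = 0 \<and> C = 0"
  shows "good F"
proof -
  consider "q1 \<noteq> 0" "A \<noteq> 0" | "q1 \<noteq> 0" "A = 0" "h1 \<noteq> 0" | "q1 \<noteq> 0" "A = 0" "h1 = 0" "k1 \<noteq> 0"
    | "A = 0" "h1 = 0" "k1 = 0" | "q1 = 0" "q2 \<noteq> 0" "A \<noteq> 0" | "q1 = 0" "q2 \<noteq> 0" "A = 0" "h1 \<noteq> 0"
    | "q1 = 0" "q2 \<noteq> 0" "A = 0" "h1 = 0" "k1 \<noteq> 0" using q by argo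
  then show ?thesis
  proof cases
    case 1
    obtain \<theta> t where th: "rt3 1 0 2 1.695 1.696 \<theta> t" using cub102 by blast
    show ?thesis
      by (rule leaf_mono[where \<theta> = \<theta> and \<mu> = "case_idx \<theta> (t - \<theta>) 1 2" and ld = "case_idx [[Vx, Vy]] [[Vw]] [] [[Vx, Vx]]"])
        (use 1 th in \<open>auto simp: F all_idx ex_idx algebra_simps rt3_def\<close>)
  next
    case 2
    obtain \<theta> where th: "rt2 1 1 1.618 1.619 \<theta>" using golden by blast
    show ?thesis
      by (rule leaf_mono[where \<theta> = \<theta> and \<mu> = "case_idx \<theta> 1 1 1" and ld = "case_idx [[Vx, Vy]] [[Vx]] [] []"])
        (use 2 th A in \<open>auto simp: F all_idx ex_idx algebra_simps rt2_def\<close>)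
  next
    case 3
    obtain \<theta> t where th: "rt3 1 0 1 1.465 1.466 \<theta> t" using cub101 by blast
    show ?thesis
      by (rule leaf_mono[where \<theta> = \<theta> and \<mu> = "case_idx \<theta> (t - \<theta>) 1 1" and ld = "case_idx [[Vx, Vy]] [[Vw]] [] [[Vx]]"])
        (use 3 th A in \<open>auto simp: F all_idx ex_idx algebra_simps rt3_def\<close>)
  next
    case 4
    show ?thesis
      by (rule good1[where \<mu> = "\<lambda>e. case_idx 1 (e/4) 1 (e/4)"]) (use 4 A in \<open>auto simp: F all_idx algebra_simps\<close>)
  next
    case 5
    obtain \<theta> t where th: "rt3 0 0 4 1.587 1.588 \<theta> t" using cub004 by blast
    show ?thesis
      by (rule leaf_mono[where \<theta> = \<theta> and \<mu> = "case_idx \<theta> (t / 2) 1 2" and ld = "case_idx [[Vy, Vy]] [[Vw]] [] [[Vx, Vx]]"])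
        (use 5 th in \<open>auto simp: F all_idx ex_idx algebra_simps rt3_def\<close>)
  next
    case 6
    obtain \<theta> where th: "rt2 0 2 1.414 1.415 \<theta>" using sqrt2 by blast
    show ?thesis
      by (rule leaf_mono[where \<theta> = \<theta> and \<mu> = "case_idx \<theta> 1 1 1" and ld = "case_idx [[Vy, Vy]] [[Vx]] [] []"])
        (use 6 th A in \<open>auto simp: F all_idx ex_idx algebra_simps rt2_def\<close>)
  next
    case 7
    obtain \<theta> t where th: "rt3 0 0 2 1.259 1.26 \<theta> t" using cub002 by blast
    show ?thesis
      by (rule leaf_mono[where \<theta> = \<theta> and \<mu> = "case_idx \<theta> (t / 2) 1 1" and ld = "case_idx [[Vy, Vy]] [[Vw]] [] [[Vx]]"])
        (use 7 th A in \<open>auto simp: F all_idx ex_idx algebra_simps rt3_def\<close>)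
  qed
qed

text \<open>
  The form \<open>E\<close> after the image of \<open>y\<close> has become the coordinate \<open>w\<close>.
\<close>
lemma form_E_T:
  fixes F :: "'k::field sys"
  assumes F: "F = case_idx [(d, [Vz]), (q2, [Vy, Vy]), (x1, [Vx]), (x2, [Vy]), (x0, [])]
    [(1, [Vw])] [(c2, [Vy]), (c0, [])]
    [(A, [Vy, Vy]), (k, [Vx]), (l1, [Vy]), (l2, [Vz]), (l3, [Vw]), (l0, [])]"
    and q: "q2 \<noteq> 0"
  shows "good F"
proof -
  consider "A \<noteq> 0" | "A = 0" "k \<noteq> 0" | "A = 0" "k = 0" by blast
  then show ?thesis
  proof cases
    case 1
    obtain \<theta> where th: "rt2 0 2 1.414 1.415 \<theta>" using sqrt2 by blast
    show ?thesis
      by (rule leaf_mono[where \<theta> = \<theta> and \<mu> = "case_idx \<theta> 1 1 \<theta>" and ld = "case_idx [] [[Vw]] [] [[Vy, Vy]]"])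
        (use 1 th in \<open>auto simp: F all_idx ex_idx algebra_simps rt2_def\<close>)
  next
    case 2
    obtain \<theta> t where th: "rt3 0 0 2 1.259 1.26 \<theta> t" using cub002 by blast
    show ?thesis
      by (rule leaf_mono[where \<theta> = \<theta> and \<mu> = "case_idx t 1 1 \<theta>" and ld = "case_idx [[Vy, Vy]] [[Vw]] [] [[Vx]]"])
        (use 2 th q in \<open>auto simp: F all_idx ex_idx algebra_simps rt3_def\<close>)
  next
    case 3
    show ?thesis
      by (rule good1[where \<mu> = "\<lambda>e. case_idx 2 1 1 1"]) (use 3 in \<open>auto simp: F all_idx algebra_simps\<close>)
  qed
qed

text \<open>
  The coordinate \<open>z\<close> remembers a combination of \<open>x\<close> and \<open>y\<close>, and the quadratic part
  of the image of \<open>w\<close> is a multiple of the square of the linear form in the image of \<open>z\<close>. The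
  growth depends on whether \<open>z\<close> remembers \<open>x\<close> and on the leading monomials of the images of \<open>x\<close> and \<open>y\<close>. If the image of
  \<open>y\<close> contains neither \<open>x z\<close> nor \<open>y z\<close>, its terms in \<open>z\<close> can be absorbed by a change of the coordinate \<open>w\<close>.
\<close>
lemma form_E:
  fixes F :: "'k::alg_closed_field sys"
  assumes F: "F = case_idx [(d, [Vz]), (q1, [Vx, Vy]), (q2, [Vy, Vy]), (x1, [Vx]), (x2, [Vy]), (x0, [])]
    [(1, [Vw]), (m1, [Vx, Vz]), (m2, [Vy, Vz]), (m3, [Vz, Vz]), (h1, [Vx]), (h2, [Vy]), (h3, [Vz]), (h0, [])]
    [(c1, [Vx]), (c2, [Vy]), (c0, [])]
    [(p * c1 * c1, [Vx, Vx]), (2 * p * c1 * c2, [Vx, Vy]), (p * c2 * c2, [Vy, Vy]), (d1, [Vx]), (d2, [Vy]), (d0, [])]"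
    and q: "q1 \<noteq> 0 \<or> q2 \<noteq> 0" and inv: "c1 * d2 \<noteq> c2 * d1"
  shows "good F"
proof -
  consider "c1 \<noteq> 0" "q1 \<noteq> 0" "m1 \<noteq> 0" | "c1 \<noteq> 0" "q1 \<noteq> 0" "m1 = 0" "m2 \<noteq> 0" | "c1 \<noteq> 0" "m1 = 0" "m2 = 0"
    | "c1 \<noteq> 0" "q1 = 0" "q2 \<noteq> 0" "m1 \<noteq> 0" | "c1 \<noteq> 0" "q1 = 0" "q2 \<noteq> 0" "m1 = 0" "m2 \<noteq> 0"
    | "c1 = 0" "q1 \<noteq> 0" "m1 \<noteq> 0" | "c1 = 0" "q1 \<noteq> 0" "m1 = 0" "m2 \<noteq> 0"
    | "c1 = 0" "q1 \<noteq> 0" "m1 = 0" "m2 = 0" "h1 \<noteq> 0" | "c1 = 0" "q1 \<noteq> 0" "m1 = 0" "m2 = 0" "h1 = 0"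
    | "c1 = 0" "q1 = 0" "q2 \<noteq> 0" "m1 \<noteq> 0" | "c1 = 0" "q1 = 0" "q2 \<noteq> 0" "m1 = 0" "m2 \<noteq> 0"
    | "c1 = 0" "q1 = 0" "q2 \<noteq> 0" "m1 = 0" "m2 = 0" using q by argo
  then show ?thesis
  proof cases
    case 1
    obtain \<theta> t where th: "rt3 1 1 1 1.839 1.84 \<theta> t" using cub111 by blast
    show ?thesis
      by (rule leaf_mono[where \<theta> = \<theta> and \<mu> = "case_idx \<theta> (t - \<theta>) 1 2" and ld = "case_idx [[Vx, Vy]] [[Vx, Vz]] [[Vx]] []"])
        (use 1 th in \<open>auto simp: F all_idx ex_idx algebra_simps rt3_def\<close>)
  next
    case 2
    obtain \<theta> t where th: "rt3 2 (-1) 1 1.754 1.755 \<theta> t" using cub2m11 by blast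
    show ?thesis
      by (rule leaf_mono[where \<theta> = \<theta> and \<mu> = "case_idx \<theta> (t - \<theta>) 1 2" and ld = "case_idx [[Vx, Vy]] [[Vy, Vz]] [[Vx]] []"])
        (use 2 th in \<open>auto simp: F all_idx ex_idx algebra_simps rt3_def\<close>)
  next
    case 3
    let ?F' = "case_idx [(d, [Vz]), (q1, [Vx, Vy]), (q2, [Vy, Vy]), (x1, [Vx]), (x2, [Vy]), (x0, [])]
      [(1, [Vw]), (h1, [Vx]), (h2, [Vy]), (h0, [])] [(c1, [Vx]), (c2, [Vy]), (c0, [])]
      [((p + m3) * c1 * c1, [Vx, Vx]), (2 * (p + m3) * c1 * c2, [Vx, Vy]), ((p + m3) * c2 * c2, [Vy, Vy]),
       (2 * c0 * c1 * m3 + c1 * h3 + d1, [Vx]), (2 * c0 * c2 * m3 + c2 * h3 + d2, [Vy]), (c0 * c0 * m3 + c0 * h3 + d0, [])] :: 'k sys"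
    let ?G = "case_idx [(1, [Vx])] [(1, [Vy])] [(1, [Vz])] [(1, [Vw]), (m3, [Vz, Vz]), (h3, [Vz])] :: 'k sys"
    let ?H = "case_idx [(1, [Vx])] [(1, [Vy])] [(1, [Vz])] [(1, [Vw]), (- m3, [Vz, Vz]), (- h3, [Vz])] :: 'k sys"
    show ?thesis
    proof (rule good_conj[where F' = ?F' and G = ?G and G' = ?H])
      show "good ?F'" by (rule form_E_W[OF refl q]) (use 3 in auto)
    next
      fix a :: "idx \<Rightarrow> 'k ser"
      show "hmap ?G (hmap F a) = hmap ?F' (hmap ?G a)"
      proof
        fix j show "hmap ?G (hmap F a) j = hmap ?F' (hmap ?G a) j"
          by (cases j) (simp_all add: hmap_def F 3 cst_hom algebra_simps mult_2)
      qed
    qed (rule ext, case_tac x; simp add: hmap_def cst_hom algebra_simps)+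
  next
    case 4
    obtain \<theta> t where th: "rt3 0 2 2 1.769 1.77 \<theta> t" using cub022 by blast
    show ?thesis
      by (rule leaf_mono[where \<theta> = \<theta> and \<mu> = "case_idx \<theta> (t / 2) 1 2" and ld = "case_idx [[Vy, Vy]] [[Vx, Vz]] [[Vx]] []"])
        (use 4 th in \<open>auto simp: F all_idx ex_idx algebra_simps rt3_def\<close>)
  next
    case 5
    obtain \<theta> t where th: "rt3 1 0 2 1.695 1.696 \<theta> t" using cub102 by blast
    show ?thesis
      by (rule leaf_mono[where \<theta> = \<theta> and \<mu> = "case_idx \<theta> (t / 2) 1 2" and ld = "case_idx [[Vy, Vy]] [[Vy, Vz]] [[Vx]] []"])
        (use 5 th in \<open>auto simp: F all_idx ex_idx algebra_simps rt3_def\<close>)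
  next
    case 6
    obtain \<theta> t where th: "rt3 1 2 (-1) 1.801 1.802 \<theta> t" using cub12m1 by blast
    show ?thesis
      by (rule leaf_mono[where \<theta> = \<theta> and \<mu> = "case_idx \<theta> (t - \<theta>) (\<theta> - 1) 2" and ld = "case_idx [[Vx, Vy]] [[Vx, Vz]] [[Vy]] []"])
        (use 6 th inv in \<open>auto simp: F all_idx ex_idx algebra_simps rt3_def\<close>)
  next
    case 7
    obtain \<theta> where th: "rt2 1 1 1.618 1.619 \<theta>" using golden by blast
    \<comment> \<open>the two leading terms of the image of \<open>y\<close> might cancel; the ratio \<open>\<rho> = y z / x\<close> obeys an affine recursion, so a transcendental initial value prevents this\<close>
    let ?ld = "case_idx [[Vx, Vy]] [[Vy, Vz], [Vx]] [[Vy]] []"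
    have c2: "c2 \<noteq> 0" using inv 7 by auto
    show ?thesis
    proof (rule leaf[where \<theta> = \<theta> and \<mu> = "case_idx 1 (\<theta> - 1) (2 - \<theta>) 0.8" and ld = ?ld
          and S = "\<lambda>v. v Vx \<noteq> 0 \<and> v Vy \<noteq> 0 \<and> (\<exists>\<rho>. trs \<rho> \<and> v Vy * v Vz = \<rho> * v Vx)" and ?v0.0 = "case_idx 1 1 (mvar 1) 0"])
      fix v v' :: "idx \<Rightarrow> (4, 'k) mpoly"
      assume v: "v Vx \<noteq> 0 \<and> v Vy \<noteq> 0 \<and> (\<exists>\<rho>. trs \<rho> \<and> v Vy * v Vz = \<rho> * v Vx)" and v': "\<forall>j. ?ld j \<noteq> [] \<longrightarrow>
           v' j = (\<Sum>(c, m)\<leftarrow>filter (\<lambda>(c, m). m \<in> set (?ld j)) (F j). mconst c * prod_list (map v m))"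
      obtain \<rho> where rho: "trs \<rho>" "v Vy * v Vz = \<rho> * v Vx" using v by blast
      have "v' Vx = mconst q1 * (v Vx * v Vy)" "v' Vy = mconst m2 * (v Vy * v Vz) + mconst h1 * v Vx" "v' Vz = mconst c2 * v Vy"
        using v' by (simp_all add: F all_idx)
      then have n: "v' Vx = mconst q1 * (v Vx * v Vy)" "v' Vy = (mconst m2 * \<rho> + mconst h1) * v Vx" "v' Vz = mconst c2 * v Vy"
        unfolding rho(2) by (simp_all add: algebra_simps)
      define \<rho>' where "\<rho>' = mconst (c2 / q1 * m2) * \<rho> + mconst (c2 / q1 * h1)"
      have "mconst q1 * mconst (c2 / q1 * m2) = (mconst (c2 * m2) :: (4, 'k) mpoly)"
        "mconst q1 * mconst (c2 / q1 * h1) = (mconst (c2 * h1) :: (4, 'k) mpoly)"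
        using 7 by (simp_all flip: mconst_mult)
      then have "mconst q1 * \<rho>' = mconst c2 * (mconst m2 * \<rho> + mconst h1)"
        unfolding \<rho>'_def distrib_left mult.assoc[symmetric] by (simp add: mconst_mult)
      then have "v' Vy * v' Vz = \<rho>' * v' Vx" unfolding n by (metis (no_types, lifting) mult.assoc mult.commute)
      moreover have "trs \<rho>'" unfolding \<rho>'_def by (rule trs_affine[OF rho(1)]) (use 7 c2 in auto)
      moreover have "v' Vy \<noteq> 0" unfolding n using trs_nz[OF rho(1), of m2 h1] 7 v by auto
      ultimately show "v' Vx \<noteq> 0 \<and> v' Vy \<noteq> 0 \<and> (\<exists>\<rho>. trs \<rho> \<and> v' Vy * v' Vz = \<rho> * v' Vx)"
        using v 7 n(1) by auto
    qed (use 7 th trs_mvar in \<open>auto simp: F all_idx ex_idx algebra_simps rt2_def\<close>)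
  next
    case 8
    obtain \<theta> where th: "rt2 1 1 1.618 1.619 \<theta>" using golden by blast
    show ?thesis
      by (rule leaf_mono[where \<theta> = \<theta> and \<mu> = "case_idx 1 (\<theta> - 1) (2 - \<theta>) 0.8" and ld = "case_idx [[Vx, Vy]] [[Vx]] [] []"])
        (use 8 th in \<open>auto simp: F all_idx ex_idx algebra_simps rt2_def\<close>)
  next
    case 9
    obtain \<theta> t where th: "rt3 1 0 1 1.465 1.466 \<theta> t" using cub101 by blast
    show ?thesis
      by (rule leaf_mono[where \<theta> = \<theta> and \<mu> = "case_idx \<theta> (t - \<theta>) (\<theta> - 1) 1" and ld = "case_idx [[Vx, Vy]] [[Vw]] [] [[Vx]]"])
        (use 9 th inv in \<open>auto simp: F all_idx ex_idx algebra_simps rt3_def\<close>)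
  next
    case 10
    obtain \<theta> where th: "rt2 0 3 1.732 1.733 \<theta>" using sqrt3 by blast
    show ?thesis
      by (rule leaf_mono[where \<theta> = \<theta> and \<mu> = "case_idx 1 (\<theta> / 2) (1/2) 1" and ld = "case_idx [[Vy, Vy]] [[Vx, Vz]] [[Vy]] []"])
        (use 10 th inv in \<open>auto simp: F all_idx ex_idx algebra_simps rt2_def\<close>)
  next
    case 11
    obtain \<theta> where th: "rt2 1 1 1.618 1.619 \<theta>" using golden by blast
    show ?thesis
      by (rule leaf_mono[where \<theta> = \<theta> and \<mu> = "case_idx 1 (\<theta> / 2) (1/2) 1" and ld = "case_idx [] [[Vy, Vz]] [[Vy]] []"])
        (use 11 th inv in \<open>auto simp: F all_idx ex_idx algebra_simps rt2_def\<close>)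
  next
    case 12
    show ?thesis
    proof (rule good_elem[where i = Vy and v = Vw])
      show "F Vy = (1, [Vw]) # [(0, [Vx, Vz]), (0, [Vy, Vz]), (m3, [Vz, Vz]), (h1, [Vx]), (h2, [Vy]), (h3, [Vz]), (h0, [])]"
        using 12 by (simp add: F)
      show "good (case_idx [(d, [Vz]), (q2, [Vy, Vy]), (x1, [Vx]), (x2, [Vy]), (x0, [])]
        [(1, [Vw])] [(c2, [Vy]), (c0, [])]
        [(c2 * c2 * m3 + c2 * c2 * p + h1 * q2, [Vy, Vy]), (d1 + h1 * x1, [Vx]), (2 * c0 * c2 * m3 + c2 * h3 + d2 + h1 * x2, [Vy]),
         (d * h1, [Vz]), (h2, [Vw]), (c0 * c0 * m3 + c0 * h3 + d0 + h0 + h1 * x0, [])] :: 'k sys)"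
        by (rule form_E_T[OF refl]) (use 12 in auto)
    qed (simp_all add: F 12 all_idx cst_hom algebra_simps)
  qed
qed

section \<open>Dominant triples\<close>

text \<open>
  Functions that are polynomial in each variable separately, which is enough to conclude vanishing from vanishing outside finite
  sets.
\<close>
definition pf :: "('k::field \<Rightarrow> 'k \<Rightarrow> 'k \<Rightarrow> 'k) \<Rightarrow> bool"
  where "pf h \<longleftrightarrow> (\<forall>y z. \<exists>P. \<forall>x. h x y z = poly P x) \<and> (\<forall>x z. \<exists>P. \<forall>y. h x y z = poly P y)
     \<and> (\<forall>x y. \<exists>P. \<forall>z. h x y z = poly P z)"

lemma infinite_alg_closed: "infinite (UNIV :: 'k::alg_closed_field set)"
proof
  assume fin: "finite (UNIV :: 'k set)"
  define p :: "'k poly" where "p = (\<Prod>a\<in>UNIV. [:-a, 1:]) + 1"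
  have "Polynomial.degree (\<Prod>a\<in>(UNIV :: 'k set). [:-a, 1:]) = card (UNIV :: 'k set)"
    by (subst degree_prod_eq_sum_degree) auto
  moreover have "card (UNIV :: 'k set) > 0" using fin by (simp add: card_gt_0_iff)
  ultimately have "Polynomial.degree p > 0" unfolding p_def by (subst degree_add_eq_left) auto
  then obtain x where "poly p x = 0" using alg_closed_imp_poly_has_root by blast
  moreover have "poly (\<Prod>a\<in>(UNIV :: 'k set). [:-a, 1:]) x = 0"
    using fin by (auto simp: poly_prod intro!: prod_zero)
  ultimately show False unfolding p_def by simp
qed

lemma poly_vanishes:
  fixes P :: "'k::alg_closed_field poly"
  assumes "finite E" "\<And>x. x \<notin> E \<Longrightarrow> poly P x = 0" shows "poly P x = 0"
proof (cases "P = 0")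
  case False
  then have "finite {x. poly P x = 0}" by (rule poly_roots_finite)
  moreover have "UNIV = E \<union> {x. poly P x = 0}" using assms(2) by auto
  ultimately have "finite (UNIV :: 'k set)" using assms(1) by (metis finite_Un)
  then show ?thesis using infinite_alg_closed by blast
qed simp

text \<open>
  Preimages are found by solving quadratic equations for \<open>x\<close>, \<open>y\<close>, \<open>z\<close> in turn. This is possible outside a finite set of
  values in the first coordinate, and for each of them outside a finite set in the second.
\<close>
lemma vanish_on_dominant_image:
  fixes h :: "'k::alg_closed_field \<Rightarrow> 'k \<Rightarrow> 'k \<Rightarrow> 'k"
  assumes h: "pf h" and p: "p \<noteq> 0" and q: "q1 \<noteq> 0 \<or> q2 \<noteq> 0" and s: "s1 \<noteq> 0 \<or> s2 \<noteq> 0 \<or> s3 \<noteq> 0"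
    and z: "\<And>x y z. h (p * x * x) (q1 * y * y + q2 * x * y + q3 * x * x)
       (s1 * z * z + s2 * y * z + s3 * x * z + s4 * y * y + s5 * x * y + s6 * x * x) = 0"
  shows "h A B C = 0"
proof -
  have root: "\<exists>t. u * t * t + v * t + w = 0" if "u \<noteq> 0 \<or> v \<noteq> 0" for u v w :: 'k
  proof -
    have "\<exists>t. poly [:w, v, u:] t = 0" using that by (intro alg_closed_imp_poly_has_root) auto
    then show ?thesis by (auto simp: algebra_simps)
  qed
  have 1: "h A B C = 0" if A: "A \<noteq> 0" for A B C
  proof -
    obtain x where x: "p * x * x + 0 * x + (- A) = 0" using root[of p 0 "- A"] p by blast
    then have xA: "p * x * x = A" and x0: "x \<noteq> 0" using A by auto
    define E where "E = (if s2 = 0 then {} else {q1 * (- s3 * x / s2) * (- s3 * x / s2) + q2 * x * (- s3 * x / s2) + q3 * x * x})"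
    have 2: "h A B C = 0" if B: "B \<notin> E" for B
    proof -
      obtain y where y: "q1 * y * y + q2 * x * y + (q3 * x * x - B) = 0" using root[of q1 "q2 * x" "q3 * x * x - B"] q x0 by auto
      then have yB: "q1 * y * y + q2 * x * y + q3 * x * x = B" by (simp add: algebra_simps)
      have "s1 \<noteq> 0 \<or> s2 * y + s3 * x \<noteq> 0"
      proof (rule ccontr)
        assume *: "\<not> ?thesis"
        then have s20: "s2 \<noteq> 0" using s x0 by auto
        have "s2 * y = - s3 * x" using * by (simp add: add_eq_0_iff2)
        then have "y = - s3 * x / s2" using s20 by (simp add: field_simps)
        then show False using B yB s20 unfolding E_def by auto
      qed
      then obtain zz where "s1 * zz * zz + (s2 * y + s3 * x) * zz + (s4 * y * y + s5 * x * y + s6 * x * x - C) = 0"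
        using root by blast
      then have "s1 * zz * zz + s2 * y * zz + s3 * x * zz + s4 * y * y + s5 * x * y + s6 * x * x = C"
        by (simp add: algebra_simps)
      then show ?thesis using z[of x y zz] xA yB by simp
    qed
    obtain P where P: "\<And>y. h A y C = poly P y" using h unfolding pf_def by metis
    have "poly P B = 0" by (rule poly_vanishes[of E]) (use 2 P in \<open>auto simp: E_def\<close>)
    then show ?thesis using P by simp
  qed
  obtain P where P: "\<And>x. h x B C = poly P x" using h unfolding pf_def by metis
  have "poly P A = 0" by (rule poly_vanishes[of "{0}"]) (use 1 in \<open>auto simp flip: P\<close>)
  then show ?thesis using P by simp
qed

definition PF :: "((idx \<Rightarrow> 'k::field) \<Rightarrow> 'k) \<Rightarrow> bool"
  where "PF H \<longleftrightarrow> (\<forall>v i. \<exists>P. \<forall>t. H (v(i := t)) = poly P t)"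

lemma PF_const: "PF (\<lambda>v. c)"
  unfolding PF_def by (auto intro: exI[of _ "[:c:]"])

lemma PF_proj: "PF (\<lambda>v :: idx \<Rightarrow> 'k::field. v j)"
  unfolding PF_def
proof (intro allI)
  fix v :: "idx \<Rightarrow> 'k::field" and i
  show "\<exists>P. \<forall>t. (v(i := t)) j = poly P t"
    by (cases "i = j") (auto intro: exI[of _ "[:0, 1:]"] exI[of _ "[:v j:]"])
qed

lemma PF_add: "PF f \<Longrightarrow> PF g \<Longrightarrow> PF (\<lambda>v. f v + g v)"
  unfolding PF_def by (metis poly_add)

lemma PF_mult: "PF f \<Longrightarrow> PF g \<Longrightarrow> PF (\<lambda>v. f v * g v)"
  unfolding PF_def by (metis poly_mult)

lemma PF_hom2:
  assumes "\<And>i. PF (\<lambda>v. g v i)" shows "PF (\<lambda>v. hom2 F (g v) j)"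
proof -
  have p: "PF (\<lambda>v. prod_list (map (g v) m))" for m
    by (induction m) (auto intro: PF_const PF_mult assms)
  have "PF (\<lambda>v. \<Sum>(c, m)\<leftarrow>L. if length m = 2 then c * prod_list (map (g v) m) else 0)" for L
  proof (induction L)
    case (Cons cm L)
    obtain c m where [simp]: "cm = (c, m)" by (cases cm)
    have "PF (\<lambda>v. if length m = 2 then c * prod_list (map (g v) m) else 0)"
      by (cases "length m = 2") (auto intro!: PF_const PF_mult p)
    then show ?case using Cons by (auto intro!: PF_add)
  qed (simp add: PF_const)
  then show ?thesis unfolding hom2_def .
qed

lemma PF_hom2_iter: "PF (\<lambda>v. (hom2 F ^^ r) v j)"
  by (induction r arbitrary: j) (auto intro: PF_proj PF_hom2)

text \<open>
  If an iterate of the quadratic part vanished identically, the preceding iterate would vanish on the image of the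
  quadratic part in the three coordinates; this image is dominant when the third quadric involves \<open>z\<close>, so that iterate
  would vanish as well. If the third quadric involves only \<open>x\<close> and \<open>y\<close>, two of the three quadrics form a binary
  quadratic map that is not nilpotent.
\<close>
lemma form_dominant:
  fixes F :: "'k::alg_closed_field sys"
  assumes len: "\<forall>j. \<forall>(c, m)\<in>set (F j). c = 0 \<or> length m \<le> 2"
    and abc: "{i1, i2, i3} = {Vx, Vy, Vz}" "i1 \<noteq> i2" "i1 \<noteq> i3" "i2 \<noteq> i3"
    and hom: "\<And>v. hom2 F v i1 = p * v Vx * v Vx"
      "\<And>v. hom2 F v i2 = q1 * v Vy * v Vy + q2 * v Vx * v Vy + q3 * v Vx * v Vx"
      "\<And>v. hom2 F v i3 = s1 * v Vz * v Vz + s2 * v Vy * v Vz + s3 * v Vx * v Vz + s4 * v Vy * v Vy + s5 * v Vx * v Vy + s6 * v Vx * v Vx"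
    and p: "p \<noteq> 0" and q: "q1 \<noteq> 0 \<or> q2 \<noteq> 0" and s: "s1 = 0 \<Longrightarrow> s2 = 0 \<Longrightarrow> s3 = 0 \<Longrightarrow> s4 * q2 \<noteq> s5 * q1"
  shows "good F"
proof (cases "s1 \<noteq> 0 \<or> s2 \<noteq> 0 \<or> s3 \<noteq> 0")
  case True
  have agree: "(hom2 F ^^ r) v j = (hom2 F ^^ r) v' j"
    if "\<forall>k\<in>{i1, i2, i3}. v k = v' k" "j \<in> {i1, i2, i3}" for r v v' j
    using that
  proof (induction r arbitrary: j)
    case (Suc r)
    have "(hom2 F ^^ r) v k = (hom2 F ^^ r) v' k" if "k \<in> {Vx, Vy, Vz}" for k
      using Suc that unfolding abc(1)[symmetric] by blast
    moreover have "j = i1 \<or> j = i2 \<or> j = i3" using Suc.prems(2) by auto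
    ultimately show ?case using hom by auto
  qed auto
  have "\<exists>v. \<exists>j\<in>{i1, i2, i3}. (hom2 F ^^ r) v j \<noteq> 0" for r
  proof (induction r)
    case 0
    show ?case by (rule exI[of _ "\<lambda>_. 1"]) auto
  next
    case (Suc r)
    show ?case
    proof (rule ccontr)
      assume neg: "\<not> ?thesis"
      have z: "(hom2 F ^^ r) (hom2 F v) j = 0" if "j \<in> {i1, i2, i3}" for v j
      proof -
        have "(hom2 F ^^ Suc r) v j = 0" using neg that by blast
        then show ?thesis by (simp only: funpow_Suc_right comp_def)
      qed
      obtain v j where vj: "j \<in> {i1, i2, i3}" "(hom2 F ^^ r) v j \<noteq> 0" using Suc by blast
      define u where "u A B C = (\<lambda>k. if k = i1 then A else if k = i2 then B else C)" for A B C :: 'k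
      define h where "h A B C = (hom2 F ^^ r) (u A B C) j" for A B C
      have "pf h" unfolding pf_def
      proof (intro conjI allI)
        fix x y z
        have PF: "PF (\<lambda>v. (hom2 F ^^ r) v j)" by (rule PF_hom2_iter)
        have "\<exists>P. \<forall>t. (hom2 F ^^ r) ((u 0 y z)(i1 := t)) j = poly P t" using PF unfolding PF_def by blast
        moreover have "(u 0 y z)(i1 := t) = u t y z" for t by (auto simp: u_def)
        ultimately show "\<exists>P. \<forall>x. h x y z = poly P x" unfolding h_def by simp
        have "\<exists>P. \<forall>t. (hom2 F ^^ r) ((u x 0 z)(i2 := t)) j = poly P t" using PF unfolding PF_def by blast
        moreover have "(u x 0 z)(i2 := t) = u x t z" for t using abc(2-4) by (auto simp: u_def)
        ultimately show "\<exists>P. \<forall>y. h x y z = poly P y" unfolding h_def by simp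
        have "\<exists>P. \<forall>t. (hom2 F ^^ r) ((u x y 0)(i3 := t)) j = poly P t" using PF unfolding PF_def by blast
        moreover have "(hom2 F ^^ r) ((u x y 0)(i3 := t)) j = (hom2 F ^^ r) (u x y t) j" for t
          by (rule agree) (use abc(2-4) vj(1) in \<open>auto simp: u_def\<close>)
        ultimately show "\<exists>P. \<forall>z. h x y z = poly P z" unfolding h_def by simp
      qed
      have "h (v i1) (v i2) (v i3) = 0"
      proof (rule vanish_on_dominant_image[OF \<open>pf h\<close> p q True, where ?q3.0 = q3 and ?s4.0 = s4 and ?s5.0 = s5 and ?s6.0 = s6])
        fix x y z :: 'k
        let ?v = "case_idx x y z 0"
        have "h (hom2 F ?v i1) (hom2 F ?v i2) (hom2 F ?v i3) = (hom2 F ^^ r) (hom2 F ?v) j"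
          unfolding h_def by (rule agree) (use abc(2-4) vj(1) in \<open>auto simp: u_def\<close>)
        then show "h (p * x * x) (q1 * y * y + q2 * x * y + q3 * x * x)
          (s1 * z * z + s2 * y * z + s3 * x * z + s4 * y * y + s5 * x * y + s6 * x * x) = 0"
          using z[OF vj(1), of ?v] by (simp add: hom)
      qed
      moreover have "h (v i1) (v i2) (v i3) = (hom2 F ^^ r) v j"
        unfolding h_def by (rule agree) (use abc(2-4) vj(1) in \<open>auto simp: u_def\<close>)
      ultimately show False using vj(2) by simp
    qed
  qed
  then show ?thesis using good2[OF len] by blast
next
  case False
  then have s0: "s1 = 0" "s2 = 0" "s3 = 0" "s4 * q2 \<noteq> s5 * q1" using s by auto
  have xy: "hom2 F v i3 = s4 * v Vy * v Vy + s5 * v Vx * v Vy + s6 * v Vx * v Vx" for v using hom s0 by simp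
  \<comment> \<open>the three quadrics in \<open>x, y\<close> are linearly independent, so no two of them are proportional\<close>
  have two: "good F" if h: "\<And>v. hom2 F v Vx = a1 * v Vx * v Vx + a2 * v Vx * v Vy + a3 * v Vy * v Vy"
      "\<And>v. hom2 F v Vy = b1 * v Vx * v Vx + b2 * v Vx * v Vy + b3 * v Vy * v Vy"
    and n: "a1 * b2 \<noteq> a2 * b1 \<or> a1 * b3 \<noteq> a3 * b1 \<or> a2 * b3 \<noteq> a3 * b2" for a1 a2 a3 b1 b2 b3
  proof (rule good_binary[OF len, where i = Vx and j = Vy and Zs = "{}" and ?a1.0 = a1 and ?a2.0 = a2 and ?a3.0 = a3 and ?b1.0 = b1 and ?b2.0 = b2 and ?b3.0 = b3])
    fix v show "hom2 F v Vx = a1 * v Vx * v Vx + a2 * v Vx * v Vy + a3 * v Vy * v Vy \<and>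
        hom2 F v Vy = b1 * v Vx * v Vx + b2 * v Vx * v Vy + b3 * v Vy * v Vy \<and> (\<forall>k\<in>{}. hom2 F v k = 0)"
      using h[of v] by blast
  next
    fix u v k1 k2 k3
    assume k: "a1 = u * k1" "a2 = u * k2" "a3 = u * k3" "b1 = v * k1" "b2 = v * k2" "b3 = v * k3"
    show False using n unfolding k by (simp add: mult_ac)
  qed simp_all
  have "Vz \<in> {i1, i2, i3}" unfolding abc(1) by simp
  then have "i1 = Vz \<or> i2 = Vz \<or> i3 = Vz" by auto
  moreover have "i1 \<in> {i1, i2, i3}" "i2 \<in> {i1, i2, i3}" "i3 \<in> {i1, i2, i3}" by simp_all
  then have "i1 = Vx \<or> i1 = Vy \<or> i1 = Vz" "i2 = Vx \<or> i2 = Vy \<or> i2 = Vz" "i3 = Vx \<or> i3 = Vy \<or> i3 = Vz"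
    unfolding abc(1) by simp_all
  ultimately consider "i1 = Vz" "i2 = Vx" "i3 = Vy" | "i1 = Vz" "i2 = Vy" "i3 = Vx" | "i2 = Vz" "i1 = Vx" "i3 = Vy"
    | "i2 = Vz" "i1 = Vy" "i3 = Vx" | "i3 = Vz" "i1 = Vx" "i2 = Vy" | "i3 = Vz" "i1 = Vy" "i2 = Vx"
    using abc(2-4) by metis
  then show ?thesis
  proof cases
    case 1
    show ?thesis
      by (rule two[of q3 q2 q1 s6 s5 s4]) (use hom(2) xy 1 s0(4) in \<open>auto simp: algebra_simps\<close>)
  next
    case 2
    show ?thesis
      by (rule two[of s6 s5 s4 q3 q2 q1]) (use hom(2) xy 2 s0(4) in \<open>auto simp: algebra_simps\<close>)
  next
    case 3
    show ?thesis
      by (rule two[of p 0 0 s6 s5 s4]) (use hom(1) xy 3 s0(4) p in \<open>auto simp: algebra_simps\<close>)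
  next
    case 4
    show ?thesis
      by (rule two[of s6 s5 s4 p 0 0]) (use hom(1) xy 4 s0(4) p in \<open>auto simp: algebra_simps\<close>)
  next
    case 5
    show ?thesis
      by (rule two[of p 0 0 q3 q2 q1]) (use hom(1,2) 5 q p in \<open>auto simp: algebra_simps\<close>)
  next
    case 6
    show ?thesis
      by (rule two[of q3 q2 q1 p 0 0]) (use hom(1,2) 6 q p in \<open>auto simp: algebra_simps\<close>)
  qed
qed

section \<open>Permutation normal forms\<close>

lemma good_cong:
  assumes "\<And>j a. ev (F j) a = ev (F' j) a" "good F'" shows "good F"
proof -
  have "hmap F = hmap F'" unfolding hmap_def using assms(1) by (intro ext)
  then show ?thesis using assms(2) unfolding good_def UB_def LB_def by metis
qed

text \<open>
  The image of \<open>j\<close> is a multiple of the coordinate \<open>p j\<close> plus a polynomial of degree at most two in the coordinates preceding \<open>p j\<close>.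
\<close>
definition nf :: "(idx \<Rightarrow> idx) \<Rightarrow> (idx \<Rightarrow> 'k) \<Rightarrow> 'k \<Rightarrow> 'k \<Rightarrow> 'k \<Rightarrow> 'k \<Rightarrow> 'k \<Rightarrow> 'k \<Rightarrow> 'k \<Rightarrow> 'k \<Rightarrow> 'k \<Rightarrow> 'k
    \<Rightarrow> 'k \<Rightarrow> 'k \<Rightarrow> 'k \<Rightarrow> 'k \<Rightarrow> 'k \<Rightarrow> 'k \<Rightarrow> 'k \<Rightarrow> 'k \<Rightarrow> 'k \<Rightarrow> 'k \<Rightarrow> ('k::field) sys"
  where "nf p m c0 p1 p2 p3 q1 q2 q3 q4 q5 q6 s1 s2 s3 s4 s5 s6 s7 s8 s9 s10 = (\<lambda>j. (m j, [p j]) #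
    (case p j of Vx \<Rightarrow> [(c0, [])] | Vy \<Rightarrow> Q1 p1 p2 p3 | Vz \<Rightarrow> Q2 q1 q2 q3 q4 q5 q6
      | Vw \<Rightarrow> Q3 s1 s2 s3 s4 s5 s6 s7 s8 s9 s10))"

text \<open>
  Rescaling the coordinates changes the multipliers \<open>m j\<close> without changing which coefficients vanish.
\<close>
lemma nf_scale:
  fixes m :: "idx \<Rightarrow> 'k::field"
  assumes p: "inj p" and l: "\<And>j. l j \<noteq> 0"
    and good: "\<And>c0' p1' p2' p3' q1' q2' q3' q4' q5' q6' s1' s2' s3' s4' s5' s6' s7' s8' s9' s10'.
      (p1' = 0 \<longleftrightarrow> p1 = 0) \<Longrightarrow> (q1' = 0 \<longleftrightarrow> q1 = 0) \<Longrightarrow> (q2' = 0 \<longleftrightarrow> q2 = 0) \<Longrightarrow> (q3' = 0 \<longleftrightarrow> q3 = 0) \<Longrightarrow>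
      good (nf p (\<lambda>j. l j * m j / l (p j)) c0' p1' p2' p3' q1' q2' q3' q4' q5' q6' s1' s2' s3' s4' s5' s6' s7' s8' s9' s10')"
  shows "good (nf p m c0 p1 p2 p3 q1 q2 q3 q4 q5 q6 s1 s2 s3 s4 s5 s6 s7 s8 s9 s10)"
proof (rule good_scale[of l])
  have "surj p" using p by (simp add: finite_UNIV_inj_surj)
  then obtain jx jy jz jw where j: "p jx = Vx" "p jy = Vy" "p jz = Vz" "p jw = Vw" by (metis surjD)
  have inv: "p j = Vx \<Longrightarrow> j = jx" "p j = Vy \<Longrightarrow> j = jy" "p j = Vz \<Longrightarrow> j = jz" "p j = Vw \<Longrightarrow> j = jw" for j
    using p j by (metis injD)+
  define f where "f j c mon = l j * c / prod_list (map l mon)" for j c and mon :: "idx list"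
  have "(\<lambda>j. map (\<lambda>(c, mon). (l j * c / prod_list (map l mon), mon)) (nf p m c0 p1 p2 p3 q1 q2 q3 q4 q5 q6 s1 s2 s3 s4 s5 s6 s7 s8 s9 s10 j))
    = nf p (\<lambda>j. l j * m j / l (p j)) (f jx c0 []) (f jy p1 [Vx, Vx]) (f jy p2 [Vx]) (f jy p3 [])
      (f jz q1 [Vy, Vy]) (f jz q2 [Vx, Vy]) (f jz q3 [Vx, Vx]) (f jz q4 [Vy]) (f jz q5 [Vx]) (f jz q6 [])
      (f jw s1 [Vz, Vz]) (f jw s2 [Vy, Vz]) (f jw s3 [Vx, Vz]) (f jw s4 [Vy, Vy]) (f jw s5 [Vx, Vy]) (f jw s6 [Vx, Vx])
      (f jw s7 [Vz]) (f jw s8 [Vy]) (f jw s9 [Vx]) (f jw s10 [])"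
    (is "?F = ?G")
  proof
    fix j show "?F j = ?G j"
      by (cases "p j") (auto simp: nf_def Qs f_def dest: inv)
  qed
  moreover have "good ?G" by (rule good) (use l in \<open>auto simp: f_def\<close>)
  ultimately show "good ?F" by simp
qed (use l in auto)

lemma length_nf: "\<forall>j. \<forall>(c, mon)\<in>set (nf p m c0 p1 p2 p3 q1 q2 q3 q4 q5 q6 s1 s2 s3 s4 s5 s6 s7 s8 s9 s10 j). c = 0 \<or> length mon \<le> 2"
  by (auto simp: nf_def Qs split: idx.split)

lemma hom2_nf: "hom2 (nf p m c0 p1 p2 p3 q1 q2 q3 q4 q5 q6 s1 s2 s3 s4 s5 s6 s7 s8 s9 s10) v j
    = (case p j of Vx \<Rightarrow> 0 | Vy \<Rightarrow> p1 * v Vx * v Vx | Vz \<Rightarrow> q1 * v Vy * v Vy + q2 * v Vx * v Vy + q3 * v Vx * v Vx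
      | Vw \<Rightarrow> s1 * v Vz * v Vz + s2 * v Vy * v Vz + s3 * v Vx * v Vz + s4 * v Vy * v Vy + s5 * v Vx * v Vy + s6 * v Vx * v Vx)"
  by (auto simp: nf_def hom2_def Qs split: idx.split)

lemma case_idx_eta: "f = case_idx (f Vx) (f Vy) (f Vz) (f Vw)"
  by (intro ext) (simp split: idx.split)

lemma nf_base:
  fixes m :: "idx \<Rightarrow> 'k::alg_closed_field"
  assumes p: "inj p" and m: "\<And>j. m j \<noteq> 0" and px: "p Vx = Vx"
  shows "good (nf p m c0 p1 p2 p3 q1 q2 q3 q4 q5 q6 s1 s2 s3 s4 s5 s6 s7 s8 s9 s10)"
proof -
  let ?nf = "nf p m c0 p1 p2 p3 q1 q2 q3 q4 q5 q6 s1 s2 s3 s4 s5 s6 s7 s8 s9 s10"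
  have d: "p Vy \<noteq> p Vx" "p Vz \<noteq> p Vx" "p Vw \<noteq> p Vx" "p Vy \<noteq> p Vz" "p Vy \<noteq> p Vw" "p Vz \<noteq> p Vw"
    using p by (auto dest: injD)
  consider "p Vy = Vy" "p Vz = Vz" "p Vw = Vw" | "p Vy = Vy" "p Vz = Vw" "p Vw = Vz"
    | "p Vy = Vz" "p Vz = Vy" "p Vw = Vw" | "p Vy = Vz" "p Vz = Vw" "p Vw = Vy"
    | "p Vy = Vw" "p Vz = Vy" "p Vw = Vz" | "p Vy = Vw" "p Vz = Vz" "p Vw = Vy"
    using d px by (cases "p Vy"; cases "p Vz"; cases "p Vw") auto
  then show ?thesis
  proof cases
    case 1
    have "good (case_idx [(m Vx, [Vx]), (0, [Vy]), (c0, [])] [(p2, [Vx]), (m Vy, [Vy]), (p3, []), (p1, [Vx, Vx])]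
      ((m Vz, [Vz]) # Q2 q1 q2 q3 q4 q5 q6) ((m Vw, [Vw]) # Q3 s1 s2 s3 s4 s5 s6 s7 s8 s9 s10))"
      by (rule base2_id[OF refl]) simp
    then show ?thesis
      by (rule good_cong[rotated]) (auto simp: nf_def px 1 Qs algebra_simps split: idx.split)
  next
    case 2
    have "good (case_idx [(m Vx, [Vx]), (0, [Vy]), (c0, [])] [(p2, [Vx]), (m Vy, [Vy]), (p3, []), (p1, [Vx, Vx])]
      ((m Vz, [Vw]) # Q3 s1 s2 s3 s4 s5 s6 s7 s8 s9 s10) ((m Vw, [Vz]) # Q2 q1 q2 q3 q4 q5 q6))"
      by (rule base2_swap[OF refl]) simp
    then show ?thesis
      by (rule good_cong[rotated]) (auto simp: nf_def px 2 Qs algebra_simps split: idx.split)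
  next
    case 3
    show ?thesis
      by (rule base_213, subst case_idx_eta[of ?nf]) (simp add: nf_def px 3)
  next
    case 4
    show ?thesis
      by (rule base_231[OF _ m], subst case_idx_eta[of ?nf]) (simp add: nf_def px 4)
  next
    case 5
    show ?thesis
    proof (rule nf_scale[OF p, of "\<lambda>j. if j = Vw then m Vy else 1"])
      fix c0 p1 p2 p3 q1 q2 q3 q4 q5 q6 s1 s2 s3 s4 s5 s6 s7 s8 s9 s10 :: 'k
      let ?nf = "nf p (\<lambda>j. (if j = Vw then m Vy else 1) * m j / (if p j = Vw then m Vy else 1)) c0 p1 p2 p3 q1 q2 q3 q4 q5 q6 s1 s2 s3 s4 s5 s6 s7 s8 s9 s10"
      show "good ?nf"
        by (rule base_312[OF _ m[of Vz]], subst case_idx_eta[of ?nf]) (simp add: nf_def px 5 m)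
    qed (simp add: m)
  next
    case 6
    show ?thesis
      by (rule base_321[OF _ m], subst case_idx_eta[of ?nf]) (simp add: nf_def px 6)
  qed
qed

text \<open>
  The digits are the positions of \<open>p Vx\<close>, \<open>p Vy\<close>, \<open>p Vz\<close>, \<open>p Vw\<close>.
\<close>
lemma nf_3124:
  fixes m :: "idx \<Rightarrow> 'k::alg_closed_field"
  assumes p: "p = case_idx Vz Vx Vy Vw" and m: "\<And>j. m j \<noteq> 0"
  shows "good (nf p m c0 p1 p2 p3 q1 q2 q3 q4 q5 q6 s1 s2 s3 s4 s5 s6 s7 s8 s9 s10)"
proof (rule nf_scale[of _ "case_idx 1 1 (m Vx) 1"])
  fix c0 p1 p2 p3 q1 q2 q3 q4 q5 q6 s1 s2 s3 s4 s5 s6 s7 s8 s9 s10 :: 'k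
  let ?nf = "nf p (\<lambda>j. (case_idx 1 1 (m Vx) 1) j * m j / (case_idx 1 1 (m Vx) 1) (p j)) c0 p1 p2 p3 q1 q2 q3 q4 q5 q6 s1 s2 s3 s4 s5 s6 s7 s8 s9 s10"
  show "good ?nf"
    by (rule form_T[OF _ m[of Vy]], subst case_idx_eta[of ?nf]) (simp_all add: nf_def p m)
qed (auto simp: p m inj_def split: idx.split idx.splits)

lemma nf_3142:
  fixes m :: "idx \<Rightarrow> 'k::alg_closed_field"
  assumes p: "p = case_idx Vz Vx Vw Vy" and m: "\<And>j. m j \<noteq> 0"
  shows "good (nf p m c0 p1 p2 p3 q1 q2 q3 q4 q5 q6 s1 s2 s3 s4 s5 s6 s7 s8 s9 s10)"
proof (rule nf_scale[of _ "case_idx 1 1 (m Vx) (m Vx * m Vz)"])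
  fix c0 p1 p2 p3 q1 q2 q3 q4 q5 q6 s1 s2 s3 s4 s5 s6 s7 s8 s9 s10 :: 'k
  let ?nf = "nf p (\<lambda>j. (case_idx 1 1 (m Vx) (m Vx * m Vz)) j * m j / (case_idx 1 1 (m Vx) (m Vx * m Vz)) (p j)) c0 p1 p2 p3 q1 q2 q3 q4 q5 q6 s1 s2 s3 s4 s5 s6 s7 s8 s9 s10"
  show "good ?nf"
    by (rule form_A[OF _ m[of Vy]], subst case_idx_eta[of ?nf]) (simp_all add: nf_def p m)
qed (auto simp: p m inj_def split: idx.split idx.splits)

lemma nf_4123:
  fixes m :: "idx \<Rightarrow> 'k::alg_closed_field"
  assumes p: "p = case_idx Vw Vx Vy Vz" and m: "\<And>j. m j \<noteq> 0"
  shows "good (nf p m c0 p1 p2 p3 q1 q2 q3 q4 q5 q6 s1 s2 s3 s4 s5 s6 s7 s8 s9 s10)"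
proof (rule nf_scale[of _ "case_idx 1 1 (m Vx * m Vw) (m Vx)"])
  fix c0 p1 p2 p3 q1 q2 q3 q4 q5 q6 s1 s2 s3 s4 s5 s6 s7 s8 s9 s10 :: 'k
  let ?nf = "nf p (\<lambda>j. (case_idx 1 1 (m Vx * m Vw) (m Vx)) j * m j / (case_idx 1 1 (m Vx * m Vw) (m Vx)) (p j)) c0 p1 p2 p3 q1 q2 q3 q4 q5 q6 s1 s2 s3 s4 s5 s6 s7 s8 s9 s10"
  show "good ?nf"
    by (rule form_C[OF _ m[of Vy]], subst case_idx_eta[of ?nf]) (simp_all add: nf_def p m)
qed (auto simp: p m inj_def split: idx.split idx.splits)

lemma nf_4132:
  fixes m :: "idx \<Rightarrow> 'k::alg_closed_field"
  assumes p: "p = case_idx Vw Vx Vz Vy" and m: "\<And>j. m j \<noteq> 0" and q: "q1 \<noteq> 0 \<or> q2 \<noteq> 0 \<or> q3 \<noteq> 0"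
  shows "good (nf p m c0 p1 p2 p3 q1 q2 q3 q4 q5 q6 s1 s2 s3 s4 s5 s6 s7 s8 s9 s10)"
proof (rule nf_scale[of _ "case_idx 1 1 1 (m Vx)"])
  fix c0' p1' p2' p3' q1' q2' q3' q4' q5' q6' s1' s2' s3' s4' s5' s6' s7' s8' s9' s10' :: 'k
  assume z: "q1' = 0 \<longleftrightarrow> q1 = 0" "q2' = 0 \<longleftrightarrow> q2 = 0" "q3' = 0 \<longleftrightarrow> q3 = 0"
  have q': "q1' \<noteq> 0 \<or> q2' \<noteq> 0 \<or> q3' \<noteq> 0" using q z by blast
  let ?nf = "nf p (\<lambda>j. (case_idx 1 1 1 (m Vx)) j * m j / (case_idx 1 1 1 (m Vx)) (p j)) c0' p1' p2' p3' q1' q2' q3' q4' q5' q6' s1' s2' s3' s4' s5' s6' s7' s8' s9' s10'"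
  show "good ?nf"
    by (rule form_M[OF _ m[of Vy] m[of Vz] q'], subst case_idx_eta[of ?nf]) (simp_all add: nf_def p m)
qed (auto simp: p m inj_def split: idx.split idx.splits)

text \<open>
  The only quadratic monomial in the image of \<open>x\<close> is \<open>x x\<close>.
\<close>
lemma nf_square:
  fixes m :: "idx \<Rightarrow> 'k::alg_closed_field"
  assumes px: "p Vx = Vy" and p1: "p1 \<noteq> 0"
  shows "good (nf p m c0 p1 p2 p3 q1 q2 q3 q4 q5 q6 s1 s2 s3 s4 s5 s6 s7 s8 s9 s10)"
  by (rule good2_inv[where S = "\<lambda>v. v Vx \<noteq> 0" and ?v0.0 = "\<lambda>_. 1", OF length_nf])
    (use px p1 in \<open>auto simp: hom2_nf\<close>)

text \<open>
  The quadratic parts of the images of \<open>x\<close> and \<open>y\<close> involve only \<open>x\<close> and \<open>y\<close>.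
\<close>
lemma nf_3214:
  fixes m :: "idx \<Rightarrow> 'k::alg_closed_field"
  assumes px: "p Vx = Vz" "p Vy = Vy" and p1: "p1 \<noteq> 0" and q: "q1 \<noteq> 0 \<or> q2 \<noteq> 0"
  shows "good (nf p m c0 p1 p2 p3 q1 q2 q3 q4 q5 q6 s1 s2 s3 s4 s5 s6 s7 s8 s9 s10)"
proof (rule good_binary[where i = Vx and j = Vy and Zs = "{}" and ?a1.0 = q3 and ?a2.0 = q2 and ?a3.0 = q1
      and ?b1.0 = p1 and ?b2.0 = 0 and ?b3.0 = 0, OF length_nf])
  fix u v k1 k2 k3
  assume k: "q3 = u * k1" "q2 = u * k2" "q1 = u * k3" "p1 = v * k1" "0 = v * k2" "0 = v * k3"
  then show False using p1 q by auto
qed (simp_all add: hom2_nf px)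

lemma nf_4213:
  fixes m :: "idx \<Rightarrow> 'k::alg_closed_field"
  assumes p: "p = case_idx Vw Vy Vx Vz" and m: "\<And>j. m j \<noteq> 0" and p1: "p1 \<noteq> 0" and q: "q1 \<noteq> 0 \<or> q2 \<noteq> 0"
  shows "good (nf p m c0 p1 p2 p3 q1 q2 q3 q4 q5 q6 s1 s2 s3 s4 s5 s6 s7 s8 s9 s10)"
  (is "good ?nf")
  by (rule form_4213[OF _ m m p1 q], subst case_idx_eta[of ?nf]) (simp add: nf_def p)

lemma nf_dominant:
  fixes m :: "idx \<Rightarrow> 'k::alg_closed_field"
  assumes p: "inj p" and pw: "p Vw = Vx" and p1: "p1 \<noteq> 0" and q: "q1 \<noteq> 0 \<or> q2 \<noteq> 0"
    and s: "s1 = 0 \<Longrightarrow> s2 = 0 \<Longrightarrow> s3 = 0 \<Longrightarrow> s4 * q2 \<noteq> s5 * q1"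
  shows "good (nf p m c0 p1 p2 p3 q1 q2 q3 q4 q5 q6 s1 s2 s3 s4 s5 s6 s7 s8 s9 s10)"
proof -
  have "surj p" using p by (simp add: finite_UNIV_inj_surj)
  then obtain jy jz jw where j: "p jy = Vy" "p jz = Vz" "p jw = Vw" by (metis surjD)
  have ne: "jy \<noteq> jz" "jy \<noteq> jw" "jz \<noteq> jw" "jy \<noteq> Vw" "jz \<noteq> Vw" "jw \<noteq> Vw" using j pw by auto
  then have "{jy, jz, jw} = {Vx, Vy, Vz}" by (cases jy; cases jz; cases jw) auto
  then show ?thesis
    by (rule form_dominant[OF length_nf _ ne(1-3), where p = p1 and ?q1.0 = q1 and ?q2.0 = q2 and ?q3.0 = q3
          and ?s1.0 = s1 and ?s2.0 = s2 and ?s3.0 = s3 and ?s4.0 = s4 and ?s5.0 = s5 and ?s6.0 = s6])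
      (use p1 q s in \<open>simp_all add: hom2_nf j\<close>)
qed

definition evk :: "('k::field \<times> idx list) list \<Rightarrow> (idx \<Rightarrow> 'k) \<Rightarrow> 'k"
  where "evk L v = (\<Sum>(c, m)\<leftarrow>L. c * prod_list (map v m))"

lemma evk_Nil [simp]: "evk [] v = 0"
  and evk_Cons [simp]: "evk ((c, m) # L) v = c * prod_list (map v m) + evk L v"
  by (simp_all add: evk_def)

text \<open>
  A function on points together with the function on series that has the same coefficients.
\<close>
definition affine2 :: "((idx \<Rightarrow> 'k::field) \<Rightarrow> 'k) \<Rightarrow> ((idx \<Rightarrow> 'k ser) \<Rightarrow> 'k ser) \<Rightarrow> bool"
  where "affine2 \<phi> \<Phi> \<longleftrightarrow> (\<exists>c l. (\<forall>v. \<phi> v = c + (\<Sum>i\<in>UNIV. l i * v i)) \<and> (\<forall>a. \<Phi> a = cst c + (\<Sum>i\<in>UNIV. cst (l i) * a i)))"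

definition quadratic2 :: "((idx \<Rightarrow> 'k::field) \<Rightarrow> 'k) \<Rightarrow> ((idx \<Rightarrow> 'k ser) \<Rightarrow> 'k ser) \<Rightarrow> bool"
  where "quadratic2 \<phi> \<Phi> \<longleftrightarrow> (\<exists>c l b. (\<forall>v. \<phi> v = c + (\<Sum>i\<in>UNIV. l i * v i) + (\<Sum>i\<in>UNIV. \<Sum>j\<in>UNIV. b i j * (v i * v j)))
    \<and> (\<forall>a. \<Phi> a = cst c + (\<Sum>i\<in>UNIV. cst (l i) * a i) + (\<Sum>i\<in>UNIV. \<Sum>j\<in>UNIV. cst (b i j) * (a i * a j))))"

lemma cst_sum: "cst (sum f I) = (\<Sum>i\<in>I. cst (f i))"
  by (induction I rule: infinite_finite_induct) (simp_all add: cst_add)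

lemma affine2_const: "affine2 (\<lambda>_. c) (\<lambda>_. cst c)"
  unfolding affine2_def by (intro exI[of _ c] exI[of _ "\<lambda>_. 0"]) simp

lemma affine2_linear: "affine2 (\<lambda>v. \<Sum>i\<in>UNIV. l i * v i) (\<lambda>a. \<Sum>i\<in>UNIV. cst (l i) * a i)"
  unfolding affine2_def by (intro exI[of _ 0] exI[of _ l]) simp

lemma quadratic2_affine: "affine2 \<phi> \<Phi> \<Longrightarrow> quadratic2 \<phi> \<Phi>"
proof -
  assume "affine2 \<phi> \<Phi>"
  then obtain c l where *: "\<forall>v. \<phi> v = c + (\<Sum>i\<in>UNIV. l i * v i)" "\<forall>a. \<Phi> a = cst c + (\<Sum>i\<in>UNIV. cst (l i) * a i)"
    unfolding affine2_def by (elim exE conjE) (rule that; assumption)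
  show ?thesis unfolding quadratic2_def
    by (intro exI[of _ c] exI[of _ l] exI[of _ "\<lambda>_ _. 0"]) (simp add: *[rule_format])
qed

lemma quadratic2_add:
  assumes "quadratic2 \<phi> \<Phi>" "quadratic2 \<psi> \<Psi>" shows "quadratic2 (\<lambda>v. \<phi> v + \<psi> v) (\<lambda>a. \<Phi> a + \<Psi> a)"
proof -
  obtain c l b c' l' b' where *: "\<forall>v. \<phi> v = c + (\<Sum>i\<in>UNIV. l i * v i) + (\<Sum>i\<in>UNIV. \<Sum>j\<in>UNIV. b i j * (v i * v j))"
    "\<forall>a. \<Phi> a = cst c + (\<Sum>i\<in>UNIV. cst (l i) * a i) + (\<Sum>i\<in>UNIV. \<Sum>j\<in>UNIV. cst (b i j) * (a i * a j))"
    "\<forall>v. \<psi> v = c' + (\<Sum>i\<in>UNIV. l' i * v i) + (\<Sum>i\<in>UNIV. \<Sum>j\<in>UNIV. b' i j * (v i * v j))"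
    "\<forall>a. \<Psi> a = cst c' + (\<Sum>i\<in>UNIV. cst (l' i) * a i) + (\<Sum>i\<in>UNIV. \<Sum>j\<in>UNIV. cst (b' i j) * (a i * a j))"
    using assms unfolding quadratic2_def by (elim exE conjE) (rule that; assumption)
  note * = *[rule_format]
  show ?thesis unfolding quadratic2_def
    by (intro exI[of _ "c + c'"] exI[of _ "\<lambda>i. l i + l' i"] exI[of _ "\<lambda>i j. b i j + b' i j"])
      (simp add: * cst_add distrib_right sum.distrib)
qed

lemma quadratic2_scale:
  assumes "quadratic2 \<phi> \<Phi>" shows "quadratic2 (\<lambda>v. k * \<phi> v) (\<lambda>a. cst k * \<Phi> a)"
proof -
  obtain c l b where *: "\<forall>v. \<phi> v = c + (\<Sum>i\<in>UNIV. l i * v i) + (\<Sum>i\<in>UNIV. \<Sum>j\<in>UNIV. b i j * (v i * v j))"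
    "\<forall>a. \<Phi> a = cst c + (\<Sum>i\<in>UNIV. cst (l i) * a i) + (\<Sum>i\<in>UNIV. \<Sum>j\<in>UNIV. cst (b i j) * (a i * a j))"
    using assms unfolding quadratic2_def by (elim exE conjE) (rule that; assumption)
  note * = *[rule_format]
  show ?thesis unfolding quadratic2_def
    by (intro exI[of _ "k * c"] exI[of _ "\<lambda>i. k * l i"] exI[of _ "\<lambda>i j. k * b i j"])
      (simp add: * cst_mult distrib_left sum_distrib_left mult.assoc)
qed

lemma quadratic2_mult:
  assumes "affine2 \<phi> \<Phi>" "affine2 \<psi> \<Psi>" shows "quadratic2 (\<lambda>v. \<phi> v * \<psi> v) (\<lambda>a. \<Phi> a * \<Psi> a)"
proof -
  obtain c l c' l' where *: "\<forall>v. \<phi> v = c + (\<Sum>i\<in>UNIV. l i * v i)" "\<forall>a. \<Phi> a = cst c + (\<Sum>i\<in>UNIV. cst (l i) * a i)"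
    "\<forall>v. \<psi> v = c' + (\<Sum>i\<in>UNIV. l' i * v i)" "\<forall>a. \<Psi> a = cst c' + (\<Sum>i\<in>UNIV. cst (l' i) * a i)"
    using assms unfolding affine2_def by (elim exE conjE) (rule that; assumption)
  note * = *[rule_format]
  show ?thesis unfolding quadratic2_def
  proof (intro exI[of _ "c * c'"] exI[of _ "\<lambda>i. c * l' i + c' * l i"] exI[of _ "\<lambda>i j. l i * l' j"] conjI allI)
    fix v show "\<phi> v * \<psi> v = c * c' + (\<Sum>i\<in>UNIV. (c * l' i + c' * l i) * v i) + (\<Sum>i\<in>UNIV. \<Sum>j\<in>UNIV. l i * l' j * (v i * v j))"
      by (simp add: * UNIV_idx algebra_simps)
  next
    fix a show "\<Phi> a * \<Psi> a = cst (c * c') + (\<Sum>i\<in>UNIV. cst (c * l' i + c' * l i) * a i) + (\<Sum>i\<in>UNIV. \<Sum>j\<in>UNIV. cst (l i * l' j) * (a i * a j))"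
      by (simp add: * UNIV_idx cst_add cst_mult algebra_simps)
  qed
qed

lemma quadratic2_ev:
  assumes len: "\<forall>(c, m)\<in>set L. length m \<le> 2" and aff: "\<And>j. affine2 (\<phi> j) (\<Phi> j)"
  shows "quadratic2 (\<lambda>v. evk L (\<lambda>j. \<phi> j v)) (\<lambda>a. ev L (\<lambda>j. \<Phi> j a))"
  using len
proof (induction L)
  case Nil
  then show ?case using quadratic2_affine[OF affine2_const[of 0]] by simp
next
  case (Cons cm L)
  obtain c m where cm: "cm = (c, m)" by (cases cm)
  have "quadratic2 (\<lambda>v. prod_list (map (\<lambda>j. \<phi> j v) m)) (\<lambda>a. prod_list (map (\<lambda>j. \<Phi> j a) m))"
  proof -
    consider "m = []" | i where "m = [i]" | i j where "m = [i, j]"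
    proof -
      have "length m \<le> 2" using Cons.prems cm by simp
      then show ?thesis using that by (cases m rule: remdups_adj.cases) (auto simp: Suc_le_eq)
    qed
    then show ?thesis
    proof cases
      case 1
      then show ?thesis using quadratic2_affine[OF affine2_const[of 1]] by simp
    next
      case (2 i)
      then show ?thesis using quadratic2_affine[OF aff[of i]] by simp
    next
      case (3 i j)
      then show ?thesis using quadratic2_mult[OF aff[of i] aff[of j]] by simp
    qed
  qed
  then show ?case using Cons cm by (auto intro: quadratic2_add quadratic2_scale)
qed

lemma quadratic2_zero:
  fixes \<phi> :: "(idx \<Rightarrow> 'k::field) \<Rightarrow> 'k"
  assumes q: "quadratic2 \<phi> \<Phi>" and z: "\<forall>v. \<phi> v = 0" and two: "(2::'k) \<noteq> 0" shows "\<Phi> a = 0"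
proof -
  obtain c l b where *: "\<forall>v. \<phi> v = c + (\<Sum>i\<in>UNIV. l i * v i) + (\<Sum>i\<in>UNIV. \<Sum>j\<in>UNIV. b i j * (v i * v j))"
    "\<forall>a. \<Phi> a = cst c + (\<Sum>i\<in>UNIV. cst (l i) * a i) + (\<Sum>i\<in>UNIV. \<Sum>j\<in>UNIV. cst (b i j) * (a i * a j))"
    using q unfolding quadratic2_def by (elim exE conjE) (rule that; assumption)
  note * = *[rule_format]
  have c: "c = 0" using *(1)[of "\<lambda>_. 0"] z by simp
  define B where "B v = (\<Sum>i\<in>UNIV. \<Sum>j\<in>UNIV. b i j * (v i * v j))" for v
  have e1: "(\<Sum>i\<in>UNIV. l i * v i) + B v = 0" for v using *(1)[of v] z c by (simp add: B_def)
  have e2: "- (\<Sum>i\<in>UNIV. l i * v i) + B v = 0" for v using e1[of "\<lambda>i. - v i"] by (simp add: B_def sum_negf)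
  have B: "B v = 0" for v
  proof -
    have "2 * B v = ((\<Sum>i\<in>UNIV. l i * v i) + B v) + (- (\<Sum>i\<in>UNIV. l i * v i) + B v)" by simp
    then show ?thesis unfolding e1 e2 using two by simp
  qed
  have l: "l i = 0" for i
  proof -
    have "(\<Sum>k\<in>UNIV. l k * (if k = i then 1 else 0)) = 0" using e1[of "\<lambda>k. if k = i then 1 else 0"] B by simp
    then show ?thesis by (simp add: if_distrib[of "\<lambda>u. _ * u"] cong: if_cong)
  qed
  have delta: "(\<Sum>k\<in>UNIV. \<Sum>k'\<in>UNIV. b k k' * ((if k = i then 1 else 0) * (if k' = j then 1 else 0))) = b i j" for i j
  proof -
    have "(\<Sum>k\<in>UNIV. \<Sum>k'\<in>UNIV. b k k' * ((if k = i then 1 else 0) * (if k' = j then 1 else 0)))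
      = (\<Sum>k\<in>UNIV. if k = i then (\<Sum>k'\<in>UNIV. if k' = j then b k k' else 0) else 0)"
      by (intro sum.cong refl) (simp add: if_distrib[of "\<lambda>u. _ * u"] cong: if_cong)
    then show ?thesis by simp
  qed
  have sym: "b i j + b j i = 0" for i j
  proof -
    have d: "b i i = 0" for i using B[of "\<lambda>k. if k = i then 1 else 0"] delta[of i i] unfolding B_def by simp
    have "B (\<lambda>k. (if k = i then 1 else 0) + (if k = j then 1 else 0)) = (b i i + b j j) + (b i j + b j i)"
      unfolding B_def by (simp only: distrib_left distrib_right sum.distrib delta) (simp add: algebra_simps)
    then show ?thesis using B d by simp
  qed
  have "2 * (\<Sum>i\<in>UNIV. \<Sum>j\<in>UNIV. cst (b i j) * (a i * a j))
    = (\<Sum>i\<in>UNIV. \<Sum>j\<in>UNIV. cst (b i j) * (a i * a j)) + (\<Sum>i\<in>UNIV. \<Sum>j\<in>UNIV. cst (b j i) * (a j * a i))"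
    by (subst (3) sum.swap) simp
  also have "\<dots> = (\<Sum>i\<in>UNIV. \<Sum>j\<in>UNIV. cst (b i j + b j i) * (a i * a j))"
    by (simp add: cst_add distrib_right sum.distrib mult.commute[of "a j" "a i" for i j])
  also have "\<dots> = 0" by (simp add: sym)
  finally have "2 * \<Phi> a = 0" by (simp add: *(2) c l)
  then have "cst (1 / 2) * (2 * \<Phi> a) = 0" by simp
  moreover have "cst (1 / 2) * 2 = (1 :: 'k ser)" using two by (simp flip: cst_numeral cst_mult)
  ultimately show ?thesis by (metis mult.assoc mult_1)
qed

text \<open>
  The conjugation by the linear map \<open>E\<close> only needs to be checked on points: a quadratic polynomial that vanishes at all
  points vanishes identically, because \<open>0\<close>, \<open>1\<close> and \<open>- 1\<close> are distinct.
\<close>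
lemma good_coordinates:
  fixes F G :: "'k::field sys"
  assumes two: "(2::'k) \<noteq> 0"
    and F: "\<And>j. \<forall>(c, m)\<in>set (F j). length m \<le> 2" and G: "\<And>j. \<forall>(c, m)\<in>set (G j). length m \<le> 2"
    and inv: "\<And>i j. (\<Sum>k\<in>UNIV. E i k * E' k j) = (if i = j then 1 else 0)"
      "\<And>i j. (\<Sum>k\<in>UNIV. E' i k * E k j) = (if i = j then 1 else 0)"
    and eq: "\<And>v j. (\<Sum>i\<in>UNIV. E j i * evk (F i) v) = evk (G j) (\<lambda>j. \<Sum>i\<in>UNIV. E j i * v i)"
    and good: "good G"
  shows "good F"
proof -
  define T where "T M = (\<lambda>j. map (\<lambda>i. (M j i, [i])) [Vx, Vy, Vz, Vw])" for M :: "idx \<Rightarrow> idx \<Rightarrow> 'k"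
  have T: "hmap (T M) a j = (\<Sum>i\<in>UNIV. cst (M j i) * a i)" for M a j
    by (simp add: hmap_def T_def UNIV_idx)
  have TT: "hmap (T M) (hmap (T M') a) = a" if "\<And>i j. (\<Sum>k\<in>UNIV. M i k * M' k j) = (if i = j then 1 else 0)" for M M' a
  proof
    fix i
    have "hmap (T M) (hmap (T M') a) i = (\<Sum>k\<in>UNIV. \<Sum>j\<in>UNIV. cst (M i k * M' k j) * a j)"
      by (simp add: T sum_distrib_left cst_mult mult.assoc)
    also have "\<dots> = (\<Sum>j\<in>UNIV. cst (\<Sum>k\<in>UNIV. M i k * M' k j) * a j)"
      by (subst sum.swap) (simp add: cst_sum sum_distrib_right)
    also have "\<dots> = (\<Sum>j\<in>UNIV. if i = j then a j else 0)" unfolding that by (intro sum.cong refl) simp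
    finally show "hmap (T M) (hmap (T M') a) i = a i" by simp
  qed
  show ?thesis
  proof (rule good_conj[of "T E" F G "T E'", OF _ TT[OF inv(2)] TT[OF inv(1)] good])
    fix a
    show "hmap (T E) (hmap F a) = hmap G (hmap (T E) a)"
    proof
      fix j
      have q1: "quadratic2 (\<lambda>v. \<Sum>i\<in>I. E j i * evk (F i) v) (\<lambda>a. \<Sum>i\<in>I. cst (E j i) * ev (F i) a)" if "finite I" for I
        using that
      proof (induction I)
        case empty
        then show ?case using quadratic2_affine[OF affine2_const[of 0]] by simp
      next
        case (insert i I)
        have id: "affine2 (\<lambda>v :: idx \<Rightarrow> 'k. v j) (\<lambda>a. a j)" for j :: idx
          using affine2_linear[of "\<lambda>i. if i = j then 1 else (0 :: 'k)"] by (simp add: if_distrib[of cst] if_distrib[of "\<lambda>u. u * _"] cong: if_cong)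
        have "quadratic2 (\<lambda>v. evk (F i) (\<lambda>j. v j)) (\<lambda>a. ev (F i) (\<lambda>j. a j))" by (rule quadratic2_ev[OF F id])
        then show ?case using insert by (simp add: quadratic2_add quadratic2_scale)
      qed
      have q2: "quadratic2 (\<lambda>v. evk (G j) (\<lambda>j. \<Sum>i\<in>UNIV. E j i * v i)) (\<lambda>a. ev (G j) (\<lambda>j. \<Sum>i\<in>UNIV. cst (E j i) * a i))"
        by (rule quadratic2_ev[OF G affine2_linear])
      have "quadratic2 (\<lambda>v. (\<Sum>i\<in>UNIV. E j i * evk (F i) v) + - 1 * evk (G j) (\<lambda>j. \<Sum>i\<in>UNIV. E j i * v i))
        (\<lambda>a. (\<Sum>i\<in>UNIV. cst (E j i) * ev (F i) a) + cst (- 1) * ev (G j) (\<lambda>j. \<Sum>i\<in>UNIV. cst (E j i) * a i))"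
        by (intro quadratic2_add quadratic2_scale q1 q2) simp
      from quadratic2_zero[OF this _ two, of a] eq
      have "(\<Sum>i\<in>UNIV. cst (E j i) * ev (F i) a) + cst (- 1) * ev (G j) (\<lambda>j. \<Sum>i\<in>UNIV. cst (E j i) * a i) = 0" by simp
      then have "(\<Sum>i\<in>UNIV. cst (E j i) * ev (F i) a) = ev (G j) (\<lambda>j. \<Sum>i\<in>UNIV. cst (E j i) * a i)"
        by (simp add: cst_uminus add_eq_0_iff2)
      moreover have "hmap (T E) a = (\<lambda>j. \<Sum>i\<in>UNIV. cst (E j i) * a i)" by (intro ext T)
      ultimately show "hmap (T E) (hmap F a) j = hmap G (hmap (T E) a) j" by (simp add: T) (simp add: hmap_def)
    qed
  qed
qed

text \<open>
  At \<open>z = 0\<close> the pair \<open>(x, y)\<close> carries a binary quadratic map. If it is nilpotent, it is \<open>q (1, t)\<close> with \<open>q(1, t) = 0\<close>, and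
  the coordinate \<open>y - t x\<close> leads to the form \<open>E\<close>.
\<close>
lemma nf_3412_unit:
  fixes m :: "idx \<Rightarrow> 'k::alg_closed_field"
  assumes two: "(2::'k) \<noteq> 0" and p: "p = case_idx Vz Vw Vx Vy" and m: "\<And>j. m j \<noteq> 0" and one: "m Vy = 1"
    and q: "q1 \<noteq> 0 \<or> q2 \<noteq> 0 \<or> q3 \<noteq> 0"
  shows "good (nf p m c0 p1 p2 p3 q1 q2 q3 q4 q5 q6 s1 s2 s3 s4 s5 s6 s7 s8 s9 s10)"
proof (cases "\<exists>t. s6 = t * q3 \<and> s5 = t * q2 \<and> s4 = t * q1 \<and> q3 + q2 * t + q1 * t * t = 0")
  case False
  show ?thesis
  proof (rule good_binary[where i = Vx and j = Vy and Zs = "{Vz}" and ?a1.0 = q3 and ?a2.0 = q2 and ?a3.0 = q1 and ?b1.0 = s6 and ?b2.0 = s5 and ?b3.0 = s4, OF length_nf])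
    fix u v k1 k2 k3
    assume k: "q3 = u * k1" "q2 = u * k2" "q1 = u * k3" "s6 = v * k1" "s5 = v * k2" "s4 = v * k3"
      and uv: "k1 * u * u + k2 * u * v + k3 * v * v = 0"
    have nz: "u \<noteq> 0" using q k by auto
    have "u * k1 + u * k2 * (v / u) + u * k3 * (v / u) * (v / u) = 0" using uv nz by (simp add: field_simps)
    then have "s6 = (v / u) * q3 \<and> s5 = (v / u) * q2 \<and> s4 = (v / u) * q1 \<and> q3 + q2 * (v / u) + q1 * (v / u) * (v / u) = 0"
      using nz unfolding k by simp
    then show False using False by blast
  qed (simp_all add: hom2_nf p)
next
  case True
  then obtain t where t0: "q3 + q2 * t + q1 * t * t = 0" and ts: "s6 = t * q3" "s5 = t * q2" "s4 = t * q1" by blast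
  have "q3 = (q3 + q2 * t + q1 * t * t) - q2 * t - q1 * t * t" by simp
  then have t: "q3 = - q2 * t - q1 * t * t" "s6 = t * q3" "s5 = t * q2" "s4 = t * q1" using ts unfolding t0 by simp_all
  define P where "P = p1 / (m Vz * m Vz)"
  have P: "p1 = P * m Vz * m Vz" by (simp add: P_def m)
  have "good (case_idx [(m Vx, [Vz]), (q2 + 2 * q1 * t, [Vx, Vy]), (q1, [Vy, Vy]), (q4 * t + q5, [Vx]), (q4, [Vy]), (q6, [])]
    [(1, [Vw]), (s2 * t + s3, [Vx, Vz]), (s2, [Vy, Vz]), (s1, [Vz, Vz]), (s8 * t + s9 - t * (q4 * t + q5), [Vx]), (s8 - t * q4, [Vy]), (s7 - t * m Vx, [Vz]), (s10 - t * q6, [])]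
    [(m Vz, [Vx]), (0, [Vy]), (c0, [])]
    [(P * (m Vz) * (m Vz), [Vx, Vx]), (2 * P * (m Vz) * (0), [Vx, Vy]), (P * (0) * (0), [Vy, Vy]), (m Vw * t + p2, [Vx]), (m Vw, [Vy]), (p3, [])])"
    (is "good ?G")
    by (rule form_E[OF refl]) (use q t m in \<open>auto simp: algebra_simps\<close>)
  show ?thesis
  proof (rule good_coordinates[OF two _ _ _ _ _ \<open>good ?G\<close>, where E = "case_idx (case_idx 1 0 0 0) (case_idx (- t) 1 0 0) (case_idx 0 0 1 0) (case_idx 0 0 0 1)" and E' = "case_idx (case_idx 1 0 0 0) (case_idx t 1 0 0) (case_idx 0 0 1 0) (case_idx 0 0 0 1)"])
    fix v j
    show "(\<Sum>i\<in>UNIV. (case_idx (case_idx 1 0 0 0) (case_idx (- t) 1 0 0) (case_idx 0 0 1 0) (case_idx 0 0 0 1)) j i * evk (nf p m c0 p1 p2 p3 q1 q2 q3 q4 q5 q6 s1 s2 s3 s4 s5 s6 s7 s8 s9 s10 i) v) = evk (?G j) (\<lambda>j. \<Sum>i\<in>UNIV. (case_idx (case_idx 1 0 0 0) (case_idx (- t) 1 0 0) (case_idx 0 0 1 0) (case_idx 0 0 0 1)) j i * v i)"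
      unfolding UNIV_idx by (cases j) (simp_all add: nf_def p Qs one t P algebra_simps)
  qed (auto simp: nf_def Qs UNIV_idx p split: idx.split)
qed

lemma nf_3412:
  fixes m :: "idx \<Rightarrow> 'k::alg_closed_field"
  assumes two: "(2::'k) \<noteq> 0" and p: "p = case_idx Vz Vw Vx Vy" and m: "\<And>j. m j \<noteq> 0" and q: "q1 \<noteq> 0 \<or> q2 \<noteq> 0 \<or> q3 \<noteq> 0"
  shows "good (nf p m c0 p1 p2 p3 q1 q2 q3 q4 q5 q6 s1 s2 s3 s4 s5 s6 s7 s8 s9 s10)"
proof (rule nf_scale[of _ "case_idx 1 1 1 (m Vy)"])
  fix c0' p1' p2' p3' q1' q2' q3' q4' q5' q6' s1' s2' s3' s4' s5' s6' s7' s8' s9' s10' :: 'k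
  assume z: "q1' = 0 \<longleftrightarrow> q1 = 0" "q2' = 0 \<longleftrightarrow> q2 = 0" "q3' = 0 \<longleftrightarrow> q3 = 0"
  have q': "q1' \<noteq> 0 \<or> q2' \<noteq> 0 \<or> q3' \<noteq> 0" using q z by blast
  show "good (nf p (\<lambda>j. (case_idx 1 1 1 (m Vy)) j * m j / (case_idx 1 1 1 (m Vy)) (p j)) c0' p1' p2' p3' q1' q2' q3' q4' q5' q6' s1' s2' s3' s4' s5' s6' s7' s8' s9' s10')"
    by (rule nf_3412_unit[OF two p _ _ q']) (auto simp: p m split: idx.split)
qed (auto simp: p m inj_def split: idx.split idx.splits)

lemma nf_4312_unit:
  fixes m :: "idx \<Rightarrow> 'k::alg_closed_field"
  assumes two: "(2::'k) \<noteq> 0" and p: "p = case_idx Vw Vz Vx Vy" and m: "\<And>j. m j \<noteq> 0" and one: "m Vx = 1"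
    and q: "q1 \<noteq> 0 \<or> q2 \<noteq> 0 \<or> q3 \<noteq> 0"
  shows "good (nf p m c0 p1 p2 p3 q1 q2 q3 q4 q5 q6 s1 s2 s3 s4 s5 s6 s7 s8 s9 s10)"
proof (cases "\<exists>t. s6 = t * q3 \<and> s5 = t * q2 \<and> s4 = t * q1 \<and> q3 * t * t + q2 * t + q1 = 0")
  case False
  show ?thesis
  proof (rule good_binary[where i = Vx and j = Vy and Zs = "{Vz}" and ?a1.0 = s6 and ?a2.0 = s5 and ?a3.0 = s4 and ?b1.0 = q3 and ?b2.0 = q2 and ?b3.0 = q1, OF length_nf])
    fix u v k1 k2 k3
    assume k: "s6 = u * k1" "s5 = u * k2" "s4 = u * k3" "q3 = v * k1" "q2 = v * k2" "q1 = v * k3"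
      and uv: "k1 * u * u + k2 * u * v + k3 * v * v = 0"
    have nz: "v \<noteq> 0" using q k by auto
    have "v * k1 * (u / v) * (u / v) + v * k2 * (u / v) + v * k3 = 0" using uv nz by (simp add: field_simps)
    then have "s6 = (u / v) * q3 \<and> s5 = (u / v) * q2 \<and> s4 = (u / v) * q1 \<and> q3 * (u / v) * (u / v) + q2 * (u / v) + q1 = 0"
      using nz unfolding k by simp
    then show False using False by blast
  qed (simp_all add: hom2_nf p)
next
  case True
  then obtain t where t0: "q3 * t * t + q2 * t + q1 = 0" and ts: "s6 = t * q3" "s5 = t * q2" "s4 = t * q1" by blast
  have "q1 = (q3 * t * t + q2 * t + q1) - q2 * t - q3 * t * t" by simp
  then have t: "q1 = - q2 * t - q3 * t * t" "s6 = t * q3" "s5 = t * q2" "s4 = t * q1" using ts unfolding t0 by simp_all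
  define P where "P = p1 / (m Vz * m Vz)"
  have P: "p1 = P * m Vz * m Vz" by (simp add: P_def m)
  have "good (case_idx [(m Vy, [Vz]), (q2 + 2 * q3 * t, [Vx, Vy]), (q3, [Vy, Vy]), (q4 + q5 * t, [Vx]), (q5, [Vy]), (q6, [])]
    [(1, [Vw]), (s2 + s3 * t, [Vx, Vz]), (s3, [Vy, Vz]), (s1, [Vz, Vz]), (s8 + s9 * t - t * (q4 + q5 * t), [Vx]), (s9 - t * q5, [Vy]), (s7 - t * m Vy, [Vz]), (s10 - t * q6, [])]
    [(m Vz * t, [Vx]), (m Vz, [Vy]), (c0, [])]
    [(P * (m Vz * t) * (m Vz * t), [Vx, Vx]), (2 * P * (m Vz * t) * (m Vz), [Vx, Vy]), (P * (m Vz) * (m Vz), [Vy, Vy]), (m Vw + p2 * t, [Vx]), (p2, [Vy]), (p3, [])])"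
    (is "good ?G")
    by (rule form_E[OF refl]) (use q t m in \<open>auto simp: algebra_simps\<close>)
  show ?thesis
  proof (rule good_coordinates[OF two _ _ _ _ _ \<open>good ?G\<close>, where E = "case_idx (case_idx 0 1 0 0) (case_idx 1 (- t) 0 0) (case_idx 0 0 1 0) (case_idx 0 0 0 1)" and E' = "case_idx (case_idx t 1 0 0) (case_idx 1 0 0 0) (case_idx 0 0 1 0) (case_idx 0 0 0 1)"])
    fix v j
    show "(\<Sum>i\<in>UNIV. (case_idx (case_idx 0 1 0 0) (case_idx 1 (- t) 0 0) (case_idx 0 0 1 0) (case_idx 0 0 0 1)) j i * evk (nf p m c0 p1 p2 p3 q1 q2 q3 q4 q5 q6 s1 s2 s3 s4 s5 s6 s7 s8 s9 s10 i) v) = evk (?G j) (\<lambda>j. \<Sum>i\<in>UNIV. (case_idx (case_idx 0 1 0 0) (case_idx 1 (- t) 0 0) (case_idx 0 0 1 0) (case_idx 0 0 0 1)) j i * v i)"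
      unfolding UNIV_idx by (cases j) (simp_all add: nf_def p Qs one t P algebra_simps)
  qed (auto simp: nf_def Qs UNIV_idx p split: idx.split)
qed

lemma nf_4312:
  fixes m :: "idx \<Rightarrow> 'k::alg_closed_field"
  assumes two: "(2::'k) \<noteq> 0" and p: "p = case_idx Vw Vz Vx Vy" and m: "\<And>j. m j \<noteq> 0" and q: "q1 \<noteq> 0 \<or> q2 \<noteq> 0 \<or> q3 \<noteq> 0"
  shows "good (nf p m c0 p1 p2 p3 q1 q2 q3 q4 q5 q6 s1 s2 s3 s4 s5 s6 s7 s8 s9 s10)"
proof (rule nf_scale[of _ "case_idx 1 1 1 (m Vx)"])
  fix c0' p1' p2' p3' q1' q2' q3' q4' q5' q6' s1' s2' s3' s4' s5' s6' s7' s8' s9' s10' :: 'k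
  assume z: "q1' = 0 \<longleftrightarrow> q1 = 0" "q2' = 0 \<longleftrightarrow> q2 = 0" "q3' = 0 \<longleftrightarrow> q3 = 0"
  have q': "q1' \<noteq> 0 \<or> q2' \<noteq> 0 \<or> q3' \<noteq> 0" using q z by blast
  show "good (nf p (\<lambda>j. (case_idx 1 1 1 (m Vx)) j * m j / (case_idx 1 1 1 (m Vx)) (p j)) c0' p1' p2' p3' q1' q2' q3' q4' q5' q6' s1' s2' s3' s4' s5' s6' s7' s8' s9' s10')"
    by (rule nf_4312_unit[OF two p _ _ q']) (auto simp: p m split: idx.split)
qed (auto simp: p m inj_def split: idx.split idx.splits)

section \<open>Linear algebra in dimension four\<close>

lemma poly_coeffs_vanish:
  fixes c :: "nat \<Rightarrow> 'k::alg_closed_field"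
  assumes "\<And>t. (\<Sum>i\<le>n. c i * t ^ i) = 0" "i \<le> n"
  shows "c i = 0"
proof -
  define p where "p = (\<Sum>i\<le>n. Polynomial.monom (c i) i)"
  have "poly p t = 0" for t using assms(1)[of t] by (simp add: p_def poly_sum poly_monom)
  then have "{t. poly p t = 0} = UNIV" by auto
  then have "p = 0" using poly_roots_finite[of p] infinite_alg_closed by metis
  then have "Polynomial.coeff p i = 0" by simp
  then show ?thesis using assms(2) by (simp add: p_def coeff_sum)
qed

lemma quartic_vanish:
  fixes c0 :: "'k::alg_closed_field"
  assumes "\<And>t. c0 + c1 * t + c2 * t ^ 2 + c3 * t ^ 3 + c4 * t ^ 4 = 0"
  shows "c0 = 0 \<and> c1 = 0 \<and> c2 = 0 \<and> c3 = 0 \<and> c4 = 0"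
proof -
  define c :: "nat \<Rightarrow> 'k" where "c = (\<lambda>i. if i = 0 then c0 else if i = 1 then c1 else if i = 2 then c2 else if i = 3 then c3 else c4)"
  have "(\<Sum>i\<le>4. c i * t ^ i) = c 0 + c 1 * t + c 2 * t ^ 2 + c 3 * t ^ 3 + c 4 * t ^ 4" for t
    by (simp add: eval_nat_numeral)
  then have "(\<Sum>i\<le>4. c i * t ^ i) = 0" for t using assms[of t] by (simp add: c_def)
  then have v: "i \<le> 4 \<Longrightarrow> c i = 0" for i by (rule poly_coeffs_vanish)
  have "c 0 = 0" "c 1 = 0" "c 2 = 0" "c 3 = 0" "c 4 = 0" by (rule v, simp)+
  then show ?thesis unfolding c_def by simp
qed

lemma vec_coeffs_vanish:
  fixes v :: "nat \<Rightarrow> 'k::alg_closed_field ^ idx"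
  assumes "\<And>t. (\<Sum>i\<le>n. t ^ i *s v i) = 0" "i \<le> n"
  shows "v i = 0"
proof (subst vec_eq_iff, rule allI)
  fix j
  have "(\<Sum>i\<le>n. (v i $ j) * t ^ i) = (\<Sum>i\<le>n. t ^ i *s v i) $ j" for t
    unfolding sum_component by (intro sum.cong refl) (simp add: mult.commute)
  then have "(\<Sum>i\<le>n. (v i $ j) * t ^ i) = 0" for t unfolding assms(1) by simp
  then show "v i $ j = 0 $ j" unfolding zero_index by (rule poly_coeffs_vanish) (rule assms(2))
qed

lemma five_dependent:
  fixes v :: "nat \<Rightarrow> 'k::field ^ idx"
  shows "\<exists>c. (\<exists>i<5. c i \<noteq> 0) \<and> (\<Sum>i<5. c i *s v i) = 0"
proof (cases "inj_on v {..<5}")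
  case True
  have c4: "CARD(idx) = 4" unfolding UNIV_idx by simp
  have "vec.dim (v ` {..<5}) \<le> 4" using dim_subset_UNIV_cart_gen[of "v ` {..<5}"] unfolding c4 .
  moreover have "card (v ` {..<5}) = 5" using True by (simp add: card_image)
  ultimately have "vec.dependent (v ` {..<5})"
    using vec.dim_eq_card_independent[of "v ` {..<5}"] by linarith
  then obtain u where u: "\<exists>w\<in>v ` {..<5}. u w \<noteq> 0" "(\<Sum>w\<in>v ` {..<5}. u w *s w) = 0"
    using vec.dependent_finite[of "v ` {..<5}"] by auto
  have "(\<Sum>i<5. u (v i) *s v i) = 0" using u(2) True by (simp add: sum.reindex)
  then show ?thesis using u(1) by (intro exI[of _ "\<lambda>i. u (v i)"]) auto
next
  case False
  then obtain i j where ij: "i < 5" "j < 5" "i \<noteq> j" "v i = v j" unfolding inj_on_def by auto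
  have *: "(\<Sum>k<5. (if k = l then c else 0) *s v k) = c *s v l" if "l < 5" for l and c :: 'k
  proof -
    have "(\<Sum>k<5. (if k = l then c else 0) *s v k) = (\<Sum>k<5. if k = l then c *s v l else 0)"
      by (rule sum.cong) auto
    then show ?thesis using that by simp
  qed
  have "(\<Sum>k<5. ((if k = i then 1 else 0) - (if k = j then 1 else 0)) *s v k) = 0"
    unfolding vec.scale_left_diff_distrib sum_subtractf using *[OF ij(1), of 1] *[OF ij(2), of 1] ij(4) by simp
  moreover have "(if i = i then 1 else 0) - (if i = j then 1 else 0) \<noteq> (0::'k)" using ij(3) by simp
  ultimately show ?thesis
    by (intro exI[of _ "\<lambda>k. (if k = i then 1 else 0) - (if k = j then 1 else 0)"] conjI exI[of _ i] ij(1))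
qed

lemma sum_perm_insert:
  fixes h :: "(idx \<Rightarrow> idx) \<Rightarrow> 'k::comm_ring_1"
  assumes "finite S" "a \<notin> S"
  shows "(\<Sum>p | p permutes (insert a S). of_int (sign p) * h p)
    = (\<Sum>b\<in>insert a S. (if a = b then 1 else - 1) * (\<Sum>q | q permutes S. of_int (sign q) * h (Transposition.transpose a b \<circ> q)))"
  unfolding sum_over_permutations_insert[OF assms] sum_distrib_left
proof (intro sum.cong refl)
  fix b q assume "q \<in> {q. q permutes S}"
  then have "permutation q" using assms(1) by (auto simp: permutation_permutes)
  then have "sign (Transposition.transpose a b \<circ> q) = (if a = b then sign q else - sign q)"
    by (simp add: sign_compose permutation_swap_id sign_swap_id)
  then show "of_int (sign (Transposition.transpose a b \<circ> q)) * h (Transposition.transpose a b \<circ> q)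
     = (if a = b then 1 else - 1) * (of_int (sign q) * h (Transposition.transpose a b \<circ> q))"
    by simp
qed

lemma det4:
  fixes m :: "idx \<Rightarrow> idx \<Rightarrow> 'k::comm_ring_1"
  shows "det (\<chi> i j. m i j) = (m Vx Vx * (m Vy Vy * (m Vz Vz * m Vw Vw - m Vz Vw * m Vw Vz) - m Vy Vz * (m Vz Vy * m Vw Vw - m Vz Vw * m Vw Vy) + m Vy Vw * (m Vz Vy * m Vw Vz - m Vz Vz * m Vw Vy)) - m Vx Vy * (m Vy Vx * (m Vz Vz * m Vw Vw - m Vz Vw * m Vw Vz) - m Vy Vz * (m Vz Vx * m Vw Vw - m Vz Vw * m Vw Vx) + m Vy Vw * (m Vz Vx * m Vw Vz - m Vz Vz * m Vw Vx)) + m Vx Vz * (m Vy Vx * (m Vz Vy * m Vw Vw - m Vz Vw * m Vw Vy) - m Vy Vy * (m Vz Vx * m Vw Vw - m Vz Vw * m Vw Vx) + m Vy Vw * (m Vz Vx * m Vw Vy - m Vz Vy * m Vw Vx)) - m Vx Vw * (m Vy Vx * (m Vz Vy * m Vw Vz - m Vz Vz * m Vw Vy) - m Vy Vy * (m Vz Vx * m Vw Vz - m Vz Vz * m Vw Vx) + m Vy Vz * (m Vz Vx * m Vw Vy - m Vz Vy * m Vw Vx)))"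
proof -
  have f: "finite {Vy, Vz, Vw}" "Vx \<notin> {Vy, Vz, Vw}" "finite {Vz, Vw}" "Vy \<notin> {Vz, Vw}" "finite {Vw}" "Vz \<notin> {Vw}"
    by auto
  have "det (\<chi> i j. m i j) = (\<Sum>p | p permutes {Vx,Vy,Vz,Vw}. of_int (sign p) * (m Vx (p Vx) * (m Vy (p Vy) * (m Vz (p Vz) * m Vw (p Vw)))))"
    unfolding det_def UNIV_idx by simp
  then show ?thesis
    unfolding sum_perm_insert[OF f(1,2)] sum_perm_insert[OF f(3,4)]
      sum_perm_insert[OF f(5,6)] permutes_sing
    by (simp add: Transposition.transpose_def) (simp add: algebra_simps)
qed

text \<open>The elementary symmetric functions of the eigenvalues of a matrix.\<close>

definition charcoeffs :: "(idx \<Rightarrow> idx \<Rightarrow> 'k::comm_ring_1) \<Rightarrow> 'k list"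
  where "charcoeffs m = [m Vx Vx + m Vy Vy + m Vz Vz + m Vw Vw,
    (m Vx Vx * m Vy Vy - m Vx Vy * m Vy Vx) + (m Vx Vx * m Vz Vz - m Vx Vz * m Vz Vx) + (m Vx Vx * m Vw Vw - m Vx Vw * m Vw Vx) + (m Vy Vy * m Vz Vz - m Vy Vz * m Vz Vy) + (m Vy Vy * m Vw Vw - m Vy Vw * m Vw Vy) + (m Vz Vz * m Vw Vw - m Vz Vw * m Vw Vz),
    (m Vx Vx * (m Vy Vy * m Vz Vz - m Vy Vz * m Vz Vy) - m Vx Vy * (m Vy Vx * m Vz Vz - m Vy Vz * m Vz Vx) + m Vx Vz * (m Vy Vx * m Vz Vy - m Vy Vy * m Vz Vx)) + (m Vx Vx * (m Vy Vy * m Vw Vw - m Vy Vw * m Vw Vy) - m Vx Vy * (m Vy Vx * m Vw Vw - m Vy Vw * m Vw Vx) + m Vx Vw * (m Vy Vx * m Vw Vy - m Vy Vy * m Vw Vx)) + (m Vx Vx * (m Vz Vz * m Vw Vw - m Vz Vw * m Vw Vz) - m Vx Vz * (m Vz Vx * m Vw Vw - m Vz Vw * m Vw Vx) + m Vx Vw * (m Vz Vx * m Vw Vz - m Vz Vz * m Vw Vx)) + (m Vy Vy * (m Vz Vz * m Vw Vw - m Vz Vw * m Vw Vz) - m Vy Vz * (m Vz Vy * m Vw Vw - m Vz Vw * m Vw Vy) + m Vy Vw * (m Vz Vy * m Vw Vz - m Vz Vz * m Vw Vy)),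
    (m Vx Vx * (m Vy Vy * (m Vz Vz * m Vw Vw - m Vz Vw * m Vw Vz) - m Vy Vz * (m Vz Vy * m Vw Vw - m Vz Vw * m Vw Vy) + m Vy Vw * (m Vz Vy * m Vw Vz - m Vz Vz * m Vw Vy)) - m Vx Vy * (m Vy Vx * (m Vz Vz * m Vw Vw - m Vz Vw * m Vw Vz) - m Vy Vz * (m Vz Vx * m Vw Vw - m Vz Vw * m Vw Vx) + m Vy Vw * (m Vz Vx * m Vw Vz - m Vz Vz * m Vw Vx)) + m Vx Vz * (m Vy Vx * (m Vz Vy * m Vw Vw - m Vz Vw * m Vw Vy) - m Vy Vy * (m Vz Vx * m Vw Vw - m Vz Vw * m Vw Vx) + m Vy Vw * (m Vz Vx * m Vw Vy - m Vz Vy * m Vw Vx)) - m Vx Vw * (m Vy Vx * (m Vz Vy * m Vw Vz - m Vz Vz * m Vw Vy) - m Vy Vy * (m Vz Vx * m Vw Vz - m Vz Vz * m Vw Vx) + m Vy Vz * (m Vz Vx * m Vw Vy - m Vz Vy * m Vw Vx)))]"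

text \<open>
  Every root of the characteristic polynomial is zero. Applied to the polynomial and to its quotients by powers of the
  variable, this removes the coefficients one after another.
\<close>
lemma charcoeffs_nilpotent:
  fixes m :: "idx \<Rightarrow> idx \<Rightarrow> 'k::alg_closed_field"
  assumes noeig: "\<And>t c. t \<noteq> 0 \<Longrightarrow> (\<And>i. (\<Sum>j\<in>UNIV. m i j * c j) = t * c i) \<Longrightarrow> c = (\<lambda>_. 0)"
  shows "charcoeffs m = [0, 0, 0, 0]"
proof -
  define e1 where "e1 = charcoeffs m ! 0"
  define e2 where "e2 = charcoeffs m ! 1"
  define e3 where "e3 = charcoeffs m ! 2"
  define e4 where "e4 = charcoeffs m ! 3"
  have e: "charcoeffs m = [e1, e2, e3, e4]" by (simp add: e1_def e2_def e3_def e4_def charcoeffs_def)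
  have ch: "det (\<chi> i j. m i j - (if i = j then t else 0)) = t ^ 4 - e1 * t ^ 3 + e2 * t ^ 2 - e3 * t + e4" for t
    unfolding e1_def e2_def e3_def e4_def charcoeffs_def det4[of "\<lambda>i j. m i j - (if i = j then t else 0)"]
    by (simp add: eval_nat_numeral) (simp add: algebra_simps)
  have nr: "t = 0" if "t ^ 4 - e1 * t ^ 3 + e2 * t ^ 2 - e3 * t + e4 = 0" for t
  proof (rule ccontr)
    assume t: "t \<noteq> 0"
    let ?A = "\<chi> i j. m i j - (if i = j then t else 0)"
    have "\<not> invertible ?A" using that ch[of t] by (simp add: invertible_det_nz)
    then have "\<not> (\<forall>x. ?A *v x = 0 \<longrightarrow> x = 0)"
      unfolding matrix_left_invertible_ker[symmetric] invertible_left_inverse .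
    then obtain c where c: "c \<noteq> 0" "?A *v c = 0" by blast
    have "(\<Sum>j\<in>UNIV. m i j * vec_nth c j) = t * vec_nth c i" for i
    proof -
      have "vec_nth (?A *v c) i = 0" using c(2) by simp
      then have "(\<Sum>j\<in>UNIV. (m i j - (if i = j then t else 0)) * vec_nth c j) = 0"
        unfolding matrix_vector_mult_def by simp
      moreover have "(\<Sum>j\<in>UNIV. (if i = j then t else 0) * vec_nth c j) = t * vec_nth c i"
        by (subst sum.cong[OF refl, of _ _ "\<lambda>j. if i = j then t * vec_nth c j else 0"]) auto
      ultimately show ?thesis by (simp add: left_diff_distrib sum_subtractf)
    qed
    then have "vec_nth c = (\<lambda>_. 0)" using noeig[OF t, of "vec_nth c"] by blast
    then show False using c(1) by (metis vec_eq_iff zero_index)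
  qed
  have root: "\<exists>t. poly p t = 0" if "Polynomial.degree p > 0" for p :: "'k poly"
    using alg_closed_imp_poly_has_root[OF that] .
  have e4: "e4 = 0"
  proof -
    obtain t where t: "poly [:e4, - e3, e2, - e1, 1:] t = 0" using root[of "[:e4, - e3, e2, - e1, 1:]"] by auto
    have "poly [:e4, - e3, e2, - e1, 1:] t = t ^ 4 - e1 * t ^ 3 + e2 * t ^ 2 - e3 * t + e4"
      by (simp add: eval_nat_numeral algebra_simps)
    then have "t = 0" using nr[of t] t by metis
    then show ?thesis using t by simp
  qed
  have e3: "e3 = 0"
  proof -
    obtain t where t: "poly [:- e3, e2, - e1, 1:] t = 0" using root[of "[:- e3, e2, - e1, 1:]"] by auto
    have "t * poly [:- e3, e2, - e1, 1:] t = t ^ 4 - e1 * t ^ 3 + e2 * t ^ 2 - e3 * t + e4"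
      by (simp add: e4 eval_nat_numeral algebra_simps)
    then have "t = 0" using nr[of t] t by (metis mult_zero_right)
    then show ?thesis using t by simp
  qed
  have e2: "e2 = 0"
  proof -
    obtain t where t: "poly [:e2, - e1, 1:] t = 0" using root[of "[:e2, - e1, 1:]"] by auto
    have "t * t * poly [:e2, - e1, 1:] t = t ^ 4 - e1 * t ^ 3 + e2 * t ^ 2 - e3 * t + e4"
      by (simp add: e3 e4 eval_nat_numeral algebra_simps)
    then have "t = 0" using nr[of t] t by (metis mult_zero_right)
    then show ?thesis using t by simp
  qed
  have "e1 ^ 4 - e1 * e1 ^ 3 + e2 * e1 ^ 2 - e3 * e1 + e4 = 0" by (simp add: e2 e3 e4 eval_nat_numeral)
  then have "e1 = 0" by (rule nr)
  then show ?thesis using e e2 e3 e4 by simp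
qed

definition indep4 :: "'k::field ^ idx \<Rightarrow> 'k ^ idx \<Rightarrow> 'k ^ idx \<Rightarrow> 'k ^ idx \<Rightarrow> bool"
  where "indep4 a b c d \<longleftrightarrow> (\<forall>p q r s. p *s a + q *s b + r *s c + s *s d = 0 \<longrightarrow> p = 0 \<and> q = 0 \<and> r = 0 \<and> s = 0)"

lemma solve_for:
  fixes a :: "'k::field ^ idx"
  assumes "c *s a + b = 0" "c \<noteq> 0" shows "a = (- 1 / c) *s b"
proof -
  have "c *s a = - b" using assms(1) by (simp add: add_eq_0_iff2)
  then have "(1 / c) *s (c *s a) = (1 / c) *s (- b)" by simp
  then show ?thesis using assms(2) by simp
qed

lemma indep4_spans:
  fixes a :: "'k::field ^ idx"
  assumes "indep4 a b c d" shows "\<exists>p q r s. v = p *s a + q *s b + r *s c + s *s d"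
proof -
  let ?w = "\<lambda>i::nat. [a, b, c, d, v] ! i"
  obtain k where k: "\<exists>i<5. k i \<noteq> 0" "(\<Sum>i<5. k i *s ?w i) = 0" using five_dependent[of ?w] by blast
  have eq: "k 4 *s v + (k 0 *s a + k 1 *s b + k 2 *s c + k 3 *s d) = 0"
    using k(2) by (simp add: eval_nat_numeral add_ac)
  have "k 4 \<noteq> 0"
  proof
    assume k4: "k 4 = 0"
    then have "k 0 *s a + k 1 *s b + k 2 *s c + k 3 *s d = 0" using eq by simp
    then have "k 0 = 0" "k 1 = 0" "k 2 = 0" "k 3 = 0" using assms unfolding indep4_def by blast+
    moreover have "i < 5 \<Longrightarrow> i = 0 \<or> i = 1 \<or> i = 2 \<or> i = 3 \<or> i = (4::nat)" for i by linarith
    ultimately show False using k(1) k4 by metis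
  qed
  from solve_for[OF eq this] show ?thesis
    by (intro exI[of _ "- k 0 / k 4"] exI[of _ "- k 1 / k 4"] exI[of _ "- k 2 / k 4"] exI[of _ "- k 3 / k 4"])
      (simp add: vec.scale_right_distrib)
qed

text \<open>The value of \<open>p(f)\<close> at the vector \<open>v\<close>.\<close>

definition pe :: "('k::field ^ idx \<Rightarrow> 'k ^ idx) \<Rightarrow> 'k ^ idx \<Rightarrow> 'k poly \<Rightarrow> 'k ^ idx"
  where "pe f v p = fold_coeffs (\<lambda>a w. a *s v + f w) p 0"

lemma pe_0 [simp]: "pe f v 0 = 0"
  by (simp add: pe_def)

context
  fixes f :: "'k::field ^ idx \<Rightarrow> 'k ^ idx"
  assumes f: "Vector_Spaces.linear (*s) (*s) f"
begin

lemma pe_pCons: "pe f v (pCons a p) = a *s v + f (pe f v p)"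
  by (cases "p = 0 \<and> a = 0") (auto simp: pe_def vec.linear_0[OF f])

lemma pe_diff: "pe f v (p - q) = pe f v p - pe f v q"
proof (induction p q rule: poly_induct2)
  case (pCons a p b q)
  then show ?case by (simp add: pe_pCons vec.linear_diff[OF f] vec.scale_left_diff_distrib)
qed simp

lemma pe_smult: "pe f v (Polynomial.smult c p) = c *s pe f v p"
  by (induction p) (simp_all add: pe_pCons vec.linear_scale[OF f] vec.scale_right_distrib)

lemma pe_shift: "pe f (f v) p = f (pe f v p)"
  by (induction p) (simp_all add: pe_pCons vec.linear_scale[OF f] vec.linear_add[OF f] vec.linear_0[OF f])

end

text \<open>
  Split off a linear factor from \<open>p\<close>. Either the cofactor already annihilates \<open>v\<close>, or its value at \<open>v\<close> is an eigenvector.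
\<close>
lemma eigenvector_from_annihilator:
  fixes f :: "'k::alg_closed_field ^ idx \<Rightarrow> 'k ^ idx"
  assumes f: "Vector_Spaces.linear (*s) (*s) f" and v: "v \<noteq> 0"
  shows "p \<noteq> 0 \<Longrightarrow> pe f v p = 0 \<Longrightarrow>
    \<exists>q \<mu>. Polynomial.degree q < Polynomial.degree p \<and> pe f v q \<noteq> 0 \<and> f (pe f v q) = \<mu> *s pe f v q"
proof (induction "Polynomial.degree p" arbitrary: p rule: less_induct)
  case less
  have "Polynomial.degree p \<noteq> 0"
  proof
    assume "Polynomial.degree p = 0"
    then obtain a where "p = [:a:]" by (auto elim: degree_eq_zeroE)
    then show False using less.prems v by (simp add: pe_pCons[OF f] vec.linear_0[OF f])
  qed
  then obtain c where "poly p c = 0" using alg_closed_imp_poly_has_root[of p] by auto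
  then obtain q where q: "p = [:- c, 1:] * q" by (auto simp: poly_eq_0_iff_dvd dvd_def)
  have q0: "q \<noteq> 0" using q less.prems by auto
  have dq: "Polynomial.degree q < Polynomial.degree p" using q0 unfolding q by (subst degree_mult_eq) auto
  show ?case
  proof (cases "pe f v q = 0")
    case True
    from less.hyps[OF dq q0 this] show ?thesis using dq by (meson less_trans)
  next
    case False
    have "p = pCons 0 q - Polynomial.smult c q" by (simp add: q)
    then have "f (pe f v q) - c *s pe f v q = 0"
      using less.prems(2) by (simp add: pe_diff[OF f] pe_smult[OF f] pe_pCons[OF f])
    then show ?thesis using False dq by auto
  qed
qed

section \<open>Commutative algebras without nonzero eigenvalues\<close>

text \<open>
  Multiplication by \<open>\<alpha> x + \<beta> x\<^sup>2 + \<gamma> x\<^sup>3 + \<delta> x\<^sup>4\<close> in the basis of powers of \<open>x\<close>, where \<open>p\<close>, \<open>q\<close>, \<open>r\<close> are the coordinates of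
  \<open>x\<^sup>2 x\<^sup>2\<close>, \<open>x\<^sup>2 x\<^sup>3\<close>, \<open>x\<^sup>3 x\<^sup>3\<close>; the other products are forced by the vanishing of all fifth powers.
\<close>
definition regular_matrix :: "'k::comm_ring_1 \<Rightarrow> 'k \<Rightarrow> 'k \<Rightarrow> 'k \<Rightarrow> 'k \<Rightarrow> 'k \<Rightarrow> 'k \<Rightarrow> 'k \<Rightarrow> 'k \<Rightarrow> 'k \<Rightarrow> 'k \<Rightarrow> 'k
    \<Rightarrow> 'k \<Rightarrow> 'k \<Rightarrow> 'k \<Rightarrow> 'k \<Rightarrow> idx \<Rightarrow> idx \<Rightarrow> 'k"
  where "regular_matrix p1 p2 p3 p4 q1 q2 q3 q4 r1 r2 r3 r4 \<alpha> \<beta> \<gamma> \<delta> = case_idx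
    (case_idx 0 (\<beta> * p1 + \<gamma> * q1) (\<beta> * q1 + \<gamma> * r1) 0)
    (case_idx \<alpha> (\<beta> * p2 + \<gamma> * q2 - \<delta> * q1) (\<beta> * q2 + \<gamma> * r2 - \<delta> * r1) (- \<beta> * q1 - \<gamma> * r1))
    (case_idx \<beta> (\<alpha> + \<beta> * p3 + \<gamma> * q3 - \<delta> * (q2 + p1)) (\<beta> * q3 + \<gamma> * r3 - \<delta> * (r2 + q1))
      (- \<beta> * (q2 + p1) - \<gamma> * (r2 + q1) + \<delta> * r1))
    (case_idx \<gamma> (\<beta> * p4 + \<gamma> * q4 - \<delta> * (q3 + p2)) (\<alpha> + \<beta> * q4 + \<gamma> * r4 - \<delta> * (r3 + q2))
      (- \<beta> * (q3 + p2) - \<gamma> * (r3 + q2) + \<delta> * (r2 + 2 * q1)))"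

text \<open>
  The constants disappear one after another, typically in pairs: for suitable multipliers the second and third characteristic coefficients
  are binary forms in two of the constants that have no common zero except the origin.
\<close>
lemma regular_matrix_nilpotent:
  fixes p1 :: "'k::alg_closed_field"
  assumes nil: "\<And>\<alpha> \<beta> \<gamma> \<delta>. charcoeffs (regular_matrix p1 p2 p3 p4 q1 q2 q3 q4 r1 r2 r3 r4 \<alpha> \<beta> \<gamma> \<delta>) = [0, 0, 0, 0]" and r1: "r1 = 0"
  shows "p1 = 0 \<and> p2 = 0 \<and> q1 = 0 \<and> q2 = 0 \<and> q3 = 0 \<and> r2 = 0 \<and> r3 = 0"
proof -
  define m where "m = regular_matrix p1 p2 p3 p4 q1 q2 q3 q4 r1 r2 r3 r4"
  have ch: "charcoeffs (m \<alpha> \<beta> \<gamma> \<delta>) = [0, 0, 0, 0]" for \<alpha> \<beta> \<gamma> \<delta> unfolding m_def by (rule nil)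
  have "0 - 3 * q1 ^ 2 - 3 * q1 * r2 - r2 ^ 2 = charcoeffs (m 0 0 0 1) ! 1"
    unfolding m_def regular_matrix_def charcoeffs_def by (simp add: r1) (simp add: algebra_simps eval_nat_numeral)
  then have E1: "0 - 3 * q1 ^ 2 - 3 * q1 * r2 - r2 ^ 2 = 0" using ch by simp
  have "2 * q1 ^ 3 + 3 * q1 ^ 2 * r2 + q1 * r2 ^ 2 = charcoeffs (m 0 0 0 1) ! 2"
    unfolding m_def regular_matrix_def charcoeffs_def by (simp add: r1) (simp add: algebra_simps eval_nat_numeral)
  then have E2: "2 * q1 ^ 3 + 3 * q1 ^ 2 * r2 + q1 * r2 ^ 2 = 0" using ch by simp
  have "q1 ^ 3 = - (q1 * (0 - 3 * q1 ^ 2 - 3 * q1 * r2 - r2 ^ 2) + (2 * q1 ^ 3 + 3 * q1 ^ 2 * r2 + q1 * r2 ^ 2))"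
    by (simp add: algebra_simps eval_nat_numeral)
  then have "q1 ^ 3 = 0" unfolding E1 E2 by simp
  then have q1: "q1 = 0" by simp
  then have r2: "r2 = 0" using E1 by simp
  have "0 - q2 ^ 2 - q2 * r3 - r3 ^ 2 = charcoeffs (m 0 0 1 0) ! 1"
    unfolding m_def regular_matrix_def charcoeffs_def by (simp add: r1 q1 r2) (simp add: algebra_simps eval_nat_numeral)
  then have E3: "0 - q2 ^ 2 - q2 * r3 - r3 ^ 2 = 0" using ch by simp
  have "0 - q2 ^ 2 * r3 - q2 * r3 ^ 2 = charcoeffs (m 0 0 1 0) ! 2"
    unfolding m_def regular_matrix_def charcoeffs_def by (simp add: r1 q1 r2) (simp add: algebra_simps eval_nat_numeral)
  then have E4: "0 - q2 ^ 2 * r3 - q2 * r3 ^ 2 = 0" using ch by simp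
  have "q2 ^ 3 = - (q2 * (0 - q2 ^ 2 - q2 * r3 - r3 ^ 2) - (0 - q2 ^ 2 * r3 - q2 * r3 ^ 2))"
    by (simp add: algebra_simps eval_nat_numeral)
  then have "q2 ^ 3 = 0" unfolding E3 E4 by simp
  then have q2: "q2 = 0" by simp
  then have r3: "r3 = 0" using E3 by simp
  have "0 + 0 * t + (0 - p1 ^ 2) * t ^ 2 + (0 - p1 ^ 2 * q4 + p1 * p2 * q3 + p1 * q3 ^ 2) * t ^ 3 + 0 * t ^ 4 = charcoeffs (m 1 t 0 0) ! 3" for t
    unfolding m_def regular_matrix_def charcoeffs_def by (simp add: r1 q1 r2 q2 r3) (simp add: algebra_simps eval_nat_numeral)
  then have v: "0 + 0 * t + (0 - p1 ^ 2) * t ^ 2 + (0 - p1 ^ 2 * q4 + p1 * p2 * q3 + p1 * q3 ^ 2) * t ^ 3 + 0 * t ^ 4 = 0" for t using ch by simp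
  have E5: "0 - p1 ^ 2 = 0" using quartic_vanish[OF v] by blast+
  have p1: "p1 = 0" using E5 by simp
  have "0 - p2 ^ 2 - p2 * q3 - q3 ^ 2 = charcoeffs (m 0 1 0 0) ! 1"
    unfolding m_def regular_matrix_def charcoeffs_def by (simp add: r1 q1 r2 q2 r3 p1) (simp add: algebra_simps eval_nat_numeral)
  then have E6: "0 - p2 ^ 2 - p2 * q3 - q3 ^ 2 = 0" using ch by simp
  have "0 - p2 ^ 2 * q3 - p2 * q3 ^ 2 = charcoeffs (m 0 1 0 0) ! 2"
    unfolding m_def regular_matrix_def charcoeffs_def by (simp add: r1 q1 r2 q2 r3 p1) (simp add: algebra_simps eval_nat_numeral)
  then have E7: "0 - p2 ^ 2 * q3 - p2 * q3 ^ 2 = 0" using ch by simp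
  have "p2 ^ 3 = - (p2 * (0 - p2 ^ 2 - p2 * q3 - q3 ^ 2) - (0 - p2 ^ 2 * q3 - p2 * q3 ^ 2))"
    by (simp add: algebra_simps eval_nat_numeral)
  then have "p2 ^ 3 = 0" unfolding E6 E7 by simp
  then have p2: "p2 = 0" by simp
  then have q3: "q3 = 0" using E6 by simp
  show ?thesis using p1 p2 q1 q2 q3 r2 r3 by simp
qed

text \<open>
  The lowest coefficients of the characteristic equations successively express the constants through a few of them, until
  the remaining equations contradict each other.
\<close>
lemma regular_matrix_not_nilpotent:
  fixes p1 :: "'k::alg_closed_field"
  assumes nil: "\<And>\<alpha> \<beta> \<gamma> \<delta>. charcoeffs (regular_matrix p1 p2 p3 p4 q1 q2 q3 q4 r1 r2 r3 r4 \<alpha> \<beta> \<gamma> \<delta>) = [0, 0, 0, 0]" and r1: "r1 = 1"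
  shows False
proof -
  define m where "m = regular_matrix p1 p2 p3 p4 q1 q2 q3 q4 r1 r2 r3 r4"
  have ch: "charcoeffs (m \<alpha> \<beta> \<gamma> \<delta>) = [0, 0, 0, 0]" for \<alpha> \<beta> \<gamma> \<delta> unfolding m_def by (rule nil)
  have "0 + 0 * t + (3 * q1 + r2) * t ^ 2 + (0 - 2 * p1 * q1 - p1 * r2 + p2 + 2 * q1 ^ 3 + 3 * q1 ^ 2 * r2 - 3 * q1 * q2 + q1 * r2 ^ 2 - q1 * r3 - q2 * r2 + q3) * t ^ 3 + 0 * t ^ 4 = charcoeffs (m 1 0 0 t) ! 2" for t
    unfolding m_def regular_matrix_def charcoeffs_def by (simp add: r1) (simp add: algebra_simps eval_nat_numeral)
  then have v: "0 + 0 * t + (3 * q1 + r2) * t ^ 2 + (0 - 2 * p1 * q1 - p1 * r2 + p2 + 2 * q1 ^ 3 + 3 * q1 ^ 2 * r2 - 3 * q1 * q2 + q1 * r2 ^ 2 - q1 * r3 - q2 * r2 + q3) * t ^ 3 + 0 * t ^ 4 = 0" for t using ch by simp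
  have E1: "3 * q1 + r2 = 0" using quartic_vanish[OF v] by blast+
  have "0 - p1 - 3 * q1 ^ 2 - 3 * q1 * r2 - r2 ^ 2 + r3 = charcoeffs (m 0 0 0 1) ! 1"
    unfolding m_def regular_matrix_def charcoeffs_def by (simp add: r1) (simp add: algebra_simps eval_nat_numeral)
  then have E2: "0 - p1 - 3 * q1 ^ 2 - 3 * q1 * r2 - r2 ^ 2 + r3 = 0" using ch by simp
  have "0 + 0 * t + (2 * q1 * q2 + 2 * q2 * r2 + r2 * r3 - r4) * t ^ 2 + (q1 * q2 * r4 - q1 * q4 * r2 - 2 * q1 - q2 ^ 2 * r3 + q2 * q3 * r2 + q2 * r2 * r4 - q2 * r3 ^ 2 + q3 * r2 * r3 - q3 * r4 - q4 * r2 ^ 2 + q4 * r3 - r2) * t ^ 3 + 0 * t ^ 4 = charcoeffs (m 1 0 t 0) ! 2" for t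
    unfolding m_def regular_matrix_def charcoeffs_def by (simp add: r1) (simp add: algebra_simps eval_nat_numeral)
  then have v: "0 + 0 * t + (2 * q1 * q2 + 2 * q2 * r2 + r2 * r3 - r4) * t ^ 2 + (q1 * q2 * r4 - q1 * q4 * r2 - 2 * q1 - q2 ^ 2 * r3 + q2 * q3 * r2 + q2 * r2 * r4 - q2 * r3 ^ 2 + q3 * r2 * r3 - q3 * r4 - q4 * r2 ^ 2 + q4 * r3 - r2) * t ^ 3 + 0 * t ^ 4 = 0" for t using ch by simp
  have E3: "2 * q1 * q2 + 2 * q2 * r2 + r2 * r3 - r4 = 0" using quartic_vanish[OF v] by blast+
  have "0 + 0 * t + (0 - 2 * q1 ^ 2 + 2 * q1 * q2 - 3 * q1 * r2 + 3 * q1 + 2 * q2 * r2 - q2 - r2 ^ 2 + r2 * r3 + r2 - r4) * t ^ 2 + (2 * p1 * q1 * r2 - 2 * p1 * q1 - p1 * q2 * r2 + p1 * r2 ^ 2 - p1 * r2 * r3 - p1 * r2 + p1 * r4 + p2 * q1 * r2 + p2 * r2 ^ 2 - p2 * r2 - p2 * r3 + p2 + 2 * q1 ^ 3 - 2 * q1 ^ 2 * q2 + 3 * q1 ^ 2 * r2 - 2 * q1 ^ 2 * r3 - q1 ^ 2 * r4 - q1 * q2 * r2 + 3 * q1 * q2 * r3 + q1 * q2 * r4 - 3 * q1 * q2 - q1 * q3 * r2 + 2 * q1 * q3 - q1 * q4 * r2 + q1 * r2 ^ 2 - q1 * r2 * r3 - q1 * r2 * r4 + q1 * r3 ^ 2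 - q1 * r3 + q1 * r4 - 2 * q1 - q2 ^ 2 * r2 - q2 ^ 2 * r3 + q2 ^ 2 + q2 * q3 * r2 + q2 * r2 * r4 - q2 * r2 - q2 * r3 ^ 2 + q2 * r3 + q3 * r2 * r3 - q3 * r3 - q3 * r4 + q3 - q4 * r2 ^ 2 + q4 * r2 + q4 * r3 - q4 - r2 + 1) * t ^ 3 + 0 * t ^ 4 = charcoeffs (m 1 0 t t) ! 2" for t
    unfolding m_def regular_matrix_def charcoeffs_def by (simp add: r1) (simp add: algebra_simps eval_nat_numeral)
  then have v: "0 + 0 * t + (0 - 2 * q1 ^ 2 + 2 * q1 * q2 - 3 * q1 * r2 + 3 * q1 + 2 * q2 * r2 - q2 - r2 ^ 2 + r2 * r3 + r2 - r4) * t ^ 2 + (2 * p1 * q1 * r2 - 2 * p1 * q1 - p1 * q2 * r2 + p1 * r2 ^ 2 - p1 * r2 * r3 - p1 * r2 + p1 * r4 + p2 * q1 * r2 + p2 * r2 ^ 2 - p2 * r2 - p2 * r3 + p2 + 2 * q1 ^ 3 - 2 * q1 ^ 2 * q2 + 3 * q1 ^ 2 * r2 - 2 * q1 ^ 2 * r3 - q1 ^ 2 * r4 - q1 * q2 * r2 + 3 * q1 * q2 * r3 + q1 * q2 * r4 - 3 * q1 * q2 - q1 * q3 * r2 + 2 * q1 * q3 - q1 * q4 * r2 + q1 * r2 ^ 2 - q1 * r2 * r3 - q1 * r2 * r4 + q1 * r3 ^ 2 - q1 * r3 + q1 * r4 - 2 * q1 - q2 ^ 2 * r2 - q2 ^ 2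 * r3 + q2 ^ 2 + q2 * q3 * r2 + q2 * r2 * r4 - q2 * r2 - q2 * r3 ^ 2 + q2 * r3 + q3 * r2 * r3 - q3 * r3 - q3 * r4 + q3 - q4 * r2 ^ 2 + q4 * r2 + q4 * r3 - q4 - r2 + 1) * t ^ 3 + 0 * t ^ 4 = 0" for t using ch by simp
  have E4: "0 - 2 * q1 ^ 2 + 2 * q1 * q2 - 3 * q1 * r2 + 3 * q1 + 2 * q2 * r2 - q2 - r2 ^ 2 + r2 * r3 + r2 - r4 = 0" using quartic_vanish[OF v] by blast+
  have "r2 = - 3 * q1 + (3 * q1 + r2)"
    by (simp add: algebra_simps eval_nat_numeral)
  then have r2: "r2 = - 3 * q1" unfolding E1 by simp
  have "q2 = - 2 * q1 ^ 2 - ((0 - 2 * q1 ^ 2 + 2 * q1 * q2 - 3 * q1 * r2 + 3 * q1 + 2 * q2 * r2 - q2 - r2 ^ 2 + r2 * r3 + r2 - r4) - (2 * q1 * q2 + 2 * q2 * r2 + r2 * r3 - r4))"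
    unfolding r2 by (simp add: algebra_simps eval_nat_numeral)
  then have q2: "q2 = - 2 * q1 ^ 2" unfolding E3 E4 by simp
  have "r4 = 8 * q1 ^ 3 - 3 * q1 * r3 - (2 * q1 * q2 + 2 * q2 * r2 + r2 * r3 - r4)"
    unfolding r2 q2 by (simp add: algebra_simps eval_nat_numeral)
  then have r4: "r4 = 8 * q1 ^ 3 - 3 * q1 * r3" unfolding E3 by simp
  have "p1 = r3 - 3 * q1 ^ 2 - (0 - p1 - 3 * q1 ^ 2 - 3 * q1 * r2 - r2 ^ 2 + r3)"
    unfolding r2 by (simp add: algebra_simps eval_nat_numeral)
  then have p1: "p1 = r3 - 3 * q1 ^ 2" unfolding E2 by simp
  have "0 - 20 * q1 ^ 4 + 8 * q1 ^ 2 * r3 + 3 * q1 * q3 + q4 - r3 ^ 2 = charcoeffs (m 0 0 1 0) ! 1"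
    unfolding m_def regular_matrix_def charcoeffs_def by (simp add: r1 r2 q2 p1 r4) (simp add: algebra_simps eval_nat_numeral)
  then have E5: "0 - 20 * q1 ^ 4 + 8 * q1 ^ 2 * r3 + 3 * q1 * q3 + q4 - r3 ^ 2 = 0" using ch by simp
  have "0 + 0 * t + (4 * q1 ^ 2 - r3) * t ^ 2 + (16 * q1 ^ 5 - 8 * q1 ^ 3 * r3 + 2 * q1 ^ 2 * q3 - 2 * q1 * q4 + q1 * r3 ^ 2 - q3 * r3 + 1) * t ^ 3 + (2 * q1 ^ 3 - q1 * r3 + q3) * t ^ 4 = charcoeffs (m 1 0 t 0) ! 3" for t
    unfolding m_def regular_matrix_def charcoeffs_def by (simp add: r1 r2 q2 p1 r4) (simp add: algebra_simps eval_nat_numeral)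
  then have v: "0 + 0 * t + (4 * q1 ^ 2 - r3) * t ^ 2 + (16 * q1 ^ 5 - 8 * q1 ^ 3 * r3 + 2 * q1 ^ 2 * q3 - 2 * q1 * q4 + q1 * r3 ^ 2 - q3 * r3 + 1) * t ^ 3 + (2 * q1 ^ 3 - q1 * r3 + q3) * t ^ 4 = 0" for t using ch by simp
  have E6: "4 * q1 ^ 2 - r3 = 0" "16 * q1 ^ 5 - 8 * q1 ^ 3 * r3 + 2 * q1 ^ 2 * q3 - 2 * q1 * q4 + q1 * r3 ^ 2 - q3 * r3 + 1 = 0" "2 * q1 ^ 3 - q1 * r3 + q3 = 0" using quartic_vanish[OF v] by blast+
  have r3: "r3 = 4 * q1 ^ 2" using E6(1) by simp
  have "q3 = q1 * r3 - 2 * q1 ^ 3 + (2 * q1 ^ 3 - q1 * r3 + q3)" by simp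
  then have "q3 = q1 * r3 - 2 * q1 ^ 3" unfolding E6(3) by simp
  then have q3: "q3 = 2 * q1 ^ 3" unfolding r3 by (simp add: algebra_simps eval_nat_numeral)
  have "q4 = r3 ^ 2 + 20 * q1 ^ 4 - 8 * q1 ^ 2 * r3 - 3 * q1 * q3 + (0 - 20 * q1 ^ 4 + 8 * q1 ^ 2 * r3 + 3 * q1 * q3 + q4 - r3 ^ 2)" by simp
  then have "q4 = r3 ^ 2 + 20 * q1 ^ 4 - 8 * q1 ^ 2 * r3 - 3 * q1 * q3" unfolding E5 by simp
  then have q4: "q4 = - 2 * q1 ^ 4" unfolding r3 q3 by (simp add: algebra_simps eval_nat_numeral)
  have "16 * q1 ^ 5 - 8 * q1 ^ 3 * r3 + 2 * q1 ^ 2 * q3 - 2 * q1 * q4 + q1 * r3 ^ 2 - q3 * r3 + 1 = 1"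
    unfolding q4 q3 r3 by (simp add: algebra_simps eval_nat_numeral)
  then show False using E6(2) by simp
qed

text \<open>
  The algebra structure that an injective quadratic map induces on the space. The product is only controlled on a
  subspace \<open>C\<close>, so that quotients can be realized inside the same space.
\<close>
locale eigenfree_algebra =
  fixes C :: "('k::alg_closed_field ^ idx) set" and mul :: "'k ^ idx \<Rightarrow> 'k ^ idx \<Rightarrow> 'k ^ idx" (infixr "\<diamondop>" 70)
  assumes sub: "vec.subspace C"
    and comm: "u \<diamondop> v = v \<diamondop> u"
    and add_left: "(u + v) \<diamondop> w = u \<diamondop> w + v \<diamondop> w"
    and scale_left: "(c *s u) \<diamondop> v = c *s (u \<diamondop> v)"
    and closed: "u \<in> C \<Longrightarrow> v \<in> C \<Longrightarrow> u \<diamondop> v \<in> C"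
    and noeig: "u \<in> C \<Longrightarrow> v \<in> C \<Longrightarrow> c \<noteq> 0 \<Longrightarrow> u \<diamondop> v = c *s v \<Longrightarrow> v = 0"
    and two: "(2::'k) \<noteq> 0"
begin

lemma add_right: "u \<diamondop> (v + w) = u \<diamondop> v + u \<diamondop> w"
  using add_left comm by metis

lemma scale_right: "u \<diamondop> (c *s v) = c *s (u \<diamondop> v)"
  using scale_left comm by metis

lemma zero_left [simp]: "0 \<diamondop> v = 0" and zero_right [simp]: "u \<diamondop> 0 = 0"
  using scale_left[of 0 0 v] scale_right[of u 0 0] by simp_all

lemma minus_left: "(- u) \<diamondop> v = - (u \<diamondop> v)" and minus_right: "u \<diamondop> (- v) = - (u \<diamondop> v)"
  using scale_left[of "-1" u v] scale_right[of u "-1" v] by simp_all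

lemma diff_left: "(u - v) \<diamondop> w = u \<diamondop> w - v \<diamondop> w" and diff_right: "u \<diamondop> (v - w) = u \<diamondop> v - u \<diamondop> w"
  using add_left[of u "- v" w] add_right[of u v "- w"] by (simp_all add: minus_left minus_right)

lemma sum_left: "(sum f I) \<diamondop> v = (\<Sum>i\<in>I. f i \<diamondop> v)" and sum_right: "u \<diamondop> (sum f I) = (\<Sum>i\<in>I. u \<diamondop> f i)"
  by (induction I rule: infinite_finite_induct) (simp_all add: add_left add_right)

lemmas bilinear = add_left add_right scale_left scale_right minus_left minus_right diff_left diff_right

lemma C_add: "u \<in> C \<Longrightarrow> v \<in> C \<Longrightarrow> u + v \<in> C" and C_scale: "u \<in> C \<Longrightarrow> c *s u \<in> C" and C_0: "0 \<in> C"
  and C_minus: "u \<in> C \<Longrightarrow> - u \<in> C" and C_diff: "u \<in> C \<Longrightarrow> v \<in> C \<Longrightarrow> u - v \<in> C"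
  and C_sum: "(\<And>i. i \<in> I \<Longrightarrow> f i \<in> C) \<Longrightarrow> sum f I \<in> C"
  using sub by (simp_all add: vec.subspace_def vec.subspace_neg vec.subspace_diff vec.subspace_sum)

lemmas C_intros = C_add C_scale C_0 C_minus C_diff C_sum closed

lemma linear_mul: "Vector_Spaces.linear (*s) (*s) ((\<diamondop>) y)"
  unfolding Vector_Spaces.linear_iff by (simp add: vec.vector_space_axioms add_right scale_right)

lemma pe_in_C: "y \<in> C \<Longrightarrow> v \<in> C \<Longrightarrow> pe ((\<diamondop>) y) v p \<in> C"
  by (induction p) (auto simp: pe_pCons[OF linear_mul] intro!: C_intros)

lemma annihilated:
  assumes y: "y \<in> C"
  shows "v \<in> C \<Longrightarrow> p \<noteq> 0 \<Longrightarrow> Polynomial.degree p \<le> d \<Longrightarrow> pe ((\<diamondop>) y) v p = 0 \<Longrightarrow> ((\<diamondop>) y ^^ d) v = 0"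
proof (induction d arbitrary: v p)
  case 0
  then obtain a where "p = [:a:]" by (auto elim: degree_eq_zeroE)
  then show ?case using 0 by (simp add: pe_pCons[OF linear_mul])
next
  case (Suc d)
  show ?case
  proof (cases "Polynomial.degree p = 0")
    case True
    then obtain a where "p = [:a:]" by (auto elim: degree_eq_zeroE)
    then have "v = 0" using Suc.prems by (simp add: pe_pCons[OF linear_mul])
    moreover have "((\<diamondop>) y ^^ n) 0 = 0" for n by (induction n) auto
    ultimately show ?thesis by blast
  next
    case False
    then obtain c where "poly p c = 0" using alg_closed_imp_poly_has_root[of p] by auto
    then obtain q where q: "p = [:- c, 1:] * q" by (auto simp: poly_eq_0_iff_dvd dvd_def)
    have q0: "q \<noteq> 0" using q Suc.prems by auto
    then have dq: "Polynomial.degree q \<le> d"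
      using Suc.prems(3) unfolding q by (subst (asm) degree_mult_eq) auto
    have "p = pCons 0 q - Polynomial.smult c q" by (simp add: q)
    then have "y \<diamondop> pe ((\<diamondop>) y) v q - c *s pe ((\<diamondop>) y) v q = 0"
      using Suc.prems(4) by (simp add: pe_diff[OF linear_mul] pe_smult[OF linear_mul] pe_pCons[OF linear_mul])
    then have w: "y \<diamondop> pe ((\<diamondop>) y) v q = c *s pe ((\<diamondop>) y) v q" by simp
    have comm_pow: "((\<diamondop>) y ^^ Suc d) v = ((\<diamondop>) y ^^ d) (y \<diamondop> v)" by (simp add: funpow_swap1)
    show ?thesis
    proof (cases "c = 0")
      case True
      then have "pe ((\<diamondop>) y) (y \<diamondop> v) q = 0" using w by (simp add: pe_shift[OF linear_mul])
      then show ?thesis unfolding comm_pow using Suc.IH[OF closed[OF y Suc.prems(1)] q0 dq] by blast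
    next
      case False
      then have "pe ((\<diamondop>) y) v q = 0" using noeig[OF y pe_in_C[OF y Suc.prems(1)] False w] by blast
      then have "((\<diamondop>) y ^^ d) v = 0" using Suc.IH[OF Suc.prems(1) q0 dq] by blast
      then show ?thesis by simp
    qed
  qed
qed

text \<open>
  Zero is the only eigenvalue of a multiplication, and the space has dimension four.
\<close>
lemma nilpotent:
  assumes y: "y \<in> C" and v: "v \<in> C" shows "y \<diamondop> y \<diamondop> y \<diamondop> y \<diamondop> v = 0"
proof -
  obtain c :: "nat \<Rightarrow> 'k" where c: "\<exists>i<5. c i \<noteq> 0" "(\<Sum>i<5. c i *s ((\<diamondop>) y ^^ i) v) = 0"
    using five_dependent[of "\<lambda>i. ((\<diamondop>) y ^^ i) v"] by blast
  define p where "p = [:c 0, c 1, c 2, c 3, c 4:]"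
  have "pe ((\<diamondop>) y) v p = (\<Sum>i<5. c i *s ((\<diamondop>) y ^^ i) v)"
    by (simp add: p_def pe_pCons[OF linear_mul] eval_nat_numeral add_right scale_right)
  then have "pe ((\<diamondop>) y) v p = 0" using c(2) by simp
  moreover have "p \<noteq> 0"
  proof
    assume "p = 0"
    then have "c 0 = 0" "c 1 = 0" "c 2 = 0" "c 3 = 0" "c 4 = 0" by (simp_all add: p_def)
    moreover have "i < 5 \<Longrightarrow> i = 0 \<or> i = 1 \<or> i = 2 \<or> i = 3 \<or> i = (4::nat)" for i by linarith
    ultimately show False using c(1) by metis
  qed
  moreover have "Polynomial.degree p \<le> 4" by (simp add: p_def degree_pCons_le eval_nat_numeral)
  ultimately have "((\<diamondop>) y ^^ 4) v = 0" using annihilated[OF y v] by blast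
  then show ?thesis by (simp add: eval_nat_numeral)
qed

text \<open>Powers of \<open>x + t y\<close>, expanded in \<open>t\<close>.\<close>

primrec pw :: "'k ^ idx \<Rightarrow> nat \<Rightarrow> 'k ^ idx" where
  "pw x 0 = x" | "pw x (Suc k) = x \<diamondop> pw x k"

primrec pwc :: "'k ^ idx \<Rightarrow> 'k ^ idx \<Rightarrow> nat \<Rightarrow> nat \<Rightarrow> 'k ^ idx" where
  "pwc x y 0 = (\<lambda>i. if i = 0 then x else if i = 1 then y else 0)"
| "pwc x y (Suc k) = (\<lambda>i. x \<diamondop> pwc x y k i + (if i = 0 then 0 else y \<diamondop> pwc x y k (i - 1)))"

lemma pwc_above: "i > Suc k \<Longrightarrow> pwc x y k i = 0"
  by (induction k arbitrary: i) auto

lemma pw_expand: "pw (x + t *s y) k = (\<Sum>i\<le>Suc k. t ^ i *s pwc x y k i)"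
proof (induction k)
  case (Suc k)
  have "(\<Sum>i\<le>Suc (Suc k). t ^ i *s pwc x y (Suc k) i)
     = (\<Sum>i\<le>Suc (Suc k). t ^ i *s (x \<diamondop> pwc x y k i)) + (\<Sum>i\<le>Suc (Suc k). t ^ i *s (if i = 0 then 0 else y \<diamondop> pwc x y k (i - 1)))"
    by (simp add: vec.scale_right_distrib sum.distrib del: sum.atMost_Suc)
  also have "(\<Sum>i\<le>Suc (Suc k). t ^ i *s (x \<diamondop> pwc x y k i)) = x \<diamondop> pw (x + t *s y) k"
    unfolding Suc sum_right by (subst sum.atMost_Suc) (simp add: pwc_above scale_right del: sum.atMost_Suc)
  also have "(\<Sum>i\<le>Suc (Suc k). t ^ i *s (if i = 0 then 0 else y \<diamondop> pwc x y k (i - 1))) = (t *s y) \<diamondop> pw (x + t *s y) k"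
    unfolding Suc sum_right by (subst sum.atMost_Suc_shift) (simp add: scale_right scale_left mult.commute del: sum.atMost_Suc)
  finally show ?case by (simp add: add_left)
qed simp

text \<open>
  The coefficient of \<open>t\<close> in the power of \<open>x + t y\<close>.
\<close>
lemma linearize:
  assumes "\<And>x. x \<in> C \<Longrightarrow> pw x k = 0" "x \<in> C" "y \<in> C" shows "pwc x y k 1 = 0"
proof (rule vec_coeffs_vanish[where n = "Suc k"])
  fix t show "(\<Sum>i\<le>Suc k. t ^ i *s pwc x y k i) = 0"
    using assms unfolding pw_expand[symmetric] by (intro assms(1) C_intros)
qed simp

text \<open>
  Linearizing the vanishing of cubes gives \<open>y (x x) = - 2 x (x y)\<close>. If this did not vanish, in dimension four \<open>x (x b)\<close> would be
  a nonzero multiple of \<open>x x\<close> for some \<open>b\<close>, and \<open>x x\<close> would be an eigenvector of the multiplication by \<open>b\<close>.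
\<close>
lemma annihilator_cube_zero:
  assumes cube: "\<And>x. x \<in> C \<Longrightarrow> x \<diamondop> x \<diamondop> x = 0" and x: "x \<in> C" "x \<diamondop> x \<noteq> 0"
  shows "\<forall>u\<in>C. u \<diamondop> x \<diamondop> x = 0"
proof -
  have lin: "y \<diamondop> x \<diamondop> x = - 2 *s (x \<diamondop> x \<diamondop> y)" if "y \<in> C" for y
  proof -
    have "pwc x y 2 1 = 0" by (rule linearize) (use cube x that in \<open>auto simp: numeral_2_eq_2\<close>)
    then have "2 *s (x \<diamondop> x \<diamondop> y) + y \<diamondop> x \<diamondop> x = 0"
      by (simp add: numeral_2_eq_2 add_right comm[of y x] vec.scale_left_distrib[of 1 1, simplified])
    then show ?thesis by (simp add: add_eq_0_iff2)
  qed
  have "x \<diamondop> x \<diamondop> y = 0" if y: "y \<in> C" for y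
  proof (rule ccontr)
    assume ne: "x \<diamondop> x \<diamondop> y \<noteq> 0"
    obtain b where b: "b \<in> C" "x \<diamondop> x \<diamondop> b \<noteq> 0" "x \<diamondop> x \<diamondop> x \<diamondop> b = 0"
    proof (cases "x \<diamondop> x \<diamondop> x \<diamondop> y = 0")
      case False
      then show ?thesis using that[of "x \<diamondop> y"] nilpotent[OF x(1) y] x y by (auto intro: C_intros)
    qed (use ne y that in blast)
    let ?N = "\<lambda>v. x \<diamondop> v" and ?w = "\<lambda>i::nat. [b, x \<diamondop> b, x \<diamondop> x \<diamondop> b, x, x \<diamondop> x] ! i"
    obtain c where c: "\<exists>i<5. c i \<noteq> 0" "(\<Sum>i<5. c i *s ?w i) = 0" using five_dependent[of ?w] by blast
    have eq: "c 0 *s b + c 1 *s (x \<diamondop> b) + c 2 *s (x \<diamondop> x \<diamondop> b) + c 3 *s x + c 4 *s (x \<diamondop> x) = 0"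
      using c(2) by (simp add: eval_nat_numeral add_ac)
    have "x \<diamondop> x \<diamondop> (c 0 *s b + c 1 *s (x \<diamondop> b) + c 2 *s (x \<diamondop> x \<diamondop> b) + c 3 *s x + c 4 *s (x \<diamondop> x)) = 0"
      unfolding eq by simp
    then have c0: "c 0 = 0" using b cube[OF x(1)] by (simp add: add_right scale_right)
    have "x \<diamondop> (c 0 *s b + c 1 *s (x \<diamondop> b) + c 2 *s (x \<diamondop> x \<diamondop> b) + c 3 *s x + c 4 *s (x \<diamondop> x)) = 0"
      unfolding eq by simp
    then have e1: "c 1 *s (x \<diamondop> x \<diamondop> b) + c 3 *s (x \<diamondop> x) = 0" using b cube[OF x(1)] by (simp add: add_right scale_right c0)
    have "\<exists>\<beta>. x \<diamondop> x \<diamondop> b = \<beta> *s (x \<diamondop> x)"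
    proof (rule ccontr)
      assume indep: "\<not> ?thesis"
      have *: "p = 0 \<and> q = 0" if "p *s (x \<diamondop> x \<diamondop> b) + q *s (x \<diamondop> x) = 0" for p q
      proof -
        have "p = 0"
        proof (rule ccontr)
          assume p: "p \<noteq> 0"
          have "p *s (x \<diamondop> x \<diamondop> b) = (- q) *s (x \<diamondop> x)" using that by (simp add: add_eq_0_iff2)
          then have "(1 / p) *s (p *s (x \<diamondop> x \<diamondop> b)) = (1 / p) *s ((- q) *s (x \<diamondop> x))" by simp
          then have "x \<diamondop> x \<diamondop> b = (- q / p) *s (x \<diamondop> x)" using p by simp
          then show False using indep by blast
        qed
        then show ?thesis using that x(2) by simp
      qed
      have c13: "c 1 = 0" "c 3 = 0" using *[OF e1] by auto
      then have "c 2 *s (x \<diamondop> x \<diamondop> b) + c 4 *s (x \<diamondop> x) = 0" using eq c0 by simp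
      then have c24: "c 2 = 0" "c 4 = 0" using * by blast+
      moreover have "i < 5 \<Longrightarrow> i = 0 \<or> i = 1 \<or> i = 2 \<or> i = 3 \<or> i = (4::nat)" for i by linarith
      ultimately show False using c(1) c0 c13 by metis
    qed
    then obtain \<beta> where beta: "x \<diamondop> x \<diamondop> b = \<beta> *s (x \<diamondop> x)" by blast
    then have "\<beta> \<noteq> 0" using b(2) by auto
    have "b \<diamondop> x \<diamondop> x = (- 2 * \<beta>) *s (x \<diamondop> x)" using lin[OF b(1)] beta by simp
    then show False using noeig[of b "x \<diamondop> x" "- 2 * \<beta>"] two \<open>\<beta> \<noteq> 0\<close> b(1) x by (auto intro: C_intros)
  qed
  then show ?thesis using lin by simp
qed

end

section \<open>Existence of annihilating elements\<close>

context eigenfree_algebra begin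

lemma charcoeffs_zero:
  assumes y: "y \<in> C" and a: "\<And>j. a j \<in> C"
    and indep: "\<And>c. (\<Sum>j\<in>UNIV. c j *s a j) = 0 \<Longrightarrow> c = (\<lambda>_. 0)"
    and act: "\<And>j. y \<diamondop> a j = (\<Sum>i\<in>UNIV. m i j *s a i)"
  shows "charcoeffs m = [0, 0, 0, 0]"
proof (rule charcoeffs_nilpotent)
  fix t :: 'k and c assume t: "t \<noteq> 0" and eig: "\<And>i. (\<Sum>j\<in>UNIV. m i j * c j) = t * c i"
  have "y \<diamondop> (\<Sum>j\<in>UNIV. c j *s a j) = (\<Sum>j\<in>UNIV. \<Sum>i\<in>UNIV. (m i j * c j) *s a i)"
    by (simp add: sum_right scale_right act vec.scale_sum_right mult.commute)
  also have "\<dots> = (\<Sum>i\<in>UNIV. (\<Sum>j\<in>UNIV. m i j * c j) *s a i)"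
    by (subst sum.swap) (simp add: vec.scale_sum_left)
  also have "\<dots> = t *s (\<Sum>j\<in>UNIV. c j *s a j)"
    by (simp add: eig vec.scale_sum_right)
  finally have eigv: "y \<diamondop> (\<Sum>j\<in>UNIV. c j *s a j) = t *s (\<Sum>j\<in>UNIV. c j *s a j)" .
  have "(\<Sum>j\<in>UNIV. c j *s a j) \<in> C" by (intro C_sum C_scale a)
  then have "(\<Sum>j\<in>UNIV. c j *s a j) = 0" by (rule noeig[OF y _ t eigv])
  then show "c = (\<lambda>_. 0)" by (rule indep)
qed

lemma charcoeffs_zero4:
  assumes y: "y \<in> C" and a: "a1 \<in> C" "a2 \<in> C" "a3 \<in> C" "a4 \<in> C" and indep: "indep4 a1 a2 a3 a4"
    and act: "y \<diamondop> a1 = m Vx Vx *s a1 + m Vy Vx *s a2 + m Vz Vx *s a3 + m Vw Vx *s a4"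
      "y \<diamondop> a2 = m Vx Vy *s a1 + m Vy Vy *s a2 + m Vz Vy *s a3 + m Vw Vy *s a4"
      "y \<diamondop> a3 = m Vx Vz *s a1 + m Vy Vz *s a2 + m Vz Vz *s a3 + m Vw Vz *s a4"
      "y \<diamondop> a4 = m Vx Vw *s a1 + m Vy Vw *s a2 + m Vz Vw *s a3 + m Vw Vw *s a4"
  shows "charcoeffs m = [0, 0, 0, 0]"
proof (rule charcoeffs_zero[OF y, of "case_idx a1 a2 a3 a4"])
  show "case_idx a1 a2 a3 a4 j \<in> C" for j using a by (cases j) auto
  show "c = (\<lambda>_. 0)" if "(\<Sum>j\<in>UNIV. c j *s case_idx a1 a2 a3 a4 j) = 0" for c
  proof -
    have "c Vx *s a1 + c Vy *s a2 + c Vz *s a3 + c Vw *s a4 = 0"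
      using that unfolding UNIV_idx by (simp add: add.assoc)
    then have "c Vx = 0" "c Vy = 0" "c Vz = 0" "c Vw = 0" using indep unfolding indep4_def by blast+
    then show ?thesis by (intro ext) (metis idx.exhaust)
  qed
  show "y \<diamondop> case_idx a1 a2 a3 a4 j = (\<Sum>i\<in>UNIV. m i j *s case_idx a1 a2 a3 a4 i)" for j
    unfolding UNIV_idx by (cases j) (simp_all add: act add.assoc)
qed

text \<open>
  The element \<open>x\<^sup>3\<close> is annihilated by everything: the algebra is spanned by \<open>x\<close>, \<open>x\<^sup>2\<close>, \<open>x\<^sup>3\<close> and possibly one more
  element \<open>b\<close> with \<open>x b = 0\<close>, and each structure constant that would prevent this leads to a nonzero eigenvalue.
\<close>
lemma annihilator_fourth_zero:
  assumes fourth: "\<And>x. x \<in> C \<Longrightarrow> x \<diamondop> x \<diamondop> x \<diamondop> x = 0" and x: "x \<in> C" and x3: "x \<diamondop> x \<diamondop> x \<noteq> 0"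
  shows "\<exists>v\<in>C. v \<noteq> 0 \<and> (\<forall>u\<in>C. u \<diamondop> v = 0)"
proof -
  define a2 where "a2 = x \<diamondop> x"
  define a3 where "a3 = x \<diamondop> a2"
  have N: "x \<diamondop> x = a2" "x \<diamondop> a2 = a3" "x \<diamondop> a3 = 0" "a2 \<diamondop> x = a3" "a3 \<diamondop> x = 0"
    using fourth[OF x] comm[of a2 x] comm[of a3 x] by (simp_all add: a2_def a3_def)
  have C: "a2 \<in> C" "a3 \<in> C" unfolding a2_def a3_def using x by (auto intro: C_intros)
  have a3: "a3 \<noteq> 0" "x \<noteq> 0" using x3 by (auto simp: a3_def a2_def)
  have indep3: "p = 0 \<and> q = 0 \<and> r = 0" if eq: "p *s x + q *s a2 + r *s a3 = 0" for p q r
  proof -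
    have "x \<diamondop> x \<diamondop> (p *s x + q *s a2 + r *s a3) = 0" unfolding eq by simp
    then have p: "p = 0" using a3 by (simp add: bilinear N)
    have "x \<diamondop> (p *s x + q *s a2 + r *s a3) = 0" unfolding eq by simp
    then have "q = 0" using a3 p by (simp add: bilinear N)
    then show ?thesis using p a3 eq by simp
  qed
  obtain b where b: "b \<in> C" "x \<diamondop> b = 0" "b = 0 \<or> indep4 x a2 a3 b"
    and span: "\<And>v. v \<in> C \<Longrightarrow> \<exists>p q r s. v = p *s x + q *s a2 + r *s a3 + s *s b"
  proof (cases "\<forall>v\<in>C. \<exists>p q r. v = p *s x + q *s a2 + r *s a3")
    case True
    show ?thesis by (rule that[of 0]) (use True C_0 in auto)
  next
    case False
    then obtain b0 where b0: "b0 \<in> C" "\<And>p q r. b0 \<noteq> p *s x + q *s a2 + r *s a3" by blast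
    have ind0: "indep4 x a2 a3 b0"
      unfolding indep4_def
    proof (intro allI impI)
      fix p q r s assume "p *s x + q *s a2 + r *s a3 + s *s b0 = 0"
      then have eq: "s *s b0 + (p *s x + q *s a2 + r *s a3) = 0" by (simp add: add_ac)
      have "s = 0"
      proof (rule ccontr)
        assume "s \<noteq> 0"
        from solve_for[OF eq this] have "b0 = (- p / s) *s x + (- q / s) *s a2 + (- r / s) *s a3"
          by (simp add: vec.scale_right_distrib)
        then show False using b0(2) by blast
      qed
      then show "p = 0 \<and> q = 0 \<and> r = 0 \<and> s = 0" using eq indep3 by simp
    qed
    obtain \<beta>1 \<beta>2 \<beta>3 \<beta>4 where be: "x \<diamondop> b0 = \<beta>1 *s x + \<beta>2 *s a2 + \<beta>3 *s a3 + \<beta>4 *s b0"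
      using indep4_spans[OF ind0] by blast
    have "charcoeffs (case_idx (case_idx 0 0 0 \<beta>1) (case_idx 1 0 0 \<beta>2) (case_idx 0 1 0 \<beta>3) (case_idx 0 0 0 \<beta>4)) = [0, 0, 0, 0]"
      by (rule charcoeffs_zero4[OF x x C b0(1) ind0]) (simp_all add: N be)
    then have b4: "\<beta>4 = 0" by (simp add: charcoeffs_def)
    define b where "b = b0 - \<beta>2 *s x - \<beta>3 *s a2"
    have xb: "x \<diamondop> b = \<beta>1 *s x" by (simp add: b_def bilinear be N b4)
    have bC: "b \<in> C" unfolding b_def using b0 x C by (auto intro: C_intros)
    have "\<beta>1 = 0" using noeig[OF bC x, of \<beta>1] xb comm[of b x] a3 by auto
    then have xb0: "x \<diamondop> b = 0" using xb by simp
    have ind: "indep4 x a2 a3 b" unfolding indep4_def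
    proof (intro allI impI)
      fix p q r s assume "p *s x + q *s a2 + r *s a3 + s *s b = 0"
      then have "(p - s * \<beta>2) *s x + (q - s * \<beta>3) *s a2 + r *s a3 + s *s b0 = 0"
        by (simp add: b_def vec.scale_left_diff_distrib vec.scale_right_diff_distrib algebra_simps)
      then have "p - s * \<beta>2 = 0 \<and> q - s * \<beta>3 = 0 \<and> r = 0 \<and> s = 0" using ind0 unfolding indep4_def by blast
      then show "p = 0 \<and> q = 0 \<and> r = 0 \<and> s = 0" by auto
    qed
    show ?thesis by (rule that[OF bC xb0]) (use ind indep4_spans[OF ind] in auto)
  qed
  have bx: "b \<diamondop> x = 0" using b(2) comm by metis
  have N3: "x \<diamondop> x \<diamondop> x \<diamondop> v = 0" if "v \<in> C" for v
    using span[OF that] by (auto simp: bilinear N b(2))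
  have lin: "y \<diamondop> a3 = - (x \<diamondop> y \<diamondop> a2)" if "y \<in> C" for y
  proof -
    have "pwc x y 3 1 = 0" by (rule linearize) (use fourth x that in \<open>auto simp: numeral_3_eq_3\<close>)
    then have "x \<diamondop> (x \<diamondop> (x \<diamondop> y + y \<diamondop> x) + y \<diamondop> a2) + y \<diamondop> a3 = 0"
      by (simp add: numeral_3_eq_3 a2_def a3_def)
    then have "x \<diamondop> y \<diamondop> a2 + y \<diamondop> a3 = 0" unfolding comm[of y x] add_right N3[OF that] by simp
    then show ?thesis by (simp add: add_eq_0_iff2 add.commute)
  qed
  obtain p1 p2 p3 p4 where P: "a2 \<diamondop> a2 = p1 *s x + p2 *s a2 + p3 *s a3 + p4 *s b"
    using span closed[OF C(1) C(1)] by blast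
  have a23: "a2 \<diamondop> a3 = - (p1 *s a2 + p2 *s a3)" unfolding lin[OF C(1)] P by (simp add: bilinear N b(2))
  have "a3 \<diamondop> a3 = p1 *s a3" unfolding lin[OF C(2)] comm[of a3 a2] a23 by (simp add: bilinear N)
  then have p1: "p1 = 0" "a3 \<diamondop> a3 = 0" using noeig[OF C(2) C(2), of p1] a3 by auto
  have "a2 \<diamondop> a3 = (- p2) *s a3" using a23 p1 by simp
  then have p2: "p2 = 0" "a2 \<diamondop> a3 = 0" "a3 \<diamondop> a2 = 0"
    using noeig[OF C(1,2), of "- p2"] a3 comm[of a3 a2] by auto
  obtain u1 u2 u3 u4 where U: "a2 \<diamondop> b = u1 *s x + u2 *s a2 + u3 *s a3 + u4 *s b"
    using span closed[OF C(1) b(1)] by blast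
  have ba3: "b \<diamondop> a3 = - (u1 *s a2 + u2 *s a3)" unfolding lin[OF b(1)] comm[of b a2] U by (simp add: bilinear N b(2))
  have "b \<diamondop> a3 = 0"
  proof (cases "b = 0")
    case False
    then have ind: "indep4 x a2 a3 b" using b(3) by blast
    obtain w1 w2 w3 w4 where W: "b \<diamondop> b = w1 *s x + w2 *s a2 + w3 *s a3 + w4 *s b"
      using span closed[OF b(1) b(1)] by blast
    note tab = N b(2) bx p1 p2 P U W comm[of b a2] ba3
    note ch = charcoeffs_zero4[OF _ x C b(1) ind]
    have "charcoeffs (case_idx (case_idx 0 0 0 u1) (case_idx 0 0 0 u2) (case_idx 1 p3 0 u3) (case_idx 0 p4 0 u4)) = [0, 0, 0, 0]"
      by (rule ch[OF C(1)]) (simp_all add: tab)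
    then have u4: "u4 = 0" "p4 * u2 = 0" by (auto simp: charcoeffs_def)
    have "charcoeffs (case_idx (case_idx 0 0 0 u1) (case_idx 1 0 0 u2) (case_idx 1 (1 + p3) 0 u3) (case_idx 0 p4 0 u4)) = [0, 0, 0, 0]"
      by (rule ch[of "x + a2"]) (use x C in \<open>simp_all add: tab bilinear C_add vec.scale_left_distrib\<close>)
    then have p4: "p4 * u1 = 0" using u4 by (auto simp: charcoeffs_def)
    have u1: "u1 = 0"
    proof (rule ccontr)
      assume u1: "u1 \<noteq> 0"
      then have p4: "p4 = 0" using p4 by simp
      have "charcoeffs (case_idx (case_idx 0 u1 0 (u1 + w1)) (case_idx 0 u2 (- u1) (u2 + w2)) (case_idx 1 (p3 + u3) (- u2) (u3 + w3)) (case_idx 0 0 0 w4)) = [0, 0, 0, 0]"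
        by (rule ch[of "a2 + b"])
          (use C b in \<open>simp_all add: tab p4 u4 bilinear C_add vec.scale_left_distrib algebra_simps\<close>)
      then have "w4 = 0 \<and> u1 * u1 = 0" by (auto simp: charcoeffs_def)
      then show False using u1 by simp
    qed
    then have "b \<diamondop> a3 = (- u2) *s a3" using ba3 by simp
    then show ?thesis using noeig[OF b(1) C(2), of "- u2"] a3 by auto
  qed simp
  then have "\<forall>u\<in>C. u \<diamondop> a3 = 0" using span by (fastforce simp: bilinear N p1 p2)
  then show ?thesis using C(2) a3 by blast
qed

text \<open>
  The powers of \<open>x\<close> form a basis, and linearizing the vanishing of fifth powers expresses the products with \<open>x\<^sup>4\<close>
  through those of \<open>x\<^sup>2\<close> and \<open>x\<^sup>3\<close>.
\<close>
lemma regular_multiplication_table: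
  assumes x: "x \<in> C" and x4: "x \<diamondop> x \<diamondop> x \<diamondop> x \<noteq> 0"
  defines "a2 \<equiv> x \<diamondop> x" and "a3 \<equiv> x \<diamondop> x \<diamondop> x" and "a4 \<equiv> x \<diamondop> x \<diamondop> x \<diamondop> x"
  obtains p1 p2 p3 p4 q1 q2 q3 q4 r1 r2 r3 r4 where
    "a3 \<diamondop> a3 = r1 *s x + r2 *s a2 + r3 *s a3 + r4 *s a4"
    "a2 \<diamondop> a4 = - (q1 *s a2 + (q2 + p1) *s a3 + (q3 + p2) *s a4)"
    "a3 \<diamondop> a4 = - (r1 *s a2 + (r2 + q1) *s a3 + (r3 + q2) *s a4)"
    "a4 \<diamondop> a4 = r1 *s a3 + (r2 + 2 * q1) *s a4"
    "x \<diamondop> a4 = 0" "indep4 x a2 a3 a4"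
    "\<And>\<alpha> \<beta> \<gamma> \<delta>. charcoeffs (regular_matrix p1 p2 p3 p4 q1 q2 q3 q4 r1 r2 r3 r4 \<alpha> \<beta> \<gamma> \<delta>) = [0, 0, 0, 0]"
proof -
  have N: "x \<diamondop> x = a2" "x \<diamondop> a2 = a3" "x \<diamondop> a3 = a4" "x \<diamondop> a4 = 0" "a2 \<diamondop> x = a3" "a3 \<diamondop> x = a4" "a4 \<diamondop> x = 0"
    using nilpotent[OF x x] comm[of a2 x] comm[of a3 x] comm[of a4 x] by (simp_all add: a2_def a3_def a4_def)
  have C: "a2 \<in> C" "a3 \<in> C" "a4 \<in> C" unfolding a2_def a3_def a4_def using x by (auto intro: C_intros)
  have a4: "a4 \<noteq> 0" using x4 by (simp add: a4_def)
  have ind: "indep4 x a2 a3 a4" unfolding indep4_def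
  proof (intro allI impI)
    fix p q r s assume eq: "p *s x + q *s a2 + r *s a3 + s *s a4 = 0"
    have "x \<diamondop> x \<diamondop> x \<diamondop> (p *s x + q *s a2 + r *s a3 + s *s a4) = 0" unfolding eq by simp
    then have p: "p = 0" using a4 by (simp add: bilinear N)
    have "x \<diamondop> x \<diamondop> (p *s x + q *s a2 + r *s a3 + s *s a4) = 0" unfolding eq by simp
    then have q: "q = 0" using a4 p by (simp add: bilinear N)
    have "x \<diamondop> (p *s x + q *s a2 + r *s a3 + s *s a4) = 0" unfolding eq by simp
    then have "r = 0" using a4 p q by (simp add: bilinear N)
    then show "p = 0 \<and> q = 0 \<and> r = 0 \<and> s = 0" using p q a4 eq by simp
  qed
  have lin: "y \<diamondop> a4 = - (x \<diamondop> y \<diamondop> a3) - (x \<diamondop> x \<diamondop> y \<diamondop> a2)" if "y \<in> C" for y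
  proof -
    have "pwc x y 4 1 = 0"
      by (rule linearize) (use nilpotent x that in \<open>auto simp: eval_nat_numeral\<close>)
    then have "x \<diamondop> (x \<diamondop> (x \<diamondop> (x \<diamondop> y + y \<diamondop> x) + y \<diamondop> a2) + y \<diamondop> a3) + y \<diamondop> a4 = 0"
      by (simp add: eval_nat_numeral a2_def a3_def a4_def)
    then have "x \<diamondop> x \<diamondop> y \<diamondop> a2 + x \<diamondop> y \<diamondop> a3 + y \<diamondop> a4 = 0"
      unfolding comm[of y x] add_right nilpotent[OF x that] by simp
    then show ?thesis by (simp add: eq_neg_iff_add_eq_0 algebra_simps)
  qed
  obtain p1 p2 p3 p4 where P: "a2 \<diamondop> a2 = p1 *s x + p2 *s a2 + p3 *s a3 + p4 *s a4" using indep4_spans[OF ind] by blast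
  obtain q1 q2 q3 q4 where Q: "a2 \<diamondop> a3 = q1 *s x + q2 *s a2 + q3 *s a3 + q4 *s a4" using indep4_spans[OF ind] by blast
  obtain r1 r2 r3 r4 where R: "a3 \<diamondop> a3 = r1 *s x + r2 *s a2 + r3 *s a3 + r4 *s a4" using indep4_spans[OF ind] by blast
  have S: "a2 \<diamondop> a4 = - (q1 *s a2 + (q2 + p1) *s a3 + (q3 + p2) *s a4)"
    unfolding lin[OF C(1)] P Q by (simp add: bilinear N vec.scale_left_distrib algebra_simps)
  have T: "a3 \<diamondop> a4 = - (r1 *s a2 + (r2 + q1) *s a3 + (r3 + q2) *s a4)"
    unfolding lin[OF C(2)] comm[of a3 a2] Q R by (simp add: bilinear N vec.scale_left_distrib algebra_simps)
  have U: "a4 \<diamondop> a4 = r1 *s a3 + (r2 + 2 * q1) *s a4"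
    unfolding lin[OF C(3)] comm[of a4 a2] comm[of a4 a3] S T
    by (simp add: bilinear N) (simp add: vec_eq_iff algebra_simps)
  note tab = N P Q R S T U comm[of a3 a2] comm[of a4 a2] comm[of a4 a3]
  have "charcoeffs (regular_matrix p1 p2 p3 p4 q1 q2 q3 q4 r1 r2 r3 r4 \<alpha> \<beta> \<gamma> \<delta>) = [0, 0, 0, 0]" for \<alpha> \<beta> \<gamma> \<delta>
    by (rule charcoeffs_zero4[of "\<alpha> *s x + \<beta> *s a2 + \<gamma> *s a3 + \<delta> *s a4", OF _ x C ind])
      (use x C in \<open>auto intro!: C_intros simp: regular_matrix_def bilinear tab vec.scale_left_distrib
        vec.scale_left_diff_distrib vec.scale_right_distrib vec.scale_right_diff_distrib algebra_simps\<close>)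
  then show ?thesis using that[OF R S T U N(4) ind] by blast
qed

text \<open>
  The element \<open>x\<^sup>4\<close> is annihilated by everything. The essential point is \<open>r1 = 0\<close>, and otherwise \<open>r1\<close> could be normalized to 1.
\<close>
lemma annihilator_regular:
  assumes x: "x \<in> C" and x4: "x \<diamondop> x \<diamondop> x \<diamondop> x \<noteq> 0"
  shows "\<exists>v\<in>C. v \<noteq> 0 \<and> (\<forall>u\<in>C. u \<diamondop> v = 0)"
proof -
  define a2 where "a2 = x \<diamondop> x"
  define a3 where "a3 = x \<diamondop> x \<diamondop> x"
  define a4 where "a4 = x \<diamondop> x \<diamondop> x \<diamondop> x"
  obtain p1 p2 p3 p4 q1 q2 q3 q4 r1 r2 r3 r4 where
    R: "a3 \<diamondop> a3 = r1 *s x + r2 *s a2 + r3 *s a3 + r4 *s a4"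
    and S: "a2 \<diamondop> a4 = - (q1 *s a2 + (q2 + p1) *s a3 + (q3 + p2) *s a4)"
    and T: "a3 \<diamondop> a4 = - (r1 *s a2 + (r2 + q1) *s a3 + (r3 + q2) *s a4)"
    and U: "a4 \<diamondop> a4 = r1 *s a3 + (r2 + 2 * q1) *s a4" and xa4: "x \<diamondop> a4 = 0" and ind: "indep4 x a2 a3 a4"
    and ch: "\<And>\<alpha> \<beta> \<gamma> \<delta>. charcoeffs (regular_matrix p1 p2 p3 p4 q1 q2 q3 q4 r1 r2 r3 r4 \<alpha> \<beta> \<gamma> \<delta>) = [0, 0, 0, 0]"
    using regular_multiplication_table[OF x x4] unfolding a2_def a3_def a4_def by metis
  have r1: "r1 = 0"
  proof (rule ccontr)
    assume r1: "r1 \<noteq> 0"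
    \<comment> \<open>replacing \<open>x\<close> by \<open>k x\<close> multiplies \<open>r1\<close> by \<open>k ^ 5\<close>\<close>
    obtain k where k: "k ^ 5 = 1 / r1" using nth_root_exists[of 5 "1 / r1"] by auto
    have k0: "k \<noteq> 0" using k r1 by auto
    let ?x = "k *s x"
    have x': "?x \<in> C" using x by (rule C_scale)
    have pows: "?x \<diamondop> ?x = k ^ 2 *s a2" "?x \<diamondop> ?x \<diamondop> ?x = k ^ 3 *s a3" "?x \<diamondop> ?x \<diamondop> ?x \<diamondop> ?x = k ^ 4 *s a4"
      by (simp_all add: bilinear a2_def a3_def a4_def eval_nat_numeral mult_ac)
    have "?x \<diamondop> ?x \<diamondop> ?x \<diamondop> ?x \<noteq> 0" unfolding pows(3) using k0 x4 by (simp add: a4_def)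
    from regular_multiplication_table[OF x' this, unfolded pows(3), unfolded pows(2), unfolded pows(1)]
    obtain p1' p2' p3' p4' q1' q2' q3' q4' r1' r2' r3' r4' where
      R': "(k ^ 3 *s a3) \<diamondop> (k ^ 3 *s a3) = r1' *s (k *s x) + r2' *s (k ^ 2 *s a2) + r3' *s (k ^ 3 *s a3) + r4' *s (k ^ 4 *s a4)"
      and ch': "\<And>\<alpha> \<beta> \<gamma> \<delta>. charcoeffs (regular_matrix p1' p2' p3' p4' q1' q2' q3' q4' r1' r2' r3' r4' \<alpha> \<beta> \<gamma> \<delta>) = [0, 0, 0, 0]"
      by metis
    have "(k ^ 6 * r1 - r1' * k) *s x + (k ^ 6 * r2 - r2' * k ^ 2) *s a2 + (k ^ 6 * r3 - r3' * k ^ 3) *s a3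
      + (k ^ 6 * r4 - r4' * k ^ 4) *s a4 = (k ^ 3 *s a3) \<diamondop> (k ^ 3 *s a3)
        - (r1' *s (k *s x) + r2' *s (k ^ 2 *s a2) + r3' *s (k ^ 3 *s a3) + r4' *s (k ^ 4 *s a4))"
      by (simp add: bilinear R vec.scale_left_diff_distrib vec.scale_right_distrib algebra_simps flip: power_add)
    then have "(k ^ 6 * r1 - r1' * k) *s x + (k ^ 6 * r2 - r2' * k ^ 2) *s a2 + (k ^ 6 * r3 - r3' * k ^ 3) *s a3
      + (k ^ 6 * r4 - r4' * k ^ 4) *s a4 = 0" unfolding R' by simp
    then have "k ^ 6 * r1 - r1' * k = 0" using ind unfolding indep4_def by blast
    then have "k * (k ^ 5 * r1) = k * r1'" by (simp add: eval_nat_numeral mult_ac)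
    then have "r1' = 1" using k0 k r1 by simp
    then show False using regular_matrix_not_nilpotent[OF ch'] by blast
  qed
  have z: "p1 = 0 \<and> p2 = 0 \<and> q1 = 0 \<and> q2 = 0 \<and> q3 = 0 \<and> r2 = 0 \<and> r3 = 0"
    by (rule regular_matrix_nilpotent[OF ch r1])
  have "u \<diamondop> a4 = 0" for u
  proof -
    obtain p q r s where "u = p *s x + q *s a2 + r *s a3 + s *s a4" using indep4_spans[OF ind] by blast
    then show ?thesis using z r1 by (simp add: bilinear xa4 S T U)
  qed
  moreover have "a4 \<in> C" "a4 \<noteq> 0" using x x4 unfolding a4_def by (auto intro: C_intros)
  ultimately show ?thesis by blast
qed

text \<open>
  A nonvanishing left power of maximal order is annihilated by everything. If all squares vanish, then so do all
  products, by polarization.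
\<close>
theorem annihilator_exists:
  assumes "v \<in> C" "v \<noteq> 0" shows "\<exists>v\<in>C. v \<noteq> 0 \<and> (\<forall>u\<in>C. u \<diamondop> v = 0)"
proof -
  consider x where "x \<in> C" "x \<diamondop> x \<diamondop> x \<diamondop> x \<noteq> 0"
    | x where "\<forall>x\<in>C. x \<diamondop> x \<diamondop> x \<diamondop> x = 0" "x \<in> C" "x \<diamondop> x \<diamondop> x \<noteq> 0"
    | x where "\<forall>x\<in>C. x \<diamondop> x \<diamondop> x = 0" "x \<in> C" "x \<diamondop> x \<noteq> 0"
    | "\<forall>x\<in>C. x \<diamondop> x = 0" by blast
  then show ?thesis
  proof cases
    case 1
    then show ?thesis using annihilator_regular by blast
  next
    case 2
    then show ?thesis using annihilator_fourth_zero by blast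
  next
    case 3
    then show ?thesis using annihilator_cube_zero[of x] closed[of x x] by blast
  next
    case 4
    have "u \<diamondop> v = 0" if "u \<in> C" for u
    proof -
      have "(u + v) \<diamondop> (u + v) = 0" using 4 that assms(1) C_add by blast
      then have "2 *s (u \<diamondop> v) = 0" using 4 that assms(1) by (simp add: bilinear comm[of v u] vec.scale_left_distrib[of 1 1, simplified])
      then show ?thesis using two by simp
    qed
    then show ?thesis using assms by blast
  qed
qed

end

section \<open>Flags of functionals\<close>

definition pairing :: "'k::field ^ idx \<Rightarrow> 'k ^ idx \<Rightarrow> 'k"
  where "pairing g v = (\<Sum>i\<in>UNIV. vec_nth g i * vec_nth v i)"

lemma pairing_add: "pairing (g + g') v = pairing g v + pairing g' v" "pairing g (v + v') = pairing g v + pairing g v'"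
  and pairing_scale: "pairing (c *s g) v = c * pairing g v" "pairing g (c *s v) = c * pairing g v"
  and pairing_0: "pairing 0 v = 0" "pairing g 0 = 0"
  and pairing_diff: "pairing (g - g') v = pairing g v - pairing g' v" "pairing g (v - v') = pairing g v - pairing g v'"
  and pairing_minus: "pairing (- g) v = - pairing g v" "pairing g (- v) = - pairing g v"
  and pairing_commute: "pairing g v = pairing v g"
  by (simp_all add: pairing_def UNIV_idx algebra_simps)

lemma pairing_sum: "pairing (sum f I) v = (\<Sum>i\<in>I. pairing (f i) v)" "pairing g (sum f I) = (\<Sum>i\<in>I. pairing g (f i))"
  by (induction I rule: infinite_finite_induct) (simp_all add: pairing_add pairing_0)

lemmas pairing_simps = pairing_add pairing_scale pairing_0 pairing_diff pairing_minus pairing_sum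

definition indep :: "(idx \<Rightarrow> 'k::field ^ idx) \<Rightarrow> bool"
  where "indep a \<longleftrightarrow> (\<forall>c. (\<Sum>j\<in>UNIV. c j *s a j) = 0 \<longrightarrow> (\<forall>j. c j = 0))"

lemma indep_dual_basis:
  assumes "indep a"
  obtains n where "\<And>j k. pairing (n j) (a k) = (if j = k then 1 else 0)"
    "\<And>v. (\<Sum>j\<in>UNIV. pairing (n j) v *s a j) = v" "\<And>v. (\<Sum>j\<in>UNIV. pairing (a j) v *s n j) = v"
proof -
  define M where "M = (\<chi> i j. vec_nth (a j) i)"
  have Mv: "M *v c = (\<Sum>j\<in>UNIV. vec_nth c j *s a j)" for c
    by (simp add: M_def vec_eq_iff matrix_vector_mult_def UNIV_idx mult.commute)
  have "\<forall>c. M *v c = 0 \<longrightarrow> c = 0"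
  proof (intro allI impI)
    fix c assume "M *v c = 0"
    then have "\<forall>j. vec_nth c j = 0" using assms unfolding Mv indep_def by blast
    then show "c = 0" by (simp add: vec_eq_iff)
  qed
  then obtain N where N: "N ** M = mat 1" unfolding matrix_left_invertible_ker[symmetric] by blast
  then have N': "M ** N = mat 1" by (simp add: matrix_left_right_inverse)
  have e: "(\<Sum>k\<in>UNIV. vec_nth (vec_nth M i) k * vec_nth (vec_nth N k) j) = (if i = j then 1 else 0)" for i j
  proof -
    have "vec_nth (vec_nth (M ** N) i) j = (if i = j then 1 else 0)" unfolding N' by (simp add: mat_def)
    then show ?thesis by (simp add: matrix_matrix_mult_def)
  qed
  show ?thesis
  proof (rule that[of "vec_nth N"])
    fix j k
    have "vec_nth (vec_nth (N ** M) j) k = (if j = k then 1 else 0)" unfolding N by (simp add: mat_def)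
    then show "pairing (vec_nth N j) (a k) = (if j = k then 1 else 0)"
      by (simp add: matrix_matrix_mult_def pairing_def M_def)
  next
    fix v
    have "vec_nth (\<Sum>j\<in>UNIV. pairing (vec_nth N j) v *s a j) i = vec_nth v i" for i
    proof -
      have "vec_nth (\<Sum>j\<in>UNIV. pairing (vec_nth N j) v *s a j) i
        = (\<Sum>k\<in>UNIV. (\<Sum>j\<in>UNIV. vec_nth (vec_nth M i) j * vec_nth (vec_nth N j) k) * vec_nth v k)"
        by (simp add: sum_component pairing_def M_def UNIV_idx algebra_simps)
      also have "\<dots> = (\<Sum>k\<in>UNIV. if i = k then vec_nth v k else 0)" unfolding e by (intro sum.cong refl) simp
      finally show ?thesis by simp
    qed
    then show "(\<Sum>j\<in>UNIV. pairing (vec_nth N j) v *s a j) = v" by (simp add: vec_eq_iff)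
  next
    fix v
    have "vec_nth (\<Sum>j\<in>UNIV. pairing (a j) v *s vec_nth N j) i = vec_nth v i" for i
    proof -
      have "vec_nth (\<Sum>j\<in>UNIV. pairing (a j) v *s vec_nth N j) i
        = (\<Sum>k\<in>UNIV. (\<Sum>j\<in>UNIV. vec_nth (vec_nth M k) j * vec_nth (vec_nth N j) i) * vec_nth v k)"
        by (simp add: sum_component pairing_def M_def UNIV_idx algebra_simps)
      also have "\<dots> = (\<Sum>k\<in>UNIV. if k = i then vec_nth v k else 0)" unfolding e by (intro sum.cong refl) simp
      finally show ?thesis by simp
    qed
    then show "(\<Sum>j\<in>UNIV. pairing (a j) v *s vec_nth N j) = v" by (simp add: vec_eq_iff)
  qed
qed

lemma common_zero:
  fixes e1 :: "'k::field ^ idx"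
  shows "\<exists>u. u \<noteq> 0 \<and> pairing u e1 = 0 \<and> pairing u e2 = 0 \<and> pairing u e3 = 0"
proof -
  define M where "M = (\<chi> i j. vec_nth (case_idx e1 e2 e3 0 i) j)"
  have Mv: "vec_nth (M *v c) i = pairing c (case_idx e1 e2 e3 0 i)" for c i
    by (simp add: M_def matrix_vector_mult_def pairing_def mult.commute)
  have "\<not> invertible M"
  proof
    assume "invertible M"
    then obtain N where "M ** N = mat 1" unfolding invertible_def by blast
    then have "M *v (N *v axis Vw 1) = axis Vw 1" by (simp add: matrix_vector_mul_assoc)
    then have "vec_nth (M *v (N *v axis Vw 1)) Vw = 1" by (simp add: axis_def)
    then show False unfolding Mv by (simp add: pairing_0)
  qed
  then have "\<not> (\<forall>x. M *v x = 0 \<longrightarrow> x = 0)"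
    unfolding matrix_left_invertible_ker[symmetric] invertible_left_inverse .
  then obtain u where u: "M *v u = 0" "u \<noteq> 0" by blast
  then have "pairing u (case_idx e1 e2 e3 0 i) = 0" for i using Mv[of u i] by simp
  from this[of Vx] this[of Vy] this[of Vz] show ?thesis using u(2) by auto
qed

lemma linear_pairing_representation:
  assumes "Vector_Spaces.linear (*s) (*s) f"
  shows "pairing (\<chi> i. pairing g (f (axis i 1))) v = pairing g (f v)"
proof -
  have "v = (\<Sum>i\<in>UNIV. vec_nth v i *s axis i 1)" unfolding UNIV_idx by (simp add: vec_eq_iff all_idx axis_def)
  then have "pairing g (f v) = pairing g (f (\<Sum>i\<in>UNIV. vec_nth v i *s axis i 1))" by simp
  also have "\<dots> = (\<Sum>i\<in>UNIV. vec_nth v i * pairing g (f (axis i 1)))"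
    by (simp add: vec.linear_sum[OF assms] vec.linear_scale[OF assms] pairing_simps)
  finally show ?thesis by (simp add: pairing_def[of "\<chi> i. _ i"] mult.commute)
qed

lemma pairing_eqI: "(\<And>v. pairing g v = pairing g' v) \<Longrightarrow> g = g'"
proof -
  assume *: "\<And>v. pairing g v = pairing g' v"
  have "pairing h (axis i 1) = vec_nth h i" for h :: "'a ^ idx" and i
    by (cases i) (simp_all add: pairing_def UNIV_idx axis_def)
  then show ?thesis using * by (metis vec_eq_iff)
qed

definition num :: "idx \<Rightarrow> nat"
  where "num = case_idx 0 1 2 3"

lemma num_simps [simp]: "num Vx = 0" "num Vy = 1" "num Vz = 2" "num Vw = 3"
  by (simp_all add: num_def)

context eigenfree_algebra begin

text \<open>
  An annihilating element of the quotient by \<open>U\<close>, which is realized as the range of a projection with kernel \<open>U\<close>.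
  Eigenvalues of the quotient are excluded by nilpotency.
\<close>
lemma invariant_subspace_step:
  assumes U: "vec.subspace U" "U \<subseteq> C" "\<And>u v. u \<in> C \<Longrightarrow> v \<in> U \<Longrightarrow> u \<diamondop> v \<in> U" and w: "w \<notin> U" and C: "C = UNIV"
  shows "\<exists>v. v \<notin> U \<and> (\<forall>u. u \<diamondop> v \<in> U)"
proof -
  obtain B where B: "B \<subseteq> U" "vec.independent B" "U \<subseteq> vec.span B"
    using vec.maximal_independent_subset[of U] by blast
  define P where "P = vec.construct B id"
  have lin: "Vector_Spaces.linear (*s) (*s) P" unfolding P_def by (rule vec.linear_construct[OF B(2)])
  have PU: "P v \<in> U" for v
  proof -
    have "P v \<in> vec.span (id ` B)" unfolding P_def by (rule vec.construct_in_span[OF B(2)])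
    then show ?thesis using vec.span_minimal[OF B(1) U(1)] by auto
  qed
  have Pid: "P v = v" if "v \<in> U" for v
  proof -
    have "P v = id v"
    proof (rule vec.linear_eq_on[OF lin vec.linear_id])
      show "v \<in> vec.span B" using that B(3) by blast
      show "P b = id b" if "b \<in> B" for b using that unfolding P_def by (simp add: vec.construct_basis[OF B(2)])
    qed
    then show ?thesis by simp
  qed
  define p where "p v = v - P v" for v
  have p_lin: "p (u + v) = p u + p v" "p (c *s v) = c *s p v" for u v c
    by (simp_all add: p_def vec.linear_add[OF lin] vec.linear_scale[OF lin] vec.scale_right_diff_distrib)
  have p0: "p v = 0 \<longleftrightarrow> v \<in> U" for v using PU[of v] Pid[of v] by (auto simp: p_def)
  have pp: "p (p v) = p v" for v using PU[of v] Pid[of "P v"] by (simp add: p_def vec.linear_diff[OF lin])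
  have pU: "v - p v \<in> U" for v using PU by (simp add: p_def)
  have p0': "p 0 = 0" using p_lin(2)[of 0 0] by simp
  interpret q: eigenfree_algebra "range p" "\<lambda>u v. p (u \<diamondop> v)"
  proof
    show "vec.subspace (range p)" unfolding vec.subspace_def
      by (auto simp flip: p_lin intro: rev_image_eqI[of 0] simp: p0')
    fix u v and c :: 'k
    assume uv: "u \<in> range p" "v \<in> range p" "c \<noteq> 0" "p (u \<diamondop> v) = c *s v"
    have pv: "p v = v" using uv(2) pp by auto
    have "p (u \<diamondop> v - c *s v) = 0"
      using uv(4) pv p_lin(1)[of "u \<diamondop> v" "- (c *s v)"] p_lin(2)[of "-c" v] by simp
    then have e: "u \<diamondop> v - c *s v \<in> U" by (simp add: p0)
    \<comment> \<open>multiplication by \<open>u\<close> acts on the quotient by \<open>U\<close> as the nonzero scalar \<open>c\<close>, yet it is nilpotent\<close>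
    have step: "u \<diamondop> x - d * c *s v \<in> U" if "x - d *s v \<in> U" for x d
    proof -
      have "u \<diamondop> (x - d *s v) \<in> U" using U(3) that C by blast
      then have "u \<diamondop> (x - d *s v) + d *s (u \<diamondop> v - c *s v) \<in> U"
        using e U(1) by (intro vec.subspace_add vec.subspace_scale) auto
      then show ?thesis by (simp add: bilinear vec.scale_right_diff_distrib)
    qed
    have "u \<diamondop> u \<diamondop> u \<diamondop> u \<diamondop> v - 1 * c * c * c * c *s v \<in> U"
      by (intro step) (simp add: vec.subspace_0[OF U(1)])
    then have "- (c * c * c * c) *s v \<in> U" using nilpotent[of u v] C by simp
    then have "(- 1 / (c * c * c * c)) *s (- (c * c * c * c) *s v) \<in> U" by (rule vec.subspace_scale[OF U(1)])
    moreover have "(- 1 / (c * c * c * c)) *s (- (c * c * c * c) *s v) = v" using uv(3) by simp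
    ultimately have "v \<in> U" by metis
    then show "v = 0" using pv p0 by metis
  qed (auto simp: p_lin bilinear comm two)
  have "p w \<in> range p" "p w \<noteq> 0" using w p0 by auto
  from q.annihilator_exists[OF this] obtain v where v: "v \<in> range p" "v \<noteq> 0" "\<forall>u\<in>range p. p (u \<diamondop> v) = 0" by blast
  have pv: "p v = v" using v(1) pp by auto
  then have "v \<notin> U" using v(2) p0 by metis
  moreover have "u \<diamondop> v \<in> U" for u
  proof -
    have "p u \<diamondop> v \<in> U" using v(3) p0 by blast
    moreover have "(u - p u) \<diamondop> v \<in> U" using U(3)[of v "u - p u"] pU C comm[of v] by simp
    ultimately have "p u \<diamondop> v + (u - p u) \<diamondop> v \<in> U" by (rule vec.subspace_add[OF U(1)])
    then show ?thesis by (simp add: diff_left)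
  qed
  ultimately show ?thesis by blast
qed

text \<open>
  The quadratic part of each functional depends only on the preceding functionals.
\<close>
definition flagged :: "(idx \<Rightarrow> 'k ^ idx) \<Rightarrow> bool"
  where "flagged t \<longleftrightarrow> indep t \<and> (\<forall>p u v. (\<forall>i. num i < num p \<longrightarrow> pairing (t i) u = 0) \<longrightarrow> pairing (t p) (u \<diamondop> v) = 0)"

lemma flag_exists:
  assumes C: "C = UNIV" shows "\<exists>t. flagged t"
proof -
  have card4: "CARD(idx) = 4" unfolding UNIV_idx by simp
  have step: "\<exists>b. b \<notin> vec.span S \<and> (\<forall>u. u \<diamondop> b \<in> vec.span S)"
    if S: "finite S" "card S < 4" "\<And>u v. v \<in> S \<Longrightarrow> u \<diamondop> v \<in> vec.span S" for S
  proof -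
    have "vec.span S \<noteq> UNIV"
    proof
      assume "vec.span S = UNIV"
      then have "CARD(idx) = vec.dim S" using vec.dim_span[of S] vec_dim_card[where 'n = idx and 'a = 'k] by metis
      then have "CARD(idx) \<le> card S" using vec.dim_le_card'[OF S(1)] by metis
      then show False using S(2) card4 by simp
    qed
    then obtain w where w: "w \<notin> vec.span S" by blast
    have inv: "u \<diamondop> v \<in> vec.span S" if "v \<in> vec.span S" for u v
      using that
    proof (induction rule: vec.span_induct_alt)
      case (step c x y)
      then show ?case using S(3) by (auto simp: bilinear intro!: vec.span_add vec.span_scale)
    qed (simp add: vec.span_zero)
    show ?thesis by (rule invariant_subspace_step[OF vec.subspace_span _ inv w C]) (use C in auto)
  qed
  obtain b0 where b0: "b0 \<notin> vec.span {}" "\<And>u. u \<diamondop> b0 \<in> vec.span {}" using step[of "{}"] by auto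
  have S1: "u \<diamondop> b0 \<in> vec.span {b0}" for u using b0(2)[of u] vec.span_mono[of "{}" "{b0}"] by blast
  obtain b1 where b1: "b1 \<notin> vec.span {b0}" "\<And>u. u \<diamondop> b1 \<in> vec.span {b0}" using step[of "{b0}"] S1 by auto
  have S2: "u \<diamondop> v \<in> vec.span {b1, b0}" if "v \<in> {b1, b0}" for u v
    using that S1[of u] b1(2)[of u] vec.span_mono[of "{b0}" "{b1, b0}"] by blast
  obtain b2 where b2: "b2 \<notin> vec.span {b1, b0}" "\<And>u. u \<diamondop> b2 \<in> vec.span {b1, b0}"
    using step[OF _ _ S2] card_length[of "[b1, b0]"] by auto
  have S3: "u \<diamondop> v \<in> vec.span {b2, b1, b0}" if "v \<in> {b2, b1, b0}" for u v
    using that S2[of v u] b2(2)[of u] vec.span_mono[of "{b1, b0}" "{b2, b1, b0}"] by blast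
  obtain b3 where b3: "b3 \<notin> vec.span {b2, b1, b0}" "\<And>u. u \<diamondop> b3 \<in> vec.span {b2, b1, b0}"
    using step[OF _ _ S3] card_length[of "[b2, b1, b0]"] by auto
  \<comment> \<open>multiplication lowers the filtration spanned by \<open>b0\<close>, \<open>b1\<close>, \<open>b2\<close>, \<open>b3\<close>, so the functionals dual to the reversed basis form the flag\<close>
  define b where "b = case_idx b3 b2 b1 b0"
  have ne: "b0 \<noteq> 0" using b0(1) by auto
  have sp: "k1 *s b0 \<in> vec.span {b0}" "k2 *s b1 + k1 *s b0 \<in> vec.span {b1, b0}"
    "k3 *s b2 + k2 *s b1 + k1 *s b0 \<in> vec.span {b2, b1, b0}" for k1 k2 k3
    by (intro vec.span_add vec.span_scale vec.span_base; simp)+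
  have cancel: "k = 0" if "k *s x + y = 0" "y \<in> vec.span S" "x \<notin> vec.span S" for k :: 'k and x y :: "'k ^ idx" and S
  proof (rule ccontr)
    assume "k \<noteq> 0"
    then have "x = (- 1 / k) *s y" using solve_for[OF that(1)] by blast
    then show False using that(2,3) vec.span_scale by metis
  qed
  have ind: "indep b" unfolding indep_def
  proof (intro allI impI)
    fix c :: "idx \<Rightarrow> 'k" and j assume "(\<Sum>j\<in>UNIV. c j *s b j) = 0"
    then have eq: "c Vx *s b3 + (c Vy *s b2 + c Vz *s b1 + c Vw *s b0) = 0" by (simp add: UNIV_idx b_def add_ac)
    have x: "c Vx = 0" by (rule cancel[OF eq sp(3) b3(1)])
    then have eq: "c Vy *s b2 + (c Vz *s b1 + c Vw *s b0) = 0" using eq by (simp add: add_ac)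
    have y: "c Vy = 0" by (rule cancel[OF eq sp(2) b2(1)])
    then have eq: "c Vz *s b1 + c Vw *s b0 = 0" using eq by (simp add: add_ac)
    have z: "c Vz = 0" by (rule cancel[OF eq sp(1) b1(1)])
    then have "c Vw *s b0 = 0" using eq by simp
    then show "c j = 0" using x y z ne by (cases j) auto
  qed
  obtain t where t: "\<And>j k. pairing (t j) (b k) = (if j = k then 1 else 0)"
    "\<And>v. (\<Sum>j\<in>UNIV. pairing (t j) v *s b j) = v" "\<And>v. (\<Sum>j\<in>UNIV. pairing (b j) v *s t j) = v"
    using indep_dual_basis[OF ind] by blast
  have tb: "pairing (t p) (u \<diamondop> b i) = 0" if "num p \<le> num i" for p i u
  proof -
    have z: "pairing (t q) v = 0" if "v \<in> vec.span S" "\<And>s. s \<in> S \<Longrightarrow> pairing (t q) s = 0" for q v S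
      using that by (induction rule: vec.span_induct_alt) (simp_all add: pairing_simps)
    have bb: "pairing (t p) b0 = (if p = Vw then 1 else 0)" "pairing (t p) b1 = (if p = Vz then 1 else 0)"
      "pairing (t p) b2 = (if p = Vy then 1 else 0)" for p
      using t(1)[of p Vw] t(1)[of p Vz] t(1)[of p Vy] by (simp_all add: b_def)
    show ?thesis
    proof (cases i)
      case Vx
      then have "p = Vx" using that by (cases p) auto
      then show ?thesis using Vx by (auto simp: bb b_def intro!: z[OF b3(2)])
    next
      case Vy
      then have "p = Vx \<or> p = Vy" using that by (cases p) auto
      then show ?thesis using Vy by (auto simp: bb b_def intro!: z[OF b2(2)])
    next
      case Vz
      then have "p \<noteq> Vw" using that by auto
      then show ?thesis using Vz by (auto simp: bb b_def intro!: z[OF b1(2)])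
    next
      case Vw
      then show ?thesis by (auto simp: bb b_def intro!: z[OF b0(2)])
    qed
  qed
  have "indep t" unfolding indep_def
  proof (intro allI impI)
    fix c :: "idx \<Rightarrow> 'k" and j assume "(\<Sum>j\<in>UNIV. c j *s t j) = 0"
    then have "pairing (\<Sum>j\<in>UNIV. c j *s t j) (b j) = 0" by (simp add: pairing_0)
    then have "(\<Sum>k\<in>UNIV. if k = j then c k else 0) = 0"
      by (simp add: pairing_simps t(1) if_distrib[of "\<lambda>u. _ * u"] cong: if_cong)
    then show "c j = 0" by simp
  qed
  moreover have "pairing (t p) (u \<diamondop> v) = 0" if "\<forall>i. num i < num p \<longrightarrow> pairing (t i) u = 0" for p u v
  proof -
    have "pairing (t p) (u \<diamondop> v) = pairing (t p) ((\<Sum>j\<in>UNIV. pairing (t j) u *s b j) \<diamondop> v)" by (simp add: t(2))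
    also have "\<dots> = (\<Sum>j\<in>UNIV. pairing (t j) u * pairing (t p) (v \<diamondop> b j))"
      by (simp add: sum_left scale_left pairing_simps comm[of v])
    also have "\<dots> = 0"
    proof (rule sum.neutral, rule ballI)
      fix j show "pairing (t j) u * pairing (t p) (v \<diamondop> b j) = 0"
        using that tb[of p j v] by (cases "num j < num p") auto
    qed
    finally show ?thesis .
  qed
  ultimately show ?thesis unfolding flagged_def by blast
qed

end

section \<open>Functionals of a quadratic automorphism\<close>

text \<open>
  The span of the first \<open>n\<close> functionals.
\<close>
definition low :: "(idx \<Rightarrow> 'k::field ^ idx) \<Rightarrow> nat \<Rightarrow> 'k ^ idx \<Rightarrow> bool"
  where "low t n g \<longleftrightarrow> (\<exists>c. (\<forall>i. n \<le> num i \<longrightarrow> c i = 0) \<and> g = (\<Sum>i\<in>UNIV. c i *s t i))"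

lemma low_0: "low t n 0"
  unfolding low_def by (intro exI[of _ "\<lambda>_. 0"]) simp

lemma low_add: assumes "low t n g" "low t n h" shows "low t n (g + h)"
proof -
  obtain c d where "\<forall>i. n \<le> num i \<longrightarrow> c i = 0" "g = (\<Sum>i\<in>UNIV. c i *s t i)" "\<forall>i. n \<le> num i \<longrightarrow> d i = 0" "h = (\<Sum>i\<in>UNIV. d i *s t i)"
    using assms unfolding low_def by (elim exE conjE) (rule that; assumption)
  then show ?thesis unfolding low_def
    by (intro exI[of _ "\<lambda>i. c i + d i"]) (simp add: vec.scale_left_distrib sum.distrib)
qed

lemma low_scale: assumes "low t n g" shows "low t n (k *s g)"
proof -
  obtain c where "\<forall>i. n \<le> num i \<longrightarrow> c i = 0" "g = (\<Sum>i\<in>UNIV. c i *s t i)"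
    using assms unfolding low_def by (elim exE conjE) (rule that; assumption)
  then show ?thesis unfolding low_def
    by (intro exI[of _ "\<lambda>i. k * c i"]) (simp add: vec.scale_sum_right)
qed

lemma low_minus: "low t n g \<Longrightarrow> low t n (- g)"
  using low_scale[of t n g "-1"] by simp

lemma low_diff: "low t n g \<Longrightarrow> low t n h \<Longrightarrow> low t n (g - h)"
  using low_add[of t n g "- h"] low_minus[of t n h] by simp

lemma low_mono: assumes "low t n g" "n \<le> n'" shows "low t n' g"
proof -
  obtain c where "\<forall>i. n \<le> num i \<longrightarrow> c i = 0" "g = (\<Sum>i\<in>UNIV. c i *s t i)"
    using assms(1) unfolding low_def by (elim exE conjE) (rule that; assumption)
  then show ?thesis unfolding low_def using assms(2) by (intro exI[of _ c]) auto
qed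

lemma low_base: "num i < n \<Longrightarrow> low t n (t i)"
  unfolding low_def
  by (intro exI[of _ "\<lambda>k. if k = i then 1 else 0"]) (simp add: if_distrib[of "\<lambda>u. u *s _"] cong: if_cong)

lemma low_sum: "(\<And>i. i \<in> I \<Longrightarrow> low t n (f i)) \<Longrightarrow> low t n (sum f I)"
  by (induction I rule: infinite_finite_induct) (auto intro: low_add low_0)

lemma low_trans:
  assumes "low t n g" "\<And>i. num i < n \<Longrightarrow> low t' n (t i)" shows "low t' n g"
proof -
  obtain c where c: "\<forall>i. n \<le> num i \<longrightarrow> c i = 0" "g = (\<Sum>i\<in>UNIV. c i *s t i)"
    using assms(1) unfolding low_def by (elim exE conjE) (rule that; assumption)
  have "low t' n (c i *s t i)" for i
    using assms(2)[of i] c(1) by (cases "num i < n") (auto intro: low_scale low_0)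
  then show ?thesis unfolding c(2) by (intro low_sum)
qed

lemma low_zero: "low t 0 g \<Longrightarrow> g = 0"
  unfolding low_def by auto

lemma low_explicit:
  shows "low t 1 g \<Longrightarrow> \<exists>a. g = a *s t Vx"
    and "low t 2 g \<Longrightarrow> \<exists>a b. g = b *s t Vy + a *s t Vx"
    and "low t 3 g \<Longrightarrow> \<exists>a b c. g = c *s t Vz + b *s t Vy + a *s t Vx"
proof -
  assume "low t 1 g"
  then obtain c where "\<forall>i. 1 \<le> num i \<longrightarrow> c i = 0" "g = (\<Sum>i\<in>UNIV. c i *s t i)"
    unfolding low_def by (elim exE conjE) (rule that; assumption)
  then show "\<exists>a. g = a *s t Vx" by (intro exI[of _ "c Vx"]) (simp add: UNIV_idx all_idx)
next
  assume "low t 2 g"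
  then obtain c where "\<forall>i. 2 \<le> num i \<longrightarrow> c i = 0" "g = (\<Sum>i\<in>UNIV. c i *s t i)"
    unfolding low_def by (elim exE conjE) (rule that; assumption)
  then show "\<exists>a b. g = b *s t Vy + a *s t Vx" by (intro exI[of _ "c Vx"] exI[of _ "c Vy"]) (simp add: UNIV_idx all_idx add_ac)
next
  assume "low t 3 g"
  then obtain c where "\<forall>i. 3 \<le> num i \<longrightarrow> c i = 0" "g = (\<Sum>i\<in>UNIV. c i *s t i)"
    unfolding low_def by (elim exE conjE) (rule that; assumption)
  then show "\<exists>a b c. g = c *s t Vz + b *s t Vy + a *s t Vx"
    by (intro exI[of _ "c Vx"] exI[of _ "c Vy"] exI[of _ "c Vz"]) (simp add: UNIV_idx all_idx add_ac)
qed

lemma indep_unique: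
  assumes "indep t" "(\<Sum>i\<in>UNIV. c i *s t i) = (\<Sum>i\<in>UNIV. d i *s t i)" shows "c i = d i"
proof -
  have "(\<Sum>i\<in>UNIV. (c i - d i) *s t i) = 0" using assms(2) by (simp add: vec.scale_left_diff_distrib sum_subtractf)
  then show ?thesis using assms(1) unfolding indep_def by (metis eq_iff_diff_eq_0)
qed

lemma low_self: assumes "indep t" shows "\<not> low t (num i) (t i)"
proof
  assume "low t (num i) (t i)"
  then obtain c where c: "\<forall>k. num i \<le> num k \<longrightarrow> c k = 0" "t i = (\<Sum>k\<in>UNIV. c k *s t k)"
    unfolding low_def by (elim exE conjE) (rule that; assumption)
  have e: "(\<Sum>k\<in>UNIV. (if k = i then 1 else 0) *s t k) = (\<Sum>k\<in>UNIV. c k *s t k)"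
    unfolding c(2)[symmetric] by (simp add: if_distrib[of "\<lambda>u. u *s _"] cong: if_cong)
  from indep_unique[OF assms e, of i] show False using c(1) by simp
qed

lemma num_eq: "num i = num j \<longleftrightarrow> i = j"
  by (cases i; cases j) simp_all

lemma num_less_4: "num i < 4"
  by (cases i) simp_all

lemma ex_num: "n < 4 \<Longrightarrow> \<exists>i. num i = n"
  by (auto simp: ex_idx less_Suc_eq eval_nat_numeral)

text \<open>
  The last functional that occurs in \<open>g\<close> is \<open>t q\<close>.
\<close>
definition has_top :: "(idx \<Rightarrow> 'k::field ^ idx) \<Rightarrow> idx \<Rightarrow> 'k ^ idx \<Rightarrow> bool"
  where "has_top t q g \<longleftrightarrow> (\<exists>m. m \<noteq> 0 \<and> low t (num q) (g - m *s t q))"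

lemma has_top_exists:
  assumes t: "indep t" and g: "low t (Suc n) g" "\<not> low t n g" and q: "num q = n" shows "has_top t q g"
proof -
  obtain c where c: "\<forall>i. Suc n \<le> num i \<longrightarrow> c i = 0" "g = (\<Sum>i\<in>UNIV. c i *s t i)"
    using g(1) unfolding low_def by (elim exE conjE) (rule that; assumption)
  define d where "d i = (if i = q then 0 else c i)" for i
  have "g - c q *s t q = (\<Sum>i\<in>UNIV. d i *s t i)"
  proof -
    have "(\<Sum>i\<in>UNIV. c i *s t i) = (\<Sum>i\<in>UNIV. d i *s t i + (if i = q then c q *s t q else 0))"
      by (intro sum.cong refl) (auto simp: d_def)
    then show ?thesis unfolding c(2) by (simp add: sum.distrib)
  qed
  moreover have "\<forall>i. n \<le> num i \<longrightarrow> d i = 0"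
    using c(1) q num_eq by (metis d_def le_antisym not_less_eq_eq)
  ultimately have l: "low t n (g - c q *s t q)" unfolding low_def by blast
  have "c q \<noteq> 0" using l g(2) by (metis diff_zero vec.scale_zero_left)
  then show ?thesis unfolding has_top_def using l q by blast
qed

lemma has_top_add: "has_top t q g \<Longrightarrow> low t (num q) h \<Longrightarrow> has_top t q (g + h)"
proof -
  assume "has_top t q g" and h: "low t (num q) h"
  then obtain m where m: "m \<noteq> 0" "low t (num q) (g - m *s t q)" unfolding has_top_def by blast
  have "low t (num q) ((g - m *s t q) + h)" by (rule low_add[OF m(2) h])
  moreover have "(g - m *s t q) + h = (g + h) - m *s t q" by simp
  ultimately show ?thesis using m(1) unfolding has_top_def by metis
qed

lemma has_top_low: "has_top t q g \<Longrightarrow> num q < n \<Longrightarrow> low t n g"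
proof -
  assume "has_top t q g" "num q < n"
  then obtain m where "low t n (g - m *s t q)" unfolding has_top_def using low_mono[OF _ less_imp_le] by blast
  then have "low t n ((g - m *s t q) + m *s t q)" using \<open>num q < n\<close> by (intro low_add low_scale low_base)
  then show ?thesis by simp
qed

lemma indep_spans:
  assumes "indep t" shows "low t 4 g"
proof -
  obtain n where n: "\<And>i j. pairing (n i) (t j) = (if i = j then 1 else 0)" "\<And>v. (\<Sum>j\<in>UNIV. pairing (n j) v *s t j) = v"
    "\<And>v. (\<Sum>j\<in>UNIV. pairing (t j) v *s n j) = v"
    using indep_dual_basis[OF assms] by blast
  show ?thesis unfolding low_def
    by (intro exI[of _ "\<lambda>j. pairing (n j) g"]) (use num_less_4 in \<open>simp add: n(2) flip: not_less\<close>)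
qed

lemma nonzero_has_top:
  assumes t: "indep t" and g: "g \<noteq> 0" shows "\<exists>q. has_top t q g"
proof -
  define n where "n = (LEAST n. low t n g)"
  have n: "low t n g" "n \<le> 4" unfolding n_def
    using LeastI[of "\<lambda>n. low t n g", OF indep_spans[OF t]] Least_le[of "\<lambda>n. low t n g", OF indep_spans[OF t]] by blast+
  have "n \<noteq> 0" using low_zero[of t g] n(1) g by metis
  then obtain m where m: "n = Suc m" by (cases n) auto
  have "\<not> low t m g" using not_less_Least[of m "\<lambda>n. low t n g"] m unfolding n_def by simp
  moreover obtain q where "num q = m" using ex_num[of m] m n(2) by auto
  ultimately show ?thesis using has_top_exists[OF t _ _ _, of m g q] n(1) m by auto
qed

lemma has_top_unique:
  assumes t: "indep t" and g: "has_top t q (c *s t i)" shows "q = i"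
proof -
  obtain m where m: "m \<noteq> 0" "low t (num q) (c *s t i - m *s t q)" using g unfolding has_top_def by blast
  obtain d where d: "\<forall>k. num q \<le> num k \<longrightarrow> d k = 0" "c *s t i - m *s t q = (\<Sum>k\<in>UNIV. d k *s t k)"
    using m(2) unfolding low_def by (elim exE conjE) (rule that; assumption)
  show ?thesis
  proof (rule ccontr)
    assume ne: "q \<noteq> i"
    have "(\<Sum>k\<in>UNIV. ((if k = i then c else 0) - (if k = q then m else 0)) *s t k) = c *s t i - m *s t q"
      by (simp add: vec.scale_left_diff_distrib sum_subtractf if_distrib[of "\<lambda>u. u *s _"] cong: if_cong)
    then have e: "(\<Sum>k\<in>UNIV. ((if k = i then c else 0) - (if k = q then m else 0)) *s t k) = (\<Sum>k\<in>UNIV. d k *s t k)"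
      unfolding d(2) .
    from indep_unique[OF t e, of q] show False using ne d(1) m(1) by simp
  qed
qed

text \<open>
  The linear part is split off: \<open>F\<close> maps \<open>v\<close> to \<open>L (k + v + v \<diamondop> v)\<close>.
\<close>
locale quadratic_automorphism = eigenfree_algebra UNIV mul for mul :: "'k::alg_closed_field ^ idx \<Rightarrow> 'k ^ idx \<Rightarrow> 'k ^ idx" (infixr "\<diamondop>" 70) +
  fixes L Li :: "'k ^ idx \<Rightarrow> 'k ^ idx" and k :: "'k ^ idx" and F :: "'k sys"
  assumes L: "Vector_Spaces.linear (*s) (*s) L" and Li: "Vector_Spaces.linear (*s) (*s) Li"
    and inverse: "L (Li v) = v" "Li (L v) = v"
    and F_len: "\<forall>(c, m)\<in>set (F j). length m \<le> 2"
    and F_eval: "evk (F j) (vec_nth v) = vec_nth (L (k + v + v \<diamondop> v)) j"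
begin

text \<open>
  The inverse transposes: if \<open>psi r = t\<close>, then the functional \<open>t\<close> of the image \<open>F v\<close> equals \<open>r (k + v + v \<diamondop> v)\<close>.
\<close>
definition psi :: "'k ^ idx \<Rightarrow> 'k ^ idx" where "psi g = (\<chi> i. pairing g (Li (axis i 1)))"
definition phi :: "'k ^ idx \<Rightarrow> 'k ^ idx" where "phi g = (\<chi> i. pairing g (L (axis i 1)))"

lemma pairing_psi: "pairing (psi g) v = pairing g (Li v)" and pairing_phi: "pairing (phi g) v = pairing g (L v)"
  unfolding psi_def phi_def by (rule linear_pairing_representation[OF Li], rule linear_pairing_representation[OF L])

lemma psi_phi: "psi (phi g) = g" and phi_psi: "phi (psi g) = g"
  by (rule pairing_eqI, simp add: pairing_psi pairing_phi inverse)+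

lemma psi_add: "psi (g + h) = psi g + psi h" and psi_scale: "psi (c *s g) = c *s psi g"
  and phi_add: "phi (g + h) = phi g + phi h" and phi_scale: "phi (c *s g) = c *s phi g"
  by (rule pairing_eqI, simp add: pairing_psi pairing_phi pairing_simps)+

lemma psi_linear: "Vector_Spaces.linear (*s) (*s) psi"
  unfolding Vector_Spaces.linear_iff by (simp add: vec.vector_space_axioms psi_add psi_scale)

lemma psi_0: "psi 0 = 0" and psi_eq_0: "psi g = 0 \<longleftrightarrow> g = 0"
  using psi_scale[of 0 0] phi_psi[of g] phi_scale[of 0 0] by auto

lemma phi_diff: "phi (g - h) = phi g - phi h"
  by (rule pairing_eqI) (simp add: pairing_phi pairing_simps)

text \<open>
  The functionals \<open>g\<close> for which \<open>g (k + v + v \<diamondop> v)\<close> is affine in \<open>v\<close>.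
\<close>
definition affine_part :: "'k ^ idx \<Rightarrow> bool" where "affine_part g \<longleftrightarrow> (\<forall>u v. pairing g (u \<diamondop> v) = 0)"

lemma affine_partI: assumes "\<And>v. pairing g (v \<diamondop> v) = 0" shows "affine_part g"
  unfolding affine_part_def
proof (intro allI)
  fix u v
  have "pairing g ((u + v) \<diamondop> (u + v)) = pairing g (u \<diamondop> u) + 2 * pairing g (u \<diamondop> v) + pairing g (v \<diamondop> v)"
    by (simp only: add_left add_right comm[of v u] pairing_add) simp
  then show "pairing g (u \<diamondop> v) = 0" using assms two by simp
qed

lemma affine_part_add: "affine_part g \<Longrightarrow> affine_part h \<Longrightarrow> affine_part (g + h)"
  and affine_part_scale: "affine_part g \<Longrightarrow> affine_part (c *s g)"
  and affine_part_0: "affine_part 0"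
  unfolding affine_part_def by (simp_all add: pairing_simps)

lemma good_by_coordinates:
  assumes t: "indep t" and r: "\<And>j. psi (r j) = t j" and G: "\<And>j. \<forall>(c, m)\<in>set (G j). length m \<le> 2"
    and eq: "\<And>v j. pairing (r j) (k + v + v \<diamondop> v) = evk (G j) (\<lambda>i. pairing (t i) v)" and good: "good G"
  shows "good F"
proof -
  obtain n where n: "\<And>i j. pairing (n i) (t j) = (if i = j then 1 else 0)" "\<And>v. (\<Sum>j\<in>UNIV. pairing (n j) v *s t j) = v"
    "\<And>v. (\<Sum>j\<in>UNIV. pairing (t j) v *s n j) = v"
    using indep_dual_basis[OF t] by blast
  have ax: "pairing g (axis i 1) = vec_nth g i" for g :: "'k ^ idx" and i
    by (cases i) (simp_all add: pairing_def UNIV_idx axis_def)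
  show ?thesis
  proof (rule good_coordinates[OF two F_len G _ _ _ good, where E = "\<lambda>j i. vec_nth (t j) i" and E' = "\<lambda>i j. vec_nth (n j) i"])
    fix i j
    have "(\<Sum>k\<in>UNIV. vec_nth (t i) k * vec_nth (n j) k) = pairing (n j) (t i)" by (simp add: pairing_def mult.commute)
    then show "(\<Sum>k\<in>UNIV. vec_nth (t i) k * vec_nth (n j) k) = (if i = j then 1 else 0)" using n(1) by simp
    have "vec_nth (\<Sum>k\<in>UNIV. pairing (n k) (axis i 1) *s t k) j = (if i = j then 1 else 0)" unfolding n(2) by (simp add: axis_def)
    then show "(\<Sum>k\<in>UNIV. vec_nth (n k) i * vec_nth (t k) j) = (if i = j then 1 else 0)" by (simp add: sum_component ax)
  next
    fix v :: "idx \<Rightarrow> 'k" and j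
    define V where "V = (\<chi> i. v i)"
    have V: "v = vec_nth V" by (simp add: V_def fun_eq_iff)
    have "(\<Sum>i\<in>UNIV. vec_nth (t j) i * evk (F i) v) = pairing (t j) (L (k + V + V \<diamondop> V))"
      unfolding V F_eval by (simp add: pairing_def)
    also have "\<dots> = pairing (r j) (k + V + V \<diamondop> V)" unfolding r[symmetric] pairing_psi inverse ..
    also have "\<dots> = evk (G j) (\<lambda>i. pairing (t i) V)" by (rule eq)
    finally show "(\<Sum>i\<in>UNIV. vec_nth (t j) i * evk (F i) v) = evk (G j) (\<lambda>j. \<Sum>i\<in>UNIV. vec_nth (t j) i * v i)"
      unfolding V by (simp add: pairing_def)
  qed
qed

text \<open>
  The quadratic form vanishes when one argument lies in the common kernel of the first \<open>n\<close> functionals, so it is a form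
  in these functionals.
\<close>
lemma quadratic_in_coordinates:
  assumes t: "indep t" and rad: "\<And>u v. (\<forall>i. num i < n \<longrightarrow> pairing (t i) u = 0) \<Longrightarrow> pairing g (u \<diamondop> v) = 0"
  shows "\<exists>b. (\<forall>i j. n \<le> num i \<or> n \<le> num j \<longrightarrow> b i j = 0) \<and>
    (\<forall>v. pairing g (v \<diamondop> v) = (\<Sum>i\<in>UNIV. \<Sum>j\<in>UNIV. b i j * (pairing (t i) v * pairing (t j) v)))"
proof -
  obtain d where d: "\<And>j k. pairing (d j) (t k) = (if j = k then 1 else 0)"
    "\<And>v. (\<Sum>j\<in>UNIV. pairing (d j) v *s t j) = v" "\<And>v. (\<Sum>j\<in>UNIV. pairing (t j) v *s d j) = v"
    using indep_dual_basis[OF t] by blast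
  define b where "b i j = pairing g (d i \<diamondop> d j)" for i j
  have b0: "b i j = 0" if "n \<le> num i" for i j
    unfolding b_def using that d(1) by (intro rad) (auto simp: pairing_commute[of "t k" "d i" for k])
  have "b i j = b j i" for i j unfolding b_def by (simp add: comm[of "d i" "d j"])
  then have "\<forall>i j. n \<le> num i \<or> n \<le> num j \<longrightarrow> b i j = 0" using b0 by metis
  moreover have "pairing g (v \<diamondop> v) = (\<Sum>i\<in>UNIV. \<Sum>j\<in>UNIV. b i j * (pairing (t i) v * pairing (t j) v))" for v
  proof -
    have "pairing g (v \<diamondop> v) = pairing g ((\<Sum>j\<in>UNIV. pairing (t j) v *s d j) \<diamondop> (\<Sum>j\<in>UNIV. pairing (t j) v *s d j))" by (simp add: d(3))
    also have "\<dots> = (\<Sum>i\<in>UNIV. \<Sum>j\<in>UNIV. b i j * (pairing (t i) v * pairing (t j) v))"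
      by (simp add: sum_left sum_right scale_left scale_right pairing_simps b_def sum_distrib_left mult_ac comm[of "d n" "d i" for n i])
    finally show ?thesis .
  qed
  ultimately show ?thesis by blast
qed

lemma flagged_quadratics:
  assumes "flagged t"
  obtains A a1 a2 a3 b1 b2 b3 b4 b5 b6 where "\<And>v. pairing (t Vx) (v \<diamondop> v) = 0"
    "\<And>v. pairing (t Vy) (v \<diamondop> v) = A * pairing (t Vx) v * pairing (t Vx) v"
    "\<And>v. pairing (t Vz) (v \<diamondop> v) = a1 * pairing (t Vy) v * pairing (t Vy) v + a2 * pairing (t Vx) v * pairing (t Vy) v + a3 * pairing (t Vx) v * pairing (t Vx) v"
    "\<And>v. pairing (t Vw) (v \<diamondop> v) = b1 * pairing (t Vz) v * pairing (t Vz) v + b2 * pairing (t Vy) v * pairing (t Vz) v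
       + b3 * pairing (t Vx) v * pairing (t Vz) v + b4 * pairing (t Vy) v * pairing (t Vy) v
       + b5 * pairing (t Vx) v * pairing (t Vy) v + b6 * pairing (t Vx) v * pairing (t Vx) v"
proof -
  have t: "indep t" and rad: "\<And>p u v. (\<forall>i. num i < num p \<longrightarrow> pairing (t i) u = 0) \<Longrightarrow> pairing (t p) (u \<diamondop> v) = 0"
    using assms unfolding flagged_def by blast+
  have "\<forall>p. \<exists>b. (\<forall>i j. num p \<le> num i \<or> num p \<le> num j \<longrightarrow> b i j = 0) \<and>
    (\<forall>v. pairing (t p) (v \<diamondop> v) = (\<Sum>i\<in>UNIV. \<Sum>j\<in>UNIV. b i j * (pairing (t i) v * pairing (t j) v)))"
    by (rule allI, rule quadratic_in_coordinates[OF t], rule rad, assumption)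
  from choice[OF this] obtain b where B: "\<forall>p. (\<forall>i j. num p \<le> num i \<or> num p \<le> num j \<longrightarrow> b p i j = 0) \<and>
    (\<forall>v. pairing (t p) (v \<diamondop> v) = (\<Sum>i\<in>UNIV. \<Sum>j\<in>UNIV. b p i j * (pairing (t i) v * pairing (t j) v)))" ..
  have b: "num p \<le> num i \<or> num p \<le> num j \<Longrightarrow> b p i j = 0"
    "pairing (t p) (v \<diamondop> v) = (\<Sum>i\<in>UNIV. \<Sum>j\<in>UNIV. b p i j * (pairing (t i) v * pairing (t j) v))" for p i j v
    using B[THEN spec, of p] by blast+
  show ?thesis
    by (rule that[of "b Vy Vx Vx" "b Vz Vy Vy" "b Vz Vx Vy + b Vz Vy Vx" "b Vz Vx Vx" "b Vw Vz Vz" "b Vw Vy Vz + b Vw Vz Vy"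
        "b Vw Vx Vz + b Vw Vz Vx" "b Vw Vy Vy" "b Vw Vx Vy + b Vw Vy Vx" "b Vw Vx Vx"])
      (simp_all add: b UNIV_idx algebra_simps)
qed

text \<open>
  A functional with vanishing quadratic part does not depend on a preceding part of the flag, so it may be moved to the
  front; the member of the flag at its top position becomes redundant.
\<close>
lemma put_first:
  assumes t: "flagged t" and u: "affine_part u" and top: "has_top t q u"
  shows "flagged (case q of Vx \<Rightarrow> case_idx u (t Vy) (t Vz) (t Vw) | Vy \<Rightarrow> case_idx u (t Vx) (t Vz) (t Vw)
    | Vz \<Rightarrow> case_idx u (t Vx) (t Vy) (t Vw) | Vw \<Rightarrow> case_idx u (t Vx) (t Vy) (t Vz))"
proof -
  have ind: "indep t" and rad: "\<And>p u v. (\<forall>i. num i < num p \<longrightarrow> pairing (t i) u = 0) \<Longrightarrow> pairing (t p) (u \<diamondop> v) = 0"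
    using t unfolding flagged_def by blast+
  have ind': "p *s t Vx + (q *s t Vy + (r *s t Vz + s *s t Vw)) = 0 \<Longrightarrow> p = 0 \<and> q = 0 \<and> r = 0 \<and> s = 0" for p q r s
    using ind unfolding indep_def by (auto dest: spec[of _ "case_idx p q r s"] simp: UNIV_idx all_idx)
  obtain m where m: "m \<noteq> 0" "low t (num q) (u - m *s t q)" using top unfolding has_top_def by blast
  have u0: "\<And>w v. pairing u (w \<diamondop> v) = 0" using u unfolding affine_part_def by blast
  have x0: "\<And>w v. pairing (t Vx) (w \<diamondop> v) = 0" using rad[of Vx] by simp
  have y0: "pairing (t Vx) w = 0 \<Longrightarrow> pairing (t Vy) (w \<diamondop> v) = 0" for w v using rad[of Vy w v] by (simp add: all_idx)
  have z0: "pairing (t Vx) w = 0 \<Longrightarrow> pairing (t Vy) w = 0 \<Longrightarrow> pairing (t Vz) (w \<diamondop> v) = 0" for w v using rad[of Vz w v] by (simp add: all_idx)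
  have w0: "pairing (t Vx) w = 0 \<Longrightarrow> pairing (t Vy) w = 0 \<Longrightarrow> pairing (t Vz) w = 0 \<Longrightarrow> pairing (t Vw) (w \<diamondop> v) = 0" for w v
    using rad[of Vw w v] by (simp add: all_idx)
  have fl: "flagged (case_idx a b c d)" if
      "\<And>p q r s. p *s a + (q *s b + (r *s c + s *s d)) = 0 \<Longrightarrow> p = 0 \<and> q = 0 \<and> r = 0 \<and> s = 0"
      "\<And>w v. pairing a (w \<diamondop> v) = 0" "\<And>w v. pairing a w = 0 \<Longrightarrow> pairing b (w \<diamondop> v) = 0"
      "\<And>w v. pairing a w = 0 \<Longrightarrow> pairing b w = 0 \<Longrightarrow> pairing c (w \<diamondop> v) = 0"
      "\<And>w v. pairing a w = 0 \<Longrightarrow> pairing b w = 0 \<Longrightarrow> pairing c w = 0 \<Longrightarrow> pairing d (w \<diamondop> v) = 0" for a b c d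
    unfolding flagged_def indep_def
  proof (intro conjI allI impI)
    fix c' :: "idx \<Rightarrow> 'k" and j assume "(\<Sum>j\<in>UNIV. c' j *s case_idx a b c d j) = 0"
    then have "c' Vx *s a + (c' Vy *s b + (c' Vz *s c + c' Vw *s d)) = 0" by (simp add: UNIV_idx)
    from that(1)[OF this] show "c' j = 0" by (cases j) auto
  next
    fix p w v assume *: "\<forall>i. num i < num p \<longrightarrow> pairing (case_idx a b c d i) w = 0"
    show "pairing (case_idx a b c d p) (w \<diamondop> v) = 0"
      using * by (cases p) (auto simp: all_idx that)
  qed
  have eqs: "s *s (m *s t q + (u - m *s t q)) = s *s u" for s by simp
  show ?thesis
  proof (cases q)
    case Vx
    have "low t 0 (u - m *s t Vx)" using m(2) unfolding Vx num_simps .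
    then have um: "u = m *s t Vx" using low_zero by (metis eq_iff_diff_eq_0)
    have um': "pairing (t Vx) w = 0" if "pairing u w = 0" for w
      using that m(1) unfolding um by (simp add: pairing_simps)
    show ?thesis unfolding Vx idx.case
    proof (rule fl)
      fix p q r s assume "p *s u + (q *s t Vy + (r *s t Vz + s *s t Vw)) = 0"
      then have "(p * m) *s t Vx + (q *s t Vy + (r *s t Vz + s *s t Vw)) = 0" by (simp add: um)
      from ind'[OF this] show "p = 0 \<and> q = 0 \<and> r = 0 \<and> s = 0" using m(1) by simp
    qed (rule u0, rule y0, rule um', assumption, rule z0, rule um', assumption+, rule w0, rule um', assumption+)
  next
    case Vy
    have "low t 1 (u - m *s t Vy)" using m(2) unfolding Vy num_simps .
    then obtain a where "u - m *s t Vy = a *s t Vx" using low_explicit(1) by blast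
    then have um: "u = m *s t Vy + a *s t Vx" by (simp add: diff_eq_eq add_ac)
    have um': "pairing (t Vy) w = 0" if "pairing u w = 0" "pairing (t Vx) w = 0" for w
      using that m(1) unfolding um by (simp add: pairing_simps)
    show ?thesis unfolding Vy idx.case
    proof (rule fl)
      fix p q r s assume "p *s u + (q *s t Vx + (r *s t Vz + s *s t Vw)) = 0"
      then have "(p * a + q) *s t Vx + ((p * m) *s t Vy + (r *s t Vz + s *s t Vw)) = 0"
        by (simp add: um vec.scale_right_distrib vec.scale_left_distrib add_ac)
      from ind'[OF this] show "p = 0 \<and> q = 0 \<and> r = 0 \<and> s = 0" using m(1) by auto
    qed (rule u0, rule x0, rule z0, assumption, rule um', assumption+, rule w0, assumption, rule um', assumption+)
  next
    case Vz
    have "low t 2 (u - m *s t Vz)" using m(2) unfolding Vz num_simps .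
    then obtain a b where "u - m *s t Vz = b *s t Vy + a *s t Vx" using low_explicit(2) by blast
    then have um: "u = m *s t Vz + b *s t Vy + a *s t Vx" by (simp add: diff_eq_eq add_ac)
    have um': "pairing (t Vz) w = 0" if "pairing u w = 0" "pairing (t Vx) w = 0" "pairing (t Vy) w = 0" for w
      using that m(1) unfolding um by (simp add: pairing_simps)
    show ?thesis unfolding Vz idx.case
    proof (rule fl)
      fix p q r s assume "p *s u + (q *s t Vx + (r *s t Vy + s *s t Vw)) = 0"
      then have "(p * a + q) *s t Vx + ((p * b + r) *s t Vy + ((p * m) *s t Vz + s *s t Vw)) = 0"
        by (simp add: um vec.scale_right_distrib vec.scale_left_distrib add_ac)
      from ind'[OF this] show "p = 0 \<and> q = 0 \<and> r = 0 \<and> s = 0" using m(1) by auto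
    qed (rule u0, rule x0, rule y0, assumption, rule w0, assumption, assumption, rule um', assumption+)
  next
    case Vw
    have "low t 3 (u - m *s t Vw)" using m(2) unfolding Vw num_simps .
    then obtain a b c where "u - m *s t Vw = c *s t Vz + b *s t Vy + a *s t Vx" using low_explicit(3) by blast
    then have um: "u = m *s t Vw + c *s t Vz + b *s t Vy + a *s t Vx" by (simp add: diff_eq_eq add_ac)
    show ?thesis unfolding Vw idx.case
    proof (rule fl)
      fix p q r s assume "p *s u + (q *s t Vx + (r *s t Vy + s *s t Vz)) = 0"
      then have "(p * a + q) *s t Vx + ((p * b + r) *s t Vy + ((p * c + s) *s t Vz + (p * m) *s t Vw)) = 0"
        by (simp add: um vec.scale_right_distrib vec.scale_left_distrib add_ac)
      from ind'[OF this] show "p = 0 \<and> q = 0 \<and> r = 0 \<and> s = 0" using m(1) by auto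
    qed (rule u0, rule x0, rule y0, assumption, rule z0, assumption+)
  qed
qed

end

section \<open>Reduction to a permutation normal form\<close>

context quadratic_automorphism begin

text \<open>
  The relative position of \<open>psi\<close> and the flag is the permutation \<open>p\<close>.
\<close>
definition reduced :: "(idx \<Rightarrow> 'k ^ idx) \<Rightarrow> (idx \<Rightarrow> 'k ^ idx) \<Rightarrow> (idx \<Rightarrow> 'k) \<Rightarrow> (idx \<Rightarrow> idx) \<Rightarrow> bool"
  where "reduced t r m p \<longleftrightarrow> flagged t \<and> inj p \<and> (\<forall>j. m j \<noteq> 0) \<and> (\<forall>j. psi (r j) = t j) \<and>
    (\<forall>j. low t (num (p j)) (r j - m j *s t (p j)))"

lemma pairing_low: "low t n g \<Longrightarrow> (\<And>i. num i < n \<Longrightarrow> pairing (t i) u = 0) \<Longrightarrow> pairing g u = 0"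
proof -
  assume "low t n g" and z: "\<And>i. num i < n \<Longrightarrow> pairing (t i) u = 0"
  then obtain c where c: "\<forall>i. n \<le> num i \<longrightarrow> c i = 0" "g = (\<Sum>i\<in>UNIV. c i *s t i)"
    unfolding low_def by (elim exE conjE) (rule that; assumption)
  have "c i * pairing (t i) u = 0" for i using c(1) z[of i] by (cases "num i < n") auto
  then show ?thesis unfolding c(2) pairing_sum pairing_scale by (intro sum.neutral) blast
qed

text \<open>
  Bruhat decomposition. Each \<open>t j\<close> is changed by earlier functionals so that its preimage under \<open>psi\<close> enters the flag as
  early as possible; then different preimages enter at different positions.
\<close>
lemma reduction:
  assumes fl: "flagged t"
  shows "\<exists>t' r m p. reduced t' r m p \<and> (\<forall>j. low t (num j) (t' j - t j)) \<and> (\<forall>n g. low t n g \<longrightarrow> low t' n g)"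
proof -
  have t: "indep t" and rad: "\<And>p u v. (\<forall>i. num i < num p \<longrightarrow> pairing (t i) u = 0) \<Longrightarrow> pairing (t p) (u \<diamondop> v) = 0"
    using fl unfolding flagged_def by blast+
  \<comment> \<open>the position at which the preimage of a functional enters the flag\<close>
  define lev where "lev g = (LEAST n. low t n (phi g))" for g
  have "\<forall>j. \<exists>x. low t (num j) (x - t j) \<and> (\<forall>y. low t (num j) (y - t j) \<longrightarrow> lev x \<le> lev y)"
  proof
    fix j show "\<exists>x. low t (num j) (x - t j) \<and> (\<forall>y. low t (num j) (y - t j) \<longrightarrow> lev x \<le> lev y)"
      by (rule ex_has_least_nat[where k = "t j"]) (simp add: low_0)
  qed
  from choice[OF this] obtain t' where T: "\<forall>j. low t (num j) (t' j - t j) \<and> (\<forall>y. low t (num j) (y - t j) \<longrightarrow> lev (t' j) \<le> lev y)" ..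
  have d: "low t (num j) (t' j - t j)" and min: "low t (num j) (y - t j) \<Longrightarrow> lev (t' j) \<le> lev y" for j y
    using T[THEN spec, of j] by blast+
  have t'_low: "low t n (t' i)" if "num i < n" for n i
  proof -
    have "low t n ((t' i - t i) + t i)" using that by (intro low_add low_base low_mono[OF d]) auto
    then show ?thesis by simp
  qed
  have t_low': "low t' (Suc (num i)) (t i)" for i
  proof (induction "num i" arbitrary: i rule: less_induct)
    case less
    have "low t' (num i) (t' i - t i)"
    proof (rule low_trans[OF d])
      fix k assume "num k < num i"
      then show "low t' (num i) (t k)" using less low_mono by (meson Suc_leI)
    qed
    then have x: "low t' (Suc (num i)) (t' i - t i)" by (rule low_mono) simp
    have "low t' (Suc (num i)) (t' i - (t' i - t i))" by (rule low_diff[OF low_base x]) simp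
    then show ?case by simp
  qed
  have low_low': "low t' n g" if "low t n g" for n g
  proof (rule low_trans[OF that])
    fix i assume "num i < n"
    then show "low t' n (t i)" using low_mono[OF t_low'] by auto
  qed
  obtain n where n: "\<And>i j. pairing (n i) (t j) = (if i = j then 1 else 0)" "\<And>v. (\<Sum>j\<in>UNIV. pairing (n j) v *s t j) = v"
    "\<And>v. (\<Sum>j\<in>UNIV. pairing (t j) v *s n j) = v"
    using indep_dual_basis[OF t] by blast
  have nt': "pairing (t' j) (n i) = (if i = j then 1 else 0)" if "num j \<le> num i" for i j
  proof -
    have "pairing (t' j - t j) (n i) = 0"
      by (rule pairing_low[OF d]) (use that n(1) in \<open>auto simp: pairing_commute[of "t k" "n i" for k]\<close>)
    then show ?thesis using n(1)[of i j] by (simp add: pairing_simps pairing_commute[of "t j" "n i"])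
  qed
  have ind': "indep t'" unfolding indep_def
  proof (intro allI impI)
    fix c :: "idx \<Rightarrow> 'k" and j assume "(\<Sum>j\<in>UNIV. c j *s t' j) = 0"
    then have "pairing (\<Sum>j\<in>UNIV. c j *s t' j) (n i) = 0" for i by (simp add: pairing_0)
    then have e: "c Vx * pairing (t' Vx) (n i) + (c Vy * pairing (t' Vy) (n i) + (c Vz * pairing (t' Vz) (n i) + c Vw * pairing (t' Vw) (n i))) = 0" for i
      by (simp add: pairing_simps UNIV_idx)
    have w: "c Vw = 0" using e[of Vw] by (simp add: nt')
    have z: "c Vz = 0" using e[of Vz] w by (simp add: nt')
    have y: "c Vy = 0" using e[of Vy] w z by (simp add: nt')
    have "c Vx = 0" using e[of Vx] w z y by (simp add: nt')
    then show "c j = 0" using w z y by (cases j) auto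
  qed
  have fl': "flagged t'" unfolding flagged_def
  proof (intro conjI ind' allI impI)
    fix p u v assume z: "\<forall>i. num i < num p \<longrightarrow> pairing (t' i) u = 0"
    have z': "pairing (t i) u = 0" if "num i < num p" for i
      by (rule pairing_low[OF t_low'[of i]]) (use z that in auto)
    have "pairing (t' p - t p) (u \<diamondop> v) = 0"
      by (rule pairing_low[OF d]) (use z' in \<open>auto intro!: rad\<close>)
    moreover have "pairing (t p) (u \<diamondop> v) = 0" using z' by (intro rad) blast
    ultimately show "pairing (t' p) (u \<diamondop> v) = 0" by (simp add: pairing_simps)
  qed
  define r where "r j = phi (t' j)" for j
  have r: "psi (r j) = t' j" for j by (simp add: r_def psi_phi)
  have "r j \<noteq> 0" for j
  proof
    assume "r j = 0"
    then have "t' j = 0" using r[of j] psi_0 by simp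
    then show False using low_self[OF ind', of j] low_0 by metis
  qed
  then have "\<forall>j. \<exists>q. has_top t q (r j)" using nonzero_has_top[OF t] by blast
  from choice[OF this] obtain p where "\<forall>j. has_top t (p j) (r j)" ..
  then have "\<forall>j. \<exists>m. m \<noteq> 0 \<and> low t (num (p j)) (r j - m *s t (p j))" unfolding has_top_def .
  from choice[OF this] obtain m where M: "\<forall>j. m j \<noteq> 0 \<and> low t (num (p j)) (r j - m j *s t (p j))" ..
  have m: "m j \<noteq> 0" "low t (num (p j)) (r j - m j *s t (p j))" for j using M[THEN spec, of j] by blast+
  have top': "low t' (num (p j)) (r j - m j *s t' (p j))" for j
  proof -
    have "low t (num (p j)) ((r j - m j *s t (p j)) - m j *s (t' (p j) - t (p j)))"
      by (rule low_diff[OF m(2) low_scale[OF d]])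
    then show ?thesis by (intro low_low') (simp add: vec.scale_right_diff_distrib)
  qed
  \<comment> \<open>if two levels coincided, subtracting the earlier functional would lower the level of the later one\<close>
  have ne: "p j \<noteq> p i" if ji: "num i < num j" for i j
  proof
    assume eq: "p j = p i"
    define c where "c = m j / m i"
    define g where "g = t' j - c *s t' i"
    have "low t (num j) ((t' j - t j) - c *s t' i)" by (rule low_diff[OF d low_scale[OF t'_low[OF ji]]])
    then have "low t (num j) (g - t j)" by (simp add: g_def algebra_simps)
    then have "lev (t' j) \<le> lev g" by (rule min)
    moreover have "lev g \<le> num (p j)"
    proof -
      have "phi g = (r j - m j *s t (p j)) - c *s (r i - m i *s t (p i))"
        using m(1)[of i] by (simp add: g_def r_def phi_diff phi_scale eq c_def vec.scale_right_diff_distrib)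
      moreover have "low t (num (p j)) (r i - m i *s t (p i))" using m(2)[of i] eq by simp
      ultimately have "low t (num (p j)) (phi g)" using low_diff[OF m(2) low_scale] by metis
      then show ?thesis unfolding lev_def by (rule Least_le)
    qed
    moreover have "\<not> lev (t' j) \<le> num (p j)"
    proof
      assume le: "lev (t' j) \<le> num (p j)"
      have "low t (lev (t' j)) (phi (t' j))" unfolding lev_def by (rule LeastI) (rule indep_spans[OF t])
      then have "low t (num (p j)) (r j)" using le low_mono unfolding r_def by blast
      then have "low t (num (p j)) ((1 / m j) *s (r j - (r j - m j *s t (p j))))"
        by (rule low_scale[OF low_diff[OF _ m(2)]])
      then show False using low_self[OF t, of "p j"] m(1)[of j] by simp
    qed
    ultimately show False by linarith
  qed
  have "inj p"
  proof (rule injI, rule ccontr)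
    fix i j assume "p i = p j" "i \<noteq> j"
    then show False using ne[of i j] ne[of j i] num_eq[of i j] by (metis linorder_neqE_nat)
  qed
  then have "reduced t' r m p" unfolding reduced_def using fl' m(1) r top' by blast
  then show ?thesis using d low_low' by blast
qed

lemma good_from_normal_form:
  assumes red: "reduced t r m p"
    and good: "\<And>c0 p1 p2 p3 q1 q2 q3 q4 q5 q6 s1 s2 s3 s4 s5 s6 s7 s8 s9 s10. (\<And>j v. pairing (r j) (v \<diamondop> v) = hom2 (nf p m c0 p1 p2 p3 q1 q2 q3 q4 q5 q6 s1 s2 s3 s4 s5 s6 s7 s8 s9 s10) (\<lambda>i. pairing (t i) v) j) \<Longrightarrow> good (nf p m c0 p1 p2 p3 q1 q2 q3 q4 q5 q6 s1 s2 s3 s4 s5 s6 s7 s8 s9 s10)"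
  shows "good F"
proof -
  have fl: "flagged t" and p: "inj p" and m: "\<And>j. m j \<noteq> 0" and r: "\<And>j. psi (r j) = t j"
    and top: "\<And>j. low t (num (p j)) (r j - m j *s t (p j))"
    using red unfolding reduced_def by blast+
  have t: "indep t" using fl unfolding flagged_def by blast
  obtain A a1 a2 a3 b1 b2 b3 b4 b5 b6 where X: "\<And>v. pairing (t Vx) (v \<diamondop> v) = 0"
    and Y: "\<And>v. pairing (t Vy) (v \<diamondop> v) = A * pairing (t Vx) v * pairing (t Vx) v"
    and Z: "\<And>v. pairing (t Vz) (v \<diamondop> v) = a1 * pairing (t Vy) v * pairing (t Vy) v + a2 * pairing (t Vx) v * pairing (t Vy) v + a3 * pairing (t Vx) v * pairing (t Vx) v"
    and W: "\<And>v. pairing (t Vw) (v \<diamondop> v) = b1 * pairing (t Vz) v * pairing (t Vz) v + b2 * pairing (t Vy) v * pairing (t Vz) v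
       + b3 * pairing (t Vx) v * pairing (t Vz) v + b4 * pairing (t Vy) v * pairing (t Vy) v
       + b5 * pairing (t Vx) v * pairing (t Vy) v + b6 * pairing (t Vx) v * pairing (t Vx) v"
    using flagged_quadratics[OF fl] by blast
  have "surj p" using p by (simp add: finite_UNIV_inj_surj)
  then obtain jx jy jz jw where j: "p jx = Vx" "p jy = Vy" "p jz = Vz" "p jw = Vw" by (metis surjD)
  have inv: "p j = Vx \<Longrightarrow> j = jx" "p j = Vy \<Longrightarrow> j = jy" "p j = Vz \<Longrightarrow> j = jz" "p j = Vw \<Longrightarrow> j = jw" for j
    using p j by (metis injD)+
  have jcases: "j = jx \<or> j = jy \<or> j = jz \<or> j = jw" for j
    using inv[of j] by (cases "p j") blast+
  have rx: "r jx = m jx *s t Vx" using low_zero[of t "r jx - m jx *s t Vx"] top[of jx] j by simp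
  have "low t 1 (r jy - m jy *s t Vy)" using top[of jy] unfolding j num_simps .
  from low_explicit(1)[OF this] obtain e where "r jy - m jy *s t Vy = e *s t Vx" by blast
  then have ry: "r jy = m jy *s t Vy + e *s t Vx" by (simp add: diff_eq_eq add_ac)
  have "low t 2 (r jz - m jz *s t Vz)" using top[of jz] unfolding j num_simps .
  from low_explicit(2)[OF this] obtain g f where "r jz - m jz *s t Vz = f *s t Vy + g *s t Vx" by blast
  then have rz: "r jz = m jz *s t Vz + f *s t Vy + g *s t Vx" by (simp add: diff_eq_eq add_ac)
  have "low t 3 (r jw - m jw *s t Vw)" using top[of jw] unfolding j num_simps .
  from low_explicit(3)[OF this] obtain h1 h2 h3 where "r jw - m jw *s t Vw = h3 *s t Vz + h2 *s t Vy + h1 *s t Vx" by blast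
  then have rw: "r jw = m jw *s t Vw + h3 *s t Vz + h2 *s t Vy + h1 *s t Vx" by (simp add: diff_eq_eq add_ac)
  let ?nf = "nf p m (pairing (r jx) k) (m jy * A) e (pairing (r jy) k) (m jz * a1) (m jz * a2) (m jz * a3 + f * A) f g (pairing (r jz) k)
    (m jw * b1) (m jw * b2) (m jw * b3) (m jw * b4 + h3 * a1) (m jw * b5 + h3 * a2) (m jw * b6 + h3 * a3 + h2 * A) h3 h2 h1 (pairing (r jw) k)"
  have hom: "pairing (r j) (v \<diamondop> v) = hom2 ?nf (\<lambda>i. pairing (t i) v) j" for j v
    using jcases[of j] by (elim disjE) (simp_all add: hom2_nf j rx ry rz rw pairing_simps X Y Z W algebra_simps)
  show ?thesis
  proof (rule good_by_coordinates[OF t r])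
    show "\<forall>(c, m)\<in>set (?nf j). length m \<le> 2" for j by (auto simp: nf_def Qs split: idx.split)
    show "good ?nf" by (rule good[OF hom])
    fix v j
    have lin: "pairing (r j) v = (case p j of Vx \<Rightarrow> m j * pairing (t Vx) v | Vy \<Rightarrow> m j * pairing (t Vy) v + e * pairing (t Vx) v
        | Vz \<Rightarrow> m j * pairing (t Vz) v + f * pairing (t Vy) v + g * pairing (t Vx) v
        | Vw \<Rightarrow> m j * pairing (t Vw) v + h3 * pairing (t Vz) v + h2 * pairing (t Vy) v + h1 * pairing (t Vx) v)"
      using jcases[of j] by (elim disjE) (simp_all add: j rx ry rz rw pairing_simps)
    have con: "pairing (r j) k = (case p j of Vx \<Rightarrow> pairing (r jx) k | Vy \<Rightarrow> pairing (r jy) k | Vz \<Rightarrow> pairing (r jz) k | Vw \<Rightarrow> pairing (r jw) k)"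
      using jcases[of j] by (elim disjE) (simp_all add: j)
    show "pairing (r j) (k + v + v \<diamondop> v) = evk (?nf j) (\<lambda>i. pairing (t i) v)"
      unfolding pairing_add hom lin con hom2_nf by (cases "p j") (simp_all add: nf_def Qs algebra_simps)
  qed
qed

end

section \<open>Classification by the rank of the quadratic part\<close>

lemma perm_eqI: "p Vx = a \<Longrightarrow> p Vy = b \<Longrightarrow> p Vz = c \<Longrightarrow> p Vw = d \<Longrightarrow> p = case_idx a b c d"
  by (simp add: fun_eq_iff all_idx)

lemma degree_less_3: "Polynomial.degree q < 3 \<Longrightarrow> q = [:Polynomial.coeff q 0, Polynomial.coeff q 1, Polynomial.coeff q 2:]"
  by (rule poly_eqI) (auto simp: coeff_pCons coeff_eq_0 eval_nat_numeral split: nat.split)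

context quadratic_automorphism begin

lemma flagged_affine: assumes "flagged t" shows "affine_part (t Vx)"
proof -
  have "(\<forall>i. num i < num Vx \<longrightarrow> pairing (t i) u = 0) \<longrightarrow> pairing (t Vx) (u \<diamondop> v) = 0" for u v
    using assms unfolding flagged_def by blast
  then show ?thesis unfolding affine_part_def by simp
qed

lemma reducedD:
  assumes "reduced t r m p"
  shows "flagged t" "indep t" "inj p" "m j \<noteq> 0" "psi (r j) = t j" "low t (num (p j)) (r j - m j *s t (p j))"
    "has_top t (p j) (r j)" "t j \<noteq> 0" "affine_part (t Vx)"
proof -
  show f: "flagged t" and "inj p" and m: "m j \<noteq> 0" and "psi (r j) = t j" and l: "low t (num (p j)) (r j - m j *s t (p j))"
    using assms unfolding reduced_def by blast+
  show t: "indep t" using f unfolding flagged_def by blast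
  show "affine_part (t Vx)" by (rule flagged_affine[OF f])
  show "has_top t (p j) (r j)" unfolding has_top_def using l m by blast
  show "t j \<noteq> 0" using low_self[OF t, of j] low_0[of t "num j"] by metis
qed

lemma flagged_put_first:
  assumes t: "flagged t" and u: "affine_part u" "u \<noteq> 0"
  obtains t' where "flagged t'" "t' Vx = u"
proof -
  have "indep t" using t unfolding flagged_def by blast
  then obtain q where q: "has_top t q u" using nonzero_has_top u(2) by blast
  show ?thesis by (rule that[OF put_first[OF t u(1) q]]) (cases q; simp)
qed

text \<open>
  Put at the front of the flag, the eigenvector becomes an affine first coordinate.
\<close>
lemma good_if_eigenvector:
  assumes u: "affine_part u" "u \<noteq> 0" and eig: "psi u = \<mu> *s u" shows "good F"
proof -
  obtain t0 where "flagged t0" using flag_exists[OF refl] by blast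
  then obtain t where t: "flagged t" "t Vx = u" using flagged_put_first[OF _ u] by blast
  obtain t' r m p where red: "reduced t' r m p" and d: "low t (num j) (t' j - t j)" for j
    using reduction[OF t(1)] by blast
  note rd = reducedD[OF red]
  have x: "t' Vx = u" using low_zero[of t "t' Vx - t Vx"] d[of Vx] t(2) by simp
  have mu: "\<mu> \<noteq> 0" using eig u(2) psi_eq_0[of u] by auto
  have "psi ((1 / \<mu>) *s u) = u" using mu by (simp add: psi_scale eig)
  then have "r Vx = (1 / \<mu>) *s t' Vx" using phi_psi[of "r Vx"] phi_psi[of "(1 / \<mu>) *s u"] rd(5)[of Vx] x by simp
  then have px: "p Vx = Vx" using has_top_unique[OF rd(2)] rd(7)[of Vx] by metis
  show ?thesis by (rule good_from_normal_form[OF red]) (rule nf_base[OF rd(3,4) px])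
qed

context
  assumes noeig: "\<And>u \<mu>. affine_part u \<Longrightarrow> u \<noteq> 0 \<Longrightarrow> psi u \<noteq> \<mu> *s u"
begin

text \<open>
  A relation would produce an eigenvector of \<open>psi\<close> in the span of \<open>u\<close>, \<open>psi u\<close>, \<open>psi (psi u)\<close>, where all quadratic parts vanish.
\<close>
lemma krylov_independent:
  assumes u: "u \<noteq> 0" and a: "affine_part u" "affine_part (psi u)" "affine_part (psi (psi u))"
    and P: "pe psi u P = 0" "Polynomial.degree P \<le> 3"
  shows "P = 0"
proof (rule ccontr)
  assume "P \<noteq> 0"
  from eigenvector_from_annihilator[OF psi_linear u this P(1)] obtain q \<mu>
    where q: "Polynomial.degree q < Polynomial.degree P" "pe psi u q \<noteq> 0" "psi (pe psi u q) = \<mu> *s pe psi u q" by blast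
  have "q = [:Polynomial.coeff q 0, Polynomial.coeff q 1, Polynomial.coeff q 2:]" using q(1) P(2) by (intro degree_less_3) simp
  then obtain a0 a1 a2 where "q = [:a0, a1, a2:]" by blast
  then have "pe psi u q = a0 *s u + (a1 *s psi u + a2 *s psi (psi u))"
    by (simp add: pe_pCons[OF psi_linear] psi_add psi_scale psi_0)
  then have "affine_part (pe psi u q)" using a by (simp add: affine_part_add affine_part_scale)
  then show False using noeig q by blast
qed

lemma reduced_first: assumes red: "reduced t r m p" shows "p Vx \<noteq> Vx"
proof
  note rd = reducedD[OF red]
  assume "p Vx = Vx"
  then have "r Vx = m Vx *s t Vx" using low_zero[of t "r Vx - m Vx *s t Vx"] rd(6)[of Vx] by simp
  then have "t Vx = m Vx *s psi (t Vx)" using rd(5)[of Vx] by (simp add: psi_scale)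
  then have "(1 / m Vx) *s t Vx = (1 / m Vx) *s (m Vx *s psi (t Vx))" by simp
  then have "psi (t Vx) = (1 / m Vx) *s t Vx" using rd(4)[of Vx] by simp
  then show False using noeig[OF rd(9,8)] by blast
qed

text \<open>
  The quadratic parts of the last three functionals are linearly independent: a combination without quadratic part could
  be put at the front, and then the first two functionals of a flag would have no quadratic part. This excludes degenerate
  coefficients, and all permutations that move the first coordinate are covered.
\<close>
lemma good_rank3:
  assumes R3: "\<And>t. flagged t \<Longrightarrow> \<not> affine_part (t Vy)"
  shows "good F"
proof -
  obtain t0 where "flagged t0" using flag_exists[OF refl] by blast
  then obtain t r m p where red: "reduced t r m p" using reduction by blast
  note rd = reducedD[OF red]
  have top: "\<not> affine_part g" if "has_top t q g" "q \<noteq> Vx" for q g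
  proof
    assume "affine_part g"
    from R3[OF put_first[OF rd(1) this that(1)]] that(2) rd(9) show False by (cases q) auto
  qed
  have "surj p" using rd(3) by (simp add: finite_UNIV_inj_surj)
  then obtain jx jy jz jw where j: "p jx = Vx" "p jy = Vy" "p jz = Vz" "p jw = Vw" by (metis surjD)
  show ?thesis
  proof (rule good_from_normal_form[OF red])
    fix c0 p1 p2 p3 q1 q2 q3 q4 q5 q6 s1 s2 s3 s4 s5 s6 s7 s8 s9 s10
    assume hom: "\<And>j v. pairing (r j) (v \<diamondop> v) = hom2 (nf p m c0 p1 p2 p3 q1 q2 q3 q4 q5 q6 s1 s2 s3 s4 s5 s6 s7 s8 s9 s10) (\<lambda>i. pairing (t i) v) j"
    have topy: "has_top t Vy (r jy)" and topz: "has_top t Vz (r jz)" and topw: "has_top t Vw (r jw)"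
      using rd(7)[of jy] rd(7)[of jz] rd(7)[of jw] j by simp_all
    have p1: "p1 \<noteq> 0"
    proof
      assume "p1 = 0"
      then have "affine_part (r jy)" by (intro affine_partI) (simp add: hom hom2_nf j)
      then show False using top[OF topy] by simp
    qed
    have q: "q1 \<noteq> 0 \<or> q2 \<noteq> 0"
    proof (rule ccontr)
      assume "\<not> ?thesis"
      then have "affine_part (r jz + (- q3 / p1) *s r jy)"
        using p1 by (intro affine_partI) (simp add: hom hom2_nf j pairing_simps)
      moreover have "has_top t Vz (r jz + (- q3 / p1) *s r jy)"
        by (intro has_top_add topz low_scale has_top_low[OF topy]) simp
      ultimately show False using top by blast
    qed
    have s: "s4 * q2 \<noteq> s5 * q1" if z: "s1 = 0" "s2 = 0" "s3 = 0"
    proof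
      assume e: "s4 * q2 = s5 * q1"
      define l where "l = (if q1 \<noteq> 0 then s4 / q1 else s5 / q2)"
      have l: "s4 = l * q1" "s5 = l * q2" using q e by (auto simp: l_def field_simps)
      define l' where "l' = (s6 - l * q3) / p1"
      have l': "s6 = l * q3 + l' * p1" using p1 by (simp add: l'_def)
      have "affine_part (r jw + ((- l) *s r jz + (- l') *s r jy))"
        by (intro affine_partI) (simp add: hom hom2_nf j pairing_simps z l l' algebra_simps)
      moreover have "has_top t Vw (r jw + ((- l) *s r jz + (- l') *s r jy))"
        by (intro has_top_add topw low_add low_scale has_top_low[OF topy] has_top_low[OF topz]) simp_all
      ultimately show False using top by blast
    qed
    have d: "p Vy \<noteq> p Vx" "p Vz \<noteq> p Vx" "p Vw \<noteq> p Vx" "p Vy \<noteq> p Vz" "p Vy \<noteq> p Vw" "p Vz \<noteq> p Vw"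
      using rd(3) by (auto dest: injD)
    have q3: "q1 \<noteq> 0 \<or> q2 \<noteq> 0 \<or> q3 \<noteq> 0" using q by blast
    consider "p Vw = Vx" | "p Vx = Vy" | "p Vx = Vz" "p Vy = Vx" "p Vz = Vy" "p Vw = Vw" | "p Vx = Vz" "p Vy = Vx" "p Vz = Vw" "p Vw = Vy"
      | "p Vx = Vz" "p Vy = Vy" | "p Vx = Vz" "p Vy = Vw" "p Vz = Vx" "p Vw = Vy"
      | "p Vx = Vw" "p Vy = Vx" "p Vz = Vy" "p Vw = Vz" | "p Vx = Vw" "p Vy = Vx" "p Vz = Vz" "p Vw = Vy"
      | "p Vx = Vw" "p Vy = Vy" "p Vz = Vx" "p Vw = Vz" | "p Vx = Vw" "p Vy = Vz" "p Vz = Vx" "p Vw = Vy"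
      using d reduced_first[OF red] by (cases "p Vx"; cases "p Vy"; cases "p Vz"; cases "p Vw") auto
    then show "good (nf p m c0 p1 p2 p3 q1 q2 q3 q4 q5 q6 s1 s2 s3 s4 s5 s6 s7 s8 s9 s10)"
    proof cases
      case 1
      show ?thesis by (rule nf_dominant[OF rd(3) 1 p1 q s])
    next
      case 2
      show ?thesis by (rule nf_square[where p = p, OF 2 p1])
    next
      case 3
      show ?thesis by (rule nf_3124[where p = p, OF perm_eqI[where p = p, OF 3] rd(4)])
    next
      case 4
      show ?thesis by (rule nf_3142[where p = p, OF perm_eqI[where p = p, OF 4] rd(4)])
    next
      case 5
      show ?thesis by (rule nf_3214[where p = p, OF 5 p1 q])
    next
      case 6
      show ?thesis by (rule nf_3412[where p = p, OF two perm_eqI[where p = p, OF 6] rd(4) q3])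
    next
      case 7
      show ?thesis by (rule nf_4123[where p = p, OF perm_eqI[where p = p, OF 7] rd(4)])
    next
      case 8
      show ?thesis by (rule nf_4132[where p = p, OF perm_eqI[where p = p, OF 8] rd(4) q3])
    next
      case 9
      show ?thesis by (rule nf_4213[where p = p, OF perm_eqI[where p = p, OF 9] rd(4) p1 q])
    next
      case 10
      show ?thesis by (rule nf_4312[where p = p, OF two perm_eqI[where p = p, OF 10] rd(4) q3])
    qed
  qed
qed

text \<open>
  All functionals vanishing at a certain annihilating vector \<open>e\<close> have no quadratic part. A functional for which this
  remains true during two applications of \<open>psi\<close> generates coordinates in which the map is a recurrence.
\<close>
lemma good_rank1:
  assumes t: "flagged t" and aff: "affine_part (t Vy)" "affine_part (t Vz)" shows "good F"
proof -
  have ind: "indep t" and rad: "\<And>p u v. (\<forall>i. num i < num p \<longrightarrow> pairing (t i) u = 0) \<Longrightarrow> pairing (t p) (u \<diamondop> v) = 0"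
    using t unfolding flagged_def by blast+
  have affx: "affine_part (t Vx)" by (rule flagged_affine[OF t])
  obtain n where n: "\<And>i j. pairing (n i) (t j) = (if i = j then 1 else 0)" "\<And>v. (\<Sum>j\<in>UNIV. pairing (n j) v *s t j) = v"
    "\<And>v. (\<Sum>j\<in>UNIV. pairing (t j) v *s n j) = v"
    using indep_dual_basis[OF ind] by blast
  define e where "e = n Vw"
  have te: "pairing (t i) e = (if i = Vw then 1 else 0)" for i
    using n(1)[of Vw i] by (simp add: e_def pairing_commute[of "t i" "n Vw"])
  have affe: "affine_part g" if "pairing g e = 0" for g
  proof -
    have "g = pairing (n Vx) g *s t Vx + (pairing (n Vy) g *s t Vy + (pairing (n Vz) g *s t Vz + pairing e g *s t Vw))"
      using n(2)[of g] by (simp add: UNIV_idx e_def)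
    also have "pairing e g = 0" using that by (simp add: pairing_commute[of e g])
    finally have "g = pairing (n Vx) g *s t Vx + (pairing (n Vy) g *s t Vy + pairing (n Vz) g *s t Vz)" by simp
    moreover have "affine_part (pairing (n Vx) g *s t Vx + (pairing (n Vy) g *s t Vy + pairing (n Vz) g *s t Vz))"
      by (intro affine_part_add affine_part_scale affx aff)
    ultimately show ?thesis by simp
  qed
  have e_mul: "e \<diamondop> v = 0" for v
  proof -
    have "pairing (t p) (e \<diamondop> v) = 0" for p by (rule rad) (use num_less_4[of p] in \<open>auto simp: te\<close>)
    then show ?thesis using n(3)[of "e \<diamondop> v"] by simp
  qed
  \<comment> \<open>three linear conditions on a functional in dimension four: \<open>u\<close>, \<open>psi u\<close> and \<open>psi (psi u)\<close> all vanish at \<open>e\<close>\<close>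
  obtain u where u: "u \<noteq> 0" "pairing u e = 0" "pairing u (Li e) = 0" "pairing u (Li (Li e)) = 0" using common_zero by blast
  define z1 where "z1 = psi (psi u)"
  define z2 where "z2 = psi u"
  have au: "affine_part u" "affine_part z2" "affine_part z1"
    unfolding z1_def z2_def by (intro affe, simp add: pairing_psi u)+
  define T where "T = case_idx (psi z1) z1 z2 u"
  have "indep T" unfolding indep_def
  proof (intro allI impI)
    fix c :: "idx \<Rightarrow> 'k" and j assume "(\<Sum>j\<in>UNIV. c j *s T j) = 0"
    then have "pe psi u [:c Vw, c Vz, c Vy, c Vx:] = 0"
      by (simp add: UNIV_idx T_def pe_pCons[OF psi_linear] psi_add psi_scale psi_0 z1_def z2_def add_ac)
    then have "[:c Vw, c Vz, c Vy, c Vx:] = 0"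
      by (intro krylov_independent[OF u(1) au(1)]) (use au in \<open>simp_all add: z1_def z2_def\<close>)
    then show "c j = 0" by (cases j) simp_all
  qed
  note T = this
  obtain d where d: "\<And>i j. pairing (d i) (T j) = (if i = j then 1 else 0)" "\<And>v. (\<Sum>j\<in>UNIV. pairing (d j) v *s T j) = v"
    "\<And>v. (\<Sum>j\<in>UNIV. pairing (T j) v *s d j) = v"
    using indep_dual_basis[OF T] by blast
  have ze: "pairing z1 e = 0" "pairing z2 e = 0" by (simp_all add: z1_def z2_def pairing_psi u)
  have ed: "e = pairing (psi z1) e *s d Vx" using d(3)[of e] ze u(2) by (simp add: UNIV_idx T_def)
  have e0: "e \<noteq> 0" using te[of Vw] by (auto simp: pairing_0)
  have pe0: "pairing (psi z1) e \<noteq> 0" using ed e0 by auto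
  define T' where "T' = case_idx z1 z2 u (psi z1)"
  have T': "indep T'" unfolding indep_def
  proof (intro allI impI)
    fix c :: "idx \<Rightarrow> 'k" and j assume "(\<Sum>j\<in>UNIV. c j *s T' j) = 0"
    then have "(\<Sum>j\<in>UNIV. case_idx (c Vw) (c Vx) (c Vy) (c Vz) j *s T j) = 0"
      by (simp add: UNIV_idx T_def T'_def add_ac)
    then have "\<forall>j. case_idx (c Vw) (c Vx) (c Vy) (c Vz) j = 0" using T unfolding indep_def by blast
    then show "c j = 0" by (cases j) (simp_all add: all_idx)
  qed
  have "\<exists>b. (\<forall>i j. 3 \<le> num i \<or> 3 \<le> num j \<longrightarrow> b i j = 0) \<and>
    (\<forall>v. pairing (phi u) (v \<diamondop> v) = (\<Sum>i\<in>UNIV. \<Sum>j\<in>UNIV. b i j * (pairing (T' i) v * pairing (T' j) v)))"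
  proof (rule quadratic_in_coordinates[OF T'])
    fix w v assume "\<forall>i. num i < 3 \<longrightarrow> pairing (T' i) w = 0"
    then have z: "pairing z1 w = 0" "pairing z2 w = 0" "pairing u w = 0" by (simp_all add: all_idx T'_def)
    have "w = pairing (psi z1) w *s d Vx" using d(3)[of w] z by (simp add: UNIV_idx T_def)
    also have "d Vx = (1 / pairing (psi z1) e) *s e"
    proof -
      have "(1 / pairing (psi z1) e) *s e = (1 / pairing (psi z1) e) *s (pairing (psi z1) e *s d Vx)" using ed by simp
      then show ?thesis using pe0 by simp
    qed
    finally have w: "w = pairing (psi z1) w *s ((1 / pairing (psi z1) e) *s e)" .
    have "w \<diamondop> v = 0" by (subst w) (simp add: scale_left e_mul)
    then show "pairing (phi u) (w \<diamondop> v) = 0" by (simp add: pairing_0)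
  qed
  then obtain b where b: "\<forall>i j. 3 \<le> num i \<or> 3 \<le> num j \<longrightarrow> b i j = 0"
    "\<forall>v. pairing (phi u) (v \<diamondop> v) = (\<Sum>i\<in>UNIV. \<Sum>j\<in>UNIV. b i j * (pairing (T' i) v * pairing (T' j) v))" by blast
  obtain l where l: "phi u = (\<Sum>i\<in>UNIV. l i *s T i)" using indep_spans[OF T, of "phi u"] unfolding low_def by blast
  have l': "pairing (phi u) v = l Vx * pairing (psi z1) v + (l Vy * pairing z1 v + (l Vz * pairing z2 v + l Vw * pairing u v))" for v
    unfolding l by (simp add: UNIV_idx pairing_simps T_def)
  have a0: "pairing u (v \<diamondop> v) = 0" "pairing z1 (v \<diamondop> v) = 0" "pairing z2 (v \<diamondop> v) = 0" for v
    using au unfolding affine_part_def by blast+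
  let ?G = "case_idx [(1, [Vy]), (0, [Vx]), (pairing z1 k, []), (0, [Vz])] [(1, [Vz]), (0, [Vy]), (0, [Vx]), (pairing z2 k, [])]
     [(1, [Vw]), (0, [Vz]), (0, [Vy]), (0, [Vx]), (pairing u k, [])]
    [(b Vz Vz, [Vw, Vw]), (b Vy Vz + b Vz Vy, [Vz, Vw]), (b Vx Vz + b Vz Vx, [Vy, Vw]), (b Vy Vy, [Vz, Vz]),
     (b Vx Vy + b Vy Vx, [Vy, Vz]), (b Vx Vx, [Vy, Vy]),
     (l Vx, [Vx]), (l Vy, [Vy]), (l Vz, [Vz]), (l Vw, [Vw]), (pairing (phi u) k, [])]"
  show ?thesis
  proof (rule good_by_coordinates[OF T, of "case_idx z1 z2 u (phi u)" ?G])
    show "psi (case_idx z1 z2 u (phi u) j) = T j" for j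
      by (cases j) (simp_all add: T_def psi_phi z1_def z2_def)
    show "\<forall>(c, m)\<in>set (?G j). length m \<le> 2" for j by (cases j) auto
    show "good ?G" by (rule good_shift4[OF refl]) simp_all
    fix v j
    show "pairing (case_idx z1 z2 u (phi u) j) (k + v + v \<diamondop> v) = evk (?G j) (\<lambda>i. pairing (T i) v)"
      unfolding pairing_add
      by (cases j) (simp_all add: a0 T_def b UNIV_idx T'_def l'[of v] algebra_simps)
  qed
qed

text \<open>
  If some nonzero \<open>u\<close> and \<open>psi u\<close> both have no quadratic part, a flag beginning with them forces \<open>p Vy = Vx\<close>. Otherwise \<open>u\<close> is chosen
  in the plane of functionals without quadratic part such that \<open>psi u\<close> does not involve the last functional, which forces
  \<open>p Vz = Vx\<close> and \<open>p Vw = Vy\<close>.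
\<close>
lemma good_rank2:
  assumes R1: "\<And>t. flagged t \<Longrightarrow> affine_part (t Vy) \<Longrightarrow> \<not> affine_part (t Vz)"
    and t0: "flagged t0" "affine_part (t0 Vy)"
  shows "good F"
proof -
  have top: "q = Vx \<or> q = Vy" if "flagged t" "affine_part (t Vy)" "affine_part g" "has_top t q g" for t g q
  proof (rule ccontr)
    assume ne: "\<not> ?thesis"
    have "affine_part (t Vx)" by (rule flagged_affine[OF that(1)])
    then show False using R1[OF put_first[OF that(1,3,4)]] that(2) ne by (cases q) auto
  qed
  \<comment> \<open>the quadratic part of the functional of level \<open>Vz\<close> does not vanish\<close>
  have q3: "q1 \<noteq> 0 \<or> q2 \<noteq> 0 \<or> q3 \<noteq> 0"
    if red: "reduced t r m p" and ay: "affine_part (t Vy)"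
    and hom: "\<And>j v. pairing (r j) (v \<diamondop> v) = hom2 (nf p m c0 p1 p2 p3 q1 q2 q3 q4 q5 q6 s1 s2 s3 s4 s5 s6 s7 s8 s9 s10) (\<lambda>i. pairing (t i) v) j"
    for t r m p c0 p1 p2 p3 q1 q2 q3 q4 q5 q6 s1 s2 s3 s4 s5 s6 s7 s8 s9 s10
  proof (rule ccontr)
    assume z: "\<not> ?thesis"
    note rd = reducedD[OF red]
    have "surj p" using rd(3) by (simp add: finite_UNIV_inj_surj)
    then obtain jz where jz: "p jz = Vz" by (metis surjD)
    have "affine_part (r jz)" using z by (intro affine_partI) (simp add: hom hom2_nf jz)
    then show False using top[OF rd(1) ay _ rd(7)[of jz]] jz by simp
  qed
  have facts: "affine_part (t' Vy) \<and> t' Vx = t Vx \<and> (\<exists>a. t Vy = t' Vy - a *s t' Vx)"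
    if "flagged t" "affine_part (t Vy)" "\<And>j. low t (num j) (t' j - t j)" for t t'
  proof -
    have x: "t' Vx = t Vx" using low_zero[of t "t' Vx - t Vx"] that(3)[of Vx] by simp
    have "low t 1 (t' Vy - t Vy)" using that(3)[of Vy] unfolding num_simps .
    from low_explicit(1)[OF this] obtain a where a: "t' Vy - t Vy = a *s t Vx" by blast
    have "affine_part (t Vx)" by (rule flagged_affine[OF that(1)])
    then have "affine_part (t Vy + a *s t Vx)" by (intro affine_part_add affine_part_scale that(2))
    moreover have "t' Vy = t Vy + a *s t Vx" using a by (simp add: diff_eq_eq add.commute)
    ultimately show ?thesis using x by auto
  qed
  show ?thesis
  proof (cases "\<exists>u. affine_part u \<and> u \<noteq> 0 \<and> affine_part (psi u)")
    case True
    then obtain u where u: "affine_part u" "u \<noteq> 0" "affine_part (psi u)" by blast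
    have pu: "psi u \<noteq> 0" using u(2) psi_eq_0 by simp
    obtain ta where ta: "flagged ta" "ta Vx = psi u" using flagged_put_first[OF t0(1) u(3) pu] by blast
    have "indep ta" using ta(1) unfolding flagged_def by blast
    then obtain q where q: "has_top ta q u" using nonzero_has_top u(2) by blast
    have "q \<noteq> Vx"
    proof
      assume "q = Vx"
      then obtain c where c: "c \<noteq> 0" "low ta 0 (u - c *s ta Vx)" using q unfolding has_top_def by auto
      then have "u = c *s psi u" using low_zero[OF c(2)] ta(2) by simp
      then have "(1 / c) *s u = (1 / c) *s (c *s psi u)" by simp
      then have "psi u = (1 / c) *s u" using c(1) by simp
      then show False using noeig u by blast
    qed
    then obtain tb where tb: "flagged tb" "tb Vx = u" "tb Vy = psi u"
      using put_first[OF ta(1) u(1) q] ta(2) by (cases q) (auto intro: that)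
    obtain t r m p where red: "reduced t r m p" and d: "low tb (num j) (t j - tb j)" for j
      using reduction[OF tb(1)] by blast
    note rd = reducedD[OF red]
    obtain a where ay: "affine_part (t Vy)" and tx: "t Vx = u" and ty: "psi u = t Vy - a *s t Vx"
    proof -
      have "affine_part (t Vy) \<and> t Vx = tb Vx \<and> (\<exists>a. tb Vy = t Vy - a *s t Vx)"
        by (rule facts[OF tb(1) _ d]) (simp add: tb(3) u(3))
      then show ?thesis using that unfolding tb(2,3) by blast
    qed
    have "surj p" using rd(3) by (simp add: finite_UNIV_inj_surj)
    then obtain jx where jx: "p jx = Vx" by (metis surjD)
    have rjx: "r jx = m jx *s u" using low_zero[of t "r jx - m jx *s t Vx"] rd(6)[of jx] jx tx by simp
    have tjx: "t jx = m jx *s (t Vy - a *s t Vx)" using rd(5)[of jx] unfolding rjx psi_scale ty by simp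
    have "low t 2 (t jx)" unfolding tjx by (intro low_scale low_diff low_base) simp_all
    then have "\<not> 2 \<le> num jx" using low_self[OF rd(2), of jx] low_mono by blast
    then have "jx = Vx \<or> jx = Vy" by (cases jx) auto
    then have py: "p Vy = Vx" using jx reduced_first[OF red] by auto
    have px: "p Vx \<noteq> Vy"
    proof
      assume "p Vx = Vy"
      then have "low t 1 (r Vx - m Vx *s t Vy)" using rd(6)[of Vx] by simp
      from low_explicit(1)[OF this] obtain b where "r Vx - m Vx *s t Vy = b *s t Vx" by blast
      then have "r Vx = m Vx *s t Vy + b *s t Vx" by (simp add: diff_eq_eq add.commute)
      also have "t Vy = psi u + a *s u" using ty tx by simp
      finally have rx: "r Vx = m Vx *s psi u + (m Vx * a + b) *s u"
        by (simp add: tx vec.scale_right_distrib vec.scale_left_distrib add.assoc)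
      have u2: "u = m Vx *s psi (psi u) + (m Vx * a + b) *s psi u"
        using rd(5)[of Vx] unfolding rx tx psi_add psi_scale by simp
      then have z: "m Vx *s psi (psi u) + ((m Vx * a + b) *s psi u - u) = 0" by (simp only: add_diff_eq diff_self flip: u2)
      from solve_for[OF z rd(4)] have "psi (psi u) = (- 1 / m Vx) *s ((m Vx * a + b) *s psi u + (- 1) *s u)" by simp
      moreover have "affine_part ((- 1 / m Vx) *s ((m Vx * a + b) *s psi u + (- 1) *s u))"
        by (intro affine_part_scale affine_part_add u)
      ultimately have "affine_part (psi (psi u))" by simp
      moreover have "pe psi u [:- 1, m Vx * a + b, m Vx:] = m Vx *s psi (psi u) + ((m Vx * a + b) *s psi u - u)"
        by (simp add: pe_pCons[OF psi_linear] psi_add psi_scale psi_0 algebra_simps)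
      then have "pe psi u [:- 1, m Vx * a + b, m Vx:] = 0" unfolding z .
      ultimately have "[:- 1, m Vx * a + b, m Vx:] = 0" by (intro krylov_independent[OF u(2,1,3)]) simp_all
      then show False by simp
    qed
    show ?thesis
    proof (rule good_from_normal_form[OF red])
      fix c0 p1 p2 p3 q1 q2 q3 q4 q5 q6 s1 s2 s3 s4 s5 s6 s7 s8 s9 s10
      assume hom: "\<And>j v. pairing (r j) (v \<diamondop> v) = hom2 (nf p m c0 p1 p2 p3 q1 q2 q3 q4 q5 q6 s1 s2 s3 s4 s5 s6 s7 s8 s9 s10) (\<lambda>i. pairing (t i) v) j"
      note q = q3[OF red ay hom]
      have dd: "p Vz \<noteq> p Vx" "p Vw \<noteq> p Vx" "p Vy \<noteq> p Vz" "p Vy \<noteq> p Vw" "p Vz \<noteq> p Vw" "p Vx \<noteq> p Vy"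
        using rd(3) by (auto dest: injD)
      consider "p Vx = Vz" "p Vy = Vx" "p Vz = Vy" "p Vw = Vw" | "p Vx = Vz" "p Vy = Vx" "p Vz = Vw" "p Vw = Vy"
        | "p Vx = Vw" "p Vy = Vx" "p Vz = Vy" "p Vw = Vz" | "p Vx = Vw" "p Vy = Vx" "p Vz = Vz" "p Vw = Vy"
        using dd py px by (cases "p Vx"; cases "p Vz"; cases "p Vw") auto
      then show "good (nf p m c0 p1 p2 p3 q1 q2 q3 q4 q5 q6 s1 s2 s3 s4 s5 s6 s7 s8 s9 s10)"
      proof cases
        case 1
        show ?thesis by (rule nf_3124[where p = p, OF perm_eqI[where p = p, OF 1] rd(4)])
      next
        case 2
        show ?thesis by (rule nf_3142[where p = p, OF perm_eqI[where p = p, OF 2] rd(4)])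
      next
        case 3
        show ?thesis by (rule nf_4123[where p = p, OF perm_eqI[where p = p, OF 3] rd(4)])
      next
        case 4
        show ?thesis by (rule nf_4132[where p = p, OF perm_eqI[where p = p, OF 4] rd(4) q])
      qed
    qed
  next
    case False
    then have noA: "\<not> affine_part (psi u)" if "affine_part u" "u \<noteq> 0" for u using that by blast
    have ind: "indep t0" using t0(1) unfolding flagged_def by blast
    have ax: "affine_part (t0 Vx)" by (rule flagged_affine[OF t0(1)])
    obtain n where n: "\<And>i j. pairing (n i) (t0 j) = (if i = j then 1 else 0)" "\<And>v. (\<Sum>j\<in>UNIV. pairing (n j) v *s t0 j) = v"
      "\<And>v. (\<Sum>j\<in>UNIV. pairing (t0 j) v *s n j) = v"
      using indep_dual_basis[OF ind] by blast
    have low3: "low t0 3 g" if "pairing (n Vw) g = 0" for g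
      unfolding low_def by (rule exI[of _ "\<lambda>j. pairing (n j) g"]) (use that in \<open>simp add: n(2) all_idx\<close>)
    define a where "a = pairing (n Vw) (psi (t0 Vx))"
    define b where "b = pairing (n Vw) (psi (t0 Vy))"
    \<comment> \<open>a combination of the two affine functionals whose image under \<open>psi\<close> has no component at the last one\<close>
    define u where "u = (if a = 0 then t0 Vx else b *s t0 Vx - a *s t0 Vy)"
    have u: "affine_part u" unfolding u_def
      using affine_part_add[OF affine_part_scale[of "t0 Vx" b] affine_part_scale[of "t0 Vy" "- a"]] ax t0(2) by simp
    have psiu: "low t0 3 (psi u)"
    proof (rule low3)
      have "psi (b *s t0 Vx - a *s t0 Vy) = b *s psi (t0 Vx) + (- a) *s psi (t0 Vy)"
      proof -
        have "b *s t0 Vx - a *s t0 Vy = b *s t0 Vx + (- a) *s t0 Vy" by simp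
        then show ?thesis by (simp only: psi_add psi_scale)
      qed
      then show "pairing (n Vw) (psi u) = 0" by (auto simp: u_def a_def b_def pairing_simps)
    qed
    obtain tb where tb: "flagged tb" "tb Vx = u" "affine_part (tb Vy)" "low tb 3 (psi u)"
    proof (cases "a = 0")
      case True
      then have "t0 Vx = u" by (simp add: u_def)
      then show ?thesis using that[of t0] t0 psiu by blast
    next
      case False
      then have uu: "u = b *s t0 Vx - a *s t0 Vy" by (simp add: u_def)
      have tp: "has_top t0 Vy u" unfolding has_top_def
      proof (intro exI[of _ "- a"] conjI)
        have "low t0 (num Vy) (b *s t0 Vx)" by (intro low_scale low_base) simp
        then show "low t0 (num Vy) (u - - a *s t0 Vy)" unfolding uu by simp
      qed (use False in simp)
      let ?t = "case_idx u (t0 Vx) (t0 Vz) (t0 Vw)"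
      have yt: "t0 Vy = (b / a) *s ?t Vy + (- 1 / a) *s ?t Vx"
        using False by (simp add: uu vec.scale_right_diff_distrib)
      have "low ?t 3 (t0 i)" if "num i < 3" for i
      proof (cases i)
        case Vx
        have "low ?t 3 (?t Vy)" by (rule low_base) simp
        then show ?thesis using Vx by simp
      next
        case Vy
        have "low ?t 3 ((b / a) *s ?t Vy + (- 1 / a) *s ?t Vx)" by (intro low_add low_scale low_base) simp_all
        then show ?thesis unfolding Vy yt .
      next
        case Vz
        have "low ?t 3 (?t Vz)" by (rule low_base) simp
        then show ?thesis using Vz by simp
      next
        case Vw
        then show ?thesis using that by simp
      qed
      from low_trans[OF psiu this] have "low ?t 3 (psi u)" .
      then show ?thesis using that[of ?t] put_first[OF t0(1) u tp] ax by simp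
    qed
    obtain t r m p where red: "reduced t r m p" and d: "low tb (num j) (t j - tb j)" and lw: "low tb n g \<Longrightarrow> low t n g" for j n g
      using reduction[OF tb(1)] by blast
    note rd = reducedD[OF red]
    have ay: "affine_part (t Vy)" and tx: "t Vx = u" using facts[OF tb(1,3) d] tb(2) by auto
    have u0: "u \<noteq> 0" using rd(8)[of Vx] tx by simp
    have "surj p" using rd(3) by (simp add: finite_UNIV_inj_surj)
    then obtain jx jy where j: "p jx = Vx" "p jy = Vy" by (metis surjD)
    have "r jx = m jx *s u" using low_zero[of t "r jx - m jx *s t Vx"] rd(6)[of jx] j tx by simp
    then have tjx: "t jx = m jx *s psi u" using rd(5)[of jx] by (simp add: psi_scale)
    have n1: "jx \<noteq> Vx" using j reduced_first[OF red] by auto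
    have n2: "jx \<noteq> Vy"
    proof
      assume "jx = Vy"
      then have "affine_part ((1 / m jx) *s t jx)" using ay by (intro affine_part_scale) simp
      then have "affine_part (psi u)" using rd(4)[of jx] unfolding tjx by simp
      then show False using noA[OF u u0] by blast
    qed
    have n3: "jx \<noteq> Vw"
    proof
      assume "jx = Vw"
      then have "low t (num jx) (t jx)" unfolding tjx using lw[OF tb(4)] by (intro low_scale) simp
      then show False using low_self[OF rd(2)] by blast
    qed
    have pz: "p Vz = Vx" using n1 n2 n3 j by (cases jx) auto
    have "low t 1 (r jy - m jy *s t Vy)" using rd(6)[of jy] unfolding j num_simps .
    from low_explicit(1)[OF this] obtain c where "r jy - m jy *s t Vy = c *s t Vx" by blast
    then have "r jy = m jy *s t Vy + c *s t Vx" by (simp add: diff_eq_eq add.commute)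
    then have "affine_part (r jy)" using ay rd(9) by (simp add: affine_part_add affine_part_scale)
    moreover have "r jy \<noteq> 0" using rd(5)[of jy] rd(8)[of jy] psi_0 by metis
    ultimately have "\<not> affine_part (t jy)" using noA rd(5)[of jy] by metis
    then have "jy \<noteq> Vx" "jy \<noteq> Vy" using ay rd(9) by auto
    moreover have "jy \<noteq> Vz" using pz j(2) by auto
    ultimately have pw: "p Vw = Vy" using j(2) by (cases jy) auto
    show ?thesis
    proof (rule good_from_normal_form[OF red])
      fix c0 p1 p2 p3 q1 q2 q3 q4 q5 q6 s1 s2 s3 s4 s5 s6 s7 s8 s9 s10
      assume hom: "\<And>j v. pairing (r j) (v \<diamondop> v) = hom2 (nf p m c0 p1 p2 p3 q1 q2 q3 q4 q5 q6 s1 s2 s3 s4 s5 s6 s7 s8 s9 s10) (\<lambda>i. pairing (t i) v) j"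
      note q = q3[OF red ay hom]
      have dd: "p Vz \<noteq> p Vx" "p Vw \<noteq> p Vx" "p Vy \<noteq> p Vz" "p Vy \<noteq> p Vw" "p Vx \<noteq> p Vy"
        using rd(3) by (auto dest: injD)
      consider "p Vx = Vz" "p Vy = Vw" "p Vz = Vx" "p Vw = Vy" | "p Vx = Vw" "p Vy = Vz" "p Vz = Vx" "p Vw = Vy"
        using dd pz pw by (cases "p Vx"; cases "p Vy") auto
      then show "good (nf p m c0 p1 p2 p3 q1 q2 q3 q4 q5 q6 s1 s2 s3 s4 s5 s6 s7 s8 s9 s10)"
      proof cases
        case 1
        show ?thesis by (rule nf_3412[where p = p, OF two perm_eqI[where p = p, OF 1] rd(4) q])
      next
        case 2
        show ?thesis by (rule nf_4312[where p = p, OF two perm_eqI[where p = p, OF 2] rd(4) q])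
      qed
    qed
  qed
qed

end

theorem good_system: "good F"
proof (cases "\<exists>u \<mu>. affine_part u \<and> u \<noteq> 0 \<and> psi u = \<mu> *s u")
  case True
  then show ?thesis using good_if_eigenvector by blast
next
  case False
  then have noeig: "affine_part u \<Longrightarrow> u \<noteq> 0 \<Longrightarrow> psi u \<noteq> \<mu> *s u" for u \<mu> by blast
  show ?thesis
  proof (cases "\<exists>t. flagged t \<and> affine_part (t Vy) \<and> affine_part (t Vz)")
    case True
    then show ?thesis using good_rank1[OF noeig] by blast
  next
    case no1: False
    show ?thesis
    proof (cases "\<exists>t. flagged t \<and> affine_part (t Vy)")
      case True
      then show ?thesis using good_rank2[OF noeig] no1 by blast
    next
      case False
      then show ?thesis using good_rank3[OF noeig] by blast
    qed
  qed
qed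

end

section \<open>Evaluation of polynomials\<close>

text \<open>
  Evaluation of polynomials at points with coordinates in an extension of the coefficient ring, needed both for points
  over the algebraic closure and for points with coordinates in the series.
\<close>
locale coefficient_hom =
  fixes \<phi> :: "'k::comm_ring_1 \<Rightarrow> 'r::comm_ring_1"
  assumes hom_0: "\<phi> 0 = 0" and hom_1: "\<phi> 1 = 1" and hom_add: "\<phi> (a + b) = \<phi> a + \<phi> b" and hom_mult: "\<phi> (a * b) = \<phi> a * \<phi> b"
begin

definition mono :: "('n::finite \<Rightarrow> 'r) \<Rightarrow> ('n \<Rightarrow>\<^sub>0 nat) \<Rightarrow> 'r"
  where "mono a m = (\<Prod>i\<in>UNIV. a i ^ Poly_Mapping.lookup m i)"

definition mev :: "('n::finite \<Rightarrow> 'r) \<Rightarrow> ('n, 'k) mpoly \<Rightarrow> 'r"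
  where "mev a p = (\<Sum>m\<in>Poly_Mapping.keys p. \<phi> (Poly_Mapping.lookup p m) * mono a m)"

lemma mono_add: "mono a (m + n) = mono a m * mono a n"
  by (simp add: mono_def lookup_add power_add prod.distrib)

lemma mev_superset:
  assumes "finite S" "Poly_Mapping.keys p \<subseteq> S"
  shows "mev a p = (\<Sum>m\<in>S. \<phi> (Poly_Mapping.lookup p m) * mono a m)"
  unfolding mev_def using assms by (intro sum.mono_neutral_left) (auto simp: in_keys_iff hom_0)

lemma mev_add: "mev a (p + q) = mev a p + mev a q"
proof -
  let ?S = "Poly_Mapping.keys p \<union> Poly_Mapping.keys q"
  have "Poly_Mapping.keys (p + q) \<subseteq> ?S" by (rule Poly_Mapping.keys_add)
  then show ?thesis
    using mev_superset[of ?S p a] mev_superset[of ?S q a] mev_superset[of ?S "p + q" a]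
    by (simp add: lookup_add hom_add distrib_right sum.distrib)
qed

lemma mev_0: "mev a 0 = 0"
  by (simp add: mev_def)

lemma mev_sum: "mev a (sum f I) = (\<Sum>i\<in>I. mev a (f i))"
  by (induction I rule: infinite_finite_induct) (simp_all add: mev_0 mev_add)

lemma mev_single: "mev a (Poly_Mapping.single m c) = \<phi> c * mono a m"
  by (cases "c = 0") (simp_all add: mev_def hom_0)

lemma mpoly_decompose: "p = (\<Sum>m\<in>Poly_Mapping.keys p. Poly_Mapping.single m (Poly_Mapping.lookup p m))"
proof (rule poly_mapping_eqI)
  fix k
  show "Poly_Mapping.lookup p k = Poly_Mapping.lookup (\<Sum>m\<in>Poly_Mapping.keys p. Poly_Mapping.single m (Poly_Mapping.lookup p m)) k"
    by (simp add: lookup_sum lookup_single when_def in_keys_iff)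
qed

lemma mev_mult: "mev a (p * q) = mev a p * mev a q"
proof -
  have "p * q = (\<Sum>m\<in>Poly_Mapping.keys p. Poly_Mapping.single m (Poly_Mapping.lookup p m)) * (\<Sum>n\<in>Poly_Mapping.keys q. Poly_Mapping.single n (Poly_Mapping.lookup q n))"
    by (simp flip: mpoly_decompose)
  also have "\<dots> = (\<Sum>m\<in>Poly_Mapping.keys p. \<Sum>n\<in>Poly_Mapping.keys q. Poly_Mapping.single (m + n) (Poly_Mapping.lookup p m * Poly_Mapping.lookup q n))"
    by (simp add: sum_product mult_single)
  finally have "mev a (p * q) = (\<Sum>m\<in>Poly_Mapping.keys p. \<Sum>n\<in>Poly_Mapping.keys q.
      (\<phi> (Poly_Mapping.lookup p m) * mono a m) * (\<phi> (Poly_Mapping.lookup q n) * mono a n))"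
    by (simp add: mev_sum mev_single hom_mult mono_add mult_ac)
  then show ?thesis by (simp add: mev_def sum_product)
qed

lemma mev_1: "mev a 1 = 1"
  using mev_single[of a 0 1] by (simp add: mono_def hom_1)

lemma mev_power: "mev a (p ^ n) = mev a p ^ n"
  by (induction n) (simp_all add: mev_1 mev_mult)

lemma mev_prod: "mev a (prod f I) = (\<Prod>i\<in>I. mev a (f i))"
  by (induction I rule: infinite_finite_induct) (simp_all add: mev_1 mev_mult)

lemma mev_mconst: "mev a (mconst c) = \<phi> c"
  by (simp add: mconst_def mev_single mono_def)

lemma mev_mvar: "mev a (mvar i) = a i"
proof -
  have "mono a (Poly_Mapping.single i 1) = (\<Prod>j\<in>UNIV. if i = j then a j else 1)"
    unfolding mono_def by (intro prod.cong refl) (auto simp: lookup_single when_def)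
  then show ?thesis by (simp add: mvar_def mev_single hom_1)
qed

lemma mev_msubst: "mev a (msubst p g) = mev (\<lambda>i. mev a (g i)) p"
  by (simp add: msubst_def mev_sum mev_mult mev_mconst mev_prod mev_power mev_def[of _ p] mono_def)

lemma mev_endo_iter: "mev a (endo_iter f r i) = ((\<lambda>a i. mev a (f i)) ^^ r) a i"
proof (induction r arbitrary: i)
  case 0
  then show ?case by (simp add: endo_iter_def mev_mvar)
next
  case (Suc r)
  have "endo_iter f (Suc r) i = msubst (f i) (endo_iter f r)" by (simp add: endo_iter_def endo_comp_def)
  then have "mev a (endo_iter f (Suc r) i) = mev (\<lambda>i. mev a (endo_iter f r i)) (f i)" by (simp add: mev_msubst)
  then show ?case by (simp add: Suc)
qed

end

section \<open>Dynamical degrees of quadratic automorphisms\<close>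

lemma mdegree_le_iff: "mdegree p \<le> d \<longleftrightarrow> (\<forall>m\<in>Poly_Mapping.keys p. (\<Sum>i\<in>UNIV. Poly_Mapping.lookup m i) \<le> d)"
  unfolding mdegree_def by auto

lemma endo_degree_le_iff: "endo_degree f \<le> d \<longleftrightarrow> (\<forall>i. mdegree (f i) \<le> d)"
  unfolding endo_degree_def by auto

lemma bd_power:
  fixes p :: "real \<Rightarrow>\<^sub>0 'p::comm_semiring_1"
  assumes "bd p t" shows "bd (p ^ n) (real n * t)"
proof (induction n)
  case 0
  then show ?case by (simp add: bd_1)
next
  case (Suc n)
  have "bd (p * p ^ n) (t + real n * t)" by (rule bd_mult[OF assms Suc])
  then show ?case by (simp add: algebra_simps)
qed

lemma bd_prod:
  fixes p :: "'i \<Rightarrow> real \<Rightarrow>\<^sub>0 'p::comm_semiring_1"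
  shows "(\<And>i. i \<in> I \<Longrightarrow> bd (p i) (t i)) \<Longrightarrow> bd (prod p I) (sum t I)"
  by (induction I rule: infinite_finite_induct) (auto intro!: bd_mult bd_1)

text \<open>
  The bounds determine the exponential rate, since roots of constants tend to 1.
\<close>
lemma limit_of_roots:
  fixes d :: "nat \<Rightarrow> nat"
  assumes th: "\<theta> \<ge> 1" and ub: "\<And>\<theta>'. \<theta>' > \<theta> \<Longrightarrow> \<exists>C. \<forall>r. real (d r) \<le> C * \<theta>' ^ r"
    and lb: "c > 0" "\<And>r. c * \<theta> ^ r \<le> real (d r)"
  shows "(\<lambda>r. root r (real (d r))) \<longlonglongrightarrow> \<theta>"
proof (rule order_tendstoI)
  fix a assume a: "a < \<theta>"
  have "(\<lambda>r. root r c * \<theta>) \<longlonglongrightarrow> 1 * \<theta>" by (intro tendsto_intros LIMSEQ_root_const lb)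
  then have "eventually (\<lambda>r. a < root r c * \<theta>) sequentially" using a by (intro order_tendstoD) auto
  then show "eventually (\<lambda>r. a < root r (real (d r))) sequentially"
    using eventually_gt_at_top[of 0]
  proof eventually_elim
    case (elim r)
    have "root r c * \<theta> = root r (c * \<theta> ^ r)" using elim(2) th by (simp add: real_root_mult real_root_power_cancel)
    also have "\<dots> \<le> root r (real (d r))" using elim(2) lb(2)[of r] by (rule real_root_le_mono)
    finally show ?case using elim(1) by linarith
  qed
next
  fix a assume a: "\<theta> < a"
  define \<theta>' where "\<theta>' = (\<theta> + a) / 2"
  have t: "\<theta> < \<theta>'" "\<theta>' < a" using a by (auto simp: \<theta>'_def)
  obtain C where C: "\<And>r. real (d r) \<le> C * \<theta>' ^ r" using ub[OF t(1)] by blast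
  have "real (d r) \<le> max C 1 * \<theta>' ^ r" for r
    using C[of r] t th mult_right_mono[of C "max C 1" "\<theta>' ^ r"] by (simp add: order_trans)
  note C' = this
  have "(\<lambda>r. root r (max C 1) * \<theta>') \<longlonglongrightarrow> 1 * \<theta>'" by (intro tendsto_intros LIMSEQ_root_const) simp
  then have "eventually (\<lambda>r. root r (max C 1) * \<theta>' < a) sequentially" using t by (intro order_tendstoD) auto
  then show "eventually (\<lambda>r. root r (real (d r)) < a) sequentially"
    using eventually_gt_at_top[of 0]
  proof eventually_elim
    case (elim r)
    have "root r (real (d r)) \<le> root r (max C 1 * \<theta>' ^ r)" using elim(2) C'[of r] by (rule real_root_le_mono)
    also have "\<dots> = root r (max C 1) * \<theta>'" using elim(2) th t by (simp add: real_root_mult real_root_power_cancel)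
    finally show ?case using elim(1) by linarith
  qed
qed

lemma alg4_conclusion:
  assumes "alg4 \<theta>" shows "algebraic_int \<theta> \<and> degree_over_rat \<theta> \<le> 4"
proof -
  obtain p :: "int poly" where p: "Polynomial.lead_coeff p = 1" "Polynomial.degree p \<le> 4" "poly (map_poly of_int p) \<theta> = 0"
    using assms unfolding alg4_def by blast
  define q :: "rat poly" where "q = map_poly of_int p"
  have "degree_over_rat \<theta> \<le> Polynomial.degree q" unfolding degree_over_rat_def
  proof (rule Least_le, intro exI conjI)
    have "map_poly of_rat q = map_poly (of_int :: int \<Rightarrow> real) p" unfolding q_def by (subst map_poly_map_poly) (simp_all add: comp_def)
    then show "poly (map_poly of_rat q) \<theta> = 0" using p(3) by simp
    have "Polynomial.coeff q (Polynomial.degree p) = 1" unfolding q_def by (simp add: coeff_map_poly p(1))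
    then show "q \<noteq> 0" by auto
  qed simp
  also have "Polynomial.degree q \<le> 4" unfolding q_def by (rule degree_le) (use p(2) in \<open>auto simp: coeff_map_poly coeff_eq_0\<close>)
  finally show ?thesis using p by (auto simp: algebraic_int_altdef_ipoly)
qed

lemma card_idx: "CARD(idx) = CARD(4)"
  unfolding UNIV_idx by simp

text \<open>
  Polarization: \<open>h (u + v) - h (u - v) = 2 (M v + 2 B u v)\<close>. For \<open>u = 0\<close> this shows that \<open>M\<close> is injective, and in general that
  \<open>M\<^sup>-\<^sup>1 B(u, v)\<close> is no nonzero multiple of \<open>v\<close>.
\<close>
lemma quadratic_system_good:
  fixes F :: "('k::alg_closed_field) sys"
  assumes two: "(2::'k) \<noteq> 0" and len: "\<And>j. \<forall>(c, m)\<in>set (F j). length m \<le> 2"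
    and inj: "\<And>v w. (\<forall>j. evk (F j) v = evk (F j) w) \<Longrightarrow> v = w"
  shows "good F"
proof -
  have id: "affine2 (\<lambda>v :: idx \<Rightarrow> 'k. v j) (\<lambda>a. a j)" for j
    using affine2_linear[of "\<lambda>i. if i = j then 1 else (0 :: 'k)"] by (simp add: if_distrib[of cst] if_distrib[of "\<lambda>u. u * _"] cong: if_cong)
  have "\<forall>j. \<exists>cl. \<forall>v. evk (F j) v = fst cl + (\<Sum>i\<in>UNIV. fst (snd cl) i * v i) + (\<Sum>i\<in>UNIV. \<Sum>k\<in>UNIV. snd (snd cl) i k * (v i * v k))"
  proof
    fix j
    have "quadratic2 (\<lambda>v. evk (F j) (\<lambda>j. v j)) (\<lambda>a. ev (F j) (\<lambda>j. a j))" by (rule quadratic2_ev[OF len id])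
    then obtain c l b where "\<forall>v. evk (F j) v = c + (\<Sum>i\<in>UNIV. l i * v i) + (\<Sum>i\<in>UNIV. \<Sum>k\<in>UNIV. b i k * (v i * v k))"
      unfolding quadratic2_def by blast
    then show "\<exists>cl. \<forall>v. evk (F j) v = fst cl + (\<Sum>i\<in>UNIV. fst (snd cl) i * v i) + (\<Sum>i\<in>UNIV. \<Sum>k\<in>UNIV. snd (snd cl) i k * (v i * v k))"
      by (intro exI[of _ "(c, l, b)"]) simp
  qed
  from choice[OF this] obtain cl where cl: "\<forall>j v. evk (F j) v = fst (cl j) + (\<Sum>i\<in>UNIV. fst (snd (cl j)) i * v i)
    + (\<Sum>i\<in>UNIV. \<Sum>k\<in>UNIV. snd (snd (cl j)) i k * (v i * v k))" ..
  define K where "K = (\<chi> j. fst (cl j))"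
  define M where "M = (\<chi> j i. fst (snd (cl j)) i)"
  define b where "b j i k = (snd (snd (cl j)) i k + snd (snd (cl j)) k i) / 2" for j i k
  define B where "B u v = (\<chi> j. \<Sum>i\<in>UNIV. \<Sum>k\<in>UNIV. b j i k * (vec_nth u i * vec_nth v k))" for u v
  have half: "a = a / 2 + a / 2" for a :: 'k using two by (simp add: field_simps)
  have F_eq: "evk (F j) (vec_nth v) = vec_nth (K + M *v v + B v v) j" for j v
  proof -
    have "(\<Sum>i\<in>UNIV. \<Sum>k\<in>UNIV. snd (snd (cl j)) i k * (vec_nth v i * vec_nth v k))
      = (\<Sum>i\<in>UNIV. \<Sum>k\<in>UNIV. snd (snd (cl j)) i k / 2 * (vec_nth v i * vec_nth v k)) + (\<Sum>i\<in>UNIV. \<Sum>k\<in>UNIV. snd (snd (cl j)) i k / 2 * (vec_nth v i * vec_nth v k))"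
      by (simp only: sum.distrib[symmetric] distrib_right[symmetric] half[symmetric])
    also have "(\<Sum>i\<in>UNIV. \<Sum>k\<in>UNIV. snd (snd (cl j)) i k / 2 * (vec_nth v i * vec_nth v k)) + (\<Sum>i\<in>UNIV. \<Sum>k\<in>UNIV. snd (snd (cl j)) i k / 2 * (vec_nth v i * vec_nth v k))
      = (\<Sum>i\<in>UNIV. \<Sum>k\<in>UNIV. snd (snd (cl j)) i k / 2 * (vec_nth v i * vec_nth v k)) + (\<Sum>i\<in>UNIV. \<Sum>k\<in>UNIV. snd (snd (cl j)) k i / 2 * (vec_nth v k * vec_nth v i))"
      by (subst (2) sum.swap) simp
    also have "\<dots> = vec_nth (B v v) j"
      by (simp add: B_def b_def add_divide_distrib distrib_right sum.distrib mult.commute[of "vec_nth v k" "vec_nth v i" for i k])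
    finally show ?thesis using cl by (simp add: K_def M_def matrix_vector_mult_def)
  qed
  have b_sym: "b j i k = b j k i" for j i k by (simp add: b_def add.commute)
  have B_comm: "B u v = B v u" for u v
    unfolding B_def vec_eq_iff by (simp, intro allI, subst sum.swap, intro sum.cong refl) (simp add: b_sym mult.commute)
  have B_add: "B (u + u') v = B u v + B u' v" and B_scale: "B (c *s u) v = c *s B u v" for u u' v c
    by (simp_all add: B_def vec_eq_iff algebra_simps sum.distrib sum_distrib_left)
  have B_add2: "B u (v + v') = B u v + B u v'" and B_scale2: "B u (c *s v) = c *s B u v" for u v v' c
    using B_add[of v v' u] B_scale[of c v u] by (simp_all add: B_comm[of u])
  have B_minus: "B (- u) v = - B u v" "B u (- v) = - B u v" for u v
    using B_scale[of "-1" u v] B_scale2[of u "-1" v] by simp_all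
  define h where "h v = K + M *v v + B v v" for v
  have h_inj: "v = w" if "h v = h w" for v w
  proof -
    have "\<forall>j. evk (F j) (vec_nth v) = evk (F j) (vec_nth w)" using that unfolding F_eq h_def by metis
    then have "vec_nth v = vec_nth w" by (rule inj)
    then show ?thesis by (simp add: vec_nth_inject)
  qed
  have M_minus: "M *v (- v) = - (M *v v)" for v
    using vec.linear_scale[OF matrix_vector_mul_linear_gen, of M "-1" v] by simp
  have "\<forall>v. M *v v = 0 \<longrightarrow> v = 0"
  proof (intro allI impI)
    fix v assume "M *v v = 0"
    then have "h v = h (- v)" by (simp add: h_def M_minus B_minus)
    then have "v = - v" by (rule h_inj)
    then have "2 *s v = 0" by (simp add: vec.scale_left_distrib[of 1 1, simplified] eq_neg_iff_add_eq_0)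
    then show "v = 0" using two by simp
  qed
  then obtain N where N: "N ** M = mat 1" unfolding matrix_left_invertible_ker[symmetric] by blast
  then have N': "M ** N = mat 1" by (simp add: matrix_left_right_inverse)
  have MN: "M *v (N *v v) = v" "N *v (M *v v) = v" for v
    by (simp_all add: matrix_vector_mul_assoc N N')
  have lin: "Vector_Spaces.linear (*s) (*s) ((*v) A)" for A :: "'k ^ idx ^ idx" by (rule matrix_vector_mul_linear_gen)
  have noeig: "v = 0" if c: "c \<noteq> 0" and e: "N *v B u v = c *s v" for u v and c :: 'k
  proof -
    \<comment> \<open>an eigenvector would give two distinct points \<open>u' + v\<close> and \<open>u' - v\<close> with the same image\<close>
    define u' where "u' = (- 1 / (2 * c)) *s u"
    have "B u v = c *s (M *v v)" using arg_cong[OF e, of "\<lambda>w. M *v w"] by (simp add: MN vec.linear_scale[OF lin])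
    then have "B u' v = (- 1 / 2) *s (M *v v)" unfolding u'_def B_scale using c two by (simp only: vec.scale_scale) (simp add: field_simps)
    then have z: "2 *s B u' v + M *v v = 0" using two by simp
    have "h (u' + v) - h (u' - v) = 2 *s (2 *s B u' v + M *v v)"
    proof -
      have "h (u' + v) = K + (M *v u' + M *v v) + (B u' u' + B u' v + (B u' v + B v v))"
        unfolding h_def B_add B_add2 B_comm[of v u'] by (simp add: vec.linear_add[OF lin])
      moreover have "h (u' - v) = K + (M *v u' - M *v v) + (B u' u' - B u' v - (B u' v - B v v))"
        unfolding h_def diff_conv_add_uminus B_add B_add2 B_minus B_comm[of v u'] by (simp add: vec.linear_add[OF lin] vec.linear_diff[OF lin] M_minus)
      ultimately show ?thesis by (simp add: vec.scale_left_distrib[of 1 1, simplified])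
    qed
    then have "h (u' + v) = h (u' - v)" unfolding z by simp
    then have "u' + v = u' - v" by (rule h_inj)
    then have "2 *s v = 0" by (simp add: vec.scale_left_distrib[of 1 1, simplified] eq_neg_iff_add_eq_0)
    then show "v = 0" using two by simp
  qed
  have alg: "eigenfree_algebra UNIV (\<lambda>u v. N *v B u v)"
  proof (rule eigenfree_algebra.intro)
    show "N *v B u v = N *v B v u" for u v by (simp only: B_comm)
    show "N *v B (u + v) w = N *v B u w + N *v B v w" for u v w by (simp add: B_add vec.linear_add[OF lin])
    show "N *v B (c *s u) v = c *s (N *v B u v)" for c u v by (simp add: B_scale vec.linear_scale[OF lin])
  qed (use two noeig vec.subspace_UNIV in auto)
  have "quadratic_automorphism (\<lambda>u v. N *v B u v) ((*v) M) ((*v) N) (N *v K) F"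
  proof (rule quadratic_automorphism.intro[OF alg], rule quadratic_automorphism_axioms.intro)
    show "evk (F j) (vec_nth v) = vec_nth (M *v (N *v K + v + N *v B v v)) j" for j v
      unfolding F_eq by (simp add: vec.linear_add[OF lin] MN)
  qed (rule lin MN len)+
  then show ?thesis by (rule quadratic_automorphism.good_system)
qed

text \<open>
  Degrees are compared with orbits in the series. At the generic point the largest exponent of an iterate is its degree,
  which gives the upper bound. For the lower bound an arbitrary starting point is allowed, since an iterate of degree
  \<open>d\<close> multiplies exponents at most by \<open>d\<close>.
\<close>
theorem corollary1p5:
  fixes f :: "(4, 'k::field) endo"
  assumes "CHAR('k) \<noteq> 2"
    and "f \<in> Aut_affine"
    and "endo_degree f = 2"
  shows "algebraic_int (dynamical_degree f) \<and> degree_over_rat (dynamical_degree f) \<le> 4"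
proof -
  have two: "(2::'k) \<noteq> 0"
  proof
    assume "(2::'k) = 0"
    then have "of_nat 2 = (0::'k)" by simp
    then have "CHAR('k) dvd 2" by (simp only: of_nat_eq_0_iff_char_dvd)
    then have "CHAR('k) \<le> 2" "CHAR('k) \<noteq> 0" using dvd_imp_le[of "CHAR('k)" 2] by (auto intro: ccontr)
    moreover have "CHAR('k) \<noteq> 1"
    proof
      assume "CHAR('k) = 1"
      then have "of_nat 1 = (0::'k)" by (simp only: of_nat_eq_0_iff_char_dvd) simp
      then show False by simp
    qed
    ultimately show False using assms(1) by linarith
  qed
  then have two': "(2::'k alg_closure) \<noteq> 0" by (metis to_ac_eq_0_iff to_ac_numeral)
  obtain g where g: "endo_comp g f = mvar" using assms(2) unfolding Aut_affine_def by blast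
  interpret K: coefficient_hom "to_ac :: 'k \<Rightarrow> 'k alg_closure"
    by unfold_locales simp_all
  interpret S: coefficient_hom "\<lambda>c :: 'k. cst (to_ac c) :: 'k alg_closure ser"
    by unfold_locales (simp_all add: cst_hom)
  obtain e :: "idx \<Rightarrow> 4" where e: "bij e"
    using finite_same_card_bij[of "UNIV :: idx set" "UNIV :: 4 set"] card_idx by auto
  define e' where "e' = inv_into UNIV e"
  have ee: "e' (e j) = j" "e (e' i) = i" for i j
    unfolding e'_def using e by (simp_all add: bij_is_inj bij_is_surj surj_f_inv_f)
  define word where "word m = concat (map (\<lambda>i. replicate (Poly_Mapping.lookup m (e i)) i) [Vx, Vy, Vz, Vw])" for m :: "4 \<Rightarrow>\<^sub>0 nat"
  have reindex: "(\<Prod>i\<in>UNIV. h i) = (\<Prod>j\<in>UNIV. h (e j))" for h :: "4 \<Rightarrow> 'r::comm_monoid_mult"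
    using prod.reindex_bij_betw[OF e, of h] by simp
  have reindex_sum: "(\<Sum>i\<in>UNIV. h i) = (\<Sum>j\<in>UNIV. h (e j))" for h :: "4 \<Rightarrow> nat"
    using sum.reindex_bij_betw[OF e, of h] by simp
  have word: "prod_list (map a (word m)) = (\<Prod>i\<in>UNIV. a (e' i) ^ Poly_Mapping.lookup m i)" for m and a :: "idx \<Rightarrow> 'r::comm_monoid_mult"
    unfolding reindex ee by (simp add: word_def UNIV_idx prod_list_replicate mult.assoc)
  have length_word: "length (word m) = (\<Sum>i\<in>UNIV. Poly_Mapping.lookup m i)" for m
    unfolding reindex_sum by (simp add: word_def UNIV_idx)
  have "\<forall>j. \<exists>l. set l = Poly_Mapping.keys (f (e j)) \<and> distinct l" by (simp add: finite_distinct_list)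
  from choice[OF this] obtain l where l: "\<forall>j. set (l j) = Poly_Mapping.keys (f (e j)) \<and> distinct (l j)" ..
  define F where "F j = map (\<lambda>m. (to_ac (Poly_Mapping.lookup (f (e j)) m), word m)) (l j)" for j
  have evF: "ev (F j) a = S.mev (\<lambda>i. a (e' i)) (f (e j))" for j a
    using l[THEN spec, of j]
    by (simp add: ev_def F_def comp_def S.mev_def S.mono_def word sum_list_distinct_conv_sum_set)
  have evkF: "evk (F j) v = K.mev (\<lambda>i. v (e' i)) (f (e j))" for j v
    using l[THEN spec, of j]
    by (simp add: evk_def F_def comp_def K.mev_def K.mono_def word sum_list_distinct_conv_sum_set)
  have deg2: "mdegree (f i) \<le> 2" for i using assms(3) endo_degree_le_iff[of f 2] by simp
  have len: "\<forall>(c, m)\<in>set (F j). length m \<le> 2" for j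
    using deg2[of "e j"] l[THEN spec, of j] unfolding mdegree_le_iff by (auto simp: F_def length_word)
  have f_inj: "a = b" if "\<And>i. K.mev a (f i) = K.mev b (f i)" for a b
  proof
    fix i
    have "K.mev a (msubst (g i) f) = K.mev b (msubst (g i) f)" unfolding K.mev_msubst that ..
    moreover have "msubst (g i) f = mvar i" using g unfolding endo_comp_def by (rule fun_cong)
    ultimately show "a i = b i" by (simp add: K.mev_mvar)
  qed
  have "good F"
  proof (rule quadratic_system_good[OF two' len])
    fix v w assume eq: "\<forall>j. evk (F j) v = evk (F j) w"
    have "(\<lambda>i. v (e' i)) = (\<lambda>i. w (e' i))"
    proof (rule f_inj)
      fix i show "K.mev (\<lambda>i. v (e' i)) (f i) = K.mev (\<lambda>i. w (e' i)) (f i)" using eq evkF[of "e' i"] ee by metis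
    qed
    then have "v (e' (e j)) = w (e' (e j))" for j by (rule fun_cong)
    then show "v = w" by (intro ext) (simp add: ee)
  qed
  then obtain \<theta> where th: "\<theta> \<ge> 1" "alg4 \<theta>" and UB: "UB F \<theta>" and LB: "\<theta> = 1 \<or> LB F \<theta>" unfolding good_def by blast
  define d where "d r = endo_degree (endo_iter f r)" for r
  have orbit: "(hmap F ^^ r) s j = S.mev (\<lambda>i. s (e' i)) (endo_iter f r (e j))" for r s j
  proof -
    have "(\<lambda>i. (hmap F ^^ r) s (e' i)) = ((\<lambda>a i. S.mev a (f i)) ^^ r) (\<lambda>i. s (e' i))"
      by (induction r) (simp_all add: hmap_def evF ee fun_eq_iff)
    from fun_cong[OF this, of "e j"] show ?thesis by (simp add: ee S.mev_endo_iter)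
  qed
  \<comment> \<open>at the generic point scaled by the first power of the series variable, exponents of the series are degrees\<close>
  define s0 :: "idx \<Rightarrow> 'k alg_closure ser" where "s0 j = Poly_Mapping.single 1 (mvar (e j))" for j
  have pow: "Poly_Mapping.single 1 x ^ n = Poly_Mapping.single (real n) (x ^ n)" for x :: "(4, 'k alg_closure) mpoly" and n
    by (induction n) (simp_all add: mult_single add.commute)
  have mvar_pow: "mvar i ^ n = (Poly_Mapping.single (Poly_Mapping.single i n) 1 :: (4, 'k alg_closure) mpoly)" for i n
    by (induction n) (simp_all add: mvar_def mult_single flip: single_add)
  have prod_single: "(\<Prod>i\<in>I. Poly_Mapping.single (t i) (x i)) = Poly_Mapping.single (\<Sum>i\<in>I. t i) (\<Prod>i\<in>I. x i)"
    for I :: "4 set" and t :: "4 \<Rightarrow> 't::comm_monoid_add" and x :: "4 \<Rightarrow> 'r::comm_semiring_1"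
    by (induction I rule: infinite_finite_induct) (simp_all add: mult_single)
  have mono0: "S.mono (\<lambda>i. s0 (e' i)) m = Poly_Mapping.single (real (\<Sum>i\<in>UNIV. Poly_Mapping.lookup m i)) (Poly_Mapping.single m 1)" for m
  proof -
    have "(\<Sum>i\<in>UNIV. Poly_Mapping.single i (Poly_Mapping.lookup m i)) = m"
      by (rule poly_mapping_eqI) (simp add: lookup_sum lookup_single when_def)
    then show ?thesis by (simp add: S.mono_def s0_def ee pow mvar_pow prod_single)
  qed
  have generic: "mdegree p \<le> n" if b: "bd (S.mev (\<lambda>i. s0 (e' i)) p) t" and n: "t < real n + 1" for p n t
    unfolding mdegree_le_iff
  proof (rule ballI, rule ccontr)
    fix m assume m: "m \<in> Poly_Mapping.keys p" and gt: "\<not> (\<Sum>i\<in>UNIV. Poly_Mapping.lookup m i) \<le> n"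
    let ?d = "\<lambda>m. real (\<Sum>i\<in>UNIV. Poly_Mapping.lookup m i)"
    have "Poly_Mapping.lookup (S.mev (\<lambda>i. s0 (e' i)) p) (?d m) = 0"
      by (rule lookup_above_bd[OF b]) (use gt n in linarith)
    then have "Poly_Mapping.lookup (Poly_Mapping.lookup (S.mev (\<lambda>i. s0 (e' i)) p) (?d m)) m = 0" by simp
    moreover have "S.mev (\<lambda>i. s0 (e' i)) p = (\<Sum>m'\<in>Poly_Mapping.keys p. Poly_Mapping.single (?d m') (Poly_Mapping.single m' (to_ac (Poly_Mapping.lookup p m'))))"
      unfolding S.mev_def mono0 by (simp add: cst_def mconst_def mult_single)
    ultimately have "(\<Sum>m'\<in>Poly_Mapping.keys p. Poly_Mapping.lookup (Poly_Mapping.lookup (Poly_Mapping.single (?d m') (Poly_Mapping.single m' (to_ac (Poly_Mapping.lookup p m')))) (?d m)) m) = 0"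
      by (simp add: lookup_sum)
    moreover have "Poly_Mapping.lookup (Poly_Mapping.lookup (Poly_Mapping.single (?d m') (Poly_Mapping.single m' (to_ac (Poly_Mapping.lookup p m')))) (?d m)) m
      = (if m' = m then to_ac (Poly_Mapping.lookup p m) else 0)" for m'
      by (auto simp: lookup_single when_def)
    ultimately have "to_ac (Poly_Mapping.lookup p m) = 0" using m by simp
    then show False using m by (simp add: in_keys_iff)
  qed
  have ub: "\<exists>C. \<forall>r. real (d r) \<le> C * \<theta>' ^ r" if t: "\<theta>' > \<theta>" for \<theta>'
  proof -
    obtain C where C: "\<And>r j. bd ((hmap F ^^ r) s0 j) (C * \<theta>' ^ r)" using UB t unfolding UB_def by blast
    have "real (d r) \<le> max C 0 * \<theta>' ^ r" for r
    proof -
      have nn: "0 \<le> max C 0 * \<theta>' ^ r" using t th by simp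
      have le: "C * \<theta>' ^ r \<le> max C 0 * \<theta>' ^ r" using t th by (intro mult_right_mono) auto
      define n where "n = nat \<lfloor>max C 0 * \<theta>' ^ r\<rfloor>"
      have n: "real n \<le> max C 0 * \<theta>' ^ r" "max C 0 * \<theta>' ^ r < real n + 1" using nn unfolding n_def by linarith+
      have "mdegree (endo_iter f r i) \<le> n" for i
      proof (rule generic)
        show "bd (S.mev (\<lambda>i. s0 (e' i)) (endo_iter f r i)) (C * \<theta>' ^ r)" using C[of r "e' i"] unfolding orbit ee .
      qed (use le n in linarith)
      then have "d r \<le> n" unfolding d_def endo_degree_le_iff by blast
      then show ?thesis using n(1) by linarith
    qed
    then show ?thesis by blast
  qed
  have d1: "d r \<ge> 1" for r
  proof (rule ccontr)
    assume "\<not> d r \<ge> 1"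
    then have "endo_degree (endo_iter f r) \<le> 0" unfolding d_def by simp
    then have k0: "m = 0" if "m \<in> Poly_Mapping.keys (endo_iter f r i)" for m i
      using that unfolding endo_degree_le_iff mdegree_le_iff by (auto intro!: poly_mapping_eqI)
    have const: "K.mev a (endo_iter f r i) = K.mev b (endo_iter f r i)" for a b i
      unfolding K.mev_def by (intro sum.cong refl) (drule k0, simp add: K.mono_def)
    have "a = b" if "((\<lambda>a i. K.mev a (f i)) ^^ r) a = ((\<lambda>a i. K.mev a (f i)) ^^ r) b" for a b
      using that
    proof (induction r)
      case (Suc r)
      then have "\<And>i. K.mev (((\<lambda>a i. K.mev a (f i)) ^^ r) a) (f i) = K.mev (((\<lambda>a i. K.mev a (f i)) ^^ r) b) (f i)"
        by (simp add: fun_eq_iff)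
      from f_inj[OF this] show ?case by (rule Suc.IH)
    qed simp
    moreover have "((\<lambda>a i. K.mev a (f i)) ^^ r) a = ((\<lambda>a i. K.mev a (f i)) ^^ r) b" for a b
      using const[of a _ b] by (intro ext) (simp add: K.mev_endo_iter)
    ultimately have "(\<lambda>_. 0) = (\<lambda>_ :: 4. 1 :: 'k alg_closure)" by blast
    then show False by (metis zero_neq_one)
  qed
  obtain c where c: "c > 0" "\<And>r. c * \<theta> ^ r \<le> real (d r)"
  proof (cases "\<theta> = 1")
    case True
    then show ?thesis using that[of 1] d1 by simp
  next
    case False
    then obtain c D where c: "c > 0" and D: "\<forall>r. \<exists>s. (\<forall>j. bd (s j) D) \<and> (\<forall>t. (\<forall>j. bd ((hmap F ^^ r) s j) t) \<longrightarrow> c * \<theta> ^ r \<le> t)"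
      using LB unfolding LB_def by blast
    define D' where "D' = max D 1"
    have D1: "D' > 0" by (simp add: D'_def)
    have "c / D' * \<theta> ^ r \<le> real (d r)" for r
    proof -
      obtain s where s: "\<forall>j. bd (s j) D" "\<And>t. (\<forall>j. bd ((hmap F ^^ r) s j) t) \<Longrightarrow> c * \<theta> ^ r \<le> t" using D by blast
      have sD: "bd (s j) D'" for j using s(1) by (auto simp: D'_def intro: bd_mono)
      have "bd ((hmap F ^^ r) s j) (D' * real (d r))" for j
        unfolding orbit S.mev_def
      proof (rule bd_sum)
        fix m assume m: "m \<in> Poly_Mapping.keys (endo_iter f r (e j))"
        have "bd (S.mono (\<lambda>i. s (e' i)) m) (\<Sum>i\<in>UNIV. real (Poly_Mapping.lookup m i) * D')"
          unfolding S.mono_def by (intro bd_prod bd_power sD)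
        moreover have "(\<Sum>i\<in>UNIV. real (Poly_Mapping.lookup m i) * D') \<le> D' * real (d r)"
        proof -
          have "(\<Sum>i\<in>UNIV. Poly_Mapping.lookup m i) \<le> d r"
            using m endo_degree_le_iff[of "endo_iter f r" "d r"] unfolding d_def mdegree_le_iff by simp
          then have "(\<Sum>i\<in>UNIV. real (Poly_Mapping.lookup m i)) \<le> real (d r)" by (metis of_nat_le_iff of_nat_sum)
          then show ?thesis using D1 by (simp add: mult.commute flip: sum_distrib_left)
        qed
        ultimately show "bd (cst (to_ac (Poly_Mapping.lookup (endo_iter f r (e j)) m)) * S.mono (\<lambda>i. s (e' i)) m) (D' * real (d r))"
          by (intro bd_cst_mult) (rule bd_mono)
      qed
      then have "c * \<theta> ^ r \<le> D' * real (d r)" using s(2) by blast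
      then show ?thesis using D1 by (simp add: field_simps)
    qed
    then show ?thesis using that[of "c / D'"] c D1 by simp
  qed
  have "(\<lambda>r. root r (real (d r))) \<longlonglongrightarrow> \<theta>" by (rule limit_of_roots[OF th(1) ub c])
  then have "dynamical_degree f = \<theta>" unfolding dynamical_degree_def d_def by (rule limI)
  then show ?thesis using alg4_conclusion[OF th(2)] by simp
qed

end
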